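(* There is an absolute constant $C>0$ such that for every $0<\varepsilon<1$ there is a randomized $(1-\varepsilon)$-approximation algorithm for the maximum matching problem whose sensitivity on every graph of maximum degree $\Delta$ is at most $\Delta^{C/\varepsilon}$, and whose running time is \[ \min\left\{\exp\!\left(\Delta^{O(1/\varepsilon)}\right) m\log n + O(n),\ \frac{1}{\varepsilon}\Delta^{O(1/\varepsilon)} n^2 m\log n\right\}. \]
   Context: Graphs are finite, simple and undirected; for an input graph $G=(V,E)$, $n=|V|$, $m=|E|$, $\Delta$ is the maximum degree of $G$, and $\nu(G)$ is the maximum size of a matching in $G$. A randomized algorithm $A$ for the maximum matching problem outputs, on input $G$, a random matching $A(G)\subseteq E$; it is a $(1-\varepsilon)$-approximation algorithm if $\mathbb{E}[|A(G)|]\ge(1-\varepsilon)\nu(G)$ for every graph $G$. For two probability distributions $\mu,\mu'$ on subsets of a finite set $E$, the Wasserstein distance is $W(\mu,\mu')=\inf_{\pi}\mathbb{E}_{(X,Y)\sim\pi}|X\triangle Y|$, the infimum over all couplings $\pi$ of $\mu$ and $\mu'$ (Hamming distance on edge sets). The sensitivity of $A$ on $G$ is $\max_{e\in E} W(A(G),A(G-e))$, where $G-e$ is $G$ with edge $e$ deleted and both output distributions are viewed as distributions on subsets of $E$. $O(\cdot)$ hides absolute constants. *)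

theory Defs
  imports "HOL-Probability.Probability"
begin

section \<open>Graphs and matchings\<close>

text \<open>A graph on \<open>n\<close> vertices has vertex set \<open>{..<n}\<close>; an edge is the two-element set of its ends.\<close>

definition simple_graph :: "nat \<Rightarrow> nat set set \<Rightarrow> bool" where
  "simple_graph n E \<longleftrightarrow> (\<forall>e\<in>E. e \<subseteq> {..<n} \<and> card e = 2)"

definition vertex_degree :: "nat set set \<Rightarrow> nat \<Rightarrow> nat" where
  "vertex_degree E v = card {e \<in> E. v \<in> e}"

text \<open>The inserted \<open>0\<close> only matters for the graph without vertices.\<close>

definition max_degree :: "nat \<Rightarrow> nat set set \<Rightarrow> nat" where
  "max_degree n E = Max (insert 0 (vertex_degree E ` {..<n}))"

definition is_matching :: "nat set set \<Rightarrow> nat set set \<Rightarrow> bool" where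
  "is_matching E M \<longleftrightarrow> M \<subseteq> E \<and> pairwise disjnt M"

definition matching_number :: "nat set set \<Rightarrow> nat" where
  "matching_number E = Max (card ` {M. is_matching E M})"


section \<open>Approximation and sensitivity\<close>

type_synonym matching_algorithm = "nat \<Rightarrow> nat set set \<Rightarrow> nat set set pmf"

definition approximates_matching :: "real \<Rightarrow> matching_algorithm \<Rightarrow> bool" where
  "approximates_matching \<alpha> A \<longleftrightarrow>
    (\<forall>n E. simple_graph n E \<longrightarrow>
      (\<forall>M\<in>set_pmf (A n E). is_matching E M) \<and>
      measure_pmf.expectation (A n E) (\<lambda>M. real (card M)) \<ge> \<alpha> * real (matching_number E))"

definition couplings :: "'a pmf \<Rightarrow> 'b pmf \<Rightarrow> ('a \<times> 'b) pmf set" where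
  "couplings \<mu> \<mu>' = {\<pi>. map_pmf fst \<pi> = \<mu> \<and> map_pmf snd \<pi> = \<mu>'}"

definition wasserstein :: "'a set pmf \<Rightarrow> 'a set pmf \<Rightarrow> real" where
  "wasserstein \<mu> \<mu>' =
    (INF \<pi>\<in>couplings \<mu> \<mu>'.
      measure_pmf.expectation \<pi> (\<lambda>(X, Y). real (card (sym_diff X Y))))"

text \<open>The inserted \<open>0\<close> makes the sensitivity on an edgeless graph \<open>0\<close> and changes nothing else,
  distances being nonnegative.\<close>

definition sensitivity :: "matching_algorithm \<Rightarrow> nat \<Rightarrow> nat set set \<Rightarrow> real" where
  "sensitivity A n E = Max (insert 0 ((\<lambda>e. wasserstein (A n E) (A n (E - {e}))) ` E))"


section \<open>Randomized random-access machines\<close>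

text \<open>Unit-cost random-access machine with structured control flow. Programs are finite lists of
  statements over numbered registers; \<open>Load\<close> and \<open>Store\<close> give indirect access to the memory.
  \<open>Rand r k\<close> puts into register \<open>r\<close> a fresh uniform integer below the contents of register \<open>k\<close>.
  \<open>IfNZ\<close> and \<open>WhileNZ\<close> test whether a register is nonzero.\<close>

datatype binop = Add | Sub | Mul | Div | Mod

datatype stmt =
    Const nat nat
  | Binop binop nat nat nat
  | Load nat nat
  | Store nat nat
  | Rand nat nat
  | IfNZ nat "stmt list" "stmt list"
  | WhileNZ nat "stmt list"

record state =
  reg :: "nat \<Rightarrow> nat"
  mem :: "nat \<Rightarrow> nat"

type_synonym config = "stmt list \<times> state"

fun apply_binop :: "binop \<Rightarrow> nat \<Rightarrow> nat \<Rightarrow> nat" where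
  "apply_binop Add x y = x + y"
| "apply_binop Sub x y = x - y"
| "apply_binop Mul x y = x * y"
| "apply_binop Div x y = x div y"
| "apply_binop Mod x y = x mod y"

definition set_reg :: "nat \<Rightarrow> nat \<Rightarrow> state \<Rightarrow> state" where
  "set_reg r x s = s\<lparr>reg := (reg s)(r := x)\<rparr>"

definition uniform_below :: "nat \<Rightarrow> nat pmf" where
  "uniform_below k = (if k = 0 then return_pmf 0 else pmf_of_set {..<k})"

text \<open>A configuration is the list of statements still to be executed, together with the state;
  the machine has halted when the list is empty. Each step is one unit of time.\<close>

fun step :: "config \<Rightarrow> config pmf" where
  "step ([], s) = return_pmf ([], s)"
| "step (Const r c # cs, s) = return_pmf (cs, set_reg r c s)"
| "step (Binop f r x y # cs, s) =
    return_pmf (cs, set_reg r (apply_binop f (reg s x) (reg s y)) s)"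
| "step (Load r a # cs, s) = return_pmf (cs, set_reg r (mem s (reg s a)) s)"
| "step (Store a r # cs, s) = return_pmf (cs, s\<lparr>mem := (mem s)(reg s a := reg s r)\<rparr>)"
| "step (Rand r k # cs, s) = map_pmf (\<lambda>x. (cs, set_reg r x s)) (uniform_below (reg s k))"
| "step (IfNZ r ts es # cs, s) = return_pmf ((if reg s r \<noteq> 0 then ts else es) @ cs, s)"
| "step (WhileNZ r bs # cs, s) =
    return_pmf (if reg s r \<noteq> 0 then bs @ WhileNZ r bs # cs else cs, s)"

primrec run :: "nat \<Rightarrow> config \<Rightarrow> config pmf" where
  "run 0 c = return_pmf c"
| "run (Suc t) c = bind_pmf (step c) (run t)"

text \<open>Input and output are edge lists: register \<open>0\<close> holds the number of vertices (on input),
  register \<open>1\<close> the number of edges, and the ends of the \<open>i\<close>-th edge are in the memory cells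
  \<open>2 * i\<close> and \<open>2 * i + 1\<close>.\<close>

definition is_edge_list :: "(nat \<times> nat) list \<Rightarrow> nat set set \<Rightarrow> bool" where
  "is_edge_list es E \<longleftrightarrow>
    distinct (map (\<lambda>(u, v). {u, v}) es) \<and> set (map (\<lambda>(u, v). {u, v}) es) = E"

definition input_state :: "nat \<Rightarrow> (nat \<times> nat) list \<Rightarrow> state" where
  "input_state n es =
    \<lparr>reg = (\<lambda>_. 0)(0 := n, 1 := length es),
     mem = (\<lambda>i. if i < 2 * length es
                then (if even i then fst (es ! (i div 2)) else snd (es ! (i div 2)))
                else 0)\<rparr>"

definition output_edges :: "state \<Rightarrow> nat set set" where
  "output_edges s = (\<lambda>i. {mem s (2 * i), mem s (2 * i + 1)}) ` {..<reg s 1}"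

text \<open>\<open>word_bounded P s W\<close>: no register or memory cell ever exceeds \<open>W\<close>. This is the word-size
  restriction without which unit-cost multiplication would be unrealistically powerful.\<close>

definition word_bounded :: "stmt list \<Rightarrow> state \<Rightarrow> real \<Rightarrow> bool" where
  "word_bounded P s W \<longleftrightarrow>
    (\<forall>t. \<forall>(cs, s')\<in>set_pmf (run t (P, s)).
      \<forall>i. real (reg s' i) \<le> W \<and> real (mem s' i) \<le> W)"

text \<open>Time is worst case over the random choices of the machine.\<close>

definition outputs_within :: "stmt list \<Rightarrow> state \<Rightarrow> nat set set pmf \<Rightarrow> real \<Rightarrow> bool" where
  "outputs_within P s \<mu> T \<longleftrightarrow>
    (\<exists>t. real t \<le> T \<and>
      (\<forall>(cs, s')\<in>set_pmf (run t (P, s)). cs = []) \<and>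
      map_pmf (\<lambda>(cs, s'). output_edges s') (run t (P, s)) = \<mu>)"

text \<open>The output distribution may depend on the graph only, hence the quantification over all
  edge lists presenting it.\<close>

definition implements ::
    "stmt list \<Rightarrow> matching_algorithm \<Rightarrow> (nat \<Rightarrow> real) \<Rightarrow> (nat \<Rightarrow> nat set set \<Rightarrow> real) \<Rightarrow> bool" where
  "implements P A W T \<longleftrightarrow>
    (\<forall>n E es. simple_graph n E \<longrightarrow> is_edge_list es E \<longrightarrow>
      word_bounded P (input_state n es) (W n) \<and>
      outputs_within P (input_state n es) (A n E) (T n E))"

end

theory Submission
  imports Defs
begin

text \<open>The algorithm samples from a weighted monomer-dimer model. The vertices get weights \<open>V\<close> computed by
  \<open>O(1/\<epsilon>)\<close> rounds of local summation, so that \<open>V v\<close> dominates the total weight of the alternating walks of that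
  length from \<open>v\<close>, and a matching is weighted by the product of \<open>k\<^sup>2 V v\<close> over its vertices. Hence a short augmenting path starts
  at a given vertex with probability at most \<open>1/k\<^sup>2\<close>, and a matching with few short augmenting paths is nearly maximum.
  Deleting an edge changes the weights only in a ball around it, and revealing partners one at a time couples the
  Gibbs measures before and after a local change with bounded expected disagreement; this is the sensitivity bound.
  The sampler is heat-bath dynamics. Polynomial mixing comes from a spectral gap proved by induction on vertices.
  For large graphs of bounded degree the same disagreement bound is spectral independence, which yields approximate
  tensorization of entropy (by randomly pinning edges down to blocks with small components) and mixing in
  \<open>O(m log n)\<close> steps. Graphs of maximum degree at most \<open>1\<close> are output unchanged.\<close>


section \<open>The monomer-dimer model and its spectral gap\<close>

text \<open>Weights are products over vertices because flipping an augmenting path then changes the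
  weight only by the factors at its two ends, so short augmenting paths become unlikely once
  \<open>V\<close> dominates the number of ways to continue them. Everything rests on one fact: in
  every subgraph a vertex is unmatched with probability at least \<open>1 / (1 + B)\<close>, where
  \<open>B\<close> bounds the weighted degree. Influence sums, couplings and the gap all follow from
  it by revealing one partner at a time. Constants are powers of
  \<open>Q = (D + 1) ^ (14 * k)\<close>, which bounds \<open>1 + B\<close> for maximum degree
  \<open>D\<close>. With \<open>k\<close> about \<open>3 / \<epsilon>\<close>, a share
  \<open>2 / k\<close> is lost to surviving augmenting paths and \<open>1 / k\<close> to imperfect
  mixing. The gap alone costs two factors \<open>n\<close>, one from the gap and one from the
  logarithm of the initial variance. Entropy avoids both: its constant does not depend on
  \<open>n\<close>, and the chain starts with entropy at most \<open>n * ln (1 + B)\<close>. Graphs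
  with few edges still go through the gap. At maximum degree 1 the permitted sensitivity is exactly
  1, hence the deterministic answer there. Isolated edges are always output, so that a drop of the
  maximum degree from 2 to 1 has no effect far away.\<close>

definition matchings :: "'v set set => 'v set set set" where
 "matchings F = {M. M <= F & pairwise disjnt M}"

definition weight :: "('v set => real) => 'v set set => real" where
 "weight lam M = (\<Prod>e\<in>M. lam e)"

definition Zsum :: "('v set => real) => 'v set set => real" where
 "Zsum lam F = (\<Sum>M\<in>matchings F. weight lam M)"

definition gex :: "('v set => real) => 'v set set => ('v set set => real) => real" where
 "gex lam F f = (\<Sum>M\<in>matchings F. weight lam M * f M) / Zsum lam F"

definition avoid :: "'v => 'v set set => 'v set set" where
 "avoid x F = {e \<in> F. x \<notin> e}"

definition away :: "'v set => 'v set set => 'v set set" where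
 "away e F = {f \<in> F. disjnt e f}"

definition inc :: "'v => 'v set set => 'v set set" where
 "inc x F = {e \<in> F. x \<in> e}"

definition other :: "'v => 'v set => 'v" where
 "other x e = the_elem (e - {x})"

text \<open>Positivity of \<open>lam\<close> is demanded of all sets, edges or not, so that it
  passes to subgraphs and to arbitrary products of weights without side conditions. The number
  \<open>B\<close> is the only trace of the degree in the analysis.\<close>

definition wgraph :: "('v set => real) => real => 'v set set => bool" where
 "wgraph lam B F \<longleftrightarrow> finite F & (\<forall>e\<in>F. card e = 2) & (\<forall>e. 0 < lam e) & 0 <= B &
   (\<forall>x. (\<Sum>e\<in>inc x F. lam e) <= B)"

lemma other_edge: assumes "card e = 2" "x \<in> e" shows "e = {x, other x e}" "other x e ~= x"
proof -
 obtain y where y: "e - {x} = {y}"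
  using assms card_1_singletonE[of "e - {x}"] by (metis One_nat_def card_Diff_singleton diff_Suc_1 numeral_2_eq_2)
 then have "other x e = y" by (simp add: other_def)
 then show "e = {x, other x e}" "other x e ~= x" using y assms(2) by auto
qed

section \<open>Matchings and their recursions under deletion of a vertex or an edge\<close>

lemma finite_matchings [simp]: "finite F ==> finite (matchings F)"
 unfolding matchings_def by (rule finite_subset[of _ "Pow F"]) auto

lemma matchings_finite: "finite F ==> M \<in> matchings F ==> finite M"
 unfolding matchings_def using finite_subset by auto

lemma empty_matching [simp]: "{} \<in> matchings F"
 by (simp add: matchings_def)

lemma matchings_mono: "F <= G ==> matchings F <= matchings G"
 by (auto simp: matchings_def)

lemma avoid_subset: "avoid x F <= F" and away_subset: "away e F <= F" and inc_subset: "inc x F <= F"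
 by (auto simp: avoid_def away_def inc_def)

lemma avoid_avoid: "avoid y (avoid x F) = away {x, y} F"
 by (auto simp: avoid_def away_def disjnt_def)

lemma away_eq: assumes "card e = 2" "x \<in> e" shows "away e F = avoid (other x e) (avoid x F)"
 using other_edge[OF assms] avoid_avoid by metis

lemma insert_matching:
 "e \<in> F ==> M \<in> matchings (away e F) ==> insert e M \<in> matchings F"
 by (auto simp: matchings_def away_def pairwise_insert disjnt_sym)

lemma notin_away: "e ~= {} ==> M \<in> matchings (away e F) ==> e \<notin> M"
 by (auto simp: matchings_def away_def disjnt_def)

lemma remove_matching:
 "M \<in> matchings F ==> e \<in> M ==> M - {e} \<in> matchings (away e F)"
 by (auto simp: matchings_def away_def pairwise_def)

lemma weight_insert: "finite M ==> e \<notin> M ==> weight lam (insert e M) = lam e * weight lam M"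
 by (simp add: weight_def)

lemma weight_pos: "(!!e. 0 < lam e) ==> 0 < weight lam M"
 by (simp add: weight_def prod_pos)

lemma Zsum_pos: "(!!e. 0 < lam e) ==> finite F ==> 0 < Zsum lam F"
 unfolding Zsum_def using empty_matching[of F]
 by (intro sum_pos finite_matchings weight_pos) blast+

text \<open>A matching either leaves \<open>x\<close> free or contains exactly one edge at
  \<open>x\<close>. This classification is the source of all recursions that reveal the partner of a
  vertex.\<close>

lemma sum_matchings_vertex:
 assumes "finite F"
 shows "(\<Sum>M\<in>matchings F. h M) = (\<Sum>M\<in>matchings (avoid x F). h M)
   + (\<Sum>e\<in>inc x F. \<Sum>M\<in>matchings (away e F). h (insert e M))"
proof -
 let ?I = "%e. insert e ` matchings (away e F)"
 have fin: "finite (avoid x F)" "finite (inc x F)" "!!e. finite (away e F)"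
  using assms by (simp_all add: avoid_def inc_def away_def)
 have eq: "matchings F = matchings (avoid x F) Un (\<Union>e\<in>inc x F. ?I e)"
 proof (intro equalityI subsetI)
  fix M assume M: "M \<in> matchings F"
  show "M \<in> matchings (avoid x F) Un (\<Union>e\<in>inc x F. ?I e)"
  proof (cases "\<exists>e\<in>M. x \<in> e")
   case True
   then obtain e where e: "e \<in> M" "x \<in> e" by blast
   then have "M = insert e (M - {e})" by blast
   moreover have "e \<in> inc x F" using M e by (auto simp: matchings_def inc_def)
   ultimately show ?thesis using remove_matching[OF M e(1)] by blast
  next
   case False then show ?thesis using M by (auto simp: matchings_def avoid_def)
  qed
 next
  fix M assume "M \<in> matchings (avoid x F) Un (\<Union>e\<in>inc x F. ?I e)"
  then show "M \<in> matchings F"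
   using matchings_mono[OF avoid_subset, of x F] insert_matching[of _ F] by (auto simp: inc_def)
 qed
 have d1: "matchings (avoid x F) \<inter> (\<Union>e\<in>inc x F. ?I e) = {}"
  by (auto simp: matchings_def avoid_def inc_def)
 have d2: "?I e \<inter> ?I e' = {}" if "e \<in> inc x F" "e' \<in> inc x F" "e ~= e'" for e e'
 proof (rule ccontr)
  assume "?I e \<inter> ?I e' ~= {}"
  then obtain M where M: "M \<in> ?I e" "M \<in> ?I e'" by blast
  then have "M \<in> matchings F" using that insert_matching[of e F] by (auto simp: inc_def)
  moreover have "e \<in> M" "e' \<in> M" using M by auto
  ultimately have "disjnt e e'" using that(3) by (auto simp: matchings_def pairwise_def)
  then show False using that by (auto simp: inc_def disjnt_def)
 qed
 have inj: "inj_on (insert e) (matchings (away e F))" if "e \<in> inc x F" for e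
 proof (rule inj_onI)
  fix M N assume MN: "M \<in> matchings (away e F)" "N \<in> matchings (away e F)" "insert e M = insert e N"
  have "e ~= {}" using that by (auto simp: inc_def)
  then show "M = N" using notin_away[of e] MN by (metis insert_ident)
 qed
 have "(\<Sum>M\<in>matchings F. h M) = (\<Sum>M\<in>matchings (avoid x F). h M) + (\<Sum>M\<in>(\<Union>e\<in>inc x F. ?I e). h M)"
  unfolding eq using fin d1 by (intro sum.union_disjoint) auto
 also have "(\<Sum>M\<in>(\<Union>e\<in>inc x F. ?I e). h M) = (\<Sum>e\<in>inc x F. \<Sum>M\<in>?I e. h M)"
  using fin d2 by (intro sum.UNION_disjoint) auto
 also have "... = (\<Sum>e\<in>inc x F. \<Sum>M\<in>matchings (away e F). h (insert e M))"
  by (rule sum.cong[OF refl]) (simp add: sum.reindex[OF inj])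
 finally show ?thesis .
qed

lemma sum_matchings_edge:
 assumes "finite F" "e \<in> F" "e ~= {}"
 shows "(\<Sum>M\<in>matchings F. h M) = (\<Sum>M\<in>matchings (F - {e}). h M)
   + (\<Sum>M\<in>matchings (away e F). h (insert e M))"
proof -
 have eq: "matchings F = matchings (F - {e}) Un insert e ` matchings (away e F)"
 proof (intro equalityI subsetI)
  fix M assume M: "M \<in> matchings F"
  show "M \<in> matchings (F - {e}) Un insert e ` matchings (away e F)"
  proof (cases "e \<in> M")
   case True
   then have "M = insert e (M - {e})" by blast
   then show ?thesis using remove_matching[OF M True] by blast
  qed (use M in \<open>auto simp: matchings_def\<close>)
 next
  fix M assume "M \<in> matchings (F - {e}) Un insert e ` matchings (away e F)"
  then show "M \<in> matchings F"
   using matchings_mono[of "F - {e}" F] insert_matching[OF assms(2)] by auto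
 qed
 have inj: "inj_on (insert e) (matchings (away e F))"
  by (rule inj_onI) (metis notin_away[OF assms(3)] insert_ident)
 have "(\<Sum>M\<in>matchings F. h M) = (\<Sum>M\<in>matchings (F - {e}). h M) + (\<Sum>M\<in>insert e ` matchings (away e F). h M)"
  unfolding eq using assms(1) finite_subset[OF away_subset assms(1)]
  by (intro sum.union_disjoint) (auto simp: matchings_def)
 then show ?thesis by (simp add: sum.reindex[OF inj])
qed

lemma wgraph_subset: assumes "wgraph lam B F" "G <= F" shows "wgraph lam B G"
proof -
 have fin: "finite (inc x F)" for x
  using assms(1) finite_subset[OF inc_subset] by (auto simp: wgraph_def)
 have "(\<Sum>e\<in>inc x G. lam e) <= (\<Sum>e\<in>inc x F. lam e)" for x
  using assms by (intro sum_mono2 fin) (auto simp: inc_def wgraph_def less_imp_le)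
 then show ?thesis using assms unfolding wgraph_def
  by (meson finite_subset order_trans subsetD)
qed

lemma wgraphD: assumes "wgraph lam B F"
 shows "finite F" "!!e. e \<in> F ==> card e = 2" "!!e. 0 < lam e" "0 <= B" "!!x. (\<Sum>e\<in>inc x F. lam e) <= B"
  "!!e. e \<in> F ==> e ~= {}" "0 < Zsum lam F"
 using assms Zsum_pos[of lam F] by (auto simp: wgraph_def)

lemma wgraph_avoid: "wgraph lam B F ==> wgraph lam B (avoid x F)"
 and wgraph_away: "wgraph lam B F ==> wgraph lam B (away e F)"
 by (auto intro: wgraph_subset[OF _ avoid_subset] wgraph_subset[OF _ away_subset])

lemma Zsum_mono:
 assumes "wgraph lam B F" "G <= F" shows "Zsum lam G <= Zsum lam F"
 unfolding Zsum_def using wgraphD(1)[OF assms(1)] assms(2) weight_pos[of lam, OF wgraphD(3)[OF assms(1)]]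
 by (intro sum_mono2 matchings_mono finite_matchings) (auto simp: less_imp_le)

section \<open>Vertex and edge probabilities, and Gibbs expectations\<close>

definition free_prob :: "('v set => real) => 'v set set => 'v => real" where
 "free_prob lam F x = Zsum lam (avoid x F) / Zsum lam F"

definition edge_prob :: "('v set => real) => 'v set set => 'v set => real" where
 "edge_prob lam F e = lam e * Zsum lam (away e F) / Zsum lam F"

lemma Zsum_vertex:
 assumes "wgraph lam B F"
 shows "Zsum lam F = Zsum lam (avoid x F)
  + (\<Sum>e\<in>inc x F. lam e * Zsum lam (away e F))"
proof -
 have "weight lam (insert e M) = lam e * weight lam M" if "e \<in> inc x F" "M \<in> matchings (away e F)" for e M
  using that wgraphD[OF assms] notin_away[of e M F] matchings_finite[of "away e F" M]
   finite_subset[OF away_subset[of e F]] by (intro weight_insert) (auto simp: inc_def)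
 then show ?thesis unfolding Zsum_def sum_matchings_vertex[OF wgraphD(1)[OF assms], of "weight lam" x]
  by (simp add: sum_distrib_left)
qed

lemma gex_vertex:
 assumes "wgraph lam B F"
 shows "gex lam F f = free_prob lam F x * gex lam (avoid x F) f
  + (\<Sum>e\<in>inc x F. edge_prob lam F e * gex lam (away e F) (%M. f (insert e M)))"
proof -
 have "weight lam (insert e M) = lam e * weight lam M" if "e \<in> inc x F" "M \<in> matchings (away e F)" for e M
  using that wgraphD[OF assms] notin_away[of e M F] matchings_finite[of "away e F" M]
   finite_subset[OF away_subset[of e F]] by (intro weight_insert) (auto simp: inc_def)
 then have "(\<Sum>M\<in>matchings F. weight lam M * f M) = (\<Sum>M\<in>matchings (avoid x F). weight lam M * f M)
   + (\<Sum>e\<in>inc x F. lam e * (\<Sum>M\<in>matchings (away e F). weight lam M * f (insert e M)))"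
  unfolding sum_matchings_vertex[OF wgraphD(1)[OF assms], of "%M. weight lam M * f M" x]
  by (simp add: sum_distrib_left mult.assoc)
 moreover have "Zsum lam (avoid x F) ~= 0" "!!e. Zsum lam (away e F) ~= 0"
  using wgraphD(7)[OF wgraph_avoid[OF assms, of x]] wgraphD(7)[OF wgraph_away[OF assms]]
  by (auto simp: less_le)
 ultimately show ?thesis
  by (simp add: gex_def free_prob_def edge_prob_def add_divide_distrib sum_divide_distrib[of _ "inc x F"])
qed

lemma gex_edge:
 assumes "wgraph lam B F" "e \<in> F"
 shows "gex lam F f = (1 - edge_prob lam F e) * gex lam (F - {e}) f
  + edge_prob lam F e * gex lam (away e F) (%M. f (insert e M))"
  and "Zsum lam (F - {e}) / Zsum lam F = 1 - edge_prob lam F e"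
proof -
 note w = wgraphD[OF assms(1)]
 have wi: "weight lam (insert e M) = lam e * weight lam M" if "M \<in> matchings (away e F)" for M
  using that w assms(2) notin_away[of e M F] matchings_finite[of "away e F" M]
   finite_subset[OF away_subset[of e F]] by (intro weight_insert) auto
 have ps: "Zsum lam F = Zsum lam (F - {e}) + lam e * Zsum lam (away e F)"
  unfolding Zsum_def sum_matchings_edge[OF w(1) assms(2) w(6)[OF assms(2)], of "weight lam"]
  using wi by (simp add: sum_distrib_left)
 have *: "(\<Sum>M\<in>matchings F. weight lam M * f M) = (\<Sum>M\<in>matchings (F - {e}). weight lam M * f M)
   + lam e * (\<Sum>M\<in>matchings (away e F). weight lam M * f (insert e M))"
  unfolding sum_matchings_edge[OF w(1) assms(2) w(6)[OF assms(2)], of "%M. weight lam M * f M"]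
  using wi by (simp add: sum_distrib_left mult.assoc)
 have nz: "Zsum lam (F - {e}) ~= 0" "Zsum lam (away e F) ~= 0"
  using wgraphD(7)[OF wgraph_subset[OF assms(1), of "F - {e}"]] wgraphD(7)[OF wgraph_away[OF assms(1)]]
  by (auto simp: less_le)
 show 1: "Zsum lam (F - {e}) / Zsum lam F = 1 - edge_prob lam F e"
  using ps w(7) by (simp add: edge_prob_def field_simps)
 show "gex lam F f = (1 - edge_prob lam F e) * gex lam (F - {e}) f
  + edge_prob lam F e * gex lam (away e F) (%M. f (insert e M))"
  unfolding 1[symmetric] using * nz w(7) by (simp add: gex_def edge_prob_def add_divide_distrib)
qed

text \<open>The last bound drives everything that follows. Dropping the edge at \<open>x\<close>
  leaves a matching that avoids \<open>x\<close>, so matchings covering \<open>x\<close> weigh at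
  most \<open>B\<close> times those avoiding it.\<close>

lemma prob_vertex:
 assumes "wgraph lam B F"
 shows "free_prob lam F x + (\<Sum>e\<in>inc x F. edge_prob lam F e) = 1"
  "0 < free_prob lam F x" "free_prob lam F x <= 1" "0 < edge_prob lam F e" "1 <= free_prob lam F x * (1 + B)"
proof -
 note w = wgraphD[OF assms]
 have pos: "0 < Zsum lam (avoid x F)" "!!e. 0 < Zsum lam (away e F)"
  using wgraphD(7)[OF wgraph_avoid[OF assms]] wgraphD(7)[OF wgraph_away[OF assms]] by auto
 show *: "free_prob lam F x + (\<Sum>e\<in>inc x F. edge_prob lam F e) = 1"
  using w(7) Zsum_vertex[OF assms, of x]
  by (simp add: free_prob_def edge_prob_def add_divide_distrib[symmetric] sum_divide_distrib[symmetric])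
 show "0 < free_prob lam F x" "0 < edge_prob lam F e" using pos w by (auto simp: free_prob_def edge_prob_def)
 show "free_prob lam F x <= 1" using Zsum_mono[OF assms avoid_subset] w(7) by (simp add: free_prob_def)
 have "(\<Sum>e\<in>inc x F. lam e * Zsum lam (away e F)) <= (\<Sum>e\<in>inc x F. lam e * Zsum lam (avoid x F))"
  using w by (intro sum_mono mult_left_mono Zsum_mono[OF wgraph_avoid[OF assms]])
   (auto simp: inc_def away_def avoid_def disjnt_def less_imp_le)
 also have "... <= B * Zsum lam (avoid x F)"
  unfolding sum_distrib_right[symmetric] using w pos by (intro mult_right_mono) (auto simp: less_imp_le)
 finally show "1 <= free_prob lam F x * (1 + B)"
  using Zsum_vertex[OF assms, of x] w(7) by (simp add: free_prob_def field_simps)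
qed

lemma gex_cong: "(!!M. M \<in> matchings F ==> f M = g M) ==> gex lam F f = gex lam F g"
 by (simp add: gex_def)

lemma gex_add: "gex lam F (%M. f M + g M) = gex lam F f + gex lam F g"
 by (simp add: gex_def distrib_left sum.distrib add_divide_distrib)

lemma gex_diff: "gex lam F (%M. f M - g M) = gex lam F f - gex lam F g"
 by (simp add: gex_def right_diff_distrib sum_subtractf diff_divide_distrib)

lemma gex_cmult: "gex lam F (%M. c * f M) = c * gex lam F f"
 by (simp add: gex_def sum_distrib_left mult.left_commute)

lemma gex_sum: "gex lam F (%M. \<Sum>i\<in>I. f i M) = (\<Sum>i\<in>I. gex lam F (f i))"
proof -
 have "(\<Sum>M\<in>matchings F. weight lam M * (\<Sum>i\<in>I. f i M)) = (\<Sum>i\<in>I. \<Sum>M\<in>matchings F. weight lam M * f i M)"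
  by (subst sum.swap) (simp add: sum_distrib_left)
 then show ?thesis by (simp add: gex_def sum_divide_distrib)
qed

lemma gex_const: "wgraph lam B F ==> gex lam F (%_. c) = c"
 using wgraphD(7)[of lam B F] by (simp add: gex_def Zsum_def sum_distrib_right[symmetric])

lemma gex_mono: "wgraph lam B F ==> (!!M. M \<in> matchings F ==> f M <= g M) ==> gex lam F f <= gex lam F g"
 unfolding gex_def using wgraphD[of lam B F] weight_pos[of lam]
 by (intro divide_right_mono sum_mono mult_left_mono) (auto simp: less_imp_le)

lemma gex_nonneg: "wgraph lam B F ==> (!!M. M \<in> matchings F ==> 0 <= f M) ==> 0 <= gex lam F f"
 using gex_mono[of lam B F "%_. 0" f] gex_const[of lam B F 0] by simp

lemma gex_square: assumes "wgraph lam B F" shows "(gex lam F f)\<^sup>2 <= gex lam F (%M. (f M)\<^sup>2)"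
proof -
 let ?a = "gex lam F f"
 have "0 <= gex lam F (%M. (f M - ?a)\<^sup>2)" by (rule gex_nonneg[OF assms]) simp
 also have "gex lam F (%M. (f M - ?a)\<^sup>2) = gex lam F (%M. (f M)\<^sup>2 - 2 * ?a * f M + ?a\<^sup>2)"
  by (simp add: power2_diff algebra_simps)
 also have "... = gex lam F (%M. (f M)\<^sup>2) - ?a\<^sup>2"
  by (simp add: gex_add gex_diff gex_cmult gex_const[OF assms] power2_eq_square)
 finally show ?thesis by simp
qed

section \<open>Dirichlet form and Poincare inequality\<close>

lemma weighted_square_le:
 fixes w x :: "'i => real"
 assumes "!!i. i \<in> I ==> 0 <= w i"
 shows "(\<Sum>i\<in>I. w i * x i)\<^sup>2 <= (\<Sum>i\<in>I. w i) * (\<Sum>i\<in>I. w i * (x i)\<^sup>2)"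
proof -
 have "(\<Sum>i\<in>I. sqrt (w i) * (sqrt (w i) * x i))\<^sup>2 <= (\<Sum>i\<in>I. (sqrt (w i))\<^sup>2) * (\<Sum>i\<in>I. (sqrt (w i) * x i)\<^sup>2)"
  by (rule Cauchy_Schwarz_ineq_sum)
 moreover have "(\<Sum>i\<in>I. sqrt (w i) * (sqrt (w i) * x i)) = (\<Sum>i\<in>I. w i * x i)"
  by (intro sum.cong refl) (simp add: assms mult.assoc[symmetric])
 moreover have "(\<Sum>i\<in>I. (sqrt (w i))\<^sup>2) = (\<Sum>i\<in>I. w i)"
  by (intro sum.cong refl) (simp add: assms)
 moreover have "(\<Sum>i\<in>I. (sqrt (w i) * x i)\<^sup>2) = (\<Sum>i\<in>I. w i * (x i)\<^sup>2)"
  by (intro sum.cong refl) (simp add: assms power_mult_distrib)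
 ultimately show ?thesis by simp
qed

text \<open>Only removals of edges are recorded: by reversibility the insertions carry the same
  energy. Its relation to resampling single edges is \<open>sum_block_square\<close>.\<close>

definition dirichlet :: "('v set => real) => 'v set set => ('v set set => real) => real" where
 "dirichlet lam F f = gex lam F (%M. \<Sum>e\<in>M. (f M - f (M - {e}))\<^sup>2)"

lemma dirichlet_vertex:
 assumes "wgraph lam B F"
 shows "dirichlet lam F f = free_prob lam F x * dirichlet lam (avoid x F) f
  + (\<Sum>e\<in>inc x F. edge_prob lam F e * (dirichlet lam (away e F) (%M. f (insert e M))
    + gex lam (away e F) (%M. (f (insert e M) - f M)\<^sup>2)))"
proof -
 have "gex lam (away e F) (%M. \<Sum>g\<in>insert e M. (f (insert e M) - f (insert e M - {g}))\<^sup>2)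
   = dirichlet lam (away e F) (%M. f (insert e M)) + gex lam (away e F) (%M. (f (insert e M) - f M)\<^sup>2)"
  if e: "e \<in> inc x F" for e
  unfolding dirichlet_def gex_add[symmetric]
 proof (rule gex_cong)
  fix M assume M: "M \<in> matchings (away e F)"
  then have "finite M" using wgraphD(1)[OF wgraph_away[OF assms]] matchings_finite by blast
  moreover have eM: "e \<notin> M" using notin_away[OF _ M] e by (auto simp: inc_def)
  moreover have "insert e M - {g} = insert e (M - {g})" if "g \<in> M" for g using that eM by auto
  moreover have "insert e M - {e} = M" using eM by auto
  ultimately show "(\<Sum>g\<in>insert e M. (f (insert e M) - f (insert e M - {g}))\<^sup>2)
   = (\<Sum>g\<in>M. (f (insert e M) - f (insert e (M - {g})))\<^sup>2) + (f (insert e M) - f M)\<^sup>2"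
   by simp
 qed
 then show ?thesis
  unfolding dirichlet_def[of lam F] gex_vertex[OF assms, of "%M. \<Sum>e\<in>M. (f M - f (M - {e}))\<^sup>2" x]
  by (simp add: dirichlet_def)
qed

lemma dirichlet_nonneg: "wgraph lam B F ==> 0 <= dirichlet lam F f"
 unfolding dirichlet_def by (rule gex_nonneg) (auto intro: sum_nonneg)

text \<open>The Gibbs measure on \<open>avoid x F\<close> is the one on \<open>F\<close> conditioned
  on \<open>x\<close> being free, an event of probability at least \<open>1 / (1 + B)\<close>; hence
  its density is at most \<open>1 + B\<close>.\<close>

lemma gex_avoid_le:
 assumes "wgraph lam B F" "!!M. M \<in> matchings F ==> 0 <= f M"
 shows "gex lam (avoid x F) f <= (1 + B) * gex lam F f"
proof -
 note p = prob_vertex[OF assms(1)]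
 have nn: "0 <= gex lam (avoid x F) f"
  using assms(2) matchings_mono[OF avoid_subset[of x F]] by (intro gex_nonneg[OF wgraph_avoid[OF assms(1)]]) auto
 have "0 <= (\<Sum>e\<in>inc x F. edge_prob lam F e * gex lam (away e F) (%M. f (insert e M)))"
  using p(4) assms(2) insert_matching[of _ F]
  by (intro sum_nonneg mult_nonneg_nonneg gex_nonneg[OF wgraph_away[OF assms(1)]])
   (auto simp: less_imp_le inc_def)
 then have "free_prob lam F x * gex lam (avoid x F) f <= gex lam F f"
  unfolding gex_vertex[OF assms(1), of f x] by simp
 then have "(1 + B) * (free_prob lam F x * gex lam (avoid x F) f) <= (1 + B) * gex lam F f"
  using wgraphD(4)[OF assms(1)] by (intro mult_left_mono) auto
 moreover have "1 * gex lam (avoid x F) f <= (free_prob lam F x * (1 + B)) * gex lam (avoid x F) f"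
  using p(5) nn by (rule mult_right_mono)
 ultimately show ?thesis by (simp add: mult.commute mult.left_commute)
qed

lemma dirichlet_avoid_le:
 assumes "wgraph lam B F" shows "dirichlet lam (avoid x F) f <= (1 + B) * dirichlet lam F f"
 unfolding dirichlet_def by (rule gex_avoid_le[OF assms]) (auto intro: sum_nonneg)

text \<open>Both parts come from expanding the second moment about an arbitrary point
  \<open>c\<close>. The choice \<open>c = m\<close> is Jensen's inequality; the choice
  \<open>c = a\<close> bounds the variance by the second moment about one of the values.\<close>

lemma convex_square:
 fixes w x :: "'i => real"
 assumes "0 <= r" "!!i. i \<in> I ==> 0 <= w i" "r + (\<Sum>i\<in>I. w i) = 1"
 shows "(r * a + (\<Sum>i\<in>I. w i * x i))\<^sup>2 <= r * a\<^sup>2 + (\<Sum>i\<in>I. w i * (x i)\<^sup>2)"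
  "r * a\<^sup>2 + (\<Sum>i\<in>I. w i * (x i)\<^sup>2) - (r * a + (\<Sum>i\<in>I. w i * x i))\<^sup>2 <= (\<Sum>i\<in>I. w i * (x i - a)\<^sup>2)"
proof -
 define m where "m = r * a + (\<Sum>i\<in>I. w i * x i)"
 have *: "r * (a - c)\<^sup>2 + (\<Sum>i\<in>I. w i * (x i - c)\<^sup>2)
   = r * a\<^sup>2 + (\<Sum>i\<in>I. w i * (x i)\<^sup>2) - m\<^sup>2 + (m - c)\<^sup>2" for c
 proof -
  have "(\<Sum>i\<in>I. w i * (x i - c)\<^sup>2) = (\<Sum>i\<in>I. w i * (x i)\<^sup>2 - 2 * c * (w i * x i) + c\<^sup>2 * w i)"
   by (intro sum.cong refl) (simp add: power2_eq_square algebra_simps)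
  also have "... = (\<Sum>i\<in>I. w i * (x i)\<^sup>2) - 2 * c * (\<Sum>i\<in>I. w i * x i) + c\<^sup>2 * (\<Sum>i\<in>I. w i)"
   by (simp add: sum.distrib sum_subtractf sum_distrib_left)
  also have "(\<Sum>i\<in>I. w i * x i) = m - r * a" by (simp add: m_def)
  also have "(\<Sum>i\<in>I. w i) = 1 - r" using assms(3) by simp
  finally show ?thesis by (simp add: power2_eq_square algebra_simps)
 qed
 have "0 <= r * (a - m)\<^sup>2 + (\<Sum>i\<in>I. w i * (x i - m)\<^sup>2)"
  using assms by (intro add_nonneg_nonneg sum_nonneg) auto
 then show "(r * a + (\<Sum>i\<in>I. w i * x i))\<^sup>2 <= r * a\<^sup>2 + (\<Sum>i\<in>I. w i * (x i)\<^sup>2)"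
  unfolding * by (simp add: m_def)
 show "r * a\<^sup>2 + (\<Sum>i\<in>I. w i * (x i)\<^sup>2) - (r * a + (\<Sum>i\<in>I. w i * x i))\<^sup>2 <= (\<Sum>i\<in>I. w i * (x i - a)\<^sup>2)"
  using *[of a] by (simp add: m_def[symmetric])
qed

text \<open>Young's inequality with weights \<open>p\<close> and \<open>1 - p\<close>, multiplied by
  \<open>1 - p\<close>. What counts is the coefficient 1 in front of \<open>c\<^sup>2\<close>: there
  \<open>c\<close> will be the discrepancy of a smaller problem, whose constant is thus passed on
  unchanged.\<close>

lemma square_add_le:
 fixes b c p :: real
 assumes "0 < p" "p <= 1"
 shows "(1 - p) * (b + c)\<^sup>2 <= b\<^sup>2 / p + c\<^sup>2"
proof -
 have "0 <= ((1 - p) * b - p * c)\<^sup>2" by simp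
 also have "... = (1 - p)\<^sup>2 * b\<^sup>2 - 2 * (1 - p) * p * b * c + p\<^sup>2 * c\<^sup>2"
  by (simp add: power2_eq_square algebra_simps)
 also have "... <= b\<^sup>2 + p * c\<^sup>2 - p * ((1 - p) * (b + c)\<^sup>2)"
 proof -
  have "b\<^sup>2 + p * c\<^sup>2 - p * ((1 - p) * (b + c)\<^sup>2) - ((1 - p)\<^sup>2 * b\<^sup>2 - 2 * (1 - p) * p * b * c + p\<^sup>2 * c\<^sup>2) = p * b\<^sup>2"
   by (simp add: power2_eq_square algebra_simps)
  moreover have "0 <= p * b\<^sup>2" using assms by simp
  ultimately show ?thesis by linarith
 qed
 finally have "p * ((1 - p) * (b + c)\<^sup>2) <= b\<^sup>2 + p * c\<^sup>2" by simp
 then show ?thesis using assms by (simp add: field_simps)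
qed

lemma square_diff_le: "(a - b :: real)\<^sup>2 <= 2 * (a - c)\<^sup>2 + 2 * (b - c)\<^sup>2"
proof -
 have "0 <= (a + b - 2 * c)\<^sup>2" by simp
 then show ?thesis by (simp add: power2_eq_square algebra_simps)
qed

text \<open>Deleting a vertex perturbs expectations by at most the Dirichlet form. Revealing the partner \<open>y\<close>
 of \<open>x\<close> in one system and then the partner \<open>z\<close> of \<open>y\<close> in the other leaves the same problem at \<open>z\<close> on
 a smaller graph. The local errors of this step are charged to pairs of states that the smaller problem
 does not use, so the constant does not grow along the recursion.\<close>

lemma gex_avoid_diff_square:
 assumes "wgraph lam B F"
 shows "(gex lam (avoid x F) f - gex lam F f)\<^sup>2 <= 3 * (1 + B)\<^sup>2 * dirichlet lam F f"
 using assms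
proof (induction "card F" arbitrary: F x f rule: less_induct)
 case less
 note w = less.prems
 define c where "c = 3 * (1 + B)\<^sup>2"
 have B: "0 <= B" using wgraphD(4)[OF w] .
 have c0: "0 <= c" by (simp add: c_def)
 show ?case
 proof (cases "inc x F = {}")
  case True
  then have "avoid x F = F" by (auto simp: avoid_def inc_def)
  then show ?thesis using dirichlet_nonneg[OF w] by simp
 next
  case False
  define H where "H = avoid x F"
  define p where "p = free_prob lam F x"
  define q where "q = edge_prob lam F"
  define d where "d e = gex lam (away e F) (%M. (f (insert e M) - f M)\<^sup>2)" for e
  define t where "t e = gex lam H f - gex lam (away e F) (%M. f (insert e M))" for e
  define D where "D e = dirichlet lam (away e F) (%M. f (insert e M))" for e
  have wH: "wgraph lam B H" unfolding H_def by (rule wgraph_avoid[OF w])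
  have p: "p + (\<Sum>e\<in>inc x F. q e) = 1" "0 < p" "p <= 1" "!!e. 0 < q e" "1 <= p * (1 + B)"
   using prob_vertex(1-3,5)[OF w, of x] prob_vertex(4)[OF w] by (auto simp: p_def q_def)
  have d0: "0 <= d e" and D0: "0 <= D e" for e
   unfolding d_def D_def by (auto intro: gex_nonneg[OF wgraph_away[OF w]] dirichlet_nonneg[OF wgraph_away[OF w]])
  have DH0: "0 <= dirichlet lam H f" by (rule dirichlet_nonneg[OF wH])
  \<comment> \<open>When \<open>x\<close> is free the two systems agree, so the discrepancy is
    carried by the matched case alone, of total mass \<open>1 - p\<close>.\<close>
  have phi: "gex lam H f - gex lam F f = (\<Sum>e\<in>inc x F. q e * t e)"
  proof -
   have "(\<Sum>e\<in>inc x F. q e * t e) = (\<Sum>e\<in>inc x F. q e) * gex lam H f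
     - (\<Sum>e\<in>inc x F. q e * gex lam (away e F) (%M. f (insert e M)))"
    by (simp add: t_def right_diff_distrib sum_subtractf sum_distrib_right)
   also have "(\<Sum>e\<in>inc x F. q e) = 1 - p" using p(1) by simp
   finally show ?thesis unfolding gex_vertex[OF w, of f x]
    by (simp add: H_def p_def q_def algebra_simps)
  qed
  \<comment> \<open>The factor \<open>1 - p\<close> is the one that Cauchy-Schwarz over the partner
    \<open>e\<close> will supply; it is exactly what \<open>square_add_le\<close> consumes.\<close>
  have key: "(1 - p) * (t e)\<^sup>2 <= c * d e + c * D e + 2 * (1 + B) * dirichlet lam H f"
   if e: "e \<in> inc x F" for e
  proof -
   have e2: "e \<in> F" "card e = 2" "x \<in> e" using e wgraphD(2)[OF w] by (auto simp: inc_def)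
   define y where "y = other x e"
   define Y where "Y = avoid y H"
   define fe where "fe M = f (insert e M)" for M
   have Y: "away e F = Y" unfolding Y_def y_def H_def by (rule away_eq[OF e2(2,3)])
   have wY: "wgraph lam B Y" unfolding Y_def by (rule wgraph_avoid[OF wH])
   have YF: "card Y < card F"
    using e2 wgraphD(1)[OF w] unfolding Y_def H_def
    by (intro psubset_card_mono) (auto simp: avoid_def)
   define r where "r = free_prob lam H y"
   define s where "s = edge_prob lam H"
   have r: "r + (\<Sum>g\<in>inc y H. s g) = 1" "0 < r" "r <= 1" "!!g. 0 < s g"
    using prob_vertex(1-3,5)[OF wH, of y] prob_vertex(4)[OF wH] by (auto simp: r_def s_def)
   define a where "a = gex lam Y (%M. f M - fe M)"
   define b where "b g = gex lam (away g H) (%M. f (insert g M) - fe M)" for g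
   define h where "h g = gex lam (away g H) fe - gex lam Y fe" for g
   \<comment> \<open>The partner of \<open>y\<close> in \<open>H\<close> is revealed. The terms
     \<open>a\<close> and \<open>b g\<close> are local errors from adding \<open>e\<close> or
     \<open>g\<close> to the matching; \<open>h g\<close> is again the deletion of one vertex,
     namely the other end of \<open>g\<close>, now in \<open>Y\<close> and for the function
     \<open>fe\<close>.\<close>
   have te: "t e = r * a + (\<Sum>g\<in>inc y H. s g * (b g + h g))"
   proof -
    have "(\<Sum>g\<in>inc y H. s g * (b g + h g)) = (\<Sum>g\<in>inc y H. s g * gex lam (away g H) (%M. f (insert g M)))
      - (\<Sum>g\<in>inc y H. s g) * gex lam Y fe"
     by (simp add: b_def h_def gex_diff right_diff_distrib sum_subtractf sum_distrib_right)
    also have "(\<Sum>g\<in>inc y H. s g) = 1 - r" using r(1) by simp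
    finally show ?thesis
     unfolding t_def gex_vertex[OF wH, of f y] Y
     by (simp add: r_def s_def Y_def a_def gex_diff fe_def[symmetric] algebra_simps)
   qed
   have hb: "(h g)\<^sup>2 <= c * D e" if g: "g \<in> inc y H" for g
   proof -
    have "card g = 2" "y \<in> g" using g wgraphD(2)[OF wH] by (auto simp: inc_def)
    then have "away g H = avoid (other y g) Y" unfolding Y_def by (rule away_eq)
    then show ?thesis using less.hyps[OF YF wY, of "other y g" fe]
     by (simp add: h_def c_def D_def Y fe_def[abs_def])
   qed
   have bb: "(b g)\<^sup>2 <= 2 * gex lam (away g H) (%M. (f (insert g M) - f M)\<^sup>2) + 2 * (1 + B) * d e"
    if g: "g \<in> inc y H" for g
   proof -
    have wg: "wgraph lam B (away g H)" by (rule wgraph_away[OF wH])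
    have g2: "card g = 2" "y \<in> g" using g wgraphD(2)[OF wH] by (auto simp: inc_def)
    have "(b g)\<^sup>2 <= gex lam (away g H) (%M. (f (insert g M) - fe M)\<^sup>2)"
     unfolding b_def by (rule gex_square[OF wg])
    also have "... <= gex lam (away g H) (%M. 2 * (f (insert g M) - f M)\<^sup>2 + 2 * (fe M - f M)\<^sup>2)"
     by (rule gex_mono[OF wg]) (rule square_diff_le)
    also have "... = 2 * gex lam (away g H) (%M. (f (insert g M) - f M)\<^sup>2)
      + 2 * gex lam (away g H) (%M. (fe M - f M)\<^sup>2)"
     by (simp add: gex_add gex_cmult)
    also have "gex lam (away g H) (%M. (fe M - f M)\<^sup>2) <= (1 + B) * d e"
     unfolding away_eq[OF g2, of H] d_def Y Y_def[symmetric] fe_def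
     by (rule gex_avoid_le[OF wY]) simp
    finally show ?thesis by (simp add: algebra_simps)
   qed
   have sb: "(\<Sum>g\<in>inc y H. s g * gex lam (away g H) (%M. (f (insert g M) - f M)\<^sup>2)) <= dirichlet lam H f"
   proof -
    have "0 <= r * dirichlet lam (avoid y H) f" using r dirichlet_nonneg[OF wgraph_avoid[OF wH]] by simp
    moreover have "(\<Sum>g\<in>inc y H. s g * gex lam (away g H) (%M. (f (insert g M) - f M)\<^sup>2))
     <= (\<Sum>g\<in>inc y H. s g * (dirichlet lam (away g H) (%M. f (insert g M)) + gex lam (away g H) (%M. (f (insert g M) - f M)\<^sup>2)))"
     using r(4) dirichlet_nonneg[OF wgraph_away[OF wH]]
     by (intro sum_mono mult_left_mono) (auto simp: less_imp_le)
    ultimately show ?thesis unfolding dirichlet_vertex[OF wH, of f y] by (simp add: r_def s_def)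
   qed
   have "(t e)\<^sup>2 <= r * a\<^sup>2 + (\<Sum>g\<in>inc y H. s g * (b g + h g)\<^sup>2)"
    unfolding te using r by (intro convex_square(1)) (auto simp: less_imp_le)
   then have "(1 - p) * (t e)\<^sup>2 <= (1 - p) * (r * a\<^sup>2 + (\<Sum>g\<in>inc y H. s g * (b g + h g)\<^sup>2))"
    using p(3) by (intro mult_left_mono) auto
   also have "... = (1 - p) * (r * a\<^sup>2) + (\<Sum>g\<in>inc y H. s g * ((1 - p) * (b g + h g)\<^sup>2))"
    by (simp add: distrib_left sum_distrib_left mult.left_commute)
   also have "... <= d e + (\<Sum>g\<in>inc y H. s g * ((1 + B) * (2 * gex lam (away g H) (%M. (f (insert g M) - f M)\<^sup>2) + 2 * (1 + B) * d e) + c * D e))"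
   proof (intro add_mono sum_mono mult_left_mono)
    have "a\<^sup>2 <= gex lam Y (%M. (f M - fe M)\<^sup>2)" unfolding a_def by (rule gex_square[OF wY])
    also have "... = d e" unfolding d_def Y fe_def by (simp add: power2_commute)
    finally have "a\<^sup>2 <= d e" .
    moreover have "(1 - p) * r <= 1" using mult_mono[of "1 - p" 1 r 1] p r by simp
    ultimately show "(1 - p) * (r * a\<^sup>2) <= d e"
     using mult_mono[of "(1 - p) * r" 1 "a\<^sup>2" "d e"] d0[of e] by (simp add: mult.assoc)
   next
    fix g assume g: "g \<in> inc y H"
    have "(1 - p) * (b g + h g)\<^sup>2 <= (b g)\<^sup>2 / p + (h g)\<^sup>2" by (rule square_add_le[OF p(2,3)])
    moreover have "(b g)\<^sup>2 / p <= (1 + B) * (b g)\<^sup>2"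
     using mult_right_mono[OF p(5), of "(b g)\<^sup>2"] p(2) by (simp add: field_simps)
    moreover have "(1 + B) * (b g)\<^sup>2 <= (1 + B) * (2 * gex lam (away g H) (%M. (f (insert g M) - f M)\<^sup>2) + 2 * (1 + B) * d e)"
     using bb[OF g] B by (intro mult_left_mono) auto
    ultimately show "(1 - p) * (b g + h g)\<^sup>2 <= (1 + B) * (2 * gex lam (away g H) (%M. (f (insert g M) - f M)\<^sup>2) + 2 * (1 + B) * d e) + c * D e"
     using hb[OF g] by linarith
    show "0 <= s g" using r(4)[of g] by simp
   qed
   also have "... = d e + 2 * (1 + B) * (\<Sum>g\<in>inc y H. s g * gex lam (away g H) (%M. (f (insert g M) - f M)\<^sup>2))
     + (\<Sum>g\<in>inc y H. s g) * (2 * (1 + B)\<^sup>2 * d e + c * D e)"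
    by (simp add: sum_distrib_left sum_distrib_right sum.distrib[symmetric] power2_eq_square algebra_simps)
   also have "... <= d e + 2 * (1 + B) * dirichlet lam H f + 1 * (2 * (1 + B)\<^sup>2 * d e + c * D e)"
    using sb B r d0[of e] D0[of e] c0 by (intro add_mono mult_left_mono mult_right_mono) auto
   also have "... <= c * d e + c * D e + 2 * (1 + B) * dirichlet lam H f"
   proof -
    \<comment> \<open>One of the two places that fix \<open>c\<close>: here it absorbs
      \<open>1 + 2 * (1 + B)\<^sup>2\<close>, and at the end \<open>2 * (1 + B)\<close> with the
      help of \<open>1 <= p * (1 + B)\<close>.\<close>
    have "1 <= (1 + B)\<^sup>2" using B by simp
    then have "(1 + 2 * (1 + B)\<^sup>2) * d e <= c * d e" using d0[of e] by (intro mult_right_mono) (auto simp: c_def)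
    then show ?thesis by (simp add: algebra_simps)
   qed
   finally show ?thesis .
  qed
  have "(gex lam H f - gex lam F f)\<^sup>2 <= (\<Sum>e\<in>inc x F. q e) * (\<Sum>e\<in>inc x F. q e * (t e)\<^sup>2)"
   unfolding phi by (rule weighted_square_le) (simp add: p(4) less_imp_le)
  also have "... = (\<Sum>e\<in>inc x F. q e * ((1 - p) * (t e)\<^sup>2))"
  proof -
   have "(\<Sum>e\<in>inc x F. q e) = 1 - p" using p(1) by simp
   then show ?thesis by (simp add: sum_distrib_left mult.left_commute)
  qed
  also have "... <= (\<Sum>e\<in>inc x F. q e * (c * d e + c * D e + 2 * (1 + B) * dirichlet lam H f))"
   using p(4) by (intro sum_mono mult_left_mono key) (auto simp: less_imp_le)
  also have "... = c * (\<Sum>e\<in>inc x F. q e * (D e + d e)) + (\<Sum>e\<in>inc x F. q e) * (2 * (1 + B) * dirichlet lam H f)"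
   by (simp add: sum_distrib_left sum_distrib_right sum.distrib[symmetric] algebra_simps)
  also have "... <= c * (\<Sum>e\<in>inc x F. q e * (D e + d e)) + c * (p * dirichlet lam H f)"
  proof (rule add_left_mono)
   have "(\<Sum>e\<in>inc x F. q e) * (2 * (1 + B) * dirichlet lam H f) <= 1 * (2 * (1 + B) * dirichlet lam H f)"
    using p DH0 B by (intro mult_right_mono) auto
   also have "... <= (p * (1 + B)) * (3 * (1 + B) * dirichlet lam H f)"
    using p(5) DH0 B by (intro mult_mono) (auto intro: mult_right_mono)
   finally show "(\<Sum>e\<in>inc x F. q e) * (2 * (1 + B) * dirichlet lam H f) <= c * (p * dirichlet lam H f)"
    by (simp add: c_def power2_eq_square mult_ac)
  qed
  also have "... = c * dirichlet lam F f"
   unfolding dirichlet_vertex[OF w, of f x] by (simp add: p_def q_def D_def d_def H_def algebra_simps)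
  finally show ?thesis by (simp add: H_def c_def)
 qed
qed

definition gvar :: "('v set => real) => 'v set set => ('v set set => real) => real" where
 "gvar lam F f = gex lam F (%M. (f M)\<^sup>2) - (gex lam F f)\<^sup>2"

text \<open>Law of total variance over the partner of \<open>v\<close>. The conditional variances
  live on graphs without \<open>v\<close> and fall to the induction hypothesis. The conditional
  means are compared with the mean \<open>a\<close> of the case where \<open>v\<close> is free: this
  costs one removal of \<open>e\<close> and the deletion of the other end of \<open>e\<close>, which
  is \<open>gex_avoid_diff_square\<close>. Each vertex therefore adds \<open>8 * (1 + B)^3\<close>
  to the constant.\<close>

lemma gvar_le_dirichlet:
 assumes "finite U" "wgraph lam B F" "\<Union>F <= U"
 shows "gvar lam F f <= real (card U) * (8 * (1 + B)^3) * dirichlet lam F f"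
 using assms
proof (induction U arbitrary: F f rule: finite_induct)
 case empty
 then have "F = {}" using wgraphD(6)[OF empty(1)] by auto
 then have "matchings F = {{}}" by (auto simp: matchings_def)
 then show ?case using wgraphD(7)[OF empty(1)]
  by (simp add: gvar_def gex_def Zsum_def power2_eq_square weight_def)
next
 case (insert v U)
 note w = insert.prems(1)
 have B: "0 <= B" using wgraphD(4)[OF w] .
 define H where "H = avoid v F"
 define p where "p = free_prob lam F v"
 define q where "q = edge_prob lam F"
 define d where "d e = gex lam (away e F) (%M. (f (insert e M) - f M)\<^sup>2)" for e
 define D where "D e = dirichlet lam (away e F) (%M. f (insert e M))" for e
 define a where "a = gex lam H f"
 define h where "h e = gex lam (away e F) (%M. f (insert e M))" for e
 have wH: "wgraph lam B H" unfolding H_def by (rule wgraph_avoid[OF w])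
 have p: "p + (\<Sum>e\<in>inc v F. q e) = 1" "0 < p" "p <= 1" "!!e. 0 < q e" "1 <= p * (1 + B)"
  using prob_vertex(1-3,5)[OF w, of v] prob_vertex(4)[OF w] by (auto simp: p_def q_def)
 define k where "k = real (card U) * (8 * (1 + B)^3)"
 have dF: "dirichlet lam F f = p * dirichlet lam H f + (\<Sum>e\<in>inc v F. q e * (D e + d e))"
  unfolding dirichlet_vertex[OF w, of f v] by (simp add: p_def q_def D_def d_def H_def)
 have d0: "0 <= d e" and D0: "0 <= D e" for e
  unfolding d_def D_def by (auto intro: gex_nonneg[OF wgraph_away[OF w]] dirichlet_nonneg[OF wgraph_away[OF w]])
 have DH0: "0 <= dirichlet lam H f" by (rule dirichlet_nonneg[OF wH])
 have "gvar lam F f = p * gvar lam H f + (\<Sum>e\<in>inc v F. q e * gvar lam (away e F) (%M. f (insert e M)))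
   + (p * a\<^sup>2 + (\<Sum>e\<in>inc v F. q e * (h e)\<^sup>2) - (p * a + (\<Sum>e\<in>inc v F. q e * h e))\<^sup>2)"
  unfolding gvar_def gex_vertex[OF w, of f v] gex_vertex[OF w, of "%M. (f M)\<^sup>2" v]
  by (simp add: p_def q_def H_def a_def h_def right_diff_distrib sum_subtractf)
 also have "p * gvar lam H f <= p * (k * dirichlet lam H f)"
  using p(2) insert.IH[OF wH] insert.prems(2) unfolding k_def
  by (intro mult_left_mono) (auto simp: H_def avoid_def)
 also have "(\<Sum>e\<in>inc v F. q e * gvar lam (away e F) (%M. f (insert e M))) <= (\<Sum>e\<in>inc v F. q e * (k * D e))"
 proof (intro sum_mono mult_left_mono)
  fix e assume "e \<in> inc v F"
  then have "\<Union>(away e F) <= U" using insert.prems(2) by (auto simp: away_def inc_def disjnt_def)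
  then show "gvar lam (away e F) (%M. f (insert e M)) <= k * D e"
   unfolding k_def D_def by (rule insert.IH[OF wgraph_away[OF w]])
  show "0 <= q e" using p(4)[of e] by simp
 qed
 also have "p * a\<^sup>2 + (\<Sum>e\<in>inc v F. q e * (h e)\<^sup>2) - (p * a + (\<Sum>e\<in>inc v F. q e * h e))\<^sup>2
   <= (\<Sum>e\<in>inc v F. q e * (h e - a)\<^sup>2)"
  using p by (intro convex_square(2)) (auto simp: less_imp_le)
 also have "(\<Sum>e\<in>inc v F. q e * (h e - a)\<^sup>2) <= (\<Sum>e\<in>inc v F. q e * (2 * d e + 6 * (1 + B)\<^sup>2 * dirichlet lam H f))"
 proof (intro sum_mono mult_left_mono)
  fix e assume e: "e \<in> inc v F"
  then have e2: "card e = 2" "v \<in> e" using wgraphD(2)[OF w] by (auto simp: inc_def)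
  let ?g = "gex lam (away e F) f"
  have "(h e - a)\<^sup>2 <= 2 * (h e - ?g)\<^sup>2 + 2 * (a - ?g)\<^sup>2" by (rule square_diff_le)
  also have "(h e - ?g)\<^sup>2 <= d e"
   unfolding h_def d_def gex_diff[symmetric] by (rule gex_square[OF wgraph_away[OF w]])
  also have "(a - ?g)\<^sup>2 <= 3 * (1 + B)\<^sup>2 * dirichlet lam H f"
   unfolding a_def away_eq[OF e2] H_def[symmetric] power2_commute[of "gex lam H f"]
   by (rule gex_avoid_diff_square[OF wH])
  finally show "(h e - a)\<^sup>2 <= 2 * d e + 6 * (1 + B)\<^sup>2 * dirichlet lam H f" by simp
  show "0 <= q e" using p(4)[of e] by simp
 qed
 also have "... = 2 * (\<Sum>e\<in>inc v F. q e * d e) + (\<Sum>e\<in>inc v F. q e) * (6 * (1 + B)\<^sup>2 * dirichlet lam H f)"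
  by (simp add: sum_distrib_left sum_distrib_right sum.distrib[symmetric] algebra_simps)
 also have "... <= 2 * dirichlet lam F f + 1 * (6 * (1 + B)\<^sup>2 * ((1 + B) * dirichlet lam F f))"
 proof (intro add_mono mult_mono)
  have "(\<Sum>e\<in>inc v F. q e * d e) <= (\<Sum>e\<in>inc v F. q e * (D e + d e))"
   using p(4) D0 by (intro sum_mono mult_left_mono) (auto simp: less_imp_le)
  moreover have "0 <= p * dirichlet lam H f" using p(2) DH0 by simp
  ultimately show "(\<Sum>e\<in>inc v F. q e * d e) <= dirichlet lam F f" unfolding dF by linarith
  show "dirichlet lam H f <= (1 + B) * dirichlet lam F f"
   unfolding H_def by (rule dirichlet_avoid_le[OF w])
 qed (use p B DH0 d0 in \<open>auto intro!: sum_nonneg mult_nonneg_nonneg simp: less_imp_le\<close>)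
 also have "... <= 8 * (1 + B)^3 * dirichlet lam F f"
 proof -
  have "1 <= (1 + B)^3" using B by simp
  then have "(2 + 6 * (1 + B)^3) * dirichlet lam F f <= 8 * (1 + B)^3 * dirichlet lam F f"
   using dirichlet_nonneg[OF w] by (intro mult_right_mono) auto
  then show ?thesis by (simp add: algebra_simps power3_eq_cube power2_eq_square)
 qed
 finally have "gvar lam F f <= p * (k * dirichlet lam H f) + (\<Sum>e\<in>inc v F. q e * (k * D e)) + 8 * (1 + B)^3 * dirichlet lam F f"
  by simp
 also have "p * (k * dirichlet lam H f) + (\<Sum>e\<in>inc v F. q e * (k * D e)) <= k * dirichlet lam F f"
 proof -
  have "(\<Sum>e\<in>inc v F. q e * D e) <= (\<Sum>e\<in>inc v F. q e * (D e + d e))"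
   using p(4) d0 by (intro sum_mono mult_left_mono) (auto simp: less_imp_le)
  then have "k * (p * dirichlet lam H f + (\<Sum>e\<in>inc v F. q e * D e)) <= k * dirichlet lam F f"
   unfolding dF using B by (intro mult_left_mono) (auto simp: k_def)
  then show ?thesis by (simp add: distrib_left sum_distrib_left mult.left_commute)
 qed
 finally show ?case using insert.hyps by (simp add: k_def algebra_simps)
qed

section \<open>Spectral independence and entropy\<close>

definition res :: "'v set set => 'v set set => 'v set set" where
 "res S sg = {e \<in> S. \<forall>s\<in>sg. disjnt e s}"

text \<open>The conditional expectation of \<open>f\<close> under the Gibbs measure given
  \<open>M - S\<close>: what remains random is Gibbs on the edges of \<open>S\<close> that
  \<open>M - S\<close> does not block.\<close>

definition cond :: "('v set => real) => 'v set set => ('v set set => real) => 'v set set => real" where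
 "cond lam S f M = gex lam (res S (M - S)) (%K. f ((M - S) Un K))"

text \<open>The expected \<open>\<phi>\<close>-entropy left in the block \<open>S\<close> once
  everything outside it is fixed. With \<open>\<phi>\<close> general, variance and entropy share the
  decomposition along fibres and the contraction argument for the chain.\<close>

definition block_ent :: "(real => real) => ('v set => real) => 'v set set => 'v set set => ('v set set => real) => real" where
 "block_ent \<phi> lam F S f = gex lam F (%M. \<phi> (f M) - \<phi> (cond lam S f M))"

abbreviation (input) "sqent \<equiv> block_ent (%x. x\<^sup>2)"

definition fibre_prob :: "('v set => real) => 'v set set => 'v set set => 'v set set => real" where
 "fibre_prob lam F S sg = weight lam sg * Zsum lam (res S sg) / Zsum lam F"

lemma res_subset: "res S sg <= S" by (auto simp: res_def)

lemma res_empty [simp]: "res S {} = S" by (simp add: res_def)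

lemma union_matching:
 assumes "S <= F" "sg \<in> matchings (F - S)" "K \<in> matchings (res S sg)"
 shows "sg Un K \<in> matchings F" "(sg Un K) - S = sg" "(sg Un K) \<inter> S = K" "sg \<inter> K = {}"
proof -
 have s: "sg <= F - S" "pairwise disjnt sg" using assms(2) by (auto simp: matchings_def)
 have k: "K <= S" "pairwise disjnt K" "!!e s. e \<in> K ==> s \<in> sg ==> disjnt e s"
  using assms(3) by (auto simp: matchings_def res_def)
 show "(sg Un K) - S = sg" "(sg Un K) \<inter> S = K" "sg \<inter> K = {}" using s(1) k(1) by auto
 have "pairwise disjnt (sg Un K)"
  using s(2) k(2,3) unfolding pairwise_def by (metis Un_iff disjnt_sym)
 then show "sg Un K \<in> matchings F" using s(1) k(1) assms(1) by (auto simp: matchings_def)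
qed

lemma split_matching:
 assumes "M \<in> matchings F"
 shows "M - S \<in> matchings (F - S)" "M \<inter> S \<in> matchings (res S (M - S))"
 using assms by (auto simp: matchings_def res_def pairwise_def)

lemma sum_matchings_fibre:
 assumes "finite F" "S <= F"
 shows "(\<Sum>M\<in>matchings F. h M) = (\<Sum>sg\<in>matchings (F - S). \<Sum>K\<in>matchings (res S sg). h (sg Un K))"
proof -
 have fin: "finite (matchings (F - S))" "\<forall>sg\<in>matchings (F - S). finite (matchings (res S sg))"
  using assms finite_subset[OF res_subset finite_subset[OF assms(2,1)]] by (auto intro!: finite_matchings)
 have "(\<Sum>sg\<in>matchings (F - S). \<Sum>K\<in>matchings (res S sg). h (sg Un K))
   = (\<Sum>(sg, K)\<in>(SIGMA sg:matchings (F - S). matchings (res S sg)). h (sg Un K))"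
  by (rule sum.Sigma[OF fin])
 also have "... = (\<Sum>M\<in>matchings F. h M)"
  by (rule sum.reindex_bij_witness[of _ "%M. (M - S, M \<inter> S)" "%(sg, K). sg Un K"];
    clarsimp simp: union_matching[OF assms(2)] split_matching Un_Diff_Int)
 finally show ?thesis by simp
qed

lemma wgraph_res: "wgraph lam B F ==> S <= F ==> wgraph lam B (res S sg)"
 using wgraph_subset[of lam B F "res S sg"] res_subset[of S sg] by blast

lemma weight_union:
 assumes "wgraph lam B F" "S <= F" "sg \<in> matchings (F - S)" "K \<in> matchings (res S sg)"
 shows "weight lam (sg Un K) = weight lam sg * weight lam K"
proof -
 have "finite sg" "finite K"
  using matchings_finite[OF _ assms(3)] matchings_finite[OF _ assms(4)]
   wgraphD(1)[OF assms(1)] wgraphD(1)[OF wgraph_res[OF assms(1,2)]] by auto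
 then show ?thesis unfolding weight_def using union_matching(4)[OF assms(2-4)] by (rule prod.union_disjoint)
qed

lemma gex_fibre:
 assumes "wgraph lam B F" "S <= F"
 shows "gex lam F f = (\<Sum>sg\<in>matchings (F - S). fibre_prob lam F S sg * gex lam (res S sg) (%K. f (sg Un K)))"
proof -
 have nz: "Zsum lam (res S sg) ~= 0" for sg
  using wgraphD(7)[OF wgraph_res[OF assms, of sg]] by simp
 have "(\<Sum>M\<in>matchings F. weight lam M * f M)
   = (\<Sum>sg\<in>matchings (F - S). weight lam sg * (\<Sum>K\<in>matchings (res S sg). weight lam K * f (sg Un K)))"
  unfolding sum_matchings_fibre[OF wgraphD(1)[OF assms(1)] assms(2), of "%M. weight lam M * f M"]
  by (simp add: weight_union[OF assms] sum_distrib_left mult.assoc)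
 then show ?thesis
  by (simp add: gex_def fibre_prob_def nz sum_divide_distrib[of _ "matchings (F - S)"])
qed

lemma fibre_prob_pos: assumes "wgraph lam B F" "S <= F" shows "0 < fibre_prob lam F S sg"
 unfolding fibre_prob_def
 using wgraphD(7)[OF wgraph_res[OF assms, of sg]] wgraphD(7)[OF assms(1)] weight_pos[of lam sg] wgraphD(3)[OF assms(1)]
 by simp

lemma sum_fibre_prob: assumes "wgraph lam B F" "S <= F"
 shows "(\<Sum>sg\<in>matchings (F - S). fibre_prob lam F S sg) = 1"
 using gex_fibre[OF assms, of "%_. 1"] gex_const[OF assms(1)] gex_const[OF wgraph_res[OF assms]] by simp

lemma cond_fibre:
 assumes "S <= F" "sg \<in> matchings (F - S)" "K \<in> matchings (res S sg)"
 shows "cond lam S f (sg Un K) = gex lam (res S sg) (%K. f (sg Un K))"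
 unfolding cond_def union_matching(2)[OF assms] ..

text \<open>Conditioning in two stages. Inside the fibre of \<open>sg\<close> the block
  \<open>T\<close> shrinks to \<open>T \<inter> res S sg\<close>, since the other edges of
  \<open>T\<close> are blocked by \<open>sg\<close>.\<close>

lemma cond_nested:
 assumes "S <= F" "sg \<in> matchings (F - S)" "K \<in> matchings (res S sg)" "T <= S"
 shows "cond lam T f (sg Un K) = cond lam (T \<inter> res S sg) (%L. f (sg Un L)) K"
proof -
 have K: "K <= res S sg" using assms(3) by (auto simp: matchings_def)
 have 1: "sg Un K - T = sg Un (K - T)" using assms(2,4) by (auto simp: matchings_def)
 have 2: "K - T \<inter> res S sg = K - T" using K by auto
 have "res T (sg Un (K - T)) = res (T \<inter> res S sg) (K - T)" using assms(4) by (auto simp: res_def)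
 then show ?thesis by (simp add: cond_def 1 2 Un_assoc)
qed

lemma cond_full: "M \<in> matchings F ==> cond lam F f M = gex lam F f"
proof -
 assume "M \<in> matchings F" then have "M - F = {}" by (auto simp: matchings_def)
 then show ?thesis by (simp only: cond_def res_empty Un_empty_left)
qed

lemma gex_cond:
 assumes "wgraph lam B F" "S <= F" shows "gex lam F (cond lam S f) = gex lam F f"
proof -
 have "gex lam (res S sg) (%K. cond lam S f (sg Un K)) = gex lam (res S sg) (%K. f (sg Un K))"
  if "sg \<in> matchings (F - S)" for sg
 proof -
  have "gex lam (res S sg) (%K. cond lam S f (sg Un K)) = gex lam (res S sg) (%_. gex lam (res S sg) (%K. f (sg Un K)))"
   by (rule gex_cong) (rule cond_fibre[OF assms(2) that])
  then show ?thesis by (simp add: gex_const[OF wgraph_res[OF assms]])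
 qed
 then show ?thesis by (simp add: gex_fibre[OF assms])
qed

text \<open>Averaging over the boundary condition \<open>sg\<close> turns any entropy inequality on
  the restricted graphs into one for blocks of \<open>F\<close>.\<close>

lemma block_ent_fibre:
 assumes "wgraph lam B F" "S <= F" "T <= S"
 shows "block_ent \<phi> lam F T f = (\<Sum>sg\<in>matchings (F - S). fibre_prob lam F S sg
   * block_ent \<phi> lam (res S sg) (T \<inter> res S sg) (%L. f (sg Un L)))"
 unfolding block_ent_def gex_fibre[OF assms(1,2)]
 by (intro sum.cong refl arg_cong2[of _ _ _ _ times] gex_cong) (simp add: cond_nested[OF assms(2) _ _ assms(3)])

lemma block_ent_full: "block_ent \<phi> lam F F f = gex lam F (%M. \<phi> (f M)) - gex lam F (%_. \<phi> (gex lam F f))"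
 unfolding block_ent_def gex_diff[symmetric] by (rule gex_cong) (simp add: cond_full)

lemma block_ent_whole: "wgraph lam B F ==> block_ent \<phi> lam F F f = gex lam F (%M. \<phi> (f M)) - \<phi> (gex lam F f)"
 by (simp add: block_ent_full gex_const)

lemma block_ent_fibre_whole:
 assumes "wgraph lam B F" "S <= F"
 shows "block_ent \<phi> lam F S f = (\<Sum>sg\<in>matchings (F - S). fibre_prob lam F S sg
   * block_ent \<phi> lam (res S sg) (res S sg) (%L. f (sg Un L)))"
proof -
 have "S \<inter> res S sg = res S sg" for sg using res_subset[of S sg] by blast
 then show ?thesis using block_ent_fibre[OF assms order_refl, of \<phi> f] by simp
qed

section \<open>Influences, covariances and exponential moments\<close>

definition marg :: "('v set => real) => 'v set set => 'v set => real" where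
 "marg lam F g = gex lam F (%M. of_bool (g \<in> M))"

lemma marg_insert:
 assumes "wgraph lam B F" "e \<in> F"
 shows "gex lam (away e F) (%M. of_bool (g \<in> insert e M)) = of_bool (g = e) + marg lam (away e F) g"
proof -
 have "gex lam (away e F) (%M. of_bool (g \<in> insert e M)) = gex lam (away e F) (%M. of_bool (g = e) + of_bool (g \<in> M))"
  using notin_away[OF wgraphD(6)[OF assms]] by (intro gex_cong) auto
 then show ?thesis by (simp add: gex_add gex_const[OF wgraph_away[OF assms(1)]] marg_def)
qed

text \<open>With probability \<open>p\<close> the vertex is free and nothing changes. Otherwise the
  partner edge costs 1 and the rest is the deletion of its other end in \<open>avoid x F\<close>,
  which costs at most \<open>B\<close> by induction. The loop closes because
  \<open>(1 - p) * (1 + B) <= B\<close>.\<close>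

lemma sum_marg_avoid:
 assumes "finite G" "wgraph lam B F"
 shows "(\<Sum>g\<in>G. \<bar>marg lam F g - marg lam (avoid x F) g\<bar>) <= B"
 using assms(2)
proof (induction "card F" arbitrary: F x rule: less_induct)
 case less
 note w = less.prems
 define H where "H = avoid x F"
 define p where "p = free_prob lam F x"
 define q where "q = edge_prob lam F"
 have p: "p + (\<Sum>e\<in>inc x F. q e) = 1" "0 < p" "p <= 1" "!!e. 0 < q e" "1 <= p * (1 + B)"
  using prob_vertex(1-3,5)[OF w, of x] prob_vertex(4)[OF w] by (auto simp: p_def q_def)
 have wH: "wgraph lam B H" unfolding H_def by (rule wgraph_avoid[OF w])
 have B: "0 <= B" using wgraphD(4)[OF w] .
 have *: "marg lam F g - marg lam H g = (\<Sum>e\<in>inc x F. q e * (of_bool (g = e) + (marg lam (away e F) g - marg lam H g)))" for g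
 proof -
  have "marg lam F g = p * marg lam H g + (\<Sum>e\<in>inc x F. q e * (of_bool (g = e) + marg lam (away e F) g))"
  proof -
   have "(\<Sum>e\<in>inc x F. q e * gex lam (away e F) (%M. of_bool (g \<in> insert e M)))
     = (\<Sum>e\<in>inc x F. q e * (of_bool (g = e) + marg lam (away e F) g))"
    by (rule sum.cong[OF refl], subst marg_insert[OF w]) (simp_all add: inc_def)
   then show ?thesis
    unfolding marg_def[of lam F] marg_def[of lam H] gex_vertex[OF w, of _ x] p_def q_def H_def
    by (simp only: marg_def[of lam "avoid x F"])
  qed
  moreover have "(\<Sum>e\<in>inc x F. q e * (of_bool (g = e) + (marg lam (away e F) g - marg lam H g)))
    = (\<Sum>e\<in>inc x F. q e * (of_bool (g = e) + marg lam (away e F) g)) - (\<Sum>e\<in>inc x F. q e) * marg lam H g"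
   by (simp add: right_diff_distrib distrib_left add_diff_eq sum_subtractf sum.distrib sum_distrib_right)
  moreover have "(\<Sum>e\<in>inc x F. q e) = 1 - p" using p(1) by simp
  ultimately show ?thesis by (simp add: algebra_simps)
 qed
 have IH: "(\<Sum>g\<in>G. \<bar>of_bool (g = e) + (marg lam (away e F) g - marg lam H g)\<bar>) <= 1 + B" if e: "e \<in> inc x F" for e
 proof -
  have e2: "e \<in> F" "card e = 2" "x \<in> e" using e wgraphD(2)[OF w] by (auto simp: inc_def)
  have HF: "card H < card F" unfolding H_def using e2 wgraphD(1)[OF w]
   by (intro psubset_card_mono) (auto simp: avoid_def)
  have "(\<Sum>g\<in>G. \<bar>of_bool (g = e) + (marg lam (away e F) g - marg lam H g)\<bar>)
    <= (\<Sum>g\<in>G. of_bool (g = e) + \<bar>marg lam H g - marg lam (away e F) g\<bar>)"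
   by (intro sum_mono) auto
  also have "... = (\<Sum>g\<in>G. of_bool (g = e)) + (\<Sum>g\<in>G. \<bar>marg lam H g - marg lam (avoid (other x e) H) g\<bar>)"
   by (simp add: sum.distrib away_eq[OF e2(2,3)] H_def)
  also have "... <= 1 + B"
   using less.hyps[OF HF wH, of "other x e"] assms(1) by (intro add_mono) (auto simp: of_bool_def)
  finally show ?thesis .
 qed
 have "(\<Sum>g\<in>G. \<bar>marg lam F g - marg lam H g\<bar>)
   <= (\<Sum>g\<in>G. \<Sum>e\<in>inc x F. q e * \<bar>of_bool (g = e) + (marg lam (away e F) g - marg lam H g)\<bar>)"
 proof (intro sum_mono)
  fix g
  show "\<bar>marg lam F g - marg lam H g\<bar> <= (\<Sum>e\<in>inc x F. q e * \<bar>of_bool (g = e) + (marg lam (away e F) g - marg lam H g)\<bar>)"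
   unfolding * by (rule order_trans[OF sum_abs]) (simp add: abs_mult p(4) less_imp_le)
 qed
 also have "... = (\<Sum>e\<in>inc x F. q e * (\<Sum>g\<in>G. \<bar>of_bool (g = e) + (marg lam (away e F) g - marg lam H g)\<bar>))"
  by (subst sum.swap) (simp add: sum_distrib_left)
 also have "... <= (\<Sum>e\<in>inc x F. q e * (1 + B))"
  using p(4) by (intro sum_mono mult_left_mono IH) (auto simp: less_imp_le)
 also have "... = (1 - p) * (1 + B)" using p(1) by (simp add: sum_distrib_right[symmetric])
 also have "... <= B" using p(5) by (simp add: algebra_simps)
 finally show ?case by (simp add: H_def)
qed

lemma marg_eq: assumes "wgraph lam B F" "e \<in> F" shows "marg lam F e = edge_prob lam F e"
proof -
 have "gex lam (F - {e}) (%M. of_bool (e \<in> M)) = gex lam (F - {e}) (%M. 0 * of_bool (e \<in> M))"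
  by (rule gex_cong) (auto simp: matchings_def)
 then have 0: "gex lam (F - {e}) (%M. of_bool (e \<in> M)) = 0" using gex_cmult[of lam "F - {e}" 0 "%M. of_bool (e \<in> M)"] by simp
 show ?thesis unfolding marg_def using gex_edge(1)[OF assms, of "%M. of_bool (e \<in> M)"]
  by (simp add: 0 gex_const[OF wgraph_away[OF assms(1)]])
qed

text \<open>For the last bound, the edge probability factors into \<open>lam e\<close> times the
  probabilities that one end is free and that the other is free after the first is deleted.\<close>

lemma edge_prob_le: assumes "wgraph lam B F" "e \<in> F" shows "edge_prob lam F e < 1" "1 <= (1 - edge_prob lam F e) * (1 + B)"
  "lam e <= edge_prob lam F e * (1 + B)\<^sup>2"
proof -
 obtain x where x: "x \<in> e" using wgraphD(6)[OF assms] by blast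
 note e2 = wgraphD(2)[OF assms]
 have "avoid x F <= F - {e}" using x by (auto simp: avoid_def)
 then have "Zsum lam (avoid x F) <= Zsum lam (F - {e})"
  by (rule Zsum_mono[OF wgraph_subset[OF assms(1)], rotated]) auto
 then have fp: "free_prob lam F x <= 1 - edge_prob lam F e"
  unfolding gex_edge(2)[OF assms, symmetric] free_prob_def
  using wgraphD(7)[OF assms(1)] by (intro divide_right_mono) auto
 then show "edge_prob lam F e < 1" using prob_vertex(2)[OF assms(1), of x] by simp
 show "1 <= (1 - edge_prob lam F e) * (1 + B)"
  using prob_vertex(5)[OF assms(1), of x] mult_right_mono[OF fp, of "1 + B"] wgraphD(4)[OF assms(1)] by linarith
 define y where "y = other x e"
 note wx = wgraph_avoid[OF assms(1), of x]
 have "edge_prob lam F e = lam e * (free_prob lam (avoid x F) y * free_prob lam F x)"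
  unfolding edge_prob_def free_prob_def away_eq[OF e2 x] y_def[symmetric]
  using wgraphD(7)[OF wx] by simp
 moreover have "1 * 1 <= (free_prob lam (avoid x F) y * (1 + B)) * (free_prob lam F x * (1 + B))"
  using prob_vertex(5)[OF wx, of y] prob_vertex(5)[OF assms(1), of x] by (intro mult_mono) auto
 ultimately show "lam e <= edge_prob lam F e * (1 + B)\<^sup>2"
  using mult_left_mono[of 1 _ "lam e"] wgraphD(3)[OF assms(1), of e] by (simp add: power2_eq_square mult_ac)
qed

text \<open>Spectral independence. The covariance matrix \<open>C\<close> of the edge indicators has
  absolute row sums at most \<open>1 + 2 * B\<close>, because conditioning on \<open>e\<close>
  amounts to deleting its two ends, at a total influence of at most \<open>B\<close> each. For a
  symmetric matrix the row sums bound the quadratic form.\<close>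

lemma gvar_linear_le:
 assumes "wgraph lam B F"
 shows "gvar lam F (%M. \<Sum>e\<in>F. a e * of_bool (e \<in> M)) <= (1 + 2 * B) * (\<Sum>e\<in>F. (a e)\<^sup>2)"
proof -
 note w = wgraphD[OF assms]
 define C where "C e g = gex lam F (%M. of_bool (e \<in> M) * of_bool (g \<in> M)) - marg lam F e * marg lam F g" for e g
 have sym: "C e g = C g e" for e g by (simp add: C_def mult.commute)
 have C: "C e g = edge_prob lam F e * (of_bool (g = e) + marg lam (away e F) g - marg lam F g)" if e: "e \<in> F" for e g
 proof -
  have 0: "gex lam (F - {e}) (%M. of_bool (e \<in> M) * of_bool (g \<in> M)) = 0"
  proof -
   have "gex lam (F - {e}) (%M. of_bool (e \<in> M) * of_bool (g \<in> M)) = gex lam (F - {e}) (%_. 0)"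
    by (rule gex_cong) (auto simp: matchings_def)
   then show ?thesis using gex_const[OF wgraph_subset[OF assms, of "F - {e}"], of 0] by auto
  qed
  have "gex lam F (%M. of_bool (e \<in> M) * of_bool (g \<in> M)) = edge_prob lam F e * gex lam (away e F) (%M. of_bool (g \<in> insert e M))"
   unfolding gex_edge(1)[OF assms e, of "%M. of_bool (e \<in> M) * of_bool (g \<in> M)"] 0 by simp
  then show ?thesis unfolding C_def marg_insert[OF assms e] marg_eq[OF assms e] by (simp add: algebra_simps)
 qed
 have row: "(\<Sum>g\<in>F. \<bar>C e g\<bar>) <= 1 + 2 * B" if e: "e \<in> F" for e
 proof -
  obtain x where x: "x \<in> e" using w(6)[OF e] by blast
  define y where "y = other x e"
  note wx = wgraph_avoid[OF assms, of x]
  have aw: "away e F = avoid y (avoid x F)" unfolding y_def by (rule away_eq[OF w(2)[OF e] x])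
  have "(\<Sum>g\<in>F. \<bar>C e g\<bar>) <= (\<Sum>g\<in>F. of_bool (g = e) + \<bar>marg lam F g - marg lam (avoid x F) g\<bar>
    + \<bar>marg lam (avoid x F) g - marg lam (avoid y (avoid x F)) g\<bar>)"
  proof (rule sum_mono)
   fix g
   have "\<bar>C e g\<bar> = edge_prob lam F e * \<bar>of_bool (g = e) + marg lam (away e F) g - marg lam F g\<bar>"
    using C[OF e, of g] prob_vertex(4)[OF assms, of e] by (simp add: abs_mult)
   also have "... <= 1 * \<bar>of_bool (g = e) + marg lam (away e F) g - marg lam F g\<bar>"
    using edge_prob_le(1)[OF assms e] by (intro mult_right_mono) auto
   also have "... <= of_bool (g = e) + \<bar>marg lam F g - marg lam (avoid x F) g\<bar>
    + \<bar>marg lam (avoid x F) g - marg lam (avoid y (avoid x F)) g\<bar>" unfolding aw by auto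
   finally show "\<bar>C e g\<bar> <= of_bool (g = e) + \<bar>marg lam F g - marg lam (avoid x F) g\<bar>
    + \<bar>marg lam (avoid x F) g - marg lam (avoid y (avoid x F)) g\<bar>" .
  qed
  also have "... <= 1 + B + B"
   unfolding sum.distrib using sum_marg_avoid[OF w(1) assms, of x] sum_marg_avoid[OF w(1) wx, of y] w(1)
   by (intro add_mono) (auto simp: of_bool_def)
  finally show ?thesis by simp
 qed
 have sq: "(\<Sum>e\<in>F. a e * of_bool (e \<in> M))\<^sup>2 = (\<Sum>e\<in>F. \<Sum>g\<in>F. a e * a g * (of_bool (e \<in> M) * of_bool (g \<in> M)))" for M
  by (simp add: power2_eq_square sum_product mult_ac)
 have "gvar lam F (%M. \<Sum>e\<in>F. a e * of_bool (e \<in> M)) = (\<Sum>e\<in>F. \<Sum>g\<in>F. a e * a g * C e g)"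
  unfolding gvar_def sq gex_sum gex_cmult
  by (simp add: marg_def[symmetric] C_def power2_eq_square sum_product sum_subtractf[symmetric] algebra_simps)
 also have "... <= (\<Sum>e\<in>F. \<Sum>g\<in>F. (a e)\<^sup>2 / 2 * \<bar>C e g\<bar> + (a g)\<^sup>2 / 2 * \<bar>C g e\<bar>)"
 proof (intro sum_mono)
  fix e g
  have "a e * a g * C e g <= \<bar>a e * a g\<bar> * \<bar>C e g\<bar>" by (metis abs_ge_self abs_mult)
  also have "\<bar>a e * a g\<bar> <= (a e)\<^sup>2 / 2 + (a g)\<^sup>2 / 2"
   using sum_squares_bound[of "\<bar>a e\<bar>" "\<bar>a g\<bar>"] by (simp add: abs_mult)
  finally show "a e * a g * C e g <= (a e)\<^sup>2 / 2 * \<bar>C e g\<bar> + (a g)\<^sup>2 / 2 * \<bar>C g e\<bar>"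
   by (simp add: mult_right_mono algebra_simps sym[of g e])
 qed
 also have "... = (\<Sum>e\<in>F. (a e)\<^sup>2 / 2 * (\<Sum>g\<in>F. \<bar>C e g\<bar>)) + (\<Sum>g\<in>F. (a g)\<^sup>2 / 2 * (\<Sum>e\<in>F. \<bar>C g e\<bar>))"
  unfolding sum.distrib by (subst (2) sum.swap) (simp add: sum_distrib_left)
 also have "... = (\<Sum>e\<in>F. (a e)\<^sup>2 * (\<Sum>g\<in>F. \<bar>C e g\<bar>))" by (simp add: sum.distrib[symmetric])
 also have "... <= (\<Sum>e\<in>F. (a e)\<^sup>2 * (1 + 2 * B))" by (intro sum_mono mult_left_mono row) auto
 finally show ?thesis by (simp add: sum_distrib_left mult.commute)
qed

text \<open>Exponential tilting by a linear statistic changes only the edge weights, so the variance bound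
 holds along the whole path from \<open>lam\<close> to the tilted weights.\<close>

lemma log_laplace_le:
 assumes "wgraph lam B F" "!!e. \<bar>a e\<bar> <= 1"
 shows "ln (gex lam F (%M. exp (\<Sum>e\<in>F. a e * of_bool (e \<in> M))))
  <= (\<Sum>e\<in>F. a e * marg lam F e) + (1 + 6 * B) / 2 * (\<Sum>e\<in>F. (a e)\<^sup>2)"
proof -
 note w = wgraphD[OF assms(1)]
 define g where "g M = (\<Sum>e\<in>F. a e * of_bool (e \<in> M))" for M
 define lt where "lt t e = lam e * exp (t * a e)" for t e
 define N where "N j t = (\<Sum>M\<in>matchings F. weight lam M * g M ^ j * exp (t * g M))" for j :: nat and t
 have gM: "g M = (\<Sum>e\<in>M. a e)" if "M \<in> matchings F" for M
 proof -
  have "M <= F" using that by (simp add: matchings_def)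
  then show ?thesis unfolding g_def using w(1) by (simp add: of_bool_def if_distrib sum.If_cases Int_absorb1 cong: if_cong)
 qed
 have wt: "weight (lt t) M = weight lam M * exp (t * g M)" if "M \<in> matchings F" for t M
  unfolding weight_def lt_def prod.distrib gM[OF that] sum_distrib_left
  using exp_sum[OF matchings_finite[OF w(1) that], of "%e. t * a e"] by simp
 have gx: "gex (lt t) F (%M. g M ^ j) = N j t / N 0 t" for j t
  unfolding gex_def Zsum_def N_def by (simp add: wt mult_ac)
 have N0: "0 < N 0 t" for t
  using Zsum_pos[of "lt t" F] w(1,3) by (simp add: lt_def Zsum_def N_def wt)
 \<comment> \<open>Coefficients of modulus at most 1 and \<open>t <= 1\<close> raise each weight by
   a factor of at most \<open>exp 1 <= 3\<close>. This is where \<open>3 * B\<close>, and then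
   \<open>6 * B\<close>, comes from.\<close>
 have wgt: "wgraph (lt t) (3 * B) F" if "0 <= t" "t <= 1" for t
 proof -
  have "exp (t * a e) <= 3" for e
  proof -
   have "t * a e <= 1 * 1" using that assms(2)[of e] by (metis abs_ge_self abs_mult abs_of_nonneg mult_mono' order_trans abs_ge_zero)
   then have "exp (t * a e) <= exp 1" by simp
   then show ?thesis using exp_le by linarith
  qed
  then have "(\<Sum>e\<in>inc x F. lt t e) <= (\<Sum>e\<in>inc x F. 3 * lam e)" for x
   unfolding lt_def using w(3) by (intro sum_mono) (simp add: less_imp_le)
  then have "(\<Sum>e\<in>inc x F. lt t e) <= 3 * B" for x
   using w(5)[of x] by (simp add: sum_distrib_left[symmetric]) (meson mult_le_cancel_left_pos order_trans zero_less_numeral)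
  then show ?thesis using w assms(1) by (simp add: wgraph_def lt_def)
 qed
 have dN: "(N j has_real_derivative N (Suc j) t) (at t)" for j t
  unfolding N_def by (auto intro!: derivative_eq_intros sum.cong simp: mult_ac)
 \<comment> \<open>The derivatives of the logarithm of the tilted partition function:
   \<open>diff 1\<close> is the tilted mean of \<open>g\<close> and \<open>diff 2\<close> its tilted
   variance, to be bounded by \<open>gvar_linear_le\<close>.\<close>
 define diff where "diff m t = (if m = 0 then ln (N 0 t) else if m = 1 then N 1 t / N 0 t
   else (N 2 t * N 0 t - N 1 t * N 1 t) / (N 0 t * N 0 t))" for m :: nat and t
 have "\<exists>t::real. 0 < t & t < 1 & diff 0 1 = (\<Sum>m<2. (diff m 0 / fact m) * 1 ^ m) + (diff 2 t / fact 2) * 1 ^ 2"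
 proof (rule Maclaurin)
  show "\<forall>m t. m < 2 & 0 <= t & t <= 1 \<longrightarrow> (diff m has_real_derivative diff (Suc m) t) (at t)"
  proof (intro allI impI)
   fix m :: nat and t :: real assume "m < 2 & 0 <= t & t <= 1"
   then consider "m = 0" | "m = 1" by linarith
   then show "(diff m has_real_derivative diff (Suc m) t) (at t)"
   proof cases
    case 1
    then show ?thesis unfolding diff_def using N0[of t]
     by (auto intro!: derivative_eq_intros dN)
   next
    case 2
    then show ?thesis unfolding diff_def using N0[of t]
     by (auto intro!: derivative_eq_intros dN simp: numeral_2_eq_2)
   qed
  qed
 qed auto
 then obtain t where t: "0 < t" "t < 1" "diff 0 1 = (\<Sum>m<2. (diff m 0 / fact m) * 1 ^ m) + (diff 2 t / fact 2) * 1 ^ 2"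
  by blast
 then have ln: "ln (N 0 1) = ln (N 0 0) + N 1 0 / N 0 0 + diff 2 t / 2"
  by (simp add: diff_def numeral_2_eq_2)
 have "diff 2 t = gvar (lt t) F g"
 proof -
  have "gvar (lt t) F g = N 2 t / N 0 t - (N 1 t / N 0 t)\<^sup>2" unfolding gvar_def using gx[of t 2] gx[of t 1] by simp
  then show ?thesis using N0[of t] by (simp add: diff_def power2_eq_square field_simps)
 qed
 also have "... <= (1 + 2 * (3 * B)) * (\<Sum>e\<in>F. (a e)\<^sup>2)"
  unfolding g_def by (rule gvar_linear_le[OF wgt]) (use t in auto)
 finally have d2: "diff 2 t / 2 <= (1 + 6 * B) / 2 * (\<Sum>e\<in>F. (a e)\<^sup>2)" by simp
 have "lt 0 = lam" by (auto simp: lt_def)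
 then have "N 1 0 / N 0 0 = gex lam F g" using gx[of 0 1] by simp
 also have "... = (\<Sum>e\<in>F. a e * marg lam F e)" unfolding g_def by (simp add: gex_sum gex_cmult marg_def)
 finally have d1: "N 1 0 / N 0 0 = (\<Sum>e\<in>F. a e * marg lam F e)" .
 have "gex lam F (%M. exp (g M)) = N 0 1 / N 0 0" by (simp add: gex_def N_def Zsum_def)
 then have "ln (gex lam F (%M. exp (g M))) = ln (N 0 1) - ln (N 0 0)" using N0[of 0] N0[of 1] by (simp add: ln_div)
 then show ?thesis using ln d1 d2 by (simp add: g_def)
qed

section \<open>Entropy, and its loss when one edge is pinned\<close>

definition xlx :: "real => real" where "xlx x = x * ln x"

abbreviation (input) "ent \<equiv> block_ent xlx"

text \<open>By convexity the graph of \<open>xlx\<close> lies above its tangent at \<open>x\<close>.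
  The lower bounds on entropy below arise from letting \<open>x\<close> depend on the matching. The
  value \<open>y = 0\<close> is covered because \<open>xlx 0 = 0\<close>.\<close>

lemma xlx_tangent: assumes "0 <= y" "0 < x" shows "y * ln x + y - x <= xlx y"
proof (cases "y = 0")
 case False
 then have "ln (x / y) <= x / y - 1" using assms by (intro ln_le_minus_one) auto
 then have "y * (ln x - ln y) <= y * (x / y - 1)" using assms False by (intro mult_left_mono) (auto simp: ln_div)
 then show ?thesis using False by (simp add: xlx_def algebra_simps)
qed (use assms in \<open>simp add: xlx_def\<close>)

lemma xlx_jensen:
 assumes "finite I" "!!i. i \<in> I ==> 0 <= w i" "!!i. i \<in> I ==> 0 <= x i" "(\<Sum>i\<in>I. w i) = 1"
 shows "xlx (\<Sum>i\<in>I. w i * x i) <= (\<Sum>i\<in>I. w i * xlx (x i))"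
proof -
 define m where "m = (\<Sum>i\<in>I. w i * x i)"
 have m0: "0 <= m" unfolding m_def using assms by (intro sum_nonneg) auto
 show ?thesis
 proof (cases "m = 0")
  case True
  then have "\<forall>i\<in>I. w i * x i = 0" using assms sum_nonneg_eq_0_iff[of I "%i. w i * x i"] by (auto simp: m_def)
  then have "(\<Sum>i\<in>I. w i * xlx (x i)) = 0" by (intro sum.neutral) (auto simp: xlx_def)
  then show ?thesis using True by (simp add: m_def[symmetric] xlx_def)
 next
  case False
  then have "(\<Sum>i\<in>I. w i * (x i * ln m + x i - m)) <= (\<Sum>i\<in>I. w i * xlx (x i))"
   using assms m0 by (intro sum_mono mult_left_mono xlx_tangent) auto
  also have "(\<Sum>i\<in>I. w i * (x i * ln m + x i - m)) = (\<Sum>i\<in>I. ln m * (w i * x i) + w i * x i - m * w i)"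
   by (intro sum.cong refl) (simp add: algebra_simps)
  also have "... = ln m * m + m - m * (\<Sum>i\<in>I. w i)"
   by (simp only: sum.distrib sum_subtractf sum_distrib_left[symmetric] m_def[symmetric])
  finally show ?thesis using assms(4) by (simp add: m_def[symmetric] xlx_def mult.commute)
 qed
qed

lemma gex_xlx_jensen:
 assumes "wgraph lam B F" "!!M. M \<in> matchings F ==> 0 <= f M"
 shows "xlx (gex lam F f) <= gex lam F (%M. xlx (f M))"
proof -
 note w = wgraphD[OF assms(1)]
 have "xlx (\<Sum>M\<in>matchings F. weight lam M / Zsum lam F * f M)
   <= (\<Sum>M\<in>matchings F. weight lam M / Zsum lam F * xlx (f M))"
  using w weight_pos[of lam] assms(2)
  by (intro xlx_jensen) (auto simp: less_imp_le sum_divide_distrib[symmetric] Zsum_def[symmetric])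
 then show ?thesis by (simp add: gex_def sum_divide_distrib)
qed

lemma block_ent_nonneg:
 assumes "wgraph lam B F" "S <= F" "!!M. M \<in> matchings F ==> 0 <= f M"
 shows "0 <= ent lam F S f"
 unfolding block_ent_fibre_whole[OF assms(1,2)]
proof (intro sum_nonneg mult_nonneg_nonneg)
 fix sg assume s: "sg \<in> matchings (F - S)"
 note wr = wgraph_res[OF assms(1,2), of sg]
 show "0 <= fibre_prob lam F S sg" using fibre_prob_pos[OF assms(1,2), of sg] by simp
 show "0 <= ent lam (res S sg) (res S sg) (%L. f (sg Un L))"
  unfolding block_ent_whole[OF wr] using gex_xlx_jensen[OF wr, of "%L. f (sg Un L)"] union_matching(1)[OF assms(2) s] assms(3)
  by auto
qed

text \<open>Duality: for a density \<open>f\<close>, the entropy is at least the expectation of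
  \<open>f * g\<close> minus \<open>ln\<close> of the expectation of \<open>exp g\<close>. A linear
  \<open>g\<close> makes the last term quadratic by \<open>log_laplace_le\<close>. The slope
  \<open>x e / C\<close> with \<open>C = 1 + 6 * B\<close> maximizes the resulting bound, and also
  keeps the coefficients within modulus 1.\<close>

lemma marginal_shift_le_entropy:
 assumes "wgraph lam B F" "!!M. M \<in> matchings F ==> 0 <= f M" "gex lam F f = 1"
 defines "x \<equiv> %e. gex lam F (%M. f M * of_bool (e \<in> M)) - marg lam F e"
 shows "(\<Sum>e\<in>F. (x e)\<^sup>2) <= 2 * (1 + 6 * B) * gex lam F (%M. xlx (f M))"
proof -
 note w = wgraphD[OF assms(1)]
 define C where "C = 1 + 6 * B"
 have C: "1 <= C" using w(4) by (simp add: C_def)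
 have m01: "0 <= marg lam F e" "marg lam F e <= 1" for e
  using gex_nonneg[OF assms(1), of "%M. of_bool (e \<in> M)"] gex_mono[OF assms(1), of "%M. of_bool (e \<in> M)" "%_. 1"]
   gex_const[OF assms(1), of 1] by (auto simp: marg_def)
 have n01: "0 <= gex lam F (%M. f M * of_bool (e \<in> M))" "gex lam F (%M. f M * of_bool (e \<in> M)) <= 1" for e
  using gex_nonneg[OF assms(1), of "%M. f M * of_bool (e \<in> M)"] gex_mono[OF assms(1), of "%M. f M * of_bool (e \<in> M)" f]
   assms(2,3) by (auto simp: of_bool_def)
 define a where "a e = x e / C" for e
 have xb: "\<bar>x e\<bar> <= 1" for e using m01[of e] n01[of e] by (auto simp: x_def)
 have a1: "\<bar>a e\<bar> <= 1" for e
 proof -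
  have "\<bar>x e\<bar> / C <= 1 / 1" using xb[of e] C by (intro frac_le) auto
  then show ?thesis using C by (simp add: a_def)
 qed
 define g where "g M = (\<Sum>e\<in>F. a e * of_bool (e \<in> M))" for M
 define G where "G = gex lam F (%M. exp (g M))"
 have ne: "matchings F ~= {}" using empty_matching[of F] by blast
 have G: "0 < G" unfolding G_def gex_def using w weight_pos[of lam] ne
  by (intro divide_pos_pos sum_pos mult_pos_pos finite_matchings) auto
 have lnG: "ln (exp (g M) * inverse G) = g M - ln G" for M
  using G by (simp add: ln_div divide_inverse[symmetric])
 have "gex lam F (%M. f M * ln (exp (g M) / G) + f M - exp (g M) / G) <= gex lam F (%M. xlx (f M))"
  using G assms(2) by (intro gex_mono[OF assms(1)] xlx_tangent) auto
 also have "gex lam F (%M. f M * ln (exp (g M) / G) + f M - exp (g M) / G)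
   = gex lam F (%M. f M * g M - ln G * f M + f M - inverse G * exp (g M))"
  unfolding divide_inverse lnG by (simp add: algebra_simps)
 also have "... = gex lam F (%M. f M * g M) - ln G"
  using G by (simp add: gex_add gex_diff gex_cmult assms(3) G_def[symmetric])
 finally have dv: "gex lam F (%M. f M * g M) - ln G <= gex lam F (%M. xlx (f M))" .
 have "gex lam F (%M. f M * g M) = gex lam F (%M. \<Sum>e\<in>F. a e * (f M * of_bool (e \<in> M)))"
  by (simp add: g_def sum_distrib_left mult.left_commute)
 also have "... = (\<Sum>e\<in>F. a e * gex lam F (%M. f M * of_bool (e \<in> M)))" by (simp add: gex_sum gex_cmult)
 finally have fg: "gex lam F (%M. f M * g M) = (\<Sum>e\<in>F. a e * gex lam F (%M. f M * of_bool (e \<in> M)))" .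
 have "ln G <= (\<Sum>e\<in>F. a e * marg lam F e) + C / 2 * (\<Sum>e\<in>F. (a e)\<^sup>2)"
  unfolding G_def g_def C_def by (rule log_laplace_le[OF assms(1) a1])
 then have "gex lam F (%M. xlx (f M)) \<ge> (\<Sum>e\<in>F. a e * x e) - C / 2 * (\<Sum>e\<in>F. (a e)\<^sup>2)"
  using dv unfolding fg x_def right_diff_distrib sum_subtractf by linarith
 also have "(\<Sum>e\<in>F. a e * x e) - C / 2 * (\<Sum>e\<in>F. (a e)\<^sup>2) = (\<Sum>e\<in>F. (x e)\<^sup>2) / (2 * C)"
 proof -
  have "(\<Sum>e\<in>F. a e * x e) = (\<Sum>e\<in>F. (x e)\<^sup>2) / C" by (simp add: a_def power2_eq_square sum_divide_distrib)
  moreover have "(\<Sum>e\<in>F. (a e)\<^sup>2) = (\<Sum>e\<in>F. (x e)\<^sup>2) / C\<^sup>2" by (simp add: a_def power_divide sum_divide_distrib)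
  ultimately show ?thesis using C by (simp add: field_simps power2_eq_square)
 qed
 finally show ?thesis unfolding C_def[symmetric] using C by (simp add: field_simps)
qed

lemma cond_pin_edge:
 assumes "wgraph lam B F" "e \<in> F" "M \<in> matchings F"
 shows "cond lam (F - {e}) f M = (if e \<in> M then gex lam (away e F) (%K. f (insert e K)) else gex lam (F - {e}) f)"
proof (cases "e \<in> M")
 case True
 have 1: "M - (F - {e}) = {e}" using True assms(3) by (auto simp: matchings_def)
 have 2: "res (F - {e}) {e} = away e F" using wgraphD(6)[OF assms(1,2)] by (auto simp: res_def away_def disjnt_def)
 show ?thesis unfolding cond_def 1 2 using True by simp
next
 case False
 then have 1: "M - (F - {e}) = {}" using assms(3) by (auto simp: matchings_def)
 show ?thesis unfolding cond_def 1 res_empty using False by simp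
qed

text \<open>The left side is the entropy of a two-valued function, the conditional mean of
  \<open>f\<close> given whether \<open>e\<close> is present. The bound
  \<open>xlx y <= y * (y - 1)\<close> replaces it by the variance, which is the squared marginal
  shift over \<open>q * (1 - q)\<close>. From \<open>1 <= lam e\<close> follows
  \<open>1 <= q * (1 - q) * (1 + B)^3\<close>.\<close>

lemma edge_entropy_le:
 assumes "wgraph lam B F" "!!M. M \<in> matchings F ==> 0 <= f M" "gex lam F f = 1" "e \<in> F" "1 <= lam e"
 shows "ent lam F F f - ent lam F (F - {e}) f
  <= (1 + B)^3 * (gex lam F (%M. f M * of_bool (e \<in> M)) - marg lam F e)\<^sup>2"
proof -
 define q where "q = edge_prob lam F e"
 define al where "al = gex lam (away e F) (%K. f (insert e K))"
 define be where "be = gex lam (F - {e}) f"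
 have wm: "wgraph lam B (F - {e})" by (rule wgraph_subset[OF assms(1)]) auto
 have q: "0 < q" "q < 1" "1 <= (1 - q) * (1 + B)" "1 <= q * (1 + B)\<^sup>2"
  using prob_vertex(4)[OF assms(1)] edge_prob_le[OF assms(1,4)] assms(5) by (auto simp: q_def)
 have al0: "0 <= al" unfolding al_def using insert_matching[OF assms(4)] assms(2)
  by (intro gex_nonneg[OF wgraph_away[OF assms(1)]]) auto
 have be0: "0 <= be" unfolding be_def using matchings_mono[of "F - {e}" F] assms(2) by (intro gex_nonneg[OF wm]) auto
 have mean: "(1 - q) * be + q * al = 1"
  using gex_edge(1)[OF assms(1,4), of f] assms(3) by (simp add: q_def al_def be_def)
 have x: "gex lam F (%M. f M * of_bool (e \<in> M)) - marg lam F e = q * (al - 1)"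
 proof -
  have "gex lam (F - {e}) (%M. f M * of_bool (e \<in> M)) = gex lam (F - {e}) (%_. 0)"
   by (rule gex_cong) (auto simp: matchings_def)
  then show ?thesis using gex_edge(1)[OF assms(1,4), of "%M. f M * of_bool (e \<in> M)"]
   by (simp add: gex_const[OF wm] marg_eq[OF assms(1,4)] q_def al_def algebra_simps)
 qed
 have "ent lam F F f - ent lam F (F - {e}) f = gex lam F (%M. xlx (cond lam (F - {e}) f M))"
  unfolding block_ent_whole[OF assms(1)] unfolding block_ent_def gex_diff assms(3) by (simp add: xlx_def)
 also have "... = gex lam F (%M. if e \<in> M then xlx al else xlx be)"
  by (rule gex_cong) (simp add: cond_pin_edge[OF assms(1,4)] al_def be_def)
 also have "... = (1 - q) * xlx be + q * xlx al"
 proof -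
  have "gex lam (F - {e}) (%M. if e \<in> M then xlx al else xlx be) = gex lam (F - {e}) (%_. xlx be)"
   by (rule gex_cong) (auto simp: matchings_def)
  then show ?thesis using gex_edge(1)[OF assms(1,4), of "%M. if e \<in> M then xlx al else xlx be"]
   by (simp add: gex_const[OF wm] gex_const[OF wgraph_away[OF assms(1)]] q_def)
 qed
 also have "... <= (1 - q) * (be * (be - 1)) + q * (al * (al - 1))"
 proof -
  have "xlx y <= y * (y - 1)" if "0 <= y" for y
   using that by (cases "y = 0") (auto simp: xlx_def intro!: mult_left_mono ln_le_minus_one)
  then show ?thesis using al0 be0 q by (intro add_mono mult_left_mono) auto
 qed
 also have "... = q * (1 - q) * (al - be)\<^sup>2"
 proof -
  have "(1 - q) * (be * (be - 1)) + q * (al * (al - 1)) = (1 - q) * be\<^sup>2 + q * al\<^sup>2 - ((1 - q) * be + q * al)\<^sup>2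
    + (((1 - q) * be + q * al)\<^sup>2 - ((1 - q) * be + q * al))"
   by (simp add: power2_eq_square algebra_simps)
  also have "((1 - q) * be + q * al)\<^sup>2 - ((1 - q) * be + q * al) = 0" unfolding mean by simp
  finally show ?thesis by (simp add: power2_eq_square algebra_simps)
 qed
 also have "... <= (q * (1 + B)\<^sup>2 * ((1 - q) * (1 + B))) * (q * (1 - q) * (al - be)\<^sup>2)"
 proof -
  have "1 * 1 <= q * (1 + B)\<^sup>2 * ((1 - q) * (1 + B))" using q by (intro mult_mono) auto
  then have "1 * (q * (1 - q) * (al - be)\<^sup>2) <= (q * (1 + B)\<^sup>2 * ((1 - q) * (1 + B))) * (q * (1 - q) * (al - be)\<^sup>2)"
   using q by (intro mult_right_mono) auto
  then show ?thesis by simp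
 qed
 also have "... = (1 + B)^3 * (q * ((1 - q) * (al - be)))\<^sup>2"
  by (simp add: power2_eq_square power3_eq_cube algebra_simps)
 also have "(1 - q) * (al - be) = al - 1" using mean by (simp add: algebra_simps)
 finally show ?thesis unfolding x .
qed

lemma cond_nonneg:
 assumes "wgraph lam B F" "S <= F" "!!M. M \<in> matchings F ==> 0 <= f M" "M \<in> matchings F"
 shows "0 <= cond lam S f M"
 unfolding cond_def
 using union_matching(1)[OF assms(2) split_matching(1)[OF assms(4)]] assms(3)
 by (intro gex_nonneg[OF wgraph_res[OF assms(1,2)]]) auto

lemma cond_cmult: "cond lam S (%M. c * f M) M = c * cond lam S f M"
 by (simp add: cond_def gex_cmult)

lemma block_ent_cmult:
 assumes "wgraph lam B F" "S <= F" "!!M. M \<in> matchings F ==> 0 <= f M" "0 < c"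
 shows "ent lam F S (%M. c * f M) = c * ent lam F S f"
proof -
 have x: "xlx (c * y) = c * xlx y + c * ln c * y" if "0 <= y" for y
  using that assms(4) by (cases "y = 0") (auto simp: xlx_def ln_mult algebra_simps)
 have "ent lam F S (%M. c * f M)
   = gex lam F (%M. c * (xlx (f M) - xlx (cond lam S f M)) + c * ln c * (f M - cond lam S f M))"
  unfolding block_ent_def
  by (rule gex_cong) (simp add: cond_cmult x assms(3) cond_nonneg[OF assms(1-3)] algebra_simps)
 also have "... = c * ent lam F S f + c * ln c * gex lam F (%M. f M - cond lam S f M)"
  unfolding gex_add gex_cmult block_ent_def ..
 also have "gex lam F (%M. f M - cond lam S f M) = 0" unfolding gex_diff gex_cond[OF assms(1,2)] by simp
 finally show ?thesis by simp
qed

lemma block_ent_null: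
 assumes "S <= F" "!!M. M \<in> matchings F ==> f M = 0" "wgraph lam B F"
 shows "ent lam F S f = 0"
proof -
 have "cond lam S f M = 0" if M: "M \<in> matchings F" for M
 proof -
  have "cond lam S f M = gex lam (res S (M - S)) (%_. 0)"
   unfolding cond_def using union_matching(1)[OF assms(1) split_matching(1)[OF M]] assms(2) by (intro gex_cong) auto
  then show ?thesis by (simp add: gex_const[OF wgraph_res[OF assms(3,1)]])
 qed
 then have "ent lam F S f = gex lam F (%_. 0)"
  unfolding block_ent_def by (intro gex_cong) (simp add: assms(2))
 then show ?thesis by (simp add: gex_const[OF assms(3)])
qed

lemma gex_zeroD:
 assumes "wgraph lam B F" "!!M. M \<in> matchings F ==> 0 <= f M" "gex lam F f = 0" "M \<in> matchings F"
 shows "f M = 0"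
proof -
 note w = wgraphD[OF assms(1)]
 have "(\<Sum>M\<in>matchings F. weight lam M * f M) = 0" using assms(3) w(7) by (simp add: gex_def)
 then have "\<forall>M\<in>matchings F. weight lam M * f M = 0"
  using w weight_pos[of lam] assms(2) by (subst (asm) sum_nonneg_eq_0_iff) (auto simp: less_imp_le)
 then show ?thesis using assms(4) weight_pos[of lam M] w(3) by auto
qed

text \<open>The product of the constants of \<open>edge_entropy_le\<close> and
  \<open>marginal_shift_le_entropy\<close>, with \<open>2 * (1 + 6 * B)\<close> rounded up to
  \<open>12 * (1 + B)\<close>.\<close>

definition ent_rate :: "real => real" where "ent_rate B = 12 * (1 + B)^4"

text \<open>Pinning a uniformly random edge loses on average at most the fraction
  \<open>ent_rate B / card F\<close> of the entropy. Entropy is homogeneous of degree one, so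
  \<open>f\<close> may be scaled to mean 1.\<close>

lemma sum_edge_entropy_le:
 assumes "wgraph lam B F" "!!M. M \<in> matchings F ==> 0 <= f M" "!!e. e \<in> F ==> 1 <= lam e"
 shows "(\<Sum>e\<in>F. ent lam F F f - ent lam F (F - {e}) f) <= ent_rate B * ent lam F F f"
proof (cases "gex lam F f = 0")
 case True
 then have "!!M. M \<in> matchings F ==> f M = 0" using gex_zeroD[where f = f, OF assms(1) assms(2) True] by blast
 then have "ent lam F S f = 0" if "S <= F" for S using block_ent_null[OF that _ assms(1)] by blast
 then show ?thesis by simp
next
 case False
 define m where "m = gex lam F f"
 have m: "0 < m" using False gex_nonneg[OF assms(1), of f] assms(2) by (auto simp: m_def less_le)
 have B: "0 <= B" using wgraphD(4)[OF assms(1)] .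
 define g where "g M = inverse m * f M" for M
 have g0: "!!M. M \<in> matchings F ==> 0 <= g M" using m assms(2) by (simp add: g_def)
 have g1: "gex lam F g = 1" using m unfolding g_def gex_cmult by (simp add: m_def[symmetric])
 have bg: "ent lam F S f = m * ent lam F S g" if "S <= F" for S
  unfolding g_def using m by (subst block_ent_cmult[OF assms(1) that assms(2)]) auto
 have "(\<Sum>e\<in>F. ent lam F F g - ent lam F (F - {e}) g)
  <= (\<Sum>e\<in>F. (1 + B)^3 * (gex lam F (%M. g M * of_bool (e \<in> M)) - marg lam F e)\<^sup>2)"
  using assms(3) by (intro sum_mono edge_entropy_le[OF assms(1) g0 g1]) auto
 also have "... <= (1 + B)^3 * (2 * (1 + 6 * B) * gex lam F (%M. xlx (g M)))"
  unfolding sum_distrib_left[symmetric] using B by (intro mult_left_mono marginal_shift_le_entropy[OF assms(1) g0 g1]) auto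
 also have "gex lam F (%M. xlx (g M)) = ent lam F F g"
  unfolding block_ent_whole[OF assms(1)] g1 by (simp add: xlx_def)
 also have "(1 + B)^3 * (2 * (1 + 6 * B) * ent lam F F g) <= (1 + B)^3 * (12 * (1 + B) * ent lam F F g)"
  using B block_ent_nonneg[OF assms(1) order_refl g0] by (intro mult_left_mono mult_right_mono) auto
 also have "... = ent_rate B * ent lam F F g" by (simp add: ent_rate_def power_numeral_reduce)
 finally have "m * (\<Sum>e\<in>F. ent lam F F g - ent lam F (F - {e}) g) <= m * (ent_rate B * ent lam F F g)"
  using m by (intro mult_left_mono) auto
 then show ?thesis by (simp add: bg sum_distrib_left right_diff_distrib mult.left_commute)
qed

text \<open>The previous bound averaged over the boundary condition. Restricted graphs inherit
  \<open>B\<close>, and an edge that \<open>sg\<close> blocks contributes 0 because pinning it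
  changes nothing.\<close>

lemma pin_one_site:
 assumes "wgraph lam B F" "!!M. M \<in> matchings F ==> 0 <= f M" "!!e. e \<in> F ==> 1 <= lam e" "S <= F"
 shows "(\<Sum>e\<in>S. ent lam F S f - ent lam F (S - {e}) f) <= ent_rate B * ent lam F S f"
proof -
 define E where "E sg T = ent lam (res S sg) T (%L. f (sg Un L))" for sg T
 have S: "ent lam F S f = (\<Sum>sg\<in>matchings (F - S). fibre_prob lam F S sg * E sg (res S sg))"
  unfolding E_def by (rule block_ent_fibre_whole[OF assms(1,4)])
 have Se: "ent lam F (S - {e}) f = (\<Sum>sg\<in>matchings (F - S). fibre_prob lam F S sg * E sg ((S - {e}) \<inter> res S sg))" for e
  unfolding E_def by (rule block_ent_fibre[OF assms(1,4)]) auto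
 have "(\<Sum>e\<in>S. ent lam F S f - ent lam F (S - {e}) f)
   = (\<Sum>e\<in>S. \<Sum>sg\<in>matchings (F - S). fibre_prob lam F S sg * (E sg (res S sg) - E sg ((S - {e}) \<inter> res S sg)))"
  unfolding S Se by (simp add: right_diff_distrib sum_subtractf)
 also have "... = (\<Sum>sg\<in>matchings (F - S). fibre_prob lam F S sg * (\<Sum>e\<in>S. E sg (res S sg) - E sg ((S - {e}) \<inter> res S sg)))"
  by (subst sum.swap) (simp add: sum_distrib_left)
 also have "... <= (\<Sum>sg\<in>matchings (F - S). fibre_prob lam F S sg * (ent_rate B * E sg (res S sg)))"
 proof (intro sum_mono mult_left_mono)
  fix sg assume s: "sg \<in> matchings (F - S)"
  have "(\<Sum>e\<in>S. E sg (res S sg) - E sg ((S - {e}) \<inter> res S sg)) = (\<Sum>e\<in>res S sg. E sg (res S sg) - E sg ((S - {e}) \<inter> res S sg))"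
  proof (rule sum.mono_neutral_right)
   show "finite S" using assms(4) wgraphD(1)[OF assms(1)] finite_subset by blast
   show "\<forall>e\<in>S - res S sg. E sg (res S sg) - E sg ((S - {e}) \<inter> res S sg) = 0"
   proof
    fix e assume "e \<in> S - res S sg"
    then have "(S - {e}) \<inter> res S sg = res S sg" using res_subset[of S sg] by auto
    then show "E sg (res S sg) - E sg ((S - {e}) \<inter> res S sg) = 0" by simp
   qed
  qed (rule res_subset)
  also have "... = (\<Sum>e\<in>res S sg. E sg (res S sg) - E sg (res S sg - {e}))"
  proof (intro sum.cong refl)
   fix e
   have "(S - {e}) \<inter> res S sg = res S sg - {e}" using res_subset[of S sg] by auto
   then show "E sg (res S sg) - E sg ((S - {e}) \<inter> res S sg) = E sg (res S sg) - E sg (res S sg - {e})" by simp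
  qed
  also have "... <= ent_rate B * E sg (res S sg)"
   unfolding E_def using union_matching(1)[OF assms(4) s] assms(2,3,4) res_subset[of S sg]
   by (intro sum_edge_entropy_le[OF wgraph_res[OF assms(1,4)]]) auto
  finally show "(\<Sum>e\<in>S. E sg (res S sg) - E sg ((S - {e}) \<inter> res S sg)) <= ent_rate B * E sg (res S sg)" .
  show "0 <= fibre_prob lam F S sg" using fibre_prob_pos[OF assms(1,4), of sg] by simp
 qed
 also have "... = ent_rate B * ent lam F S f" unfolding S by (simp add: sum_distrib_left mult.left_commute)
 finally show ?thesis .
qed

section \<open>Approximate tensorization of entropy\<close>

text \<open>Double counting of the pairs of a set and one of its elements: a set with
  \<open>j\<close> elements arises in \<open>card F - j\<close> ways by deleting one
  element.\<close>

lemma subset_average_step: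
 fixes a :: "'b set => real"
 assumes "finite F" "!!S. S <= F ==> card S = Suc j ==> (real (Suc j) - k) * a S <= (\<Sum>e\<in>S. a (S - {e}))"
 shows "(real (Suc j) - k) * (\<Sum>S | S <= F & card S = Suc j. a S)
   <= real (card F - j) * (\<Sum>S | S <= F & card S = j. a S)"
proof -
 have fin: "finite {S. S <= F & card S = i}" for i
  by (rule finite_subset[of _ "Pow F"]) (use assms(1) in auto)
 have finS: "finite S" if "S <= F" for S using that assms(1) finite_subset by blast
 have "(real (Suc j) - k) * (\<Sum>S | S <= F & card S = Suc j. a S)
   <= (\<Sum>S | S <= F & card S = Suc j. \<Sum>e\<in>S. a (S - {e}))"
  unfolding sum_distrib_left using assms(2) by (intro sum_mono) auto
 also have "... = (\<Sum>(S, e)\<in>(SIGMA S:{S. S <= F & card S = Suc j}. S). a (S - {e}))"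
  using finS by (intro sum.Sigma fin) auto
 also have "... = (\<Sum>(S, e)\<in>(SIGMA S:{S. S <= F & card S = j}. F - S). a S)"
  by (rule sum.reindex_bij_witness[of _ "%(S, e). (insert e S, e)" "%(S, e). (S - {e}, e)"])
   (auto simp: insert_absorb card_insert_if finS card_Diff_singleton)
 also have "... = (\<Sum>S | S <= F & card S = j. \<Sum>e\<in>F - S. a S)"
  using assms(1) by (intro sum.Sigma[symmetric] fin) auto
 also have "... = (\<Sum>S | S <= F & card S = j. real (card F - j) * a S)"
  by (intro sum.cong refl) (auto simp: card_Diff_subset finS)
 finally show ?thesis by (simp add: sum_distrib_left)
qed

text \<open>Elements are pinned one at a time in random order. Going from size \<open>j + 1\<close>
  to \<open>j\<close> costs a factor \<open>(j + 1) / (j + 1 - k)\<close>, at most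
  \<open>exp (2 * k / (j + 1))\<close> because \<open>2 * k <= l\<close>. Since
  \<open>1 / (j + 1) <= ln (j + 1) - ln j\<close>, the exponents telescope.\<close>

lemma subset_average_chain:
 fixes a :: "'b set => real"
 assumes "finite F" "0 <= k" "0 < l" "l <= card F" "2 * k <= real l"
  "!!S. S <= F ==> 0 <= a S" "!!S. S <= F ==> (real (card S) - k) * a S <= (\<Sum>e\<in>S. a (S - {e}))"
 shows "a F <= exp (2 * k * (ln (real (card F)) - ln (real l)))
   * ((\<Sum>S | S <= F & card S = l. a S) / real (card F choose l))"
proof -
 define c where "c j = (\<Sum>S | S <= F & card S = j. a S) / real (card F choose j)" for j
 have c0: "0 <= c j" for j unfolding c_def using assms(6) by (intro divide_nonneg_nonneg sum_nonneg) auto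
 have step: "c (Suc j) <= exp (2 * k * (ln (real (Suc j)) - ln (real j))) * c j" if j: "l <= j" "j < card F" for j
 proof -
  define x where "x = k / real (Suc j)"
  have x: "0 <= x" "x <= 1 / 2" using assms(2,5) j by (auto simp: x_def field_simps)
  have step1: "(real (Suc j) - k) * (\<Sum>S | S <= F & card S = Suc j. a S)
   <= real (card F - j) * (\<Sum>S | S <= F & card S = j. a S)"
  proof (rule subset_average_step[OF assms(1)])
   fix S assume "S <= F" "card S = Suc j"
   then show "(real (Suc j) - k) * a S <= (\<Sum>e\<in>S. a (S - {e}))" using assms(7)[of S] by simp
  qed
  have ch: "0 < card F choose j" "0 < card F choose Suc j" using j by auto
  have "real (Suc j) * real (card F choose Suc j) = real (card F - j) * real (card F choose j)"
   using binomial_absorption[of j "card F"] binomial_absorb_comp[of "card F" j]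
   by (metis of_nat_mult)
  then have r: "real (card F - j) / real (card F choose Suc j) = real (Suc j) / real (card F choose j)"
   using ch by (simp add: field_simps)
  have "real (card F - j) * (\<Sum>S | S <= F & card S = j. a S) / real (card F choose Suc j)
    = real (card F - j) / real (card F choose Suc j) * (\<Sum>S | S <= F & card S = j. a S)" by simp
  also have "... = real (Suc j) * c j" unfolding r c_def by simp
  finally have e2: "real (card F - j) * (\<Sum>S | S <= F & card S = j. a S) / real (card F choose Suc j) = real (Suc j) * c j" .
  have "(real (Suc j) - k) * (\<Sum>S | S <= F & card S = Suc j. a S) / real (card F choose Suc j)
    <= real (card F - j) * (\<Sum>S | S <= F & card S = j. a S) / real (card F choose Suc j)"
   using step1 by (intro divide_right_mono) auto
  then have "(real (Suc j) - k) * c (Suc j) <= real (Suc j) * c j"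
   unfolding e2 by (simp add: c_def)
  then have "(1 - x) * c (Suc j) <= c j" by (simp add: x_def field_simps)
  then have e3: "exp (2 * x) * ((1 - x) * c (Suc j)) <= exp (2 * x) * c j" by simp
  have e4: "1 <= exp (2 * x) * (1 - x)"
  proof -
   have "0 <= x * (1 - 2 * x)" using x by simp
   then have "1 <= (1 + 2 * x) * (1 - x)" by (simp add: algebra_simps)
   also have "... <= exp (2 * x) * (1 - x)" using x exp_ge_add_one_self[of "2 * x"] by (intro mult_right_mono) auto
   finally show ?thesis .
  qed
  have "1 * c (Suc j) <= exp (2 * x) * (1 - x) * c (Suc j)" using e4 c0 by (rule mult_right_mono)
  then have "c (Suc j) <= exp (2 * x) * c j" using e3 by (simp only: mult.assoc mult_1_left)
  moreover have "2 * x <= 2 * k * (ln (real (Suc j)) - ln (real j))"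
  proof -
   have j0: "0 < j" using j assms(3) by simp
   then have "ln (real j / real (Suc j)) <= real j / real (Suc j) - 1" by (intro ln_le_minus_one) auto
   then have "1 / real (Suc j) <= ln (real (Suc j)) - ln (real j)" using j0 by (simp add: ln_div field_simps)
   then have "2 * k * (1 / real (Suc j)) <= 2 * k * (ln (real (Suc j)) - ln (real j))"
    using assms(2) by (intro mult_left_mono) auto
   then show ?thesis by (simp add: x_def)
  qed
  ultimately show ?thesis using c0[of j] by (meson exp_le_cancel_iff mult_right_mono order_trans)
 qed
 have "j <= card F \<longrightarrow> c j <= exp (2 * k * (ln (real j) - ln (real l))) * c l" if "l <= j" for j
  using that
 proof (induction j rule: dec_induct)
  case (step n)
  show ?case
  proof
   assume n: "Suc n <= card F"
   have "c (Suc n) <= exp (2 * k * (ln (real (Suc n)) - ln (real n))) * c n" using \<open>l <= n\<close> n by (intro \<open>!!j. l <= j ==> j < card F ==> c (Suc j) <= exp (2 * k * (ln (real (Suc j)) - ln (real j))) * c j\<close>) auto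
   also have "... <= exp (2 * k * (ln (real (Suc n)) - ln (real n))) * (exp (2 * k * (ln (real n) - ln (real l))) * c l)"
    using step.IH n by (intro mult_left_mono) auto
   also have "... = exp (2 * k * (ln (real (Suc n)) - ln (real l))) * c l"
    unfolding mult.assoc[symmetric] exp_add[symmetric] by (simp add: right_diff_distrib)
   finally show "c (Suc n) <= exp (2 * k * (ln (real (Suc n)) - ln (real l))) * c l" .
  qed
 qed simp
 from this[OF assms(4)] have "c (card F) <= exp (2 * k * (ln (real (card F)) - ln (real l))) * c l" by simp
 moreover have "{S. S <= F & card S = card F} = {F}" using assms(1) card_subset_eq by auto
 then have "c (card F) = a F" by (simp add: c_def)
 ultimately show ?thesis by (simp add: c_def)
qed

text \<open>The probability that a uniform set of size \<open>l\<close> contains \<open>T\<close> is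
  a product of ratios \<open>(l - i) / (m - i)\<close>, with \<open>m\<close> the size of
  \<open>F\<close>, each at most \<open>l / m\<close>. The induction strips one element from
  \<open>T\<close>, from \<open>F\<close> and from the chosen sets.\<close>

lemma card_supersets_le:
 assumes "finite F" "T <= F" "l <= card F" "0 < card F"
 shows "real (card {S. S <= F & card S = l & T <= S}) <= real (card F choose l) * (real l / real (card F)) ^ card T"
 using finite_subset[OF assms(2,1)] assms
proof (induction T arbitrary: F l rule: finite_induct)
 case empty
 then show ?case using n_subsets[of F l] by simp
next
 case (insert x T)
 have x: "x \<in> F" "x \<notin> T" using insert by auto
 show ?case
 proof (cases "l = 0")
  case True
  have "finite S ==> card S = 0 ==> insert x T <= S ==> False" for S by auto
  then have eq0: "{S. S <= F & card S = l & insert x T <= S} = {}" using True insert.prems(1) finite_subset by blast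
  show ?thesis unfolding eq0 by simp
 next
  case False
  define G where "G = F - {x}"
  have G: "finite G" "T <= G" "card G = card F - 1" "l - 1 <= card G"
   using insert.prems insert.hyps x by (auto simp: G_def)
  have bij: "bij_betw (%S. S - {x}) {S. S <= F & card S = l & insert x T <= S} {S. S <= G & card S = l - 1 & T <= S}"
  proof (rule bij_betw_byWitness[where f' = "insert x"])
   show "(%S. S - {x}) ` {S. S <= F & card S = l & insert x T <= S} <= {S. S <= G & card S = l - 1 & T <= S}"
    using x by (auto simp: G_def)
   show "insert x ` {S. S <= G & card S = l - 1 & T <= S} <= {S. S <= F & card S = l & insert x T <= S}"
    using x False finite_subset[OF _ G(1)] by (auto simp: G_def card_insert_if)
  qed (use x in \<open>auto simp: G_def\<close>)
  have eq: "real (card {S. S <= F & card S = l & insert x T <= S}) = real (card {S. S <= G & card S = l - 1 & T <= S})"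
   using bij_betw_same_card[OF bij] by simp
  have ab: "real (card F) * real (card G choose (l - 1)) = real l * real (card F choose l)"
   using binomial_absorption[of "l - 1" "card F"] False G(3) by (metis Suc_pred' neq0_conv of_nat_mult)
  show ?thesis
  proof (cases "card G = 0")
   case True
   then have "T = {}" using G by auto
   moreover have "l = 1" "card F = 1" using G insert.prems False True by auto
   moreover have "{S. S <= F & card S = 1 & insert x {} <= S} <= {F}"
   proof
    fix S assume "S \<in> {S. S <= F & card S = 1 & insert x {} <= S}"
    then show "S \<in> {F}" using card_subset_eq[OF insert.prems(1), of S] \<open>card F = 1\<close> by simp
   qed
   then have "card {S. S <= F & card S = 1 & insert x {} <= S} <= 1"
    using card_mono[of "{F}"] by simp
   ultimately show ?thesis by simp
  next
   case False2: False
   have "real (card {S. S <= G & card S = l - 1 & T <= S}) <= real (card G choose (l - 1)) * (real (l - 1) / real (card G)) ^ card T"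
    using False2 by (intro insert.IH G) auto
   also have "... <= real (card G choose (l - 1)) * (real l / real (card F)) ^ card T"
   proof (intro mult_left_mono power_mono)
    have "real (l - 1) = real l - 1" "real (card F) = real (card G) + 1" "real l <= real (card G) + 1"
     using False G(3) insert.prems by auto
    then show "real (l - 1) / real (card G) <= real l / real (card F)"
     using False2 insert.prems by (simp add: divide_simps) (simp add: algebra_simps)
   qed auto
   also have "real (card G choose (l - 1)) = real (card F choose l) * (real l / real (card F))"
    using ab insert.prems(4) by (simp add: eq_divide_eq mult.commute)
   finally show ?thesis unfolding eq using insert.hyps by (simp add: mult_ac)
  qed
 qed
qed

section \<open>Connected sets and walks\<close>

definition walks :: "('b => 'b => bool) => 'b set => nat => 'b => 'b list set" where
 "walks R F n e = {w. length w = Suc n & hd w = e & set w <= F & successively R w}"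

lemma card_walks_le:
 assumes "finite F" "!!g. g \<in> F ==> card {h \<in> F. R g h} <= D" "e \<in> F"
 shows "finite (walks R F n e)" "card (walks R F n e) <= D ^ n"
proof -
 have "finite (walks R F n e)" for e
  by (rule finite_subset[OF _ finite_lists_length_eq[OF assms(1), of "Suc n"]]) (auto simp: walks_def)
 then show "finite (walks R F n e)" .
 show "card (walks R F n e) <= D ^ n" using assms(3)
 proof (induction n arbitrary: e)
  case 0
  have "walks R F 0 e <= {[e]}" by (auto simp: walks_def length_Suc_conv)
  then have "card (walks R F 0 e) <= card {[e]}" by (intro card_mono) auto
  then show ?case by simp
 next
  case (Suc n)
  have fw: "finite (walks R F n e)" for e
   by (rule finite_subset[OF _ finite_lists_length_eq[OF assms(1), of "Suc n"]]) (auto simp: walks_def)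
  have "walks R F (Suc n) e <= (\<Union>h\<in>{h \<in> F. R e h}. (#) e ` walks R F n h)"
  proof
   fix w assume "w \<in> walks R F (Suc n) e"
   then obtain h v where w: "w = e # h # v" "length v = n" "set w <= F" "successively R w"
    by (auto simp: walks_def length_Suc_conv)
   then have "h # v \<in> walks R F n h" "h \<in> F" "R e h" by (auto simp: walks_def)
   then show "w \<in> (\<Union>h\<in>{h \<in> F. R e h}. (#) e ` walks R F n h)" using w(1) by blast
  qed
  then have "card (walks R F (Suc n) e) <= card (\<Union>h\<in>{h \<in> F. R e h}. (#) e ` walks R F n h)"
   using assms(1) fw by (intro card_mono) auto
  also have "... <= (\<Sum>h\<in>{h \<in> F. R e h}. card ((#) e ` walks R F n h))"
   using assms(1) by (intro card_UN_le) auto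
  also have "... <= (\<Sum>h\<in>{h \<in> F. R e h}. D ^ n)"
   using Suc.IH by (intro sum_mono order_trans[OF card_image_le[OF fw]]) auto
  also have "... <= D * D ^ n" using assms(2)[OF Suc.prems] by (simp add: mult_right_mono)
  finally show ?case by simp
 qed
qed

definition component :: "('b => 'b => bool) => 'b set => 'b => 'b set" where
 "component R S e = {g. (e, g) \<in> {(a, b). a \<in> S & b \<in> S & R a b}\<^sup>*}"

lemma component_refl: "e \<in> component R S e" by (simp add: component_def)

lemma component_subset: "e \<in> S ==> component R S e <= S"
proof
 fix g assume "e \<in> S" "g \<in> component R S e"
 then have "(e, g) \<in> {(a, b). a \<in> S & b \<in> S & R a b}\<^sup>*" by (simp add: component_def)
 then show "g \<in> S" using \<open>e \<in> S\<close> by (induction rule: rtrancl_induct) auto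
qed

lemma component_closed: "a \<in> component R S e ==> a \<in> S ==> b \<in> S ==> R a b ==> b \<in> component R S e"
 unfolding component_def by (auto intro: rtrancl_into_rtrancl)

text \<open>Traversal of a spanning tree. Starting from \<open>[e]\<close>, a new element
  \<open>x\<close> next to a visited \<open>t\<close> is inserted as the detour
  \<open>t, x, t\<close>, which adds two steps. Hence the number of possible components of a given
  size is at most the number of walks.\<close>

lemma component_walk:
 assumes "finite S" "e \<in> S" "symp R"
 shows "\<exists>w \<in> walks R S (2 * card (component R S e) - 2) e. set w = component R S e"
proof -
 define C where "C = component R S e"
 have C: "finite C" "e \<in> C" "C <= S"
  unfolding C_def using component_subset[OF assms(2)] component_refl finite_subset[OF component_subset[OF assms(2)] assms(1)]
  by auto
 have "\<exists>w \<in> walks R S (2 * card C - 2) e. set w = C"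
  if "T <= C" "e \<in> T" "w \<in> walks R S (2 * card T - 2) e" "set w = T" for T w
  using that
 proof (induction "card (C - T)" arbitrary: T w rule: less_induct)
  case less
  show ?case
  proof (cases "T = C")
   case True
   then show ?thesis using less.prems by blast
  next
   case False
   have "\<exists>t\<in>T. \<exists>x\<in>C - T. R t x"
   proof (rule ccontr)
    assume no: "\<not> (\<exists>t\<in>T. \<exists>x\<in>C - T. R t x)"
    have "g \<in> T" if "g \<in> C" for g
    proof -
     have "(e, g) \<in> {(a, b). a \<in> S & b \<in> S & R a b}\<^sup>*" using that by (simp add: C_def component_def)
     then show ?thesis
     proof (induction rule: rtrancl_induct)
      case (step y z)
      then have "y \<in> S" "z \<in> S" "R y z" "y \<in> T" by auto
      moreover have "z \<in> C" using component_closed[of y R S e z] calculation less.prems(1) by (auto simp: C_def)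
      ultimately show ?case using no by blast
     qed (rule less.prems)
    qed
    then show False using False less.prems(1) by blast
   qed
   then obtain t x where tx: "t \<in> T" "x \<in> C" "x \<notin> T" "R t x" by blast
   have "t \<in> set w" using tx less.prems by simp
   then obtain u v where w: "w = u @ t # v" by (meson split_list)
   define w' where "w' = u @ t # x # t # v"
   have finT: "finite T" using less.prems(1) C(1) finite_subset by blast
   have cT: "0 < card T" using finT less.prems(2) by (auto simp: card_gt_0_iff)
   have "R x t" using assms(3) tx(4) by (simp add: sympD)
   then have "successively R w'"
    using less.prems(3) tx(4) unfolding w w'_def walks_def
    by (auto simp: successively_append_iff)
   moreover have "set w' = insert x T" using less.prems(4) by (auto simp: w w'_def)
   moreover have "hd w' = e" using less.prems(3) by (cases u) (auto simp: w w'_def walks_def)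
   moreover have "length w' = Suc (2 * card (insert x T) - 2)"
    using less.prems(3) tx(3) finT cT by (auto simp: w w'_def walks_def)
   ultimately have "w' \<in> walks R S (2 * card (insert x T) - 2) e"
    using less.prems(1) tx(2) C(3) by (auto simp: walks_def)
   moreover have "card (C - insert x T) < card (C - T)"
    using tx C(1) by (intro psubset_card_mono) auto
   ultimately show ?thesis
    using less.hyps[of "insert x T" w'] less.prems tx \<open>set w' = insert x T\<close> by auto
  qed
 qed
 from this[of "{e}" "[e]"] show ?thesis using C assms(2) by (simp add: C_def[symmetric] walks_def)
qed

section \<open>Entropy of independent parts\<close>

lemma gex_product:
 assumes "wgraph lam B F" "F = C Un R" "C \<inter> R = {}" "!!c r. c \<in> C ==> r \<in> R ==> disjnt c r"
 shows "gex lam F f = gex lam R (%\<rho>. gex lam C (%\<kappa>. f (\<rho> Un \<kappa>)))"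
proof -
 have CF: "C <= F" and FC: "F - C = R" using assms(2,3) by auto
 have wR: "wgraph lam B R" by (rule wgraph_subset[OF assms(1)]) (use assms(2) in auto)
 have res: "res C \<rho> = C" if "\<rho> \<in> matchings R" for \<rho>
  using that assms(4) by (auto simp: res_def matchings_def)
 have fp: "fibre_prob lam F C \<rho> = weight lam \<rho> * (Zsum lam C / Zsum lam F)" if "\<rho> \<in> matchings R" for \<rho>
  unfolding fibre_prob_def res[OF that] by simp
 have "1 = (\<Sum>\<rho>\<in>matchings R. fibre_prob lam F C \<rho>)" using sum_fibre_prob[OF assms(1) CF] by (simp add: FC)
 also have "... = Zsum lam R * (Zsum lam C / Zsum lam F)"
  unfolding Zsum_def[of lam R] by (simp add: fp sum_distrib_right sum_divide_distrib)
 finally have "Zsum lam C / Zsum lam F = 1 / Zsum lam R"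
  using wgraphD(7)[OF wR] by (auto simp: field_simps)
 then have fp': "fibre_prob lam F C \<rho> = weight lam \<rho> / Zsum lam R" if "\<rho> \<in> matchings R" for \<rho>
  using fp[OF that] by simp
 show ?thesis unfolding gex_fibre[OF assms(1) CF] FC
  by (simp add: fp' res gex_def[of lam R] sum_divide_distrib cong: sum.cong)
qed

text \<open>Each \<open>g i\<close> is tested against the tangent at \<open>n i / m * G\<close>, the
  multiple of the mixture \<open>G\<close> that has the same mean as \<open>g i\<close>. Entropy
  being homogeneous of degree one, convexity takes this form for arbitrary positive weights.\<close>

lemma entropy_convex:
 assumes "wgraph lam B F" "!!i M. i \<in> I ==> M \<in> matchings F ==> 0 <= g i M" "finite I" "!!i. i \<in> I ==> 0 < w i"
 shows "ent lam F F (%M. \<Sum>i\<in>I. w i * g i M) <= (\<Sum>i\<in>I. w i * ent lam F F (g i))"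
proof -
 define G where "G M = (\<Sum>i\<in>I. w i * g i M)" for M
 define m where "m = gex lam F G"
 define n where "n i = gex lam F (g i)" for i
 have G0: "0 <= G M" if "M \<in> matchings F" for M
  unfolding G_def using assms(2,4) that by (intro sum_nonneg mult_nonneg_nonneg) (auto simp: less_imp_le)
 have n0: "0 <= n i" if "i \<in> I" for i unfolding n_def using assms(2)[OF that] by (rule gex_nonneg[OF assms(1)])
 have m: "m = (\<Sum>i\<in>I. w i * n i)" unfolding m_def G_def n_def by (simp add: gex_sum gex_cmult)
 have key: "gex lam F (%M. g i M * ln (G M)) - n i * ln m <= ent lam F F (g i)" if i: "i \<in> I" for i
 proof (cases "n i = 0")
  case True
  have z: "g i M = 0" if "M \<in> matchings F" for M
   using gex_zeroD[where f = "g i", OF assms(1) assms(2)[OF i] _ that] True by (simp add: n_def)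
  have "gex lam F (%M. g i M * ln (G M)) = gex lam F (%_. 0)" by (rule gex_cong) (simp add: z)
  then show ?thesis using block_ent_nonneg[OF assms(1) order_refl, of "g i"] assms(2)[OF i] True by (simp add: gex_const[OF assms(1)])
 next
  case False
  then have ni: "0 < n i" using n0[OF i] by simp
  have "w i * n i <= m" unfolding m using assms(3,4) i n0 by (intro member_le_sum) (auto simp: less_imp_le)
  then have m0: "0 < m" using ni assms(4)[OF i] by (meson mult_pos_pos less_le_trans)
  have "gex lam F (%M. g i M * ln (G M) + (ln (n i) - ln m) * g i M + g i M - n i / m * G M) <= gex lam F (%M. xlx (g i M))"
  proof (rule gex_mono[OF assms(1)])
   fix M assume M: "M \<in> matchings F"
   show "g i M * ln (G M) + (ln (n i) - ln m) * g i M + g i M - n i / m * G M <= xlx (g i M)"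
   proof (cases "G M = 0")
    case True
    have "w i * g i M <= G M" unfolding G_def using assms(2,3,4) i M by (intro member_le_sum) (auto simp: less_imp_le)
    then have "g i M = 0" using True assms(2)[OF i M] assms(4)[OF i] by (simp add: mult_le_0_iff)
    then show ?thesis using True by (simp add: xlx_def)
   next
    case False
    then have "0 < G M" using G0[OF M] by simp
    then show ?thesis using xlx_tangent[of "g i M" "n i / m * G M"] assms(2)[OF i M] ni m0
     by (simp add: ln_mult ln_div algebra_simps)
   qed
  qed
  also have "gex lam F (%M. g i M * ln (G M) + (ln (n i) - ln m) * g i M + g i M - n i / m * G M)
    = gex lam F (%M. g i M * ln (G M)) + (ln (n i) - ln m) * n i + n i - n i / m * m"
   unfolding gex_add gex_diff gex_cmult n_def m_def ..
  finally show ?thesis unfolding block_ent_whole[OF assms(1)] n_def[symmetric] using m0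
   by (simp add: xlx_def algebra_simps)
 qed
 have "ent lam F F G = gex lam F (%M. \<Sum>i\<in>I. w i * (g i M * ln (G M))) - m * ln m"
  unfolding block_ent_whole[OF assms(1)] m_def[symmetric] xlx_def
  by (simp add: G_def sum_distrib_right mult.assoc)
 also have "... = (\<Sum>i\<in>I. w i * (gex lam F (%M. g i M * ln (G M)) - n i * ln m))"
  unfolding m by (simp add: gex_sum gex_cmult right_diff_distrib sum_subtractf sum_distrib_right mult.assoc)
 also have "... <= (\<Sum>i\<in>I. w i * ent lam F F (g i))"
  using assms(4) by (intro sum_mono mult_left_mono key) (auto simp: less_imp_le)
 finally show ?thesis by (simp add: G_def[abs_def])
qed

text \<open>By the chain rule the entropy is the average entropy inside \<open>C\<close> plus the
  entropy of \<open>h\<close>, the average of \<open>g\<close> over \<open>C\<close>. As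
  \<open>h\<close> is a mixture of the slices of \<open>g\<close>, convexity bounds its entropy by
  the average entropy inside \<open>R\<close>.\<close>

lemma block_ent_product:
 assumes "wgraph lam B F" "F = C Un R" "C \<inter> R = {}" "!!c r. c \<in> C ==> r \<in> R ==> disjnt c r"
  "!!M. M \<in> matchings F ==> 0 <= g M"
 shows "ent lam F F g <= ent lam F C g + ent lam F R g"
proof -
 have CF: "C <= F" "R <= F" using assms(2) by auto
 note wC = wgraph_subset[OF assms(1) CF(1)] and wR = wgraph_subset[OF assms(1) CF(2)]
 have P: "gex lam F f = gex lam R (%\<rho>. gex lam C (%\<kappa>. f (\<rho> Un \<kappa>)))" for f
  by (rule gex_product[OF assms(1-4)])
 have P': "gex lam F f = gex lam C (%\<kappa>. gex lam R (%\<rho>. f (\<kappa> Un \<rho>)))" for f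
  using assms(2-4) by (intro gex_product[OF assms(1)]) (auto simp: disjnt_sym)
 have FC: "F - C = R" "F - R = C" using assms(2,3) by auto
 have resC: "res C \<rho> = C" if "\<rho> \<in> matchings R" for \<rho> using that assms(4) by (auto simp: res_def matchings_def)
 have resR: "res R \<kappa> = R" if "\<kappa> \<in> matchings C" for \<kappa> using that assms(4) by (auto simp: res_def matchings_def disjnt_sym)
 define h where "h \<rho> = gex lam C (%\<kappa>. g (\<rho> Un \<kappa>))" for \<rho>
 have C1: "ent lam F C g = gex lam R (%\<rho>. gex lam C (%\<kappa>. xlx (g (\<rho> Un \<kappa>))) - xlx (h \<rho>))"
  unfolding block_ent_def P
 proof (rule gex_cong)
  fix \<rho> assume r: "\<rho> \<in> matchings R"
  have "gex lam C (%\<kappa>. xlx (g (\<rho> Un \<kappa>)) - xlx (cond lam C g (\<rho> Un \<kappa>))) = gex lam C (%\<kappa>. xlx (g (\<rho> Un \<kappa>)) - xlx (h \<rho>))"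
  proof (rule gex_cong)
   fix \<kappa> assume "\<kappa> \<in> matchings C"
   then have "cond lam C g (\<rho> Un \<kappa>) = h \<rho>"
    using cond_fibre[OF CF(1), of \<rho> \<kappa> lam g] r by (simp add: FC resC h_def)
   then show "xlx (g (\<rho> Un \<kappa>)) - xlx (cond lam C g (\<rho> Un \<kappa>)) = xlx (g (\<rho> Un \<kappa>)) - xlx (h \<rho>)" by simp
  qed
  then show "gex lam C (%\<kappa>. xlx (g (\<rho> Un \<kappa>)) - xlx (cond lam C g (\<rho> Un \<kappa>)))
   = gex lam C (%\<kappa>. xlx (g (\<rho> Un \<kappa>))) - xlx (h \<rho>)" by (simp add: gex_diff gex_const[OF wC])
 qed
 have R1: "ent lam F R g = gex lam C (%\<kappa>. ent lam R R (%\<rho>. g (\<kappa> Un \<rho>)))"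
  unfolding block_ent_def[of xlx lam F R] P'
 proof (rule gex_cong)
  fix \<kappa> assume k: "\<kappa> \<in> matchings C"
  have "gex lam R (%\<rho>. xlx (g (\<kappa> Un \<rho>)) - xlx (cond lam R g (\<kappa> Un \<rho>)))
    = gex lam R (%\<rho>. xlx (g (\<kappa> Un \<rho>)) - xlx (gex lam R (%\<rho>. g (\<kappa> Un \<rho>))))"
  proof (rule gex_cong)
   fix \<rho> assume "\<rho> \<in> matchings R"
   then have "cond lam R g (\<kappa> Un \<rho>) = gex lam R (%\<rho>. g (\<kappa> Un \<rho>))"
    using cond_fibre[OF CF(2), of \<kappa> \<rho> lam g] k by (simp add: FC resR)
   then show "xlx (g (\<kappa> Un \<rho>)) - xlx (cond lam R g (\<kappa> Un \<rho>)) = xlx (g (\<kappa> Un \<rho>)) - xlx (gex lam R (%\<rho>. g (\<kappa> Un \<rho>)))" by simp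
  qed
  then show "gex lam R (%\<rho>. xlx (g (\<kappa> Un \<rho>)) - xlx (cond lam R g (\<kappa> Un \<rho>))) = ent lam R R (%\<rho>. g (\<kappa> Un \<rho>))"
   by (simp add: block_ent_full gex_diff)
 qed
 have "ent lam F F g = ent lam F C g + ent lam R R h"
  unfolding block_ent_whole[OF assms(1)] block_ent_whole[OF wR] C1 gex_diff P h_def[symmetric] by simp
 also have "ent lam R R h <= ent lam F R g"
 proof -
  have h: "h = (%\<rho>. \<Sum>\<kappa>\<in>matchings C. weight lam \<kappa> / Zsum lam C * g (\<kappa> Un \<rho>))"
   by (rule ext) (simp add: h_def gex_def sum_divide_distrib Un_commute)
  have un: "\<kappa> Un \<rho> \<in> matchings F" if "\<kappa> \<in> matchings C" "\<rho> \<in> matchings R" for \<kappa> \<rho>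
   using union_matching(1)[OF CF(2), of \<kappa> \<rho>] that by (simp add: FC resR)
  have "ent lam R R h <= (\<Sum>\<kappa>\<in>matchings C. weight lam \<kappa> / Zsum lam C * ent lam R R (%\<rho>. g (\<kappa> Un \<rho>)))"
   unfolding h using wgraphD[OF wC] weight_pos[of lam] assms(5) un by (intro entropy_convex[OF wR]) auto
  also have "... = ent lam F R g" unfolding R1 gex_def by (simp add: sum_divide_distrib)
  finally show ?thesis .
 qed
 finally show ?thesis by simp
qed

lemma block_ent_split:
 assumes "wgraph lam B F" "C Un R <= F" "C \<inter> R = {}" "!!c r. c \<in> C ==> r \<in> R ==> disjnt c r"
  "!!M. M \<in> matchings F ==> 0 <= f M"
 shows "ent lam F (C Un R) f <= ent lam F C f + ent lam F R f"
proof -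
 let ?S = "C Un R"
 have "ent lam F ?S f = (\<Sum>sg\<in>matchings (F - ?S). fibre_prob lam F ?S sg
   * ent lam (res ?S sg) (res ?S sg) (%L. f (sg Un L)))"
  by (rule block_ent_fibre_whole[OF assms(1,2)])
 also have "... <= (\<Sum>sg\<in>matchings (F - ?S). fibre_prob lam F ?S sg
   * (ent lam (res ?S sg) (C \<inter> res ?S sg) (%L. f (sg Un L)) + ent lam (res ?S sg) (R \<inter> res ?S sg) (%L. f (sg Un L))))"
 proof (intro sum_mono mult_left_mono block_ent_product[OF wgraph_res[OF assms(1,2)]])
  fix sg assume s: "sg \<in> matchings (F - ?S)"
  show "0 <= fibre_prob lam F ?S sg" using fibre_prob_pos[OF assms(1,2), of sg] by simp
  show "res ?S sg = C \<inter> res ?S sg Un R \<inter> res ?S sg" using res_subset[of ?S sg] by auto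
  show "!!M. M \<in> matchings (res ?S sg) ==> 0 <= f (sg Un M)"
   using union_matching(1)[OF assms(2) s] assms(5) by auto
 qed (use assms(3,4) in auto)
 also have "... = ent lam F C f + ent lam F R f"
  by (subst (1 2) block_ent_fibre[OF assms(1,2)]) (auto simp: distrib_left sum.distrib)
 finally show ?thesis .
qed

text \<open>The tangent inequality is applied at \<open>m / u * sqrt (f M)\<close>, the multiple of
  the square root that has the mean of \<open>f\<close>. Its logarithm contains half of
  \<open>ln (f M)\<close>, so half of the entropy term survives, which is the inequality
  \<open>key\<close>. Both claims then follow from \<open>ln x <= x - 1\<close>; the second bounds
  the squared Hellinger distance.\<close>

lemma gex_sqrt_le_entropy:
 assumes "wgraph lam B F" "!!M. M \<in> matchings F ==> 0 <= f M"
 shows "gvar lam F (%M. sqrt (f M)) <= ent lam F F f"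
  "gex lam F f = 1 ==> 2 * (1 - gex lam F (%M. sqrt (f M))) <= gex lam F (%M. xlx (f M))"
proof -
 define m where "m = gex lam F f"
 define u where "u = gex lam F (%M. sqrt (f M))"
 have m0: "0 <= m" unfolding m_def by (rule gex_nonneg[OF assms])
 have u0: "0 <= u" unfolding u_def using assms(2) by (intro gex_nonneg[OF assms(1)]) auto
 have gv: "gvar lam F (%M. sqrt (f M)) = m - u\<^sup>2"
 proof -
  have "gex lam F (%M. (sqrt (f M))\<^sup>2) = m" unfolding m_def by (rule gex_cong) (simp add: assms(2))
  then show ?thesis by (simp add: gvar_def u_def)
 qed
 have key: "2 * m * (ln m - ln u) <= gex lam F (%M. xlx (f M)) & 0 < u" if mp: "0 < m"
 proof
  show up: "0 < u"
  proof (rule ccontr)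
   assume "\<not> 0 < u"
   then have "u = 0" using u0 by simp
   then have "sqrt (f M) = 0" if "M \<in> matchings F" for M
    using gex_zeroD[where f = "%M. sqrt (f M)", OF assms(1) _ _ that] assms(2) by (simp add: u_def)
   then have "gex lam F f = gex lam F (%_. 0)" by (intro gex_cong) simp
   then show False using mp by (simp add: m_def gex_const[OF assms(1)])
  qed
  have "gex lam F (%M. (1 / 2) * xlx (f M) + (ln m - ln u) * f M + f M - m / u * sqrt (f M)) <= gex lam F (%M. xlx (f M))"
  proof (rule gex_mono[OF assms(1)])
   fix M assume M: "M \<in> matchings F"
   show "(1 / 2) * xlx (f M) + (ln m - ln u) * f M + f M - m / u * sqrt (f M) <= xlx (f M)"
   proof (cases "f M = 0")
    case True then show ?thesis by (simp add: xlx_def)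
   next
    case False
    then have f: "0 < f M" using assms(2)[OF M] by simp
    then have lneq: "ln (m / u * sqrt (f M)) = ln m - ln u + ln (f M) / 2" using mp up by (simp add: ln_mult ln_div ln_sqrt)
    have "f M * ln (m / u * sqrt (f M)) + f M - m / u * sqrt (f M) <= xlx (f M)"
     using f mp up by (intro xlx_tangent) auto
    then show ?thesis unfolding lneq by (simp add: xlx_def algebra_simps)
   qed
  qed
  also have "gex lam F (%M. (1 / 2) * xlx (f M) + (ln m - ln u) * f M + f M - m / u * sqrt (f M))
   = (1 / 2) * gex lam F (%M. xlx (f M)) + (ln m - ln u) * m + m - m / u * u"
   unfolding gex_add gex_diff gex_cmult m_def u_def ..
  finally show "2 * m * (ln m - ln u) <= gex lam F (%M. xlx (f M))" using up by (simp add: algebra_simps)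
 qed
 show "gvar lam F (%M. sqrt (f M)) <= ent lam F F f"
 proof (cases "m = 0")
  case True
  have "0 <= ent lam F F f" using assms(2) by (rule block_ent_nonneg[OF assms(1) order_refl])
  moreover have "0 <= u\<^sup>2" by simp
  ultimately show ?thesis unfolding gv True by linarith
 next
  case False
  then have mp: "0 < m" using m0 by simp
  note k = key[OF mp]
  have "ln (u\<^sup>2 / m) <= u\<^sup>2 / m - 1" using k mp by (intro ln_le_minus_one) auto
  then have "m * (2 * ln u - ln m) <= m * (u\<^sup>2 / m - 1)"
   using k mp by (intro mult_left_mono) (auto simp: ln_div ln_realpow)
  then have "m - u\<^sup>2 <= 2 * m * (ln m - ln u) - m * ln m" using mp by (simp add: algebra_simps)
  then show ?thesis unfolding gv block_ent_whole[OF assms(1)] m_def[symmetric] xlx_def[of m] using k by linarith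
 qed
 show "2 * (1 - gex lam F (%M. sqrt (f M))) <= gex lam F (%M. xlx (f M))" if "gex lam F f = 1"
 proof -
  have "m = 1" using that by (simp add: m_def)
  then have "2 * (- ln u) <= gex lam F (%M. xlx (f M))" "0 < u" using key by auto
  moreover have "ln u <= u - 1" using calculation(2) by (rule ln_le_minus_one)
  ultimately show ?thesis by (simp add: u_def[symmetric])
 qed
qed

text \<open>A converse with loss \<open>1 / \<delta>\<close>, where \<open>\<delta>\<close> bounds
  all atoms from below. The entropy is at most a second moment of \<open>f\<close> about
  \<open>u\<^sup>2\<close>. With \<open>s\<close> the square root of \<open>f\<close>,
  \<open>f - u\<^sup>2\<close> factors as \<open>(s + u) * (s - u)\<close>, and
  \<open>f <= m / \<delta>\<close> since one atom alone cannot exceed the mean.\<close>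

lemma entropy_le_gvar_sqrt:
 assumes "wgraph lam B F" "!!M. M \<in> matchings F ==> 0 <= f M" "0 < \<delta>" "\<delta> <= 1"
  "!!M. M \<in> matchings F ==> \<delta> <= weight lam M / Zsum lam F"
 shows "ent lam F F f <= 4 / \<delta> * gvar lam F (%M. sqrt (f M))"
proof (cases "gex lam F f = 0")
 case True
 then have "f M = 0" if "M \<in> matchings F" for M using gex_zeroD[where f = f, OF assms(1) assms(2) True that] by blast
 then have "ent lam F F f = 0" using block_ent_null[OF order_refl _ assms(1)] by blast
 moreover have "0 <= gvar lam F (%M. sqrt (f M))" unfolding gvar_def using gex_square[OF assms(1)] by simp
 ultimately show ?thesis using assms(3) by simp
next
 case False
 define m where "m = gex lam F f"
 have m: "0 < m" using False gex_nonneg[OF assms(1), of f] assms(2) by (auto simp: m_def less_le)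
 define s where "s M = sqrt (f M)" for M
 define u where "u = gex lam F s"
 have s2: "(s M)\<^sup>2 = f M" if "M \<in> matchings F" for M using assms(2)[OF that] by (simp add: s_def)
 have u2: "u\<^sup>2 <= m"
 proof -
  have "u\<^sup>2 <= gex lam F (%M. (s M)\<^sup>2)" unfolding u_def by (rule gex_square[OF assms(1)])
  also have "... = m" unfolding m_def by (rule gex_cong) (rule s2)
  finally show ?thesis .
 qed
 have fb: "f M <= m / \<delta>" if M: "M \<in> matchings F" for M
 proof -
  note w = wgraphD[OF assms(1)]
  have "weight lam M * f M / Zsum lam F <= m"
   unfolding m_def gex_def using w weight_pos[of lam] assms(2) M
   by (intro divide_right_mono member_le_sum) (auto simp: less_imp_le)
  moreover have "\<delta> * f M <= weight lam M / Zsum lam F * f M"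
   using assms(2,5)[OF M] by (intro mult_right_mono) auto
  ultimately show ?thesis using assms(3) by (simp add: field_simps)
 qed
 have "gex lam F (%M. xlx (f M)) <= gex lam F (%M. ln m * f M + (f M - u\<^sup>2)\<^sup>2 / m + (2 * u\<^sup>2 / m - 1) * f M - (u\<^sup>2)\<^sup>2 / m)"
 proof (rule gex_mono[OF assms(1)])
  fix M assume M: "M \<in> matchings F"
  have "xlx (f M) <= ln m * f M + f M * (f M / m - 1)"
  proof (cases "f M = 0")
   case False
   then have f: "0 < f M" using assms(2)[OF M] by simp
   then have "ln (f M / m) <= f M / m - 1" using m by (intro ln_le_minus_one) auto
   then have "f M * (ln (f M) - ln m) <= f M * (f M / m - 1)" using f m by (intro mult_left_mono) (auto simp: ln_div)
   then show ?thesis by (simp add: xlx_def algebra_simps)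
  qed (simp add: xlx_def)
  also have "... = ln m * f M + (f M - u\<^sup>2)\<^sup>2 / m + (2 * u\<^sup>2 / m - 1) * f M - (u\<^sup>2)\<^sup>2 / m"
   using m by (simp add: field_simps power2_eq_square)
  finally show "xlx (f M) <= ln m * f M + (f M - u\<^sup>2)\<^sup>2 / m + (2 * u\<^sup>2 / m - 1) * f M - (u\<^sup>2)\<^sup>2 / m" .
 qed
 also have "... = gex lam F (%M. ln m * f M + inverse m * (f M - u\<^sup>2)\<^sup>2 + (2 * u\<^sup>2 / m - 1) * f M - (u\<^sup>2)\<^sup>2 / m)"
  by (simp add: divide_inverse mult.commute)
 also have "... = ln m * m + inverse m * gex lam F (%M. (f M - u\<^sup>2)\<^sup>2) + (2 * u\<^sup>2 / m - 1) * m - (u\<^sup>2)\<^sup>2 / m"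
  by (simp only: gex_add gex_diff gex_cmult gex_const[OF assms(1)] m_def)
 also have "... <= xlx m + gex lam F (%M. (f M - u\<^sup>2)\<^sup>2) / m"
 proof -
  have "(2 * u\<^sup>2 / m - 1) * m - (u\<^sup>2)\<^sup>2 / m = - (m - u\<^sup>2)\<^sup>2 / m" using m by (simp add: field_simps power2_eq_square)
  also have "... <= 0" using m by simp
  finally have "(2 * u\<^sup>2 / m - 1) * m - (u\<^sup>2)\<^sup>2 / m <= 0" .
  then show ?thesis by (simp add: xlx_def divide_inverse mult.commute)
 qed
 finally have 1: "ent lam F F f <= gex lam F (%M. (f M - u\<^sup>2)\<^sup>2) / m"
  unfolding block_ent_whole[OF assms(1)] m_def[symmetric] by simp
 have "gex lam F (%M. (f M - u\<^sup>2)\<^sup>2) <= gex lam F (%M. 4 * m / \<delta> * (s M - u)\<^sup>2)"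
 proof (rule gex_mono[OF assms(1)])
  fix M assume M: "M \<in> matchings F"
  have "(f M - u\<^sup>2)\<^sup>2 = (s M + u)\<^sup>2 * (s M - u)\<^sup>2"
   unfolding s2[OF M, symmetric] by (simp add: power2_eq_square algebra_simps)
  also have "(s M + u)\<^sup>2 <= 2 * (s M)\<^sup>2 + 2 * u\<^sup>2"
   using square_diff_le[of "s M" "- u" 0] by simp
  also have "2 * (s M)\<^sup>2 + 2 * u\<^sup>2 <= 4 * m / \<delta>"
  proof -
   have "m <= m / \<delta>" using m assms(3,4) by (simp add: field_simps)
   then show ?thesis using fb[OF M] u2 s2[OF M] by simp
  qed
  finally show "(f M - u\<^sup>2)\<^sup>2 <= 4 * m / \<delta> * (s M - u)\<^sup>2" by (simp add: mult_right_mono)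
 qed
 also have "... = 4 * m / \<delta> * gvar lam F s"
 proof -
  have "gex lam F (%M. (s M - u)\<^sup>2) = gex lam F (%M. (s M)\<^sup>2 - 2 * u * s M + u\<^sup>2)"
   by (simp add: power2_diff algebra_simps)
  also have "... = gvar lam F s"
   by (simp add: gex_add gex_diff gex_cmult gex_const[OF assms(1)] u_def[symmetric] gvar_def power2_eq_square)
  finally show ?thesis unfolding gex_cmult by simp
 qed
 finally have "gex lam F (%M. (f M - u\<^sup>2)\<^sup>2) / m <= 4 * m / \<delta> * gvar lam F s / m"
  using m by (intro divide_right_mono) auto
 also have "... = 4 / \<delta> * gvar lam F s" using m by simp
 finally show ?thesis using 1 by (simp add: s_def[abs_def])
qed

section \<open>Resampling single edges, and crude tensorization\<close>

lemma matchings_singleton: "matchings {e} = {{}, {e}}" by (auto simp: matchings_def subset_singleton_iff)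

lemma gex_singleton: assumes "0 < lam e"
 shows "gex lam {e} g = (g {} + lam e * g {e}) / (1 + lam e)"
 using assms by (simp add: gex_def Zsum_def matchings_singleton weight_def)

text \<open>An unblocked edge is present with conditional probability
  \<open>lam e / (1 + lam e)\<close>, so its local variance is
  \<open>lam e / (1 + lam e)\<^sup>2\<close> times the squared difference; comparison with the
  removal energy leaves the factor \<open>1 + lam e\<close>.\<close>

lemma sum_block_square:
 assumes "wgraph lam B F"
 shows "dirichlet lam F s = (\<Sum>e\<in>F. (1 + lam e) * sqent lam F {e} s)"
proof -
 note w = wgraphD[OF assms]
 have edge: "gex lam F (%M. of_bool (e \<in> M) * (s M - s (M - {e}))\<^sup>2)
   = (1 + lam e) * sqent lam F {e} s" if e: "e \<in> F" for e
 proof -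
  have ne: "e ~= {}" using w(6)[OF e] .
  define d where "d sg = (s (insert e sg) - s sg)\<^sup>2" for sg
  have fin: "finite (away e F)" using w(1) away_subset finite_subset by blast
  have "gex lam (F - {e}) (%M. of_bool (e \<in> M) * (s M - s (M - {e}))\<^sup>2) = gex lam (F - {e}) (%_. 0)"
   by (rule gex_cong) (auto simp: matchings_def)
  also have "... = 0" by (rule gex_const[OF wgraph_subset[OF assms]]) auto
  finally have 0: "gex lam (F - {e}) (%M. of_bool (e \<in> M) * (s M - s (M - {e}))\<^sup>2) = 0" .
  have "gex lam (away e F) (%M. of_bool (e \<in> insert e M) * (s (insert e M) - s (insert e M - {e}))\<^sup>2) = gex lam (away e F) d"
   by (rule gex_cong) (simp add: d_def notin_away[OF ne] insert_Diff_if)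
  then have "gex lam F (%M. of_bool (e \<in> M) * (s M - s (M - {e}))\<^sup>2) = edge_prob lam F e * gex lam (away e F) d"
   using gex_edge(1)[OF assms e, of "%M. of_bool (e \<in> M) * (s M - s (M - {e}))\<^sup>2"] 0 by simp
  also have "... = (\<Sum>sg\<in>matchings (away e F). weight lam sg * lam e / Zsum lam F * d sg)"
   using wgraphD(7)[OF wgraph_away[OF assms, of e]]
   by (simp add: gex_def edge_prob_def sum_distrib_left sum_divide_distrib mult_ac)
  also have "... = (1 + lam e) * (\<Sum>sg\<in>matchings (away e F). fibre_prob lam F {e} sg
    * sqent lam (res {e} sg) (res {e} sg) (%L. s (sg Un L)))"
   unfolding sum_distrib_left
  proof (rule sum.cong[OF refl])
   fix sg assume s: "sg \<in> matchings (away e F)"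
   have r: "res {e} sg = {e}" using s by (auto simp: res_def matchings_def away_def)
   have we: "wgraph lam B {e}" by (rule wgraph_subset[OF assms]) (use e in auto)
   have l: "0 < 1 + lam e" using w(3)[of e] by simp
   have "sqent lam {e} {e} (%L. s (sg Un L)) = lam e / (1 + lam e)\<^sup>2 * d sg"
    unfolding block_ent_whole[OF we] gex_singleton[OF w(3)] d_def using l
    by (simp add: divide_simps) (simp add: power2_eq_square algebra_simps)
   moreover have "fibre_prob lam F {e} sg = weight lam sg * (1 + lam e) / Zsum lam F"
    unfolding fibre_prob_def r by (simp add: Zsum_def[of _ "{e}"] matchings_singleton weight_def[of _ "{e}"] weight_def[of _ "{}"])
   ultimately show "weight lam sg * lam e / Zsum lam F * d sg = (1 + lam e) * (fibre_prob lam F {e} sg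
    * sqent lam (res {e} sg) (res {e} sg) (%L. s (sg Un L)))"
    unfolding r using l by (simp add: power2_eq_square)
  qed
  also have "(\<Sum>sg\<in>matchings (away e F). fibre_prob lam F {e} sg
    * sqent lam (res {e} sg) (res {e} sg) (%L. s (sg Un L))) = sqent lam F {e} s"
  proof -
   have eF: "{e} <= F" using e by auto
   show ?thesis unfolding block_ent_fibre_whole[OF assms eF]
   proof (rule sum.mono_neutral_left)
    show "finite (matchings (F - {e}))" using w(1) by simp
    show "matchings (away e F) <= matchings (F - {e})" using ne by (intro matchings_mono) (auto simp: away_def)
    show "\<forall>sg\<in>matchings (F - {e}) - matchings (away e F). fibre_prob lam F {e} sg
     * sqent lam (res {e} sg) (res {e} sg) (%L. s (sg Un L)) = 0"
    proof
     fix sg assume "sg \<in> matchings (F - {e}) - matchings (away e F)"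
     then have r: "res {e} sg = {}" by (auto simp: res_def matchings_def away_def)
     have "sqent lam {} {} (%L. s (sg Un L)) = 0"
      unfolding block_ent_whole[OF wgraph_subset[OF assms empty_subsetI]]
      by (simp add: gex_def Zsum_def matchings_def weight_def)
     then show "fibre_prob lam F {e} sg * sqent lam (res {e} sg) (res {e} sg) (%L. s (sg Un L)) = 0"
      unfolding r by simp
    qed
   qed
  qed
  finally show ?thesis .
 qed
 have "dirichlet lam F s = gex lam F (%M. \<Sum>e\<in>F. of_bool (e \<in> M) * (s M - s (M - {e}))\<^sup>2)"
  unfolding dirichlet_def
 proof (rule gex_cong)
  fix M assume "M \<in> matchings F"
  then have "M <= F" by (simp add: matchings_def)
  then show "(\<Sum>e\<in>M. (s M - s (M - {e}))\<^sup>2) = (\<Sum>e\<in>F. of_bool (e \<in> M) * (s M - s (M - {e}))\<^sup>2)"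
   using w(1) by (intro sum.mono_neutral_cong_left) auto
 qed
 also have "... = (\<Sum>e\<in>F. (1 + lam e) * sqent lam F {e} s)"
  unfolding gex_sum by (intro sum.cong refl edge)
 finally show ?thesis .
qed

lemma lam_le: "wgraph lam B F ==> e \<in> F ==> lam e <= B"
proof -
 assume w: "wgraph lam B F" and e: "e \<in> F"
 note d = wgraphD[OF w]
 obtain x where "x \<in> e" using d(6)[OF e] by blast
 then have "lam e <= (\<Sum>e\<in>inc x F. lam e)"
  using d(1,3) e finite_subset[OF inc_subset d(1)] by (intro member_le_sum) (auto simp: inc_def less_imp_le)
 then show "lam e <= B" using d(5)[of x] by linarith
qed

lemma block_square_nonneg: assumes "wgraph lam B F" "S <= F" shows "0 <= sqent lam F S s"
 unfolding block_ent_fibre_whole[OF assms] block_ent_whole[OF wgraph_res[OF assms]]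
 using fibre_prob_pos[OF assms] gex_square[OF wgraph_res[OF assms]]
 by (intro sum_nonneg mult_nonneg_nonneg) (auto simp: less_imp_le)

lemma gvar_le_sum_block_square:
 assumes "wgraph lam B F" "finite U" "\<Union>F <= U"
 shows "gvar lam F s <= real (card U) * (8 * (1 + B)^4) * (\<Sum>e\<in>F. sqent lam F {e} s)"
proof -
 have B: "0 <= B" using wgraphD(4)[OF assms(1)] .
 have "dirichlet lam F s <= (1 + B) * (\<Sum>e\<in>F. sqent lam F {e} s)"
  unfolding sum_block_square[OF assms(1)] sum_distrib_left
  using lam_le[OF assms(1)] block_square_nonneg[OF assms(1)] by (intro sum_mono mult_right_mono) auto
 then have "real (card U) * (8 * (1 + B)^3) * dirichlet lam F s
   <= real (card U) * (8 * (1 + B)^3) * ((1 + B) * (\<Sum>e\<in>F. sqent lam F {e} s))"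
  using B by (intro mult_left_mono) auto
 then show ?thesis using gvar_le_dirichlet[OF assms(2,1,3), of s]
  by (simp add: power_numeral_reduce mult_ac)
qed

lemma block_square_sqrt_le:
 assumes "wgraph lam B F" "S <= F" "!!M. M \<in> matchings F ==> 0 <= f M"
 shows "sqent lam F S (%M. sqrt (f M)) <= ent lam F S f"
 unfolding block_ent_fibre_whole[OF assms(1,2)]
proof (intro sum_mono mult_left_mono)
 fix sg assume s: "sg \<in> matchings (F - S)"
 note wr = wgraph_res[OF assms(1,2), of sg]
 have "sqent lam (res S sg) (res S sg) (%L. sqrt (f (sg Un L))) = gvar lam (res S sg) (%L. sqrt (f (sg Un L)))"
  unfolding block_ent_whole[OF wr] gvar_def ..
 also have "... <= ent lam (res S sg) (res S sg) (%L. f (sg Un L))"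
  using union_matching(1)[OF assms(2) s] assms(3) by (intro gex_sqrt_le_entropy(1)[OF wr]) auto
 finally show "sqent lam (res S sg) (res S sg) (%L. sqrt (f (sg Un L)))
   <= ent lam (res S sg) (res S sg) (%L. f (sg Un L))" .
 show "0 <= fibre_prob lam F S sg" using fibre_prob_pos[OF assms(1,2), of sg] by simp
qed

lemma Zsum_le: assumes "wgraph lam B F" shows "Zsum lam F <= (1 + B) ^ card F"
proof -
 have "finite F" using wgraphD(1)[OF assms] .
 then show ?thesis using assms
 proof (induction F rule: finite_induct)
  case empty
  have "matchings {} = ({{}} :: 'a set set set)" by (auto simp: matchings_def)
  then show ?case by (simp add: Zsum_def weight_def)
 next
  case (insert e F)
  note w = wgraphD[OF insert.prems]
  have wF: "wgraph lam B F" by (rule wgraph_subset[OF insert.prems]) auto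
  have eF: "e \<in> insert e F" "insert e F - {e} = F" using insert.hyps by auto
  have sub: "away e (insert e F) <= F" using w(6)[of e] by (auto simp: away_def)
  have "Zsum lam (insert e F) = Zsum lam F + lam e * Zsum lam (away e (insert e F))"
   using gex_edge(2)[OF insert.prems eF(1)] w(7) unfolding eF(2) edge_prob_def by (simp add: field_simps)
  also have "... <= Zsum lam F + B * Zsum lam F"
   using lam_le[OF insert.prems eF(1)] Zsum_mono[OF wF sub] w(3,4) wgraphD(7)[OF wgraph_away[OF insert.prems]]
   by (intro add_left_mono mult_mono) (auto simp: less_imp_le)
  also have "... = (1 + B) * Zsum lam F" by (simp add: algebra_simps)
  also have "... <= (1 + B) * (1 + B) ^ card F" using insert.IH[OF wF] w(4) by (intro mult_left_mono) auto
  finally show ?case using insert.hyps by simp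
 qed
qed

lemma card_Union_edges_le: assumes "wgraph lam B F" shows "finite (\<Union>F)" "card (\<Union>F) <= 2 * card F"
proof -
 note w = wgraphD[OF assms]
 show "finite (\<Union>F)"
 proof (rule finite_Union[OF w(1)])
  fix e assume "e \<in> F"
  then have "0 < card e" using w(2) by simp
  then show "finite e" by (rule card_ge_0_finite)
 qed
 have "card (\<Union>F) <= (\<Sum>e\<in>F. card e)" using card_Union_le_sum_card by simp
 also have "... = 2 * card F" using w(2) by simp
 finally show "card (\<Union>F) <= 2 * card F" .
qed

text \<open>Crude tensorization, with a constant exponential in the number of edges; it is only applied to
 the small components of a sparse random set of edges.\<close>

lemma entropy_crude:
 assumes "wgraph lam B F" "!!M. M \<in> matchings F ==> 0 <= f M" "!!e. e \<in> F ==> 1 <= lam e" "card F <= k"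
 shows "ent lam F F f <= 64 * real k * (1 + B) ^ (k + 4) * (\<Sum>e\<in>F. ent lam F {e} f)"
proof -
 note w = wgraphD[OF assms(1)]
 \<comment> \<open>A lower bound for every atom: matchings weigh at least 1, since all edge weights
   do, and the partition function is at most \<open>(1 + B) ^ k\<close>.\<close>
 define \<delta> where "\<delta> = 1 / (1 + B) ^ k"
 have B: "1 <= (1 + B) ^ k" using w(4) by simp
 have d: "0 < \<delta>" "\<delta> <= 1" using B w(4) by (auto simp: \<delta>_def)
 define A where "A = (\<Sum>e\<in>F. ent lam F {e} f)"
 have A: "0 <= A" unfolding A_def by (intro sum_nonneg block_ent_nonneg[OF assms(1)] assms(2)) auto
 have "\<delta> <= weight lam M / Zsum lam F" if "M \<in> matchings F" for M
 proof -
  have "Zsum lam F <= (1 + B) ^ k"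
   using Zsum_le[OF assms(1)] power_increasing[OF assms(4), of "1 + B"] w(4) by linarith
  moreover have "1 <= weight lam M" unfolding weight_def using that assms(3) by (intro prod_ge_1) (auto simp: matchings_def)
  ultimately show ?thesis unfolding \<delta>_def using w(7) by (intro frac_le) auto
 qed
 then have "ent lam F F f <= 4 / \<delta> * gvar lam F (%M. sqrt (f M))"
  using d assms(2) by (intro entropy_le_gvar_sqrt[OF assms(1)]) auto
 also have "... <= 4 / \<delta> * (real (card (\<Union>F)) * (8 * (1 + B)^4) * A)"
 proof (rule mult_left_mono)
  have "gvar lam F (%M. sqrt (f M)) <= real (card (\<Union>F)) * (8 * (1 + B)^4) * (\<Sum>e\<in>F. sqent lam F {e} (%M. sqrt (f M)))"
   by (rule gvar_le_sum_block_square[OF assms(1) card_Union_edges_le(1)[OF assms(1)] order_refl])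
  also have "... <= real (card (\<Union>F)) * (8 * (1 + B)^4) * A"
   unfolding A_def using w(4) by (intro mult_left_mono sum_mono block_square_sqrt_le[OF assms(1)] assms(2)) auto
  finally show "gvar lam F (%M. sqrt (f M)) <= real (card (\<Union>F)) * (8 * (1 + B)^4) * A" .
 qed (use d in auto)
 also have "... <= 4 / \<delta> * (real (2 * k) * (8 * (1 + B)^4) * A)"
  using card_Union_edges_le(2)[OF assms(1)] assms(4) d A w(4)
  by (intro mult_left_mono mult_right_mono) (auto simp: of_nat_le_iff[symmetric] simp del: of_nat_le_iff)
 also have "... = 64 * real k * (1 + B) ^ (k + 4) * A" by (simp add: \<delta>_def power_add mult_ac)
 finally show ?thesis by (simp add: A_def)
qed

definition crude :: "real => nat => real" where "crude B t = 64 * real t * (1 + B) ^ (t + 4)"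

lemma block_ent_crude:
 assumes "wgraph lam B F" "!!M. M \<in> matchings F ==> 0 <= f M" "!!e. e \<in> F ==> 1 <= lam e" "T <= F"
 shows "ent lam F T f <= crude B (card T) * (\<Sum>e\<in>T. ent lam F {e} f)"
proof -
 define E where "E sg S = ent lam (res T sg) S (%L. f (sg Un L))" for sg S
 have B: "0 <= B" using wgraphD(4)[OF assms(1)] .
 have finT: "finite T" using assms(4) wgraphD(1)[OF assms(1)] finite_subset by blast
 have c0: "0 <= crude B (card T)" using B by (simp add: crude_def)
 have "ent lam F T f = (\<Sum>sg\<in>matchings (F - T). fibre_prob lam F T sg * E sg (res T sg))"
  unfolding E_def by (rule block_ent_fibre_whole[OF assms(1,4)])
 also have "... <= (\<Sum>sg\<in>matchings (F - T). fibre_prob lam F T sg * (crude B (card T) * (\<Sum>e\<in>T. E sg ({e} \<inter> res T sg))))"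
 proof (intro sum_mono mult_left_mono)
  fix sg assume s: "sg \<in> matchings (F - T)"
  note wr = wgraph_res[OF assms(1,4), of sg]
  have f0: "!!M. M \<in> matchings (res T sg) ==> 0 <= f (sg Un M)" using union_matching(1)[OF assms(4) s] assms(2) by auto
  have "E sg (res T sg) <= crude B (card T) * (\<Sum>e\<in>res T sg. E sg {e})"
   unfolding E_def crude_def using f0 assms(3,4) res_subset[of T sg] finT
   by (intro entropy_crude[OF wr] card_mono) auto
  also have "(\<Sum>e\<in>res T sg. E sg {e}) = (\<Sum>e\<in>res T sg. E sg ({e} \<inter> res T sg))" by (intro sum.cong refl) auto
  also have "... <= (\<Sum>e\<in>T. E sg ({e} \<inter> res T sg))"
   unfolding E_def using res_subset[of T sg] finT f0 by (intro sum_mono2 block_ent_nonneg[OF wr]) auto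
  finally show "E sg (res T sg) <= crude B (card T) * (\<Sum>e\<in>T. E sg ({e} \<inter> res T sg))" using c0 by (simp add: mult_left_mono)
  show "0 <= fibre_prob lam F T sg" using fibre_prob_pos[OF assms(1,4), of sg] by simp
 qed
 also have "... = crude B (card T) * (\<Sum>e\<in>T. \<Sum>sg\<in>matchings (F - T). fibre_prob lam F T sg * E sg ({e} \<inter> res T sg))"
  by (simp add: sum_distrib_left mult.left_commute sum.swap[of _ "matchings (F - T)" T])
 also have "(\<Sum>e\<in>T. \<Sum>sg\<in>matchings (F - T). fibre_prob lam F T sg * E sg ({e} \<inter> res T sg)) = (\<Sum>e\<in>T. ent lam F {e} f)"
  unfolding E_def by (intro sum.cong refl block_ent_fibre[OF assms(1,4), symmetric]) auto
 finally show ?thesis .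
qed

section \<open>Components of a random edge set\<close>

abbreviation touch :: "'v set => 'v set => bool" where "touch a b \<equiv> \<not> disjnt a b"

text \<open>Edges in different components of \<open>S\<close> do not interact inside
  \<open>S\<close>, so \<open>block_ent_split\<close> peels off one component at a time and each is
  treated crudely. The components of the remaining edges are the same in \<open>R\<close> as in
  \<open>S\<close>.\<close>

lemma block_ent_components:
 assumes "wgraph lam B F" "!!M. M \<in> matchings F ==> 0 <= f M" "!!e. e \<in> F ==> 1 <= lam e" "S <= F"
 shows "ent lam F S f <= (\<Sum>e\<in>S. crude B (card (component touch S e)) * ent lam F {e} f)"
 using assms(4)
proof (induction "card S" arbitrary: S rule: less_induct)
 case less
 have finS: "finite S" using less.prems wgraphD(1)[OF assms(1)] finite_subset by blast
 show ?case
 proof (cases "S = {}")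
  case True
  have "ent lam F {} f <= crude B (card ({} :: 'a set set)) * (\<Sum>e\<in>{}. ent lam F {e} f)"
   by (rule block_ent_crude[OF assms(1-3)]) auto
  then show ?thesis using True by simp
 next
  case False
  then obtain e where e: "e \<in> S" by blast
  define C where "C = component touch S e"
  define R where "R = S - C"
  have C: "C <= S" "e \<in> C" unfolding C_def using component_subset[OF e] component_refl by auto
  have S: "S = C Un R" "C \<inter> R = {}" using C by (auto simp: R_def)
  have dis: "disjnt c r" if "c \<in> C" "r \<in> R" for c r
   using component_closed[of c touch S e r] that C(1) by (auto simp: R_def C_def)
  have compC: "component touch S g = C" if "g \<in> C" for g
  proof -
   let ?r = "{(a, b). a \<in> S & b \<in> S & touch a b}"
   have "sym (?r\<^sup>*)" by (rule sym_rtrancl) (auto simp: sym_def disjnt_sym)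
   moreover have "(e, g) \<in> ?r\<^sup>*" using that by (simp add: C_def component_def)
   ultimately have "(g, e) \<in> ?r\<^sup>*" by (simp add: symD)
   with \<open>(e, g) \<in> ?r\<^sup>*\<close> show ?thesis by (auto simp: C_def component_def dest: rtrancl_trans)
  qed
  have compR: "component touch S g = component touch R g" if g: "g \<in> R" for g
  proof (intro equalityI subsetI)
   fix h assume "h \<in> component touch S g"
   then have "(g, h) \<in> {(a, b). a \<in> S & b \<in> S & touch a b}\<^sup>*" by (simp add: component_def)
   then show "h \<in> component touch R g"
   proof (induction rule: rtrancl_induct)
    case base then show ?case by (rule component_refl)
   next
    case (step y z)
    have "y \<in> R" using component_subset[OF g] step.IH by blast
    moreover have z: "z \<in> S" "touch y z" using step.hyps(2) by auto
    moreover have "z \<in> R"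
    proof (rule ccontr)
     assume "z \<notin> R"
     then have "disjnt z y" using dis \<open>y \<in> R\<close> z(1) by (simp add: R_def)
     then show False using z(2) disjnt_sym[of z y] by simp
    qed
    ultimately show ?case using component_closed[OF step.IH, of z] by simp
   qed
  next
   fix h assume "h \<in> component touch R g"
   then have "(g, h) \<in> {(a, b). a \<in> R & b \<in> R & touch a b}\<^sup>*" by (simp add: component_def)
   moreover have "{(a, b). a \<in> R & b \<in> R & touch a b} <= {(a, b). a \<in> S & b \<in> S & touch a b}" by (auto simp: R_def)
   ultimately show "h \<in> component touch S g" unfolding component_def using rtrancl_mono by blast
  qed
  have CF: "C Un R <= F" using S less.prems by auto
  have finC: "finite C" "finite R" using finite_subset[OF C(1) finS] finS by (simp_all add: R_def)
  have cardR: "card R < card S" using e C finS by (intro psubset_card_mono) (auto simp: R_def)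
  have "ent lam F S f <= ent lam F C f + ent lam F R f"
   unfolding S(1) using dis assms(2) by (intro block_ent_split[OF assms(1) CF S(2)]) auto
  also have "ent lam F C f <= crude B (card C) * (\<Sum>e\<in>C. ent lam F {e} f)"
   using CF by (intro block_ent_crude[OF assms(1-3)]) auto
  also have "... = (\<Sum>g\<in>C. crude B (card (component touch S g)) * ent lam F {g} f)"
   by (simp add: sum_distrib_left compC)
  also have "ent lam F R f <= (\<Sum>g\<in>R. crude B (card (component touch R g)) * ent lam F {g} f)"
   using CF by (intro less.hyps[OF cardR]) auto
  also have "... = (\<Sum>g\<in>R. crude B (card (component touch S g)) * ent lam F {g} f)"
   by (intro sum.cong refl) (simp add: compR)
  also have "(\<Sum>g\<in>C. crude B (card (component touch S g)) * ent lam F {g} f)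
    + (\<Sum>g\<in>R. crude B (card (component touch S g)) * ent lam F {g} f)
    = (\<Sum>g\<in>S. crude B (card (component touch S g)) * ent lam F {g} f)"
   using finC S by (subst sum.union_disjoint[symmetric]) auto
  finally show ?thesis by simp
 qed
qed

lemma card_inc_le:
 assumes "wgraph lam B F" "!!e. e \<in> F ==> 1 <= lam e"
 shows "real (card (inc x F)) <= B"
proof -
 have "real (card (inc x F)) = (\<Sum>e\<in>inc x F. 1)" by simp
 also have "... <= (\<Sum>e\<in>inc x F. lam e)" using assms(2) by (intro sum_mono) (auto simp: inc_def)
 also have "... <= B" by (rule wgraphD(5)[OF assms(1)])
 finally show ?thesis .
qed

lemma card_touch_le:
 assumes "wgraph lam B F" "!!e. e \<in> F ==> 1 <= lam e" "g \<in> F"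
 shows "real (card {h \<in> F. touch g h}) <= 2 * B"
proof -
 note w = wgraphD[OF assms(1)]
 obtain x where x: "x \<in> g" using w(6)[OF assms(3)] by blast
 define y where "y = other x g"
 have g: "g = {x, y}" unfolding y_def by (rule other_edge(1)[OF w(2)[OF assms(3)] x])
 have fin: "finite (inc z F)" for z using finite_subset[OF inc_subset w(1)] .
 have "card {h \<in> F. touch g h} <= card (inc x F Un inc y F)"
  using fin by (intro card_mono) (auto simp: g inc_def disjnt_def)
 also have "... <= card (inc x F) + card (inc y F)" by (rule card_Un_le)
 finally have "real (card {h \<in> F. touch g h}) <= real (card (inc x F)) + real (card (inc y F))"
  by (simp add: of_nat_add[symmetric] del: of_nat_add)
 then show ?thesis using card_inc_le[OF assms(1,2), of x] card_inc_le[OF assms(1,2), of y] by linarith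
qed

lemma sum_half_powers: "(\<Sum>t\<in>{1..n}. (1 / 2 :: real) ^ t) <= 1"
proof -
 have "(\<Sum>t\<in>{1..n}. (1 / 2 :: real) ^ t) = 1 - (1 / 2) ^ n" by (induction n) auto
 then show ?thesis by simp
qed

text \<open>The factors 64, \<open>t\<close> and the power become exponents 6, \<open>t\<close> and
  \<open>t + 4\<close> of \<open>1 + B >= 2\<close>; their sum is at most
  \<open>12 * t\<close>.\<close>

lemma crude_le: assumes "1 <= B" "1 <= t" shows "crude B t <= (1 + B) ^ (12 * t)"
proof -
 define b where "b = 1 + B"
 have b: "2 <= b" using assms by (simp add: b_def)
 have "real t <= 2 ^ t" using of_nat_less_two_power[of t, where 'a = real] by simp
 also have "... <= b ^ t" using b by (intro power_mono) auto
 finally have 1: "real t <= b ^ t" .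
 have "(2::real) ^ 6 <= b ^ 6" using b by (intro power_mono) auto
 then have 2: "64 <= b ^ 6" by simp
 have "crude B t <= b ^ 6 * b ^ t * b ^ (t + 4)"
  unfolding crude_def b_def[symmetric] using 1 2 b by (intro mult_right_mono mult_mono) auto
 also have "... = b ^ (2 * t + 10)" by (simp add: power_add[symmetric] algebra_simps)
 also have "... <= b ^ (12 * t)" using b assms by (intro power_increasing) auto
 finally show ?thesis by (simp add: b_def)
qed

text \<open>Union bound over the connected sets of size \<open>t\<close> that contain
  \<open>e\<close>. There are at most \<open>b ^ (4 * t)\<close>, by walks of
  \<open>2 * t - 2\<close> steps with at most \<open>b ^ 2\<close> choices each; a random set of
  size \<open>l\<close> contains a given one with probability at most \<open>(l / m) ^ t\<close>;
  the crude cost is at most \<open>b ^ (12 * t)\<close>. With \<open>b ^ 17 * l <= m\<close> the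
  series is dominated by powers of one half.\<close>

lemma sum_components_le:
 assumes "wgraph lam B F" "!!e. e \<in> F ==> 1 <= lam e" "1 <= B" "e \<in> F" "(1 + B) ^ 17 * real l <= real (card F)"
 shows "(\<Sum>S | S <= F & card S = l & e \<in> S. crude B (card (component touch S e))) <= real (card F choose l)"
proof -
 note w = wgraphD[OF assms(1)]
 define b where "b = 1 + B"
 define m where "m = card F"
 have b: "2 <= b" using assms(3) by (simp add: b_def)
 have m: "0 < m" using assms(4) w(1) by (auto simp: m_def card_gt_0_iff)
 have "1 * real l <= b ^ 17 * real l" using b by (intro mult_right_mono) auto
 then have lm: "l <= m" using assms(5) by (simp add: b_def m_def)
 define D where "D = nat \<lfloor>2 * B\<rfloor>"
 have D: "real D <= b ^ 2"
 proof -
  have "real D <= 2 * B" using assms(3) by (simp add: D_def)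
  also have "... <= b ^ 2" by (simp add: b_def power2_eq_square algebra_simps)
  finally show ?thesis .
 qed
 have cardD: "card {h \<in> F. touch g h} <= D" if "g \<in> F" for g
  using card_touch_le[OF assms(1,2) that] by (simp add: D_def le_nat_floor)
 define \<T> where "\<T> t = {T \<in> set ` walks touch F (2 * t - 2) e. card T = t}" for t
 have finT: "finite (\<T> t)" for t using card_walks_le(1)[OF w(1) cardD assms(4)] by (simp add: \<T>_def)
 have cardT: "real (card (\<T> t)) <= b ^ (4 * t)" for t
 proof -
  have "card (\<T> t) <= card (set ` walks touch F (2 * t - 2) e)"
   using card_walks_le(1)[OF w(1) cardD assms(4)] by (intro card_mono) (auto simp: \<T>_def)
  also have "... <= card (walks touch F (2 * t - 2) e)"
   by (rule card_image_le[OF card_walks_le(1)[OF w(1) cardD assms(4)]])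
  also have "... <= D ^ (2 * t - 2)" by (rule card_walks_le(2)[OF w(1) cardD assms(4)])
  finally have "real (card (\<T> t)) <= real D ^ (2 * t - 2)" by (simp flip: of_nat_power)
  also have "... <= (b ^ 2) ^ (2 * t - 2)" using D by (intro power_mono) auto
  also have "... <= (b ^ 2) ^ (2 * t)" using b by (intro power_increasing) (auto intro: order_trans[OF _ power_increasing[of 0 2]])
  finally show ?thesis by (simp add: power_mult[symmetric])
 qed
 have TF: "T <= F" "card T = t" if "T \<in> \<T> t" for T t using that by (auto simp: \<T>_def walks_def)
 let ?L = "{S. S <= F & card S = l & e \<in> S}"
 have finL: "finite ?L" by (rule finite_subset[of _ "Pow F"]) (use w(1) in auto)
 have "(\<Sum>S\<in>?L. crude B (card (component touch S e))) <= (\<Sum>S\<in>?L. \<Sum>t\<in>{1..m}. \<Sum>T\<in>\<T> t. of_bool (T <= S) * b ^ (12 * t))"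
 proof (rule sum_mono)
  fix S assume "S \<in> ?L"
  then have S: "S <= F" "e \<in> S" by auto
  have finS: "finite S" using S(1) w(1) finite_subset by blast
  define C where "C = component touch S e"
  define t where "t = card C"
  have CS: "C <= S" "e \<in> C" unfolding C_def using component_subset[OF S(2)] component_refl by auto
  have finC: "finite C" using CS(1) finS finite_subset by blast
  have t1: "1 <= t" using finC CS(2) by (auto simp: t_def Suc_le_eq card_gt_0_iff)
  have tm: "t <= m" unfolding t_def m_def using CS S w(1) by (intro card_mono) auto
  obtain wk where wk: "wk \<in> walks touch S (2 * t - 2) e" "set wk = C"
  proof -
   have "symp (touch :: 'a set => 'a set => bool)" by (rule sympI) (metis disjnt_sym)
   then show thesis using component_walk[OF finS S(2), of touch] that unfolding t_def C_def by blast
  qed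
  then have "C \<in> \<T> t" using S(1) by (auto simp: \<T>_def walks_def t_def)
  then have "of_bool (C <= S) * b ^ (12 * t) <= (\<Sum>T\<in>\<T> t. of_bool (T <= S) * b ^ (12 * t))"
   using finT b by (intro member_le_sum) auto
  also have "... <= (\<Sum>t\<in>{1..m}. \<Sum>T\<in>\<T> t. of_bool (T <= S) * b ^ (12 * t))"
   using t1 tm b by (intro member_le_sum[of t "{1..m}" "%t. \<Sum>T\<in>\<T> t. of_bool (T <= S) * b ^ (12 * t)"]) (auto intro!: sum_nonneg)
  finally have "b ^ (12 * t) <= (\<Sum>t\<in>{1..m}. \<Sum>T\<in>\<T> t. of_bool (T <= S) * b ^ (12 * t))" using CS by simp
  then show "crude B (card (component touch S e)) <= (\<Sum>t\<in>{1..m}. \<Sum>T\<in>\<T> t. of_bool (T <= S) * b ^ (12 * t))"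
   using crude_le[OF assms(3) t1] unfolding b_def C_def t_def by linarith
 qed
 also have "... = (\<Sum>t\<in>{1..m}. \<Sum>T\<in>\<T> t. \<Sum>S\<in>?L. of_bool (T <= S) * b ^ (12 * t))"
  by (subst sum.swap, rule sum.cong[OF refl], subst sum.swap) simp
 also have "... <= (\<Sum>t\<in>{1..m}. \<Sum>T\<in>\<T> t. b ^ (12 * t) * (real (m choose l) * (real l / real m) ^ t))"
 proof (intro sum_mono)
  fix t T assume T: "T \<in> \<T> t"
  have "(\<Sum>S\<in>?L. of_bool (T <= S) * b ^ (12 * t)) = b ^ (12 * t) * real (card {S \<in> ?L. T <= S})"
  proof -
   have "(\<Sum>S\<in>?L. of_bool (T <= S) * b ^ (12 * t)) = (\<Sum>S\<in>{S \<in> ?L. T <= S}. b ^ (12 * t))"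
    using finL by (intro sum.mono_neutral_cong_right) auto
   then show ?thesis by simp
  qed
  also have "... <= b ^ (12 * t) * real (card {S. S <= F & card S = l & T <= S})"
   using b w(1) by (intro mult_left_mono) (auto intro!: card_mono finite_subset[of _ "Pow F"])
  also have "... <= b ^ (12 * t) * (real (m choose l) * (real l / real m) ^ t)"
   using card_supersets_le[OF w(1) TF(1)[OF T], of l] lm m b TF(2)[OF T] by (intro mult_left_mono) (auto simp: m_def)
  finally show "(\<Sum>S\<in>?L. of_bool (T <= S) * b ^ (12 * t)) <= b ^ (12 * t) * (real (m choose l) * (real l / real m) ^ t)" .
 qed
 also have "... = (\<Sum>t\<in>{1..m}. real (card (\<T> t)) * (b ^ (12 * t) * (real (m choose l) * (real l / real m) ^ t)))" by simp
 also have "... <= (\<Sum>t\<in>{1..m}. b ^ (4 * t) * (b ^ (12 * t) * (real (m choose l) * (real l / real m) ^ t)))"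
  using b by (intro sum_mono mult_right_mono cardT) auto
 also have "... = (\<Sum>t\<in>{1..m}. real (m choose l) * (b ^ 16 * real l / real m) ^ t)"
 proof (rule sum.cong[OF refl])
  fix t
  have "b ^ (4 * t) * b ^ (12 * t) = (b ^ 16) ^ t" by (simp add: power_add[symmetric] power_mult[symmetric])
  then show "b ^ (4 * t) * (b ^ (12 * t) * (real (m choose l) * (real l / real m) ^ t)) = real (m choose l) * (b ^ 16 * real l / real m) ^ t"
   by (simp add: power_mult_distrib power_divide mult_ac)
 qed
 also have "... <= (\<Sum>t\<in>{1..m}. real (m choose l) * (1 / 2) ^ t)"
 proof (intro sum_mono mult_left_mono power_mono)
  have "2 * (b ^ 16 * real l) <= b * (b ^ 16 * real l)" using b by (intro mult_right_mono) auto
  also have "... = b ^ 17 * real l" by (simp add: power_numeral_reduce mult_ac)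
  also have "... <= real m" using assms(5) by (simp add: b_def m_def)
  finally show "b ^ 16 * real l / real m <= 1 / 2" using m by (simp add: field_simps)
 qed (use b in auto)
 also have "... = real (m choose l) * (\<Sum>t\<in>{1..m}. (1 / 2) ^ t)" by (simp add: sum_distrib_left)
 also have "... <= real (m choose l) * 1" by (intro mult_left_mono sum_half_powers) auto
 finally show ?thesis by (simp add: m_def)
qed

text \<open>Edges are pinned until a random block of about \<open>m / b ^ 17\<close> edges is left,
  where the expected crude constant is at most 1. The price of pinning is
  \<open>exp (2 * ent_rate B * ln (m / l))\<close>, and \<open>m / l <= b ^ 18\<close> gives
  \<open>2 * 12 * 18 = 432\<close>. The exponent 27 is \<open>17 + 10\<close>: it leaves
  \<open>l >= b ^ 10 - 1\<close>, enough for the requirement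
  \<open>2 * ent_rate B <= l\<close>.\<close>

theorem entropy_tensorization:
 assumes "wgraph lam B F" "!!M. M \<in> matchings F ==> 0 <= f M" "!!e. e \<in> F ==> 1 <= lam e" "1 <= B"
  "(1 + B) ^ 27 <= real (card F)"
 shows "ent lam F F f <= exp (432 * (1 + B) ^ 5) * (\<Sum>e\<in>F. ent lam F {e} f)"
proof -
 note w = wgraphD[OF assms(1)]
 define b where "b = 1 + B"
 define m where "m = card F"
 define l where "l = nat \<lfloor>real m / b ^ 17\<rfloor>"
 define A where "A e = ent lam F {e} f" for e
 have A0: "0 <= A e" if "e \<in> F" for e unfolding A_def using that by (intro block_ent_nonneg[OF assms(1)] assms(2)) auto
 have b: "2 <= b" using assms(4) by (simp add: b_def)
 have b17: "0 < b ^ 17" using b by simp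
 have mb: "b ^ 10 <= real m / b ^ 17"
  using assms(5) b17 by (simp add: b_def[symmetric] m_def[symmetric] pos_le_divide_eq power_add[symmetric])
 have "(2::real) ^ 6 <= b ^ 6" using b by (intro power_mono) auto
 then have "64 * b ^ 4 <= b ^ 6 * b ^ 4" using b by (intro mult_right_mono) auto
 then have b10: "64 * b ^ 4 <= b ^ 10" by (simp add: power_add[symmetric])
 have b4: "1 <= b ^ 4" using b by simp
 have l1: "real l <= real m / b ^ 17" using b17 by (simp add: l_def)
 have l2: "real m / b ^ 17 - 1 <= real l" unfolding l_def by linarith
 have lk: "2 * ent_rate B <= real l" using l2 mb b10 b4 by (simp add: ent_rate_def b_def)
 have l0: "0 < l" using lk b4 by (simp add: ent_rate_def b_def[symmetric])
 have lm: "real l * b ^ 17 <= real m" using l1 b17 by (simp add: field_simps)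
 have lm': "l <= m"
 proof -
  have "real l * 1 <= real l * b ^ 17" using b by (intro mult_left_mono) auto
  then show ?thesis using lm by simp
 qed
 have "ent lam F F f <= exp (2 * ent_rate B * (ln (real m) - ln (real l)))
   * ((\<Sum>S | S <= F & card S = l. ent lam F S f) / real (m choose l))"
  unfolding m_def
 proof (rule subset_average_chain[OF w(1) _ l0 _ lk])
  show "0 <= ent_rate B" using assms(4) by (simp add: ent_rate_def)
  show "l <= card F" using lm' by (simp add: m_def)
  fix S assume S: "S <= F"
  show "0 <= ent lam F S f" using assms(2) by (rule block_ent_nonneg[OF assms(1) S])
  show "(real (card S) - ent_rate B) * ent lam F S f <= (\<Sum>e\<in>S. ent lam F (S - {e}) f)"
   using pin_one_site[OF assms(1-3) S] by (simp add: sum_subtractf algebra_simps)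
 qed
 also have "... <= exp (432 * b ^ 5) * (\<Sum>e\<in>F. A e)"
 proof (intro mult_mono)
  have "real m <= 2 * b ^ 17 * real l"
  proof -
   have "1 <= real l" using l0 by simp
   then have "real m / b ^ 17 <= 2 * real l" using l2 by linarith
   then show ?thesis using b17 by (simp add: field_simps)
  qed
  also have "... <= b ^ 18 * real l"
   using b by (intro mult_right_mono) (auto simp: power_Suc[of b 17, simplified] mult_right_mono)
  finally have "ln (real m) <= ln (b ^ 18 * real l)" using l0 lm' by (intro ln_mono) auto
  also have "... = 18 * ln b + ln (real l)" using b l0 by (simp add: ln_mult ln_realpow)
  also have "ln b <= b" using ln_le_minus_one[of b] b by linarith
  finally have "ln (real m) - ln (real l) <= 18 * b" by simp
  then have "2 * ent_rate B * (ln (real m) - ln (real l)) <= 2 * ent_rate B * (18 * b)"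
   using assms(4) by (intro mult_left_mono) (auto simp: ent_rate_def)
  also have "... = 432 * b ^ 5" by (simp add: ent_rate_def b_def[symmetric] power_numeral_reduce)
  finally show "exp (2 * ent_rate B * (ln (real m) - ln (real l))) <= exp (432 * b ^ 5)" by simp
 next
  let ?L = "{S. S <= F & card S = l}"
  have finL: "finite ?L" by (rule finite_subset[of _ "Pow F"]) (use w(1) in auto)
  have "(\<Sum>S\<in>?L. ent lam F S f) <= (\<Sum>S\<in>?L. \<Sum>e\<in>S. crude B (card (component touch S e)) * A e)"
   unfolding A_def by (intro sum_mono block_ent_components[OF assms(1-3)]) auto
  also have "... = (\<Sum>S\<in>?L. \<Sum>e\<in>F. of_bool (e \<in> S) * (crude B (card (component touch S e)) * A e))"
   using w(1) by (intro sum.cong refl sum.mono_neutral_cong_left) auto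
  also have "... = (\<Sum>e\<in>F. A e * (\<Sum>S\<in>?L. of_bool (e \<in> S) * crude B (card (component touch S e))))"
   by (subst sum.swap) (simp add: sum_distrib_left mult_ac)
  also have "... = (\<Sum>e\<in>F. A e * (\<Sum>S | S <= F & card S = l & e \<in> S. crude B (card (component touch S e))))"
   using finL by (intro sum.cong refl arg_cong2[of _ _ _ _ times] sum.mono_neutral_cong_right) auto
  also have "... <= (\<Sum>e\<in>F. A e * real (m choose l))"
   using A0 lm unfolding m_def
   by (intro sum_mono mult_left_mono sum_components_le[OF assms(1,3,4)]) (auto simp: b_def mult.commute)
  also have "... = (\<Sum>e\<in>F. A e) * real (m choose l)" by (simp add: sum_distrib_right)
  finally show "(\<Sum>S\<in>?L. ent lam F S f) / real (m choose l) <= (\<Sum>e\<in>F. A e)"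
   using lm' by (simp add: divide_le_eq)
 next
  show "0 <= (\<Sum>S | S <= F & card S = l. ent lam F S f) / real (m choose l)"
   using assms(2) by (intro divide_nonneg_nonneg sum_nonneg block_ent_nonneg[OF assms(1)]) auto
 qed simp
 finally show ?thesis by (simp add: b_def A_def)
qed

section \<open>Heat-bath dynamics\<close>

text \<open>In contrast to \<open>Zsum_le\<close>, the exponent counts vertices; this keeps the
  initial entropy linear in the number of vertices.\<close>

lemma Zsum_le_vertices:
 assumes "finite U" "wgraph lam B F" "\<Union>F <= U"
 shows "Zsum lam F <= (1 + B) ^ card U"
 using assms
proof (induction U arbitrary: F rule: finite_induct)
 case empty
 then have "F = {}" using wgraphD(6)[OF empty(1)] by auto
 then show ?case using Zsum_le[OF empty(1)] by simp
next
 case (insert v U)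
 note w = insert.prems(1)
 have "Zsum lam (avoid v F) <= (1 + B) ^ card U"
  using insert.prems(2) by (intro insert.IH wgraph_avoid[OF w]) (auto simp: avoid_def)
 then have "(1 + B) * Zsum lam (avoid v F) <= (1 + B) * (1 + B) ^ card U"
  using wgraphD(4)[OF w] by (intro mult_left_mono) auto
 moreover have "Zsum lam F <= (1 + B) * Zsum lam (avoid v F)"
  using prob_vertex(5)[OF w, of v] wgraphD(7)[OF w] by (simp add: free_prob_def field_simps)
 ultimately show ?case using insert.hyps by simp
qed

section \<open>The chain and the evolution of its density\<close>

lemma gex_cond_adjoint:
 assumes "wgraph lam B F" "S <= F"
 shows "gex lam F (%M. f M * cond lam S h M) = gex lam F (%M. cond lam S f M * h M)"
proof -
 have "gex lam F (%M. f M * cond lam S h M)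
   = (\<Sum>sg\<in>matchings (F - S). fibre_prob lam F S sg * (gex lam (res S sg) (%K. f (sg Un K)) * gex lam (res S sg) (%K. h (sg Un K))))" for f h
  unfolding gex_fibre[OF assms]
 proof (intro sum.cong refl arg_cong2[of _ _ _ _ times])
  fix sg assume s: "sg \<in> matchings (F - S)"
  have "gex lam (res S sg) (%K. f (sg Un K) * cond lam S h (sg Un K))
   = gex lam (res S sg) (%K. gex lam (res S sg) (%K. h (sg Un K)) * f (sg Un K))"
   by (rule gex_cong) (simp add: cond_fibre[OF assms(2) s])
  then show "gex lam (res S sg) (%K. f (sg Un K) * cond lam S h (sg Un K))
   = gex lam (res S sg) (%K. f (sg Un K)) * gex lam (res S sg) (%K. h (sg Un K))" by (simp add: gex_cmult)
 qed
 from this[of f h] this[of h f] show ?thesis by (simp add: mult.commute)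
qed

text \<open>With \<open>r\<close> uniform below \<open>L e + 1\<close>, the event
  \<open>r ~= 0\<close> has the heat-bath probability \<open>L e / (L e + 1)\<close>. Integer
  weights are what allows one uniform integer to suffice.\<close>

definition upd :: "'v set => nat => 'v set set => 'v set set" where
 "upd e r M = (if r ~= 0 & (\<forall>f\<in>M - {e}. disjnt e f) then insert e M else M - {e})"

definition glauber_step :: "('v set => nat) => 'v set set => 'v set set => 'v set set pmf" where
 "glauber_step L E M = bind_pmf (pmf_of_set E) (%e. map_pmf (%r. upd e r M) (pmf_of_set {..<Suc (L e)}))"

primrec glauber :: "('v set => nat) => 'v set set => nat => 'v set set pmf" where
 "glauber L E 0 = return_pmf {}"
| "glauber L E (Suc t) = bind_pmf (glauber L E t) (glauber_step L E)"

lemma upd_matching: "e \<in> E ==> M \<in> matchings E ==> upd e r M \<in> matchings E"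
 by (auto simp: upd_def matchings_def pairwise_def disjnt_def)

lemma cond_edge:
 assumes "0 < lam e" "M \<in> matchings E"
 shows "cond lam {e} h M = (if \<forall>f\<in>M - {e}. disjnt e f then (h (M - {e}) + lam e * h (insert e M)) / (1 + lam e) else h M)"
proof (cases "\<forall>f\<in>M - {e}. disjnt e f")
 case True
 then have r: "res {e} (M - {e}) = {e}" by (auto simp: res_def)
 have "M - {e} Un {e} = insert e M" by auto
 then show ?thesis using True by (simp add: cond_def r gex_singleton[where lam = lam, OF assms(1)])
next
 case False
 then have r: "res {e} (M - {e}) = {}" by (auto simp: res_def)
 have "e \<notin> M" using False assms(2) by (auto simp: matchings_def pairwise_def)
 then have "M - {e} = M" by auto
 moreover have "gex lam {} (%K. h (M Un K)) = h M"
 proof -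
  have "matchings {} = ({{}} :: 'a set set set)" by (auto simp: matchings_def)
  then show ?thesis by (simp add: gex_def Zsum_def weight_def)
 qed
 ultimately show ?thesis using False r unfolding cond_def by auto
qed

lemma pmf_upd:
 assumes "lam e = real (L e)" "0 < L e" "M \<in> matchings E"
 shows "pmf (map_pmf (%r. upd e r M) (pmf_of_set {..<Suc (L e)})) N = cond lam {e} (%N'. of_bool (N' = N)) M"
proof -
 have "pmf (map_pmf (%r. upd e r M) (pmf_of_set {..<Suc (L e)})) N
   = measure_pmf.expectation (pmf_of_set {..<Suc (L e)}) (%r. of_bool (upd e r M = N))"
 proof -
  have "pmf (map_pmf (%r. upd e r M) (pmf_of_set {..<Suc (L e)})) N = measure_pmf.prob (pmf_of_set {..<Suc (L e)}) {r. upd e r M = N}"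
   by (simp add: pmf_map vimage_def)
  also have "... = measure_pmf.expectation (pmf_of_set {..<Suc (L e)}) (indicator {r. upd e r M = N})" by simp
  also have "indicator {r. upd e r M = N} = (%r. of_bool (upd e r M = N) :: real)" by (auto simp: indicator_def)
  finally show ?thesis .
 qed
 also have "... = (\<Sum>r<Suc (L e). of_bool (upd e r M = N)) / real (Suc (L e))"
  by (subst integral_pmf_of_set) auto
 also have "(\<Sum>r<Suc (L e). of_bool (upd e r M = N)) = (of_bool (upd e 0 M = N) + real (L e) * of_bool (upd e 1 M = N) :: real)"
 proof -
  have c: "upd e (Suc r) M = upd e 1 M" for r by (simp add: upd_def)
  show ?thesis unfolding sum.lessThan_Suc_shift c by simp
 qed
 also have "(of_bool (upd e 0 M = N) + real (L e) * of_bool (upd e 1 M = N)) / real (Suc (L e)) = cond lam {e} (%N'. of_bool (N' = N)) M"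
 proof (cases "\<forall>f\<in>M - {e}. disjnt e f")
  case True
  then show ?thesis using assms by (simp add: cond_edge[OF _ assms(3)] upd_def add.commute)
 next
  case False
  then have "e \<notin> M" using assms(3) by (auto simp: matchings_def pairwise_def)
  then have "upd e 0 M = M" "upd e 1 M = M" using False by (auto simp: upd_def)
  moreover have "cond lam {e} (%N'. of_bool (N' = N)) M = of_bool (M = N)"
   using cond_edge[of lam e M E "%N'. of_bool (N' = N)"] assms unfolding if_not_P[OF False] by simp
  ultimately show ?thesis by simp
 qed
 finally show ?thesis .
qed

definition density_of :: "('v set => real) => 'v set set => 'v set set pmf => ('v set set => real) => bool" where
 "density_of lam E \<mu> f \<longleftrightarrow> set_pmf \<mu> <= matchings E &
   (\<forall>M\<in>matchings E. pmf \<mu> M = weight lam M / Zsum lam E * f M)"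

definition glauber_avg :: "('v set => real) => 'v set set => ('v set set => real) => 'v set set => real" where
 "glauber_avg lam E f M = (\<Sum>e\<in>E. cond lam {e} f M) / real (card E)"

text \<open>Reversibility: conditional expectations are self-adjoint, so the density with respect to
  the Gibbs measure evolves by the same averaging operator that acts on functions.\<close>

lemma density_glauber_step:
 assumes "wgraph lam B E" "E ~= {}" "!!e. e \<in> E ==> lam e = real (L e)" "density_of lam E \<mu> f"
 shows "density_of lam E (bind_pmf \<mu> (glauber_step L E)) (glauber_avg lam E f)"
proof -
 note w = wgraphD[OF assms(1)]
 have L: "0 < L e" if "e \<in> E" for e using w(3)[of e] assms(3)[OF that] by simp
 have sup: "set_pmf \<mu> <= matchings E" and pm: "!!M. M \<in> matchings E ==> pmf \<mu> M = weight lam M / Zsum lam E * f M"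
  using assms(4) by (auto simp: density_of_def)
 have step: "set_pmf (glauber_step L E M) <= matchings E" if "M \<in> matchings E" for M
  using that upd_matching[of _ E M] w(1) assms(2) by (auto simp: glauber_step_def)
 have "pmf (bind_pmf \<mu> (glauber_step L E)) N = weight lam N / Zsum lam E * glauber_avg lam E f N"
  if N: "N \<in> matchings E" for N
 proof -
  have st: "pmf (glauber_step L E M) N = (\<Sum>e\<in>E. cond lam {e} (%N'. of_bool (N' = N)) M) / real (card E)"
   if M: "M \<in> matchings E" for M
  proof -
   have "(\<Sum>e\<in>E. pmf (map_pmf (%r. upd e r M) (pmf_of_set {..<Suc (L e)})) N)
     = (\<Sum>e\<in>E. cond lam {e} (%N'. of_bool (N' = N)) M)"
    by (intro sum.cong refl pmf_upd[OF assms(3) L M])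
   then show ?thesis unfolding glauber_step_def pmf_bind_pmf_of_set[OF assms(2) w(1)] by simp
  qed
  have "pmf (bind_pmf \<mu> (glauber_step L E)) N = (\<Sum>M\<in>matchings E. pmf (glauber_step L E M) N * pmf \<mu> M)"
   unfolding pmf_bind by (rule integral_measure_pmf_real) (use w(1) sup in auto)
  also have "... = gex lam E (%M. f M * ((\<Sum>e\<in>E. cond lam {e} (%N'. of_bool (N' = N)) M) / real (card E)))"
   unfolding gex_def sum_divide_distrib by (intro sum.cong refl) (simp add: st pm sum_divide_distrib[symmetric])
  also have "... = gex lam E (%M. \<Sum>e\<in>E. inverse (real (card E)) * (f M * cond lam {e} (%N'. of_bool (N' = N)) M))"
   by (simp add: sum_distrib_left divide_inverse mult_ac)
  also have "... = (\<Sum>e\<in>E. inverse (real (card E)) * gex lam E (%M. cond lam {e} f M * of_bool (M = N)))"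
   unfolding gex_sum gex_cmult by (intro sum.cong refl arg_cong2[of _ _ _ _ times] gex_cond_adjoint[OF assms(1)]) auto
  also have "... = (\<Sum>e\<in>E. inverse (real (card E)) * (weight lam N / Zsum lam E * cond lam {e} f N))"
  proof (intro sum.cong refl arg_cong2[of _ _ _ _ times])
   fix e
   have "(\<Sum>M\<in>matchings E. weight lam M * (cond lam {e} f M * of_bool (M = N))) = weight lam N * cond lam {e} f N"
    using w(1) N by (subst sum.remove[of _ N]) (auto intro!: sum.neutral)
   then show "gex lam E (%M. cond lam {e} f M * of_bool (M = N)) = weight lam N / Zsum lam E * cond lam {e} f N"
    by (simp add: gex_def)
  qed
  also have "... = weight lam N / Zsum lam E * glauber_avg lam E f N"
   by (simp add: glauber_avg_def sum_distrib_left sum_divide_distrib divide_inverse mult_ac)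
  finally show ?thesis .
 qed
 moreover have "set_pmf (bind_pmf \<mu> (glauber_step L E)) <= matchings E" using sup step by auto
 ultimately show ?thesis by (simp add: density_of_def)
qed

lemma glauber_avg_props:
 assumes "wgraph lam B E" "E ~= {}" "!!M. M \<in> matchings E ==> 0 <= f M"
 shows "M \<in> matchings E ==> 0 <= glauber_avg lam E f M" "gex lam E (glauber_avg lam E f) = gex lam E f"
proof -
 show "M \<in> matchings E ==> 0 <= glauber_avg lam E f M"
  unfolding glauber_avg_def using assms(3) by (intro divide_nonneg_nonneg sum_nonneg cond_nonneg[OF assms(1)]) auto
 have "gex lam E (glauber_avg lam E f) = gex lam E (%M. inverse (real (card E)) * (\<Sum>e\<in>E. cond lam {e} f M))"
  by (simp add: glauber_avg_def[abs_def] divide_inverse mult.commute)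
 also have "... = inverse (real (card E)) * (\<Sum>e\<in>E. gex lam E f)"
  unfolding gex_cmult gex_sum by (intro arg_cong2[of _ _ _ _ times] refl sum.cong gex_cond[OF assms(1)]) auto
 finally show "gex lam E (glauber_avg lam E f) = gex lam E f"
  using assms(2) wgraphD(1)[OF assms(1)] by simp
qed

text \<open>Resampling \<open>e\<close> removes exactly the block entropy at \<open>e\<close>. By
  convexity of \<open>\<phi>\<close>, choosing \<open>e\<close> at random removes at least the
  average of these, which tensorization makes a fraction \<open>1 / (card E * C)\<close> of the
  whole.\<close>

lemma block_ent_glauber_avg:
 assumes "wgraph lam B E" "E ~= {}" "!!M. M \<in> matchings E ==> 0 <= f M" "0 < C"
  and jensen: "!!(w :: 'v set => real) x. (!!i. i \<in> E ==> 0 <= w i) ==> (!!i. i \<in> E ==> 0 <= x i) ==> (\<Sum>i\<in>E. w i) = 1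
    ==> \<phi> (\<Sum>i\<in>E. w i * x i) <= (\<Sum>i\<in>E. w i * \<phi> (x i))"
  and tens: "block_ent \<phi> lam E E f <= C * (\<Sum>e\<in>E. block_ent \<phi> lam E {e} f)"
 shows "block_ent \<phi> lam E E (glauber_avg lam E f) <= (1 - 1 / (real (card E) * C)) * block_ent \<phi> lam E E f"
proof -
 define m where "m = real (card E)"
 have m: "0 < m" using assms(2) wgraphD(1)[OF assms(1)] by (simp add: m_def card_gt_0_iff)
 have "gex lam E (%M. \<phi> (glauber_avg lam E f M)) <= gex lam E (%M. \<Sum>e\<in>E. (1 / m) * \<phi> (cond lam {e} f M))"
 proof (rule gex_mono[OF assms(1)])
  fix M assume M: "M \<in> matchings E"
  have "\<phi> (\<Sum>e\<in>E. (1 / m) * cond lam {e} f M) <= (\<Sum>e\<in>E. (1 / m) * \<phi> (cond lam {e} f M))"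
   using m assms(3) M by (intro jensen cond_nonneg[OF assms(1)]) (auto simp: m_def)
  then show "\<phi> (glauber_avg lam E f M) <= (\<Sum>e\<in>E. (1 / m) * \<phi> (cond lam {e} f M))"
   by (simp add: glauber_avg_def m_def sum_divide_distrib)
 qed
 also have "... = (1 / m) * (\<Sum>e\<in>E. gex lam E (%M. \<phi> (cond lam {e} f M)))"
  unfolding gex_sum gex_cmult by (simp add: sum_distrib_left)
 also have "... = (1 / m) * (\<Sum>e\<in>E. gex lam E (%M. \<phi> (f M)) - block_ent \<phi> lam E {e} f)"
  by (simp add: block_ent_def gex_diff)
 also have "... = gex lam E (%M. \<phi> (f M)) - (1 / m) * (\<Sum>e\<in>E. block_ent \<phi> lam E {e} f)"
  using m by (simp add: sum_subtractf m_def field_simps)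
 finally have "block_ent \<phi> lam E E (glauber_avg lam E f) <= block_ent \<phi> lam E E f - (1 / m) * (\<Sum>e\<in>E. block_ent \<phi> lam E {e} f)"
  using glauber_avg_props(2)[OF assms(1,2), of f] assms(3) unfolding block_ent_whole[OF assms(1)] by simp
 moreover have "(1 / (m * C)) * block_ent \<phi> lam E E f <= (1 / m) * (\<Sum>e\<in>E. block_ent \<phi> lam E {e} f)"
  using tens m assms(4) by (simp add: field_simps)
 ultimately show ?thesis unfolding m_def by (simp add: algebra_simps)
qed

text \<open>The first part is Pinsker's inequality up to the constant, through the Hellinger
  distance: \<open>f - 1\<close> factors through \<open>sqrt f\<close> and the product is split by
  Young's inequality. The second part splits the absolute value against its square in the same
  way.\<close>

lemma gex_l1_le:
 assumes "wgraph lam B E" "!!M. M \<in> matchings E ==> 0 <= f M" "gex lam E f = 1" "0 < \<delta>"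
 shows "gex lam E (%M. xlx (f M)) <= \<delta>\<^sup>2 ==> gex lam E (%M. \<bar>f M - 1\<bar>) <= 2 * \<delta>"
  "gvar lam E f <= \<delta>\<^sup>2 ==> gex lam E (%M. \<bar>f M - 1\<bar>) <= \<delta>"
proof -
 assume ent: "gex lam E (%M. xlx (f M)) <= \<delta>\<^sup>2"
 define u where "u = gex lam E (%M. sqrt (f M))"
 have u1: "2 * (1 - u) <= \<delta>\<^sup>2" using gex_sqrt_le_entropy(2)[OF assms(1-3)] ent by (simp add: u_def)
 have u2: "u <= 1"
 proof -
  have "u <= gex lam E (%M. (1 / 2) * f M + 1 / 2)" unfolding u_def
  proof (rule gex_mono[OF assms(1)])
   fix M assume "M \<in> matchings E"
   then have "0 <= f M" by (rule assms(2))
   then show "sqrt (f M) <= (1 / 2) * f M + 1 / 2"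
    using arith_geo_mean_sqrt[of "f M" 1] by simp
  qed
  then show ?thesis by (simp only: gex_add gex_cmult gex_const[OF assms(1)] assms(3))
 qed
 have "gex lam E (%M. \<bar>f M - 1\<bar>) <= gex lam E (%M. (1 / \<delta>) * (f M - 2 * sqrt (f M) + 1) + (\<delta> / 4) * (f M + 2 * sqrt (f M) + 1))"
 proof (rule gex_mono[OF assms(1)])
  fix M assume M: "M \<in> matchings E"
  define s where "s = sqrt (f M)"
  have s: "0 <= s" "f M = s\<^sup>2" using assms(2)[OF M] by (auto simp: s_def)
  have "\<bar>f M - 1\<bar> = \<bar>s - 1\<bar> * (s + 1)"
  proof -
   have "f M - 1 = (s - 1) * (s + 1)" by (simp add: s(2) power2_eq_square algebra_simps)
   then show ?thesis using s(1) by (simp add: abs_mult)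
  qed
  also have "... <= (1 / \<delta>) * (s - 1)\<^sup>2 + (\<delta> / 4) * (s + 1)\<^sup>2"
  proof -
   have "0 <= (\<bar>s - 1\<bar> - \<delta> / 2 * (s + 1))\<^sup>2" by simp
   also have "... = (s - 1)\<^sup>2 - \<delta> * (\<bar>s - 1\<bar> * (s + 1)) + \<delta>\<^sup>2 / 4 * (s + 1)\<^sup>2"
    by (simp add: power2_diff power_mult_distrib power_divide)
   finally have "\<delta> * (\<bar>s - 1\<bar> * (s + 1)) <= \<delta> * ((1 / \<delta>) * (s - 1)\<^sup>2 + (\<delta> / 4) * (s + 1)\<^sup>2)"
    using assms(4) by (simp add: distrib_left power2_eq_square[of \<delta>])
   then show ?thesis using assms(4) by (simp only: mult_le_cancel_left_pos)
  qed
  also have "(s - 1)\<^sup>2 = f M - 2 * sqrt (f M) + 1" by (simp only: s_def[symmetric]) (simp add: s(2) power2_eq_square algebra_simps)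
  also have "(s + 1)\<^sup>2 = f M + 2 * sqrt (f M) + 1" by (simp only: s_def[symmetric]) (simp add: s(2) power2_eq_square algebra_simps)
  finally show "\<bar>f M - 1\<bar> <= (1 / \<delta>) * (f M - 2 * sqrt (f M) + 1) + (\<delta> / 4) * (f M + 2 * sqrt (f M) + 1)" .
 qed
 also have "... = (1 / \<delta>) * (1 - 2 * u + 1) + (\<delta> / 4) * (1 + 2 * u + 1)"
  by (simp only: gex_add gex_diff gex_cmult gex_const[OF assms(1)] assms(3) u_def)
 also have "... <= (1 / \<delta>) * \<delta>\<^sup>2 + (\<delta> / 4) * 4"
  using u1 u2 assms(4) by (intro add_mono mult_left_mono) auto
 also have "... = 2 * \<delta>" using assms(4) by (simp add: power2_eq_square)
 finally show "gex lam E (%M. \<bar>f M - 1\<bar>) <= 2 * \<delta>" .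
next
 assume var: "gvar lam E f <= \<delta>\<^sup>2"
 have "gex lam E (%M. \<bar>f M - 1\<bar>) <= gex lam E (%M. (1 / (2 * \<delta>)) * ((f M)\<^sup>2 - 2 * f M + 1) + \<delta> / 2)"
 proof (rule gex_mono[OF assms(1)])
  fix M
  have "0 <= (\<bar>f M - 1\<bar> - \<delta>)\<^sup>2" by simp
  also have "... = ((f M)\<^sup>2 - 2 * f M + 1) - 2 * \<delta> * \<bar>f M - 1\<bar> + \<delta>\<^sup>2"
   by (simp add: power2_diff algebra_simps)
  finally have "2 * \<delta> * \<bar>f M - 1\<bar> <= 2 * \<delta> * ((1 / (2 * \<delta>)) * ((f M)\<^sup>2 - 2 * f M + 1) + \<delta> / 2)"
   using assms(4) by (simp add: distrib_left power2_eq_square[of \<delta>])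
  then show "\<bar>f M - 1\<bar> <= (1 / (2 * \<delta>)) * ((f M)\<^sup>2 - 2 * f M + 1) + \<delta> / 2" using assms(4) by (simp only: mult_le_cancel_left_pos)
 qed
 also have "... = (1 / (2 * \<delta>)) * (gex lam E (%M. (f M)\<^sup>2) - 2 * 1 + 1) + \<delta> / 2"
  by (simp only: gex_add gex_diff gex_cmult gex_const[OF assms(1)] assms(3))
 also have "gex lam E (%M. (f M)\<^sup>2) - 2 * 1 + 1 = gvar lam E f" by (simp add: gvar_def assms(3))
 also have "(1 / (2 * \<delta>)) * gvar lam E f + \<delta> / 2 <= (1 / (2 * \<delta>)) * \<delta>\<^sup>2 + \<delta> / 2"
  using var assms(4) by (intro add_right_mono mult_left_mono) auto
 also have "... = \<delta>" using assms(4) by (simp add: power2_eq_square)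
 finally show "gex lam E (%M. \<bar>f M - 1\<bar>) <= \<delta>" .
qed

text \<open>The density of the point mass at the empty matching, which has weight 1. Its entropy is
  \<open>ln\<close> of the partition function, whereas its second moment is the partition function
  itself.\<close>

definition start_density :: "('v set => real) => 'v set set => 'v set set => real" where
 "start_density lam E M = Zsum lam E * of_bool (M = {})"

definition glauber_density :: "('v set => real) => 'v set set => nat => 'v set set => real" where
 "glauber_density lam E t = (glauber_avg lam E ^^ t) (start_density lam E)"

lemma gex_at_empty:
 assumes "wgraph lam B E" shows "gex lam E (%M. g M * of_bool (M = {})) = g {} / Zsum lam E"
proof -
 have "(\<Sum>M\<in>matchings E. weight lam M * (g M * of_bool (M = {}))) = g {}"
  using wgraphD(1)[OF assms] by (subst sum.remove[of _ "{}"]) (auto intro!: sum.neutral simp: weight_def)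
 then show ?thesis by (simp add: gex_def)
qed

lemma glauber_density_props:
 assumes "wgraph lam B E" "E ~= {}"
 shows "!!M. M \<in> matchings E ==> 0 <= glauber_density lam E t M" "gex lam E (glauber_density lam E t) = 1"
  "(!!e. e \<in> E ==> lam e = real (L e)) ==> density_of lam E (glauber L E t) (glauber_density lam E t)"
proof -
 note Z = wgraphD(7)[OF assms(1)]
 have *: "(\<forall>M\<in>matchings E. 0 <= glauber_density lam E t M) & gex lam E (glauber_density lam E t) = 1" for t
 proof (induction t)
  case 0
  have "gex lam E (start_density lam E) = 1"
   unfolding start_density_def[abs_def] using gex_at_empty[OF assms(1), of "%_. Zsum lam E"] Z by simp
  moreover have "0 <= start_density lam E M" for M using Z by (simp add: start_density_def)
  ultimately show ?case by (simp add: glauber_density_def)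
 next
  case (Suc t)
  then show ?case using glauber_avg_props[OF assms, of "glauber_density lam E t"] by (simp add: glauber_density_def)
 qed
 then show "!!M. M \<in> matchings E ==> 0 <= glauber_density lam E t M" "gex lam E (glauber_density lam E t) = 1" by auto
 assume L: "!!e. e \<in> E ==> lam e = real (L e)"
 show "density_of lam E (glauber L E t) (glauber_density lam E t)"
 proof (induction t)
  case 0
  then show ?case using Z by (auto simp: density_of_def glauber_density_def start_density_def indicator_def weight_def)
 next
  case (Suc t)
  then show ?case using density_glauber_step[OF assms L] by (simp add: glauber_density_def)
 qed
qed

lemma glauber_decay:
 assumes "wgraph lam B E" "E ~= {}" "1 <= C"
  and jensen: "!!(w :: 'v set => real) x. (!!i. i \<in> E ==> 0 <= w i) ==> (!!i. i \<in> E ==> 0 <= x i) ==> (\<Sum>i\<in>E. w i) = 1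
    ==> \<phi> (\<Sum>i\<in>E. w i * x i) <= (\<Sum>i\<in>E. w i * \<phi> (x i))"
  and tens: "!!f. (!!M. M \<in> matchings E ==> 0 <= f M) ==> block_ent \<phi> lam E E f <= C * (\<Sum>e\<in>E. block_ent \<phi> lam E {e} f)"
  and init: "block_ent \<phi> lam E E (start_density lam E) <= I" "0 <= I"
 shows "block_ent \<phi> lam E E (glauber_density lam E t) <= exp (- real t / (real (card E) * C)) * I"
proof -
 define q where "q = 1 / (real (card E) * C)"
 have m: "1 <= real (card E)" using assms(2) wgraphD(1)[OF assms(1)] by (simp add: Suc_le_eq card_gt_0_iff)
 have mC: "1 <= real (card E) * C" using mult_mono[OF m assms(3)] m by simp
 have q: "0 <= 1 - q" "1 - q <= exp (- q)" using mC exp_ge_add_one_self[of "- q"] by (auto simp: q_def)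
 have "block_ent \<phi> lam E E (glauber_density lam E t) <= (1 - q) ^ t * I"
 proof (induction t)
  case 0 then show ?case using init(1) by (simp add: glauber_density_def)
 next
  case (Suc t)
  have "block_ent \<phi> lam E E (glauber_density lam E (Suc t)) <= (1 - q) * block_ent \<phi> lam E E (glauber_density lam E t)"
   unfolding q_def using glauber_density_props(1)[OF assms(1,2)] assms(3)
   by (simp add: glauber_density_def)
    (intro block_ent_glauber_avg[OF assms(1,2)] jensen tens; force simp: glauber_density_def)
  also have "... <= (1 - q) * ((1 - q) ^ t * I)" using q(1) Suc by (intro mult_left_mono) auto
  finally show ?case by (simp add: mult.assoc)
 qed
 also have "... <= exp (- q) ^ t * I"
 proof (rule mult_right_mono)
  show "(1 - q) ^ t <= exp (- q) ^ t" using q by (intro power_mono) auto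
 qed (rule init(2))
 also have "exp (- q) ^ t = exp (- real t / (real (card E) * C))" by (simp add: q_def exp_of_nat_mult[symmetric] mult.commute)
 finally show ?thesis .
qed

lemma exp_decay_le:
 fixes I \<delta> c T :: real
 assumes "0 < I" "0 < \<delta>" "0 < c" "c * (ln I + 2 * ln (1 / \<delta>)) <= T"
 shows "exp (- T / c) * I <= \<delta>\<^sup>2"
proof -
 have "ln I + 2 * ln (1 / \<delta>) <= T / c" using assms(3,4) by (simp add: field_simps)
 then have "- T / c + ln I <= 2 * ln \<delta>" using assms(2) by (simp add: ln_div)
 then have "exp (- T / c + ln I) <= exp (2 * ln \<delta>)" by (simp only: exp_le_cancel_iff)
 also have "exp (2 * ln \<delta>) = \<delta>\<^sup>2" using assms(2) exp_of_nat_mult[of 2 "ln \<delta>"] by simp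
 finally show ?thesis unfolding exp_add using assms(1) by simp
qed

text \<open>The initial entropy is at most linear in \<open>card U\<close>, and the time depends
  only on its logarithm: this is the source of the factor \<open>log n\<close>.\<close>

theorem glauber_mixing_entropy:
 assumes "wgraph lam B E" "!!e. e \<in> E ==> 1 <= lam e" "1 <= B" "(1 + B) ^ 27 <= real (card E)"
  "finite U" "\<Union>E <= U" "0 < \<delta>"
  "real (card E) * exp (432 * (1 + B) ^ 5) * (ln (real (card U) * (1 + B)) + 2 * ln (2 / \<delta>)) <= real t"
 shows "gex lam E (%M. \<bar>glauber_density lam E t M - 1\<bar>) <= \<delta>"
proof -
 note w = wgraphD[OF assms(1)]
 define b where "b = 1 + B"
 have b: "2 <= b" using assms(3) by (simp add: b_def)
 have "1 <= b ^ 27" using b by simp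
 then have "0 < card E" using assms(4) by (simp add: b_def[symmetric] of_nat_0_less_iff[symmetric] del: of_nat_0_less_iff)
 then have E: "E ~= {}" by auto
 then have "U ~= {}" using assms(6) w(6) by blast
 then have U: "1 <= real (card U)" using assms(5) by (simp add: Suc_le_eq card_gt_0_iff)
 define I where "I = real (card U) * b"
 have I: "0 < I" using U b by (simp add: I_def)
 note g = glauber_density_props(1,2)[OF assms(1) E]
 have Z: "0 < Zsum lam E" "Zsum lam E <= b ^ card U"
  using w(7) Zsum_le_vertices[OF assms(5,1,6)] by (auto simp: b_def)
 have start: "ent lam E E (start_density lam E) <= I"
 proof -
  have "gex lam E (%M. xlx (start_density lam E M)) = gex lam E (%M. xlx (Zsum lam E) * of_bool (M = {}))"
   by (rule gex_cong) (simp add: start_density_def xlx_def)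
  also have "... = ln (Zsum lam E)" unfolding gex_at_empty[OF assms(1)] using Z by (simp add: xlx_def)
  also have "... <= ln (b ^ card U)" using Z by (intro ln_mono) auto
  also have "... = real (card U) * ln b" using b by (simp add: ln_realpow)
  also have "... <= I" unfolding I_def using ln_le_minus_one[of b] b by (intro mult_left_mono) auto
  finally show ?thesis unfolding block_ent_whole[OF assms(1)]
   using glauber_density_props(2)[OF assms(1) E, of 0] by (simp add: glauber_density_def xlx_def)
 qed
 have C: "1 <= exp (432 * b ^ 5)" using b by simp
 have dec: "ent lam E E (glauber_density lam E t) <= exp (- real t / (real (card E) * exp (432 * b ^ 5))) * I"
 proof (rule glauber_decay[OF assms(1) E C _ _ start])
  show "ent lam E E f <= exp (432 * b ^ 5) * (\<Sum>e\<in>E. ent lam E {e} f)"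
   if "!!M. M \<in> matchings E ==> 0 <= f M" for f
   unfolding b_def using that assms by (intro entropy_tensorization[OF assms(1)]) auto
 qed (use I w(1) in \<open>auto intro!: xlx_jensen\<close>)
 have "gex lam E (%M. xlx (glauber_density lam E t M)) = ent lam E E (glauber_density lam E t)"
  unfolding block_ent_whole[OF assms(1)] g(2) by (simp add: xlx_def)
 also note dec
 also have "exp (- real t / (real (card E) * exp (432 * b ^ 5))) * I <= (\<delta> / 2)\<^sup>2"
  using assms(7,8) I \<open>0 < card E\<close> by (intro exp_decay_le) (auto simp: I_def b_def)
 finally have "gex lam E (%M. \<bar>glauber_density lam E t M - 1\<bar>) <= 2 * (\<delta> / 2)"
  using assms(7) g by (intro gex_l1_le(1)[OF assms(1)]) auto
 then show ?thesis by simp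
qed

text \<open>The logarithm of the initial variance and the inverse gap are both linear in
  \<open>card U\<close>. Taking for \<open>U\<close> the non-isolated vertices pays off when there
  are few edges.\<close>

theorem glauber_mixing_variance:
 assumes "wgraph lam B E" "E ~= {}" "1 <= B" "finite U" "\<Union>E <= U" "0 < \<delta>"
  "real (card E) * (real (card U) * (8 * (1 + B) ^ 4)) * (real (card U) * ln (1 + B) + 2 * ln (1 / \<delta>)) <= real t"
 shows "gex lam E (%M. \<bar>glauber_density lam E t M - 1\<bar>) <= \<delta>"
proof -
 note w = wgraphD[OF assms(1)]
 define b where "b = 1 + B"
 have b: "2 <= b" using assms(3) by (simp add: b_def)
 have "U ~= {}" using assms(2,5) w(6) by blast
 then have U: "1 <= real (card U)" using assms(4) by (simp add: Suc_le_eq card_gt_0_iff)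
 have E0: "0 < card E" using assms(2) w(1) by (simp add: card_gt_0_iff)
 note g = glauber_density_props(1,2)[OF assms(1,2)]
 define I where "I = b ^ card U"
 have I: "0 < I" using b by (simp add: I_def)
 have Z: "0 < Zsum lam E" "Zsum lam E <= I"
  using w(7) Zsum_le_vertices[OF assms(4,1,5)] by (auto simp: b_def I_def)
 have start: "sqent lam E E (start_density lam E) <= I"
 proof -
  have "gex lam E (%M. (start_density lam E M)\<^sup>2) = gex lam E (%M. (Zsum lam E)\<^sup>2 * of_bool (M = {}))"
   by (rule gex_cong) (simp add: start_density_def)
  also have "... = Zsum lam E" unfolding gex_at_empty[OF assms(1)] using Z by (simp add: power2_eq_square)
  finally have "gex lam E (%M. (start_density lam E M)\<^sup>2) = Zsum lam E" .
  then show ?thesis unfolding block_ent_whole[OF assms(1)] using Z(2)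
   by (smt (verit, best) zero_le_power2)
 qed
 define C where "C = real (card U) * (8 * b ^ 4)"
 have C: "1 <= C"
 proof -
  have "1 <= b ^ 4" using b by simp
  then have "1 * 1 <= real (card U) * (8 * b ^ 4)" using U by (intro mult_mono) auto
  then show ?thesis by (simp add: C_def)
 qed
 have gv: "gvar lam E f = sqent lam E E f" for f unfolding block_ent_whole[OF assms(1)] gvar_def ..
 have "sqent lam E E (glauber_density lam E t) <= exp (- real t / (real (card E) * C)) * I"
 proof (rule glauber_decay[OF assms(1,2) C _ _ start])
  show "sqent lam E E f <= C * (\<Sum>e\<in>E. sqent lam E {e} f)" for f
   using gvar_le_sum_block_square[OF assms(1,4,5), of f] unfolding gv by (simp add: C_def b_def)
  show "(\<Sum>i\<in>E. u i * x i)\<^sup>2 <= (\<Sum>i\<in>E. u i * (x i)\<^sup>2)" if "!!i. i \<in> E ==> 0 <= u i" "(\<Sum>i\<in>E. u i) = 1" for u x :: "'a set => real"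
   using weighted_square_le[of E u x] that by simp
 qed (use I in auto)
 also have "exp (- real t / (real (card E) * C)) * I <= \<delta>\<^sup>2"
  using assms(6,7) I C E0 b by (intro exp_decay_le) (auto simp: I_def C_def b_def ln_realpow)
 finally have "gvar lam E (glauber_density lam E t) <= \<delta>\<^sup>2" unfolding gv .
 then show ?thesis using assms(6) g by (intro gex_l1_le(2)[OF assms(1)]) auto
qed

section \<open>Couplings\<close>

lemma finite_pmf_exists:
 fixes w :: "'b => real"
 assumes "finite A" "!!x. x \<in> A ==> 0 <= w x" "(\<Sum>x\<in>A. w x) = 1"
 obtains p where "set_pmf p <= A" "!!x. x \<in> A ==> pmf p x = w x"
proof -
 define f where "f x = (if x \<in> A then w x else 0)" for x
 have nn: "0 <= f x" for x using assms(2) by (simp add: f_def)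
 have "(\<integral>\<^sup>+x. ennreal (f x) \<partial>count_space UNIV) = (\<Sum>x\<in>A. ennreal (f x))"
  by (rule nn_integral_count_space'[OF assms(1)]) (auto simp: f_def)
 also have "... = (\<Sum>x\<in>A. ennreal (w x))" by (intro sum.cong refl) (simp add: f_def)
 also have "... = ennreal (\<Sum>x\<in>A. w x)" by (rule sum_ennreal) (rule assms(2))
 finally have one: "(\<integral>\<^sup>+x. ennreal (f x) \<partial>count_space UNIV) = 1" using assms(3) by simp
 show ?thesis
 proof (rule that[of "embed_pmf f"])
  show "set_pmf (embed_pmf f) <= A" unfolding set_embed_pmf[OF nn one] by (auto simp: f_def)
  show "pmf (embed_pmf f) x = w x" if "x \<in> A" for x unfolding pmf_embed_pmf[OF nn one] using that by (simp add: f_def)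
 qed
qed

text \<open>A Wasserstein bound with a witness. The nonnegative integral spares integrability
  conditions under composition. Finiteness is recorded because \<open>card\<close> is 0 on infinite
  sets, which would break the triangle inequality.\<close>

definition couple :: "'a set pmf => 'a set pmf => real => bool" where
 "couple \<mu> \<nu> c \<longleftrightarrow> 0 <= c & (\<exists>\<pi>\<in>couplings \<mu> \<nu>. (\<forall>(X, Y)\<in>set_pmf \<pi>. finite X & finite Y) &
   (\<integral>\<^sup>+p. ennreal (real (card (sym_diff (fst p) (snd p)))) \<partial>measure_pmf \<pi>) <= ennreal c)"

lemma couple_wasserstein: assumes "couple \<mu> \<nu> c" shows "wasserstein \<mu> \<nu> <= c"
proof -
 define d :: "'a set \<times> 'a set => real" where "d p = real (card (sym_diff (fst p) (snd p)))" for p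
 obtain \<pi> where p: "\<pi> \<in> couplings \<mu> \<nu>" "(\<integral>\<^sup>+p. ennreal (d p) \<partial>measure_pmf \<pi>) <= ennreal c"
  and c: "0 <= c" using assms by (auto simp: couple_def d_def)
 have "wasserstein \<mu> \<nu> <= measure_pmf.expectation \<pi> d"
  unfolding wasserstein_def d_def case_prod_unfold
  by (rule cINF_lower[OF _ p(1)]) (auto intro!: bdd_belowI[of _ 0] integral_nonneg_AE)
 also have "... = enn2real (\<integral>\<^sup>+p. ennreal (d p) \<partial>measure_pmf \<pi>)"
  by (rule integral_eq_nn_integral) (auto simp: d_def)
 also have "... <= c" using p(2) c by (rule enn2real_leI[rotated])
 finally show ?thesis .
qed

lemma couple_mono: "couple \<mu> \<nu> c ==> c <= c' ==> couple \<mu> \<nu> c'"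
 unfolding couple_def using ennreal_leI[of c c'] order_trans by (meson order_trans)

lemma couple_sym: assumes "couple \<mu> \<nu> c" shows "couple \<nu> \<mu> c"
proof -
 obtain \<pi> where p: "\<pi> \<in> couplings \<mu> \<nu>" "\<forall>(X, Y)\<in>set_pmf \<pi>. finite X & finite Y"
   "(\<integral>\<^sup>+p. ennreal (real (card (sym_diff (fst p) (snd p)))) \<partial>measure_pmf \<pi>) <= ennreal c" and c: "0 <= c"
  using assms by (auto simp: couple_def)
 define q where "q = map_pmf prod.swap \<pi>"
 have "q \<in> couplings \<nu> \<mu>" using p(1) by (auto simp: couplings_def q_def map_pmf_comp o_def)
 moreover have "\<forall>(X, Y)\<in>set_pmf q. finite X & finite Y" using p(2) by (auto simp: q_def)
 moreover have "(\<integral>\<^sup>+p. ennreal (real (card (sym_diff (fst p) (snd p)))) \<partial>measure_pmf q) <= ennreal c"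
  using p(3) by (simp add: q_def Un_commute)
 ultimately show ?thesis using c by (auto simp: couple_def)
qed

lemma couple_refl: assumes "!!X. X \<in> set_pmf \<mu> ==> finite X" shows "couple \<mu> \<mu> 0"
proof -
 have "map_pmf (%x. (x, x)) \<mu> \<in> couplings \<mu> \<mu>" by (auto simp: couplings_def map_pmf_comp)
 then show ?thesis unfolding couple_def using assms by (auto intro!: bexI[of _ "map_pmf (%x. (x, x)) \<mu>"])
qed

lemma couple_map:
 assumes "couple \<mu> \<nu> c" "0 <= a" "!!X. finite X ==> finite (f X)" "!!X. finite X ==> finite (g X)"
  "!!X Y. finite X ==> finite Y ==> real (card (sym_diff (f X) (g Y))) <= a + real (card (sym_diff X Y))"
 shows "couple (map_pmf f \<mu>) (map_pmf g \<nu>) (a + c)"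
proof -
 define d :: "'a set \<times> 'a set => real" where "d p = real (card (sym_diff (fst p) (snd p)))" for p
 obtain \<pi> where p: "\<pi> \<in> couplings \<mu> \<nu>" "\<forall>(X, Y)\<in>set_pmf \<pi>. finite X & finite Y"
   "(\<integral>\<^sup>+p. ennreal (d p) \<partial>measure_pmf \<pi>) <= ennreal c" and c: "0 <= c"
  using assms(1) by (auto simp: couple_def d_def)
 define q where "q = map_pmf (map_prod f g) \<pi>"
 have "q \<in> couplings (map_pmf f \<mu>) (map_pmf g \<nu>)" using p(1) by (auto simp: couplings_def q_def map_pmf_comp)
 moreover have "\<forall>(X, Y)\<in>set_pmf q. finite X & finite Y" using p(2) assms(3,4) by (fastforce simp: q_def)
 moreover have "(\<integral>\<^sup>+p. ennreal (real (card (sym_diff (fst p) (snd p)))) \<partial>measure_pmf q) <= ennreal (a + c)"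
 proof -
  have "(\<integral>\<^sup>+p. ennreal (real (card (sym_diff (fst p) (snd p)))) \<partial>measure_pmf q)
    = (\<integral>\<^sup>+p. ennreal (real (card (sym_diff (f (fst p)) (g (snd p))))) \<partial>measure_pmf \<pi>)" by (simp add: q_def)
  also have "... <= (\<integral>\<^sup>+p. ennreal a + ennreal (d p) \<partial>measure_pmf \<pi>)"
  proof (rule nn_integral_mono_AE, unfold AE_measure_pmf_iff, intro ballI)
   fix p assume "p \<in> set_pmf \<pi>"
   then have "finite (fst p)" "finite (snd p)" using p(2) by auto
   then have "real (card (sym_diff (f (fst p)) (g (snd p)))) <= a + d p" unfolding d_def by (rule assms(5))
   then have "ennreal (real (card (sym_diff (f (fst p)) (g (snd p))))) <= ennreal (a + d p)" by (rule ennreal_leI)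
   also have "... = ennreal a + ennreal (d p)" using assms(2) by (intro ennreal_plus) (auto simp: d_def)
   finally show "ennreal (real (card (sym_diff (f (fst p)) (g (snd p))))) <= ennreal a + ennreal (d p)" .
  qed
  also have "... = ennreal a + (\<integral>\<^sup>+p. ennreal (d p) \<partial>measure_pmf \<pi>)"
   by (subst nn_integral_add) auto
  also have "... <= ennreal a + ennreal c" using p(3) by (rule add_left_mono)
  finally show ?thesis using assms(2) c by (simp add: ennreal_plus)
 qed
 ultimately show ?thesis using c assms(2) by (auto simp: couple_def)
qed

lemma couple_mix:
 assumes "!!i. i \<in> set_pmf \<kappa> ==> couple (K i) (J i) (c i)" "finite (set_pmf \<kappa>)"
  "(\<Sum>i\<in>set_pmf \<kappa>. pmf \<kappa> i * c i) <= C"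
 shows "couple (bind_pmf \<kappa> K) (bind_pmf \<kappa> J) C"
proof -
 define d :: "'b set \<times> 'b set => real" where "d p = real (card (sym_diff (fst p) (snd p)))" for p
 have "\<forall>i\<in>set_pmf \<kappa>. \<exists>\<pi>. \<pi> \<in> couplings (K i) (J i) & (\<forall>(X, Y)\<in>set_pmf \<pi>. finite X & finite Y) &
   (\<integral>\<^sup>+p. ennreal (d p) \<partial>measure_pmf \<pi>) <= ennreal (c i)"
  using assms(1) unfolding couple_def d_def by blast
 then obtain \<pi> where p: "!!i. i \<in> set_pmf \<kappa> ==> \<pi> i \<in> couplings (K i) (J i)"
  "!!i. i \<in> set_pmf \<kappa> ==> \<forall>(X, Y)\<in>set_pmf (\<pi> i). finite X & finite Y"
  "!!i. i \<in> set_pmf \<kappa> ==> (\<integral>\<^sup>+p. ennreal (d p) \<partial>measure_pmf (\<pi> i)) <= ennreal (c i)"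
  by metis
 have c0: "0 <= c i" if "i \<in> set_pmf \<kappa>" for i using assms(1)[OF that] by (simp add: couple_def)
 have C0: "0 <= C" using c0 by (intro order_trans[OF sum_nonneg assms(3)]) auto
 define q where "q = bind_pmf \<kappa> \<pi>"
 have "q \<in> couplings (bind_pmf \<kappa> K) (bind_pmf \<kappa> J)"
  using p(1) by (auto simp: couplings_def q_def map_bind_pmf intro!: bind_pmf_cong)
 moreover have "\<forall>(X, Y)\<in>set_pmf q. finite X & finite Y" using p(2) by (fastforce simp: q_def)
 moreover have "(\<integral>\<^sup>+p. ennreal (d p) \<partial>measure_pmf q) <= ennreal C"
 proof -
  have "(\<integral>\<^sup>+p. ennreal (d p) \<partial>measure_pmf q) = (\<integral>\<^sup>+i. (\<integral>\<^sup>+p. ennreal (d p) \<partial>measure_pmf (\<pi> i)) \<partial>measure_pmf \<kappa>)"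
   by (simp add: q_def)
  also have "... <= (\<integral>\<^sup>+i. ennreal (c i) \<partial>measure_pmf \<kappa>)"
   using p(3) by (intro nn_integral_mono_AE) (simp add: AE_measure_pmf_iff)
  also have "... = (\<Sum>i\<in>set_pmf \<kappa>. ennreal (c i) * ennreal (pmf \<kappa> i))"
   using assms(2) by (subst nn_integral_measure_pmf_finite) auto
  also have "... = ennreal (\<Sum>i\<in>set_pmf \<kappa>. pmf \<kappa> i * c i)"
   using c0 by (subst sum_ennreal[symmetric]) (auto simp: ennreal_mult mult.commute)
  also have "... <= ennreal C" using assms(3) by (rule ennreal_leI)
  finally show ?thesis .
 qed
 ultimately show ?thesis using C0 by (auto simp: couple_def d_def)
qed

lemma card_sym_diff_triangle:
 assumes "finite X" "finite Y" "finite Z"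
 shows "card (sym_diff X Z) <= card (sym_diff X Y) + card (sym_diff Y Z)"
proof -
 have "card (sym_diff X Z) <= card (sym_diff X Y Un sym_diff Y Z)" using assms by (intro card_mono) auto
 also have "... <= card (sym_diff X Y) + card (sym_diff Y Z)" by (rule card_Un_le)
 finally show ?thesis .
qed

text \<open>Gluing along the middle marginal: \<open>K y\<close> is \<open>q\<close> conditioned on
  its first component being \<open>y\<close>, and the third set is drawn from it given the
  second.\<close>

lemma couple_trans:
 assumes "couple \<mu> \<nu> a" "couple \<nu> \<rho> b" shows "couple \<mu> \<rho> (a + b)"
proof -
 define d :: "'a set => 'a set => ennreal" where "d X Y = ennreal (real (card (sym_diff X Y)))" for X Y
 obtain p where p: "map_pmf fst p = \<mu>" "map_pmf snd p = \<nu>" "!!X Y. (X, Y) \<in> set_pmf p ==> finite X & finite Y"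
   "(\<integral>\<^sup>+z. d (fst z) (snd z) \<partial>measure_pmf p) <= ennreal a" and a: "0 <= a"
  using assms(1) by (fastforce simp: couple_def couplings_def d_def)
 obtain q where q: "map_pmf fst q = \<nu>" "map_pmf snd q = \<rho>" "!!X Y. (X, Y) \<in> set_pmf q ==> finite X & finite Y"
   "(\<integral>\<^sup>+z. d (fst z) (snd z) \<partial>measure_pmf q) <= ennreal b" and b: "0 <= b"
  using assms(2) by (fastforce simp: couple_def couplings_def d_def)
 define K where "K y = cond_pmf q {z. y = fst z}" for y
 have ne: "set_pmf q \<inter> {z. y = fst z} ~= {}" if "y \<in> set_pmf \<nu>" for y
  using that unfolding q(1)[symmetric] by auto
 have Kset: "set_pmf (K y) = set_pmf q \<inter> {z. y = fst z}" if "y \<in> set_pmf \<nu>" for y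
  unfolding K_def by (rule set_cond_pmf[OF ne[OF that]])
 have dis: "bind_pmf \<nu> K = q"
  unfolding K_def
 proof (rule bind_cond_pmf_cancel)
  fix z assume "z \<in> set_pmf q"
  then have "fst z \<in> set_pmf \<nu>" unfolding q(1)[symmetric] by auto
  then show "set_pmf \<nu> \<inter> {y. y = fst z} ~= {}" by auto
 next
  fix y and z :: "'a set \<times> 'a set" assume "y = fst z"
  have "measure_pmf.prob \<nu> {y'. y' = fst z} = measure_pmf.prob q (fst -` {y'. y' = fst z})"
   unfolding q(1)[symmetric] by simp
  then show "measure_pmf.prob q {z. y = fst z} = measure_pmf.prob \<nu> {y'. y' = fst z}"
   using \<open>y = fst z\<close> by (simp add: vimage_def eq_commute)
 qed (rule ne)
 define r where "r = bind_pmf p (%(x, y). map_pmf (%z. (x, snd z)) (K y))"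
 have "map_pmf fst r = \<mu>"
  by (simp add: r_def map_bind_pmf case_prod_unfold map_pmf_comp p(1)[symmetric] map_pmf_def[of fst p])
 moreover have "map_pmf snd r = \<rho>"
 proof -
  have "map_pmf snd r = bind_pmf p (%z. map_pmf snd (K (snd z)))"
   by (simp add: r_def map_bind_pmf case_prod_unfold map_pmf_comp)
  also have "... = bind_pmf (map_pmf snd p) (%y. map_pmf snd (K y))" by (simp add: bind_map_pmf)
  also have "... = map_pmf snd (bind_pmf \<nu> K)" by (simp add: map_bind_pmf p(2))
  finally show ?thesis by (simp add: dis q(2))
 qed
 moreover have psnd: "snd z \<in> set_pmf \<nu>" if "z \<in> set_pmf p" for z using that unfolding p(2)[symmetric] by auto
 moreover have "\<forall>(X, Y)\<in>set_pmf r. finite X & finite Y"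
  using p(3) q(3) Kset psnd by (fastforce simp: r_def)
 moreover have "(\<integral>\<^sup>+z. d (fst z) (snd z) \<partial>measure_pmf r) <= ennreal (a + b)"
 proof -
  have "(\<integral>\<^sup>+z. d (fst z) (snd z) \<partial>measure_pmf r) = (\<integral>\<^sup>+x. \<integral>\<^sup>+z. d (fst x) (snd z) \<partial>measure_pmf (K (snd x)) \<partial>measure_pmf p)"
   by (simp add: r_def case_prod_unfold)
  also have "... <= (\<integral>\<^sup>+x. \<integral>\<^sup>+z. d (fst x) (snd x) + d (fst z) (snd z) \<partial>measure_pmf (K (snd x)) \<partial>measure_pmf p)"
  proof (rule nn_integral_mono_AE, unfold AE_measure_pmf_iff, intro ballI, rule nn_integral_mono_AE, unfold AE_measure_pmf_iff, intro ballI)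
   fix x z assume x: "x \<in> set_pmf p" and z: "z \<in> set_pmf (K (snd x))"
   have z': "z \<in> set_pmf q" "fst z = snd x" using z Kset[OF psnd[OF x]] by auto
   have "finite (snd z)" using q(3)[of "fst z" "snd z"] z'(1) by simp
   moreover have "finite (fst x)" "finite (snd x)" using p(3)[of "fst x" "snd x"] x by auto
   ultimately have "real (card (sym_diff (fst x) (snd z))) <= real (card (sym_diff (fst x) (snd x))) + real (card (sym_diff (fst z) (snd z)))"
    using card_sym_diff_triangle[of "fst x" "snd x" "snd z"] z'(2) by (simp del: of_nat_add add: of_nat_add[symmetric])
   then have "d (fst x) (snd z) <= ennreal (real (card (sym_diff (fst x) (snd x))) + real (card (sym_diff (fst z) (snd z))))"
    unfolding d_def by (rule ennreal_leI)
   also have "... = d (fst x) (snd x) + d (fst z) (snd z)" unfolding d_def by (rule ennreal_plus) auto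
   finally show "d (fst x) (snd z) <= d (fst x) (snd x) + d (fst z) (snd z)" .
  qed
  also have "... = (\<integral>\<^sup>+x. d (fst x) (snd x) + (\<integral>\<^sup>+z. d (fst z) (snd z) \<partial>measure_pmf (K (snd x))) \<partial>measure_pmf p)"
   by (intro nn_integral_cong) (subst nn_integral_add, auto)
  also have "... = (\<integral>\<^sup>+x. d (fst x) (snd x) \<partial>measure_pmf p) + (\<integral>\<^sup>+x. (\<integral>\<^sup>+z. d (fst z) (snd z) \<partial>measure_pmf (K (snd x))) \<partial>measure_pmf p)"
   by (subst nn_integral_add) auto
  also have "(\<integral>\<^sup>+x. (\<integral>\<^sup>+z. d (fst z) (snd z) \<partial>measure_pmf (K (snd x))) \<partial>measure_pmf p) = (\<integral>\<^sup>+z. d (fst z) (snd z) \<partial>measure_pmf q)"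
   unfolding dis[symmetric] p(2)[symmetric] by simp
  also have "(\<integral>\<^sup>+x. d (fst x) (snd x) \<partial>measure_pmf p) + ... <= ennreal a + ennreal b" using p(4) q(4) by (rule add_mono)
  finally show ?thesis using a b by (simp add: ennreal_plus)
 qed
 ultimately show ?thesis using a b unfolding couple_def couplings_def d_def by (intro conjI bexI[of _ r]) auto
qed

section \<open>Couplings of Gibbs measures\<close>

definition gibbs :: "('v set => real) => 'v set set => 'v set set pmf" where
 "gibbs lam F = (SOME p. set_pmf p <= matchings F & (\<forall>M\<in>matchings F. pmf p M = weight lam M / Zsum lam F))"

lemma gibbs_props:
 assumes "wgraph lam B F"
 shows "set_pmf (gibbs lam F) <= matchings F" "!!M. M \<in> matchings F ==> pmf (gibbs lam F) M = weight lam M / Zsum lam F"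
  "measure_pmf.expectation (gibbs lam F) h = gex lam F h"
  "pmf (map_pmf g (gibbs lam F)) N = gex lam F (%M. of_bool (g M = N))"
proof -
 note w = wgraphD[OF assms]
 obtain p where "set_pmf p <= matchings F" "!!M. M \<in> matchings F ==> pmf p M = weight lam M / Zsum lam F"
 proof (rule finite_pmf_exists)
  show "finite (matchings F)" using w(1) by simp
  show "0 <= weight lam M / Zsum lam F" for M using w weight_pos[of lam M] by (simp add: less_imp_le)
  show "(\<Sum>M\<in>matchings F. weight lam M / Zsum lam F) = 1"
   using w(7) by (simp add: sum_divide_distrib[symmetric] Zsum_def[symmetric])
 qed blast
 then have "\<exists>p. set_pmf p <= matchings F & (\<forall>M\<in>matchings F. pmf p M = weight lam M / Zsum lam F)" by blast
 from someI_ex[OF this] have g: "set_pmf (gibbs lam F) <= matchings F"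
  "!!M. M \<in> matchings F ==> pmf (gibbs lam F) M = weight lam M / Zsum lam F" by (auto simp: gibbs_def)
 show "set_pmf (gibbs lam F) <= matchings F"
  "!!M. M \<in> matchings F ==> pmf (gibbs lam F) M = weight lam M / Zsum lam F" by (fact g)+
 show e: "measure_pmf.expectation (gibbs lam F) h = gex lam F h" for h
 proof -
  have "measure_pmf.expectation (gibbs lam F) h = (\<Sum>M\<in>matchings F. h M * pmf (gibbs lam F) M)"
   by (rule integral_measure_pmf_real) (use w(1) g(1) in auto)
  also have "... = gex lam F h" unfolding gex_def sum_divide_distrib by (intro sum.cong refl) (simp add: g(2) mult.commute)
  finally show ?thesis .
 qed
 have "pmf (map_pmf g (gibbs lam F)) N = measure_pmf.expectation (gibbs lam F) (indicator {M. g M = N})"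
  by (simp add: pmf_map vimage_def)
 also have "indicator {M. g M = N} = (%M. of_bool (g M = N) :: real)" by (auto simp: indicator_def)
 finally show "pmf (map_pmf g (gibbs lam F)) N = gex lam F (%M. of_bool (g M = N))" by (simp add: e)
qed

lemma gibbs_finite: "wgraph lam B F ==> X \<in> set_pmf (gibbs lam F) ==> finite X"
 using gibbs_props(1)[of lam B F] wgraphD(1)[of lam B F] matchings_finite[of F X] by blast

lemma gibbs_cong:
 assumes "wgraph lam B F" "wgraph lam' B' F" "!!e. e \<in> F ==> lam e = lam' e"
 shows "gibbs lam F = gibbs lam' F"
proof (rule pmf_eqI)
 fix M
 have wt: "weight lam N = weight lam' N" if "N \<in> matchings F" for N
  unfolding weight_def using that assms(3) by (intro prod.cong) (auto simp: matchings_def)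
 then have "Zsum lam F = Zsum lam' F" by (simp add: Zsum_def)
 then show "pmf (gibbs lam F) M = pmf (gibbs lam' F) M"
  using gibbs_props(2)[OF assms(1)] gibbs_props(2)[OF assms(2)] wt
   pmf_eq_0_set_pmf[of "gibbs lam F" M] pmf_eq_0_set_pmf[of "gibbs lam' F" M]
   gibbs_props(1)[OF assms(1)] gibbs_props(1)[OF assms(2)]
  by (cases "M \<in> matchings F") (simp, metis subsetD)
qed

text \<open>Disagreement percolation: revealing the partner of \<open>x\<close> moves the discrepancy to that partner, and the
 process stops as soon as the current vertex is unmatched, which has probability at least \<open>1 / (1 + B)\<close>.\<close>

lemma couple_avoid:
 assumes "wgraph lam B F" shows "couple (gibbs lam F) (gibbs lam (avoid x F)) B"
 using assms
proof (induction "card F" arbitrary: F x rule: less_induct)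
 case less
 note w = less.prems
 note D = wgraphD[OF w]
 define H where "H = avoid x F"
 define p where "p = free_prob lam F x"
 define q where "q = edge_prob lam F"
 have wH: "wgraph lam B H" unfolding H_def by (rule wgraph_avoid[OF w])
 have p: "p + (\<Sum>e\<in>inc x F. q e) = 1" "0 < p" "p <= 1" "!!e. 0 < q e" "1 <= p * (1 + B)"
  using prob_vertex(1-3,5)[OF w, of x] prob_vertex(4)[OF w] by (auto simp: p_def q_def)
 \<comment> \<open>The value \<open>None\<close> stands for \<open>x\<close> being unmatched,
   \<open>Some e\<close> for \<open>e\<close> being the edge that covers \<open>x\<close>.\<close>
 define A where "A = insert None (Some ` inc x F)"
 have fi: "finite (inc x F)" using finite_subset[OF inc_subset D(1)] .
 have sumA: "(\<Sum>i\<in>A. h i) = h None + (\<Sum>e\<in>inc x F. h (Some e))" for h :: "'a set option => real"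
  unfolding A_def using fi by (subst sum.insert) (auto simp: sum.reindex)
 obtain k where k: "set_pmf k <= A" "!!i. i \<in> A ==> pmf k i = (case i of None => p | Some e => q e)"
 proof (rule finite_pmf_exists[of A "%i. case i of None => p | Some e => q e"])
  show "finite A" using fi by (simp add: A_def)
  show "0 <= (case i of None => p | Some e => q e)" for i using p by (auto simp: less_imp_le split: option.split)
  show "(\<Sum>i\<in>A. case i of None => p | Some e => q e) = 1" unfolding sumA using p(1) by simp
 qed blast
 have kN: "pmf k None = p" and kS: "!!e. e \<in> inc x F ==> pmf k (Some e) = q e" using k(2) by (auto simp: A_def)
 define K where "K i = (case i of None => gibbs lam H | Some e => map_pmf (insert e) (gibbs lam (away e F)))" for i
 have gF: "gibbs lam F = bind_pmf k K"
 proof (rule pmf_eqI)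
  fix N
  have "pmf (bind_pmf k K) N = (\<Sum>i\<in>A. pmf (K i) N * pmf k i)"
   unfolding pmf_bind by (rule integral_measure_pmf_real) (use fi k(1) in \<open>auto simp: A_def\<close>)
  also have "... = p * gex lam H (%M. of_bool (M = N)) + (\<Sum>e\<in>inc x F. q e * gex lam (away e F) (%M. of_bool (insert e M = N)))"
  proof -
   have "(\<Sum>e\<in>inc x F. pmf (map_pmf (insert e) (gibbs lam (away e F))) N * pmf k (Some e))
     = (\<Sum>e\<in>inc x F. q e * gex lam (away e F) (%M. of_bool (insert e M = N)))"
    by (rule sum.cong[OF refl]) (simp only: gibbs_props(4)[OF wgraph_away[OF w]] kS mult.commute)
   then show ?thesis unfolding sumA K_def using gibbs_props(4)[OF wH, of "%M. M" N] by (simp add: kN mult.commute)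
  qed
  also have "... = gex lam F (%M. of_bool (M = N))" unfolding gex_vertex[OF w, of _ x] by (simp add: p_def q_def H_def)
  also have "... = pmf (gibbs lam F) N" using gibbs_props(4)[OF w, of "%M. M" N] by simp
  finally show "pmf (gibbs lam F) N = pmf (bind_pmf k K) N" by simp
 qed
 have gH: "gibbs lam H = bind_pmf k (%_. gibbs lam H)" by simp
 define c where "c i = (case i of None => 0 | Some _ => 1 + B)" for i :: "'a set option"
 have "couple (bind_pmf k K) (bind_pmf k (%_. gibbs lam H)) B"
 proof (rule couple_mix[where c = c])
  show "finite (set_pmf k)" using k(1) fi finite_subset[of _ A] by (auto simp: A_def)
  show "couple (K i) (gibbs lam H) (c i)" if "i \<in> set_pmf k" for i
  proof (cases i)
   case None
   then show ?thesis using couple_refl[of "gibbs lam H"] gibbs_finite[OF wH] by (simp add: K_def c_def)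
  next
   case (Some e)
   then have e: "e \<in> inc x F" using that k(1) by (auto simp: A_def)
   then have e2: "e \<in> F" "card e = 2" "x \<in> e" using D(2) by (auto simp: inc_def)
   have HF: "card H < card F" unfolding H_def using e2 D(1) by (intro psubset_card_mono) (auto simp: avoid_def)
   have "couple (gibbs lam (away e F)) (gibbs lam H) B"
    unfolding away_eq[OF e2(2,3)] H_def[symmetric] by (rule couple_sym[OF less.hyps[OF HF wH]])
   then have "couple (map_pmf (insert e) (gibbs lam (away e F))) (map_pmf (%X. X) (gibbs lam H)) (1 + B)"
   proof (rule couple_map)
    fix X Y :: "'a set set" assume "finite X" "finite Y"
    then have "card (sym_diff (insert e X) Y) <= card (insert e (sym_diff X Y))" by (intro card_mono) auto
    also have "... <= Suc (card (sym_diff X Y))" using \<open>finite X\<close> \<open>finite Y\<close> by (simp add: card_insert_if)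
    finally show "real (card (sym_diff (insert e X) Y)) <= 1 + real (card (sym_diff X Y))" by simp
   qed auto
   then show ?thesis using Some by (simp add: K_def c_def)
  qed
  have "(\<Sum>i\<in>set_pmf k. pmf k i * c i) = (\<Sum>i\<in>A. pmf k i * c i)"
   using k(1) fi by (intro sum.mono_neutral_left) (auto simp: A_def pmf_eq_0_set_pmf)
  also have "... = (\<Sum>e\<in>inc x F. q e) * (1 + B)" unfolding sumA by (simp add: c_def kS sum_distrib_right)
  also have "(\<Sum>e\<in>inc x F. q e) = 1 - p" using p(1) by simp
  also have "(1 - p) * (1 + B) <= B" using p(5) by (simp add: algebra_simps)
  finally show "(\<Sum>i\<in>set_pmf k. pmf k i * c i) <= B" .
 qed
 then show ?case using gF gH by (simp add: H_def)
qed

text \<open>Given that \<open>e\<close> is absent, the law is already that of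
  \<open>F - {e}\<close>. Given that it is present, the rest is Gibbs on the graph without both ends
  of \<open>e\<close>, two vertex deletions away from \<open>F - {e}\<close>, and \<open>e\<close>
  itself costs 1.\<close>

lemma couple_remove_edge:
 assumes "wgraph lam B F" shows "couple (gibbs lam F) (gibbs lam (F - {e})) (1 + 2 * B)"
proof (cases "e \<in> F")
 case False
 then have "couple (gibbs lam F) (gibbs lam (F - {e})) 0" using couple_refl[of "gibbs lam F"] gibbs_finite[OF assms] by simp
 then show ?thesis using wgraphD(4)[OF assms] by (auto intro: couple_mono)
next
 case True
 note D = wgraphD[OF assms]
 obtain x where x: "x \<in> e" using D(6)[OF True] by blast
 define y where "y = other x e"
 define G where "G = F - {e}"
 define q where "q = edge_prob lam F e"
 have q: "0 < q" "q < 1" using prob_vertex(4)[OF assms] edge_prob_le(1)[OF assms True] by (auto simp: q_def)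
 have wG: "wgraph lam B G" unfolding G_def by (rule wgraph_subset[OF assms]) auto
 have aw: "away e F = avoid y (avoid x G)"
  unfolding y_def away_eq[OF D(2)[OF True] x] G_def using x by (auto simp: avoid_def)
 define K where "K i = (if i then map_pmf (insert e) (gibbs lam (away e F)) else gibbs lam G)" for i
 define k where "k = bernoulli_pmf q"
 have gF: "gibbs lam F = bind_pmf k K"
 proof (rule pmf_eqI)
  fix N
  have "pmf (bind_pmf k K) N = (\<Sum>i\<in>{True, False}. pmf (K i) N * pmf k i)"
   unfolding pmf_bind by (rule integral_measure_pmf_real) auto
  also have "... = (1 - q) * gex lam G (%M. of_bool (M = N)) + q * gex lam (away e F) (%M. of_bool (insert e M = N))"
   using q gibbs_props(4)[OF wG, of "%M. M" N] gibbs_props(4)[OF wgraph_away[OF assms], of "insert e" e N]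
   by (simp add: K_def k_def)
  also have "... = gex lam F (%M. of_bool (M = N))" unfolding gex_edge(1)[OF assms True] by (simp add: q_def G_def)
  also have "... = pmf (gibbs lam F) N" using gibbs_props(4)[OF assms, of "%M. M" N] by simp
  finally show "pmf (gibbs lam F) N = pmf (bind_pmf k K) N" by simp
 qed
 have "couple (bind_pmf k K) (bind_pmf k (%_. gibbs lam G)) (1 + 2 * B)"
 proof (rule couple_mix[where c = "%_. 1 + 2 * B"])
  show "couple (K i) (gibbs lam G) (1 + 2 * B)" for i
  proof (cases i)
   case False
   then have "couple (K i) (gibbs lam G) 0" using couple_refl[of "gibbs lam G"] gibbs_finite[OF wG] by (simp add: K_def)
   then show ?thesis using D(4) by (auto intro: couple_mono)
  next
   case True
   have "couple (gibbs lam (away e F)) (gibbs lam G) (B + B)"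
    unfolding aw by (rule couple_trans[OF couple_sym[OF couple_avoid[OF wgraph_avoid[OF wG]]] couple_sym[OF couple_avoid[OF wG]]])
   then have "couple (map_pmf (insert e) (gibbs lam (away e F))) (map_pmf (%X. X) (gibbs lam G)) (1 + (B + B))"
   proof (rule couple_map)
    fix X Y :: "'a set set" assume "finite X" "finite Y"
    then have "card (sym_diff (insert e X) Y) <= card (insert e (sym_diff X Y))" by (intro card_mono) auto
    also have "... <= Suc (card (sym_diff X Y))" using \<open>finite X\<close> \<open>finite Y\<close> by (simp add: card_insert_if)
    finally show "real (card (sym_diff (insert e X) Y)) <= 1 + real (card (sym_diff X Y))" by simp
   qed auto
   then show ?thesis using True by (simp add: K_def)
  qed
  show "finite (set_pmf k)" by (rule finite_subset[of _ UNIV]) auto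
  have "(\<Sum>i\<in>set_pmf k. pmf k i * (1 + 2 * B)) = (\<Sum>i\<in>set_pmf k. pmf k i) * (1 + 2 * B)" by (rule sum_distrib_right[symmetric])
  also have "(\<Sum>i\<in>set_pmf k. pmf k i) = 1" by (rule sum_pmf_eq_1) (auto intro: finite_subset[of _ UNIV])
  finally show "(\<Sum>i\<in>set_pmf k. pmf k i * (1 + 2 * B)) <= 1 + 2 * B" by simp
 qed
 then show ?thesis using gF by (simp add: G_def)
qed

lemma couple_remove_edges:
 assumes "finite D" "wgraph lam B F" shows "couple (gibbs lam F) (gibbs lam (F - D)) (real (card D) * (1 + 2 * B))"
 using assms(1)
proof (induction D rule: finite_induct)
 case empty
 then show ?case using couple_refl[of "gibbs lam F"] gibbs_finite[OF assms(2)] by simp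
next
 case (insert e D)
 have "couple (gibbs lam (F - D)) (gibbs lam (F - D - {e})) (1 + 2 * B)"
  by (rule couple_remove_edge[OF wgraph_subset[OF assms(2)]]) auto
 moreover have "F - insert e D = F - D - {e}" by auto
 moreover have "real (card (insert e D)) * (1 + 2 * B) = real (card D) * (1 + 2 * B) + (1 + 2 * B)"
  using insert.hyps by (simp add: distrib_right)
 ultimately show ?case using couple_trans[OF insert.IH] by simp
qed

text \<open>Maximal coupling: the common mass \<open>r\<close> sits on the diagonal and the
  remainders are coupled independently. They disagree with probability
  \<open>1 - s <= \<delta>\<close>, each time at cost at most \<open>D\<close>.\<close>

lemma couple_density:
 assumes "wgraph lam B F" "density_of lam F \<nu> f" "gex lam F (%M. \<bar>f M - 1\<bar>) <= \<delta>" "0 <= D"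
  "!!M N. M \<in> matchings F ==> N \<in> matchings F ==> real (card (sym_diff M N)) <= D"
 shows "couple \<nu> (gibbs lam F) (\<delta> * D)"
proof -
 define \<Omega> where "\<Omega> = matchings F"
 have fin: "finite \<Omega>" using wgraphD(1)[OF assms(1)] by (simp add: \<Omega>_def)
 define p where "p M = pmf \<nu> M" for M
 define q where "q M = pmf (gibbs lam F) M" for M
 define r where "r M = min (p M) (q M)" for M
 define s where "s = (\<Sum>M\<in>\<Omega>. r M)"
 have sup: "set_pmf \<nu> <= \<Omega>" "set_pmf (gibbs lam F) <= \<Omega>"
  using assms(2) gibbs_props(1)[OF assms(1)] by (auto simp: density_of_def \<Omega>_def)
 have p1: "(\<Sum>M\<in>\<Omega>. p M) = 1" "(\<Sum>M\<in>\<Omega>. q M) = 1"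
  unfolding p_def q_def using sup fin by (auto intro: sum_pmf_eq_1)
 have pr: "(\<Sum>M\<in>\<Omega>. p M - r M) = 1 - s" "(\<Sum>M\<in>\<Omega>. q M - r M) = 1 - s" by (simp_all add: sum_subtractf p1 s_def)
 have r0: "0 <= r M" "0 <= p M - r M" "0 <= q M - r M" for M by (auto simp: r_def p_def q_def)
 have s1: "s <= 1" using pr(1) r0 sum_nonneg[of \<Omega> "%M. p M - r M"] by simp
 have s\<delta>: "1 - s <= \<delta>"
 proof -
  have "1 - s = (\<Sum>M\<in>\<Omega>. p M - r M)" using pr by simp
  also have "... <= (\<Sum>M\<in>\<Omega>. \<bar>p M - q M\<bar>)" by (intro sum_mono) (auto simp: r_def)
  also have "... = gex lam F (%M. \<bar>f M - 1\<bar>)" unfolding gex_def \<Omega>_def sum_divide_distrib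
  proof (rule sum.cong[OF refl])
   fix M assume M: "M \<in> matchings F"
   define c where "c = weight lam M / Zsum lam F"
   have c: "0 <= c" unfolding c_def using wgraphD[OF assms(1)] weight_pos[of lam M] by (simp add: less_imp_le)
   have "p M - q M = c * (f M - 1)"
    using assms(2) gibbs_props(2)[OF assms(1) M] M by (simp add: p_def q_def density_of_def c_def algebra_simps diff_divide_distrib)
   then show "\<bar>p M - q M\<bar> = weight lam M * \<bar>f M - 1\<bar> / Zsum lam F" using c wgraphD(7)[OF assms(1)] weight_pos[of lam M] wgraphD(3)[OF assms(1)]
    by (simp add: abs_mult c_def)
  qed
  finally show ?thesis using assms(3) by simp
 qed
 have pz: "p M = r M" "q M = r M" if "s = 1" "M \<in> \<Omega>" for M
  using pr that r0 sum_nonneg_eq_0_iff[OF fin, of "%M. p M - r M"] sum_nonneg_eq_0_iff[OF fin, of "%M. q M - r M"] by auto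
 \<comment> \<open>If \<open>s = 1\<close> both remainders vanish and the quotient is
   \<open>0 / 0 = 0\<close>, which is the right value.\<close>
 define w where "w z = of_bool (fst z = snd z) * r (fst z) + (p (fst z) - r (fst z)) * (q (snd z) - r (snd z)) / (1 - s)" for z
 have w0: "0 <= w z" for z unfolding w_def using r0 s1 by (intro add_nonneg_nonneg mult_nonneg_nonneg divide_nonneg_nonneg) auto
 have diag: "(\<Sum>N\<in>\<Omega>. of_bool (M = N) * r M) = r M" "(\<Sum>N\<in>\<Omega>. of_bool (N = M) * r N) = r M" if "M \<in> \<Omega>" for M
  using fin that by (auto simp: of_bool_def if_distrib[of "%x. x * _"] sum.delta sum.delta' cong: if_cong)
 have rowp: "(\<Sum>N\<in>\<Omega>. w (M, N)) = p M" if "M \<in> \<Omega>" for M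
 proof -
  have "(\<Sum>N\<in>\<Omega>. w (M, N)) = r M + (p M - r M) * (1 - s) / (1 - s)"
   unfolding w_def by (simp add: sum.distrib diag that sum_distrib_left[symmetric] sum_divide_distrib[symmetric] pr)
  then show ?thesis using pz(1)[OF _ that] by (cases "s = 1") auto
 qed
 have colq: "(\<Sum>M\<in>\<Omega>. w (M, N)) = q N" if "N \<in> \<Omega>" for N
 proof -
  have "(\<Sum>M\<in>\<Omega>. w (M, N)) = r N + (1 - s) * (q N - r N) / (1 - s)"
   unfolding w_def by (simp add: sum.distrib diag that sum_distrib_right[symmetric] sum_divide_distrib[symmetric] pr)
  then show ?thesis using pz(2)[OF _ that] by (cases "s = 1") auto
 qed
 have tot: "(\<Sum>z\<in>\<Omega> \<times> \<Omega>. w z) = 1"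
  by (simp add: sum.cartesian_product' rowp p1)
 obtain \<pi> where pi: "set_pmf \<pi> <= \<Omega> \<times> \<Omega>" "!!z. z \<in> \<Omega> \<times> \<Omega> ==> pmf \<pi> z = w z"
  using finite_pmf_exists[of "\<Omega> \<times> \<Omega>" w] fin w0 tot by (metis finite_cartesian_product)
 have mf: "pmf (map_pmf h \<pi>) M = (\<Sum>z\<in>\<Omega> \<times> \<Omega>. of_bool (h z = M) * w z)" for h and M :: "'a set set"
 proof -
  have "pmf (map_pmf h \<pi>) M = measure_pmf.expectation \<pi> (indicator {z. h z = M})" by (simp add: pmf_map vimage_def)
  also have "... = (\<Sum>z\<in>\<Omega> \<times> \<Omega>. indicator {z. h z = M} z * pmf \<pi> z)"
   by (rule integral_measure_pmf_real) (use fin pi in auto)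
  also have "... = (\<Sum>z\<in>\<Omega> \<times> \<Omega>. of_bool (h z = M) * w z)" by (intro sum.cong refl) (simp add: pi(2) indicator_def of_bool_def)
  finally show ?thesis .
 qed
 have fst_eq: "map_pmf fst \<pi> = \<nu>"
 proof (rule pmf_eqI)
  fix M
  show "pmf (map_pmf fst \<pi>) M = pmf \<nu> M"
  proof (cases "M \<in> \<Omega>")
   case True
   have "pmf (map_pmf fst \<pi>) M = (\<Sum>M'\<in>\<Omega>. \<Sum>N\<in>\<Omega>. of_bool (M' = M) * w (M', N))"
    unfolding mf by (simp add: sum.cartesian_product')
   also have "... = (\<Sum>M'\<in>\<Omega>. of_bool (M' = M) * p M')" by (simp add: sum_distrib_left[symmetric] rowp)
   also have "... = p M" using True fin by (subst sum.remove[of _ M]) (auto intro!: sum.neutral)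
   finally show ?thesis by (simp add: p_def)
  next
   case False
   then have "M \<notin> set_pmf (map_pmf fst \<pi>)" "M \<notin> set_pmf \<nu>" using pi(1) sup by auto
   then show ?thesis by (simp add: pmf_eq_0_set_pmf[THEN iffD2])
  qed
 qed
 have snd_eq: "map_pmf snd \<pi> = gibbs lam F"
 proof (rule pmf_eqI)
  fix N
  show "pmf (map_pmf snd \<pi>) N = pmf (gibbs lam F) N"
  proof (cases "N \<in> \<Omega>")
   case True
   have "pmf (map_pmf snd \<pi>) N = (\<Sum>M\<in>\<Omega>. \<Sum>N'\<in>\<Omega>. of_bool (N' = N) * w (M, N'))"
    unfolding mf by (simp add: sum.cartesian_product')
   also have "... = (\<Sum>M\<in>\<Omega>. w (M, N))" using True fin
    by (intro sum.cong refl, subst sum.remove[of _ N]) (auto intro!: sum.neutral)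
   also have "... = q N" by (rule colq[OF True])
   finally show ?thesis by (simp add: q_def)
  next
   case False
   then have "N \<notin> set_pmf (map_pmf snd \<pi>)" "N \<notin> set_pmf (gibbs lam F)" using pi(1) sup by auto
   then show ?thesis by (simp add: pmf_eq_0_set_pmf[THEN iffD2])
  qed
 qed
 have cost: "(\<integral>\<^sup>+z. ennreal (real (card (sym_diff (fst z) (snd z)))) \<partial>measure_pmf \<pi>) <= ennreal (\<delta> * D)"
 proof -
  define d where "d z = real (card (sym_diff (fst z) (snd z)))" for z :: "'a set set \<times> 'a set set"
  have "(\<integral>\<^sup>+z. ennreal (d z) \<partial>measure_pmf \<pi>) = (\<Sum>z\<in>\<Omega> \<times> \<Omega>. ennreal (d z) * ennreal (pmf \<pi> z))"
  proof (subst nn_integral_measure_pmf_finite)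
   show "finite (set_pmf \<pi>)" using finite_subset[OF pi(1)] fin by auto
   show "(\<Sum>z\<in>set_pmf \<pi>. ennreal (d z) * ennreal (pmf \<pi> z)) = (\<Sum>z\<in>\<Omega> \<times> \<Omega>. ennreal (d z) * ennreal (pmf \<pi> z))"
    using pi(1) fin by (intro sum.mono_neutral_left) (auto simp: pmf_eq_0_set_pmf[THEN iffD2])
  qed simp
  also have "... = ennreal (\<Sum>z\<in>\<Omega> \<times> \<Omega>. d z * w z)"
   using w0 by (subst sum_ennreal[symmetric]) (auto simp: pi(2) ennreal_mult d_def)
  also have "(\<Sum>z\<in>\<Omega> \<times> \<Omega>. d z * w z) <= (\<Sum>z\<in>\<Omega> \<times> \<Omega>. D * ((p (fst z) - r (fst z)) * (q (snd z) - r (snd z)) / (1 - s)))"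
  proof (rule sum_mono)
   fix z assume z: "z \<in> \<Omega> \<times> \<Omega>"
   have 0: "0 <= (p (fst z) - r (fst z)) * (q (snd z) - r (snd z)) / (1 - s)"
    using r0 s1 by (intro divide_nonneg_nonneg mult_nonneg_nonneg) auto
   have "d z * w z = d z * ((p (fst z) - r (fst z)) * (q (snd z) - r (snd z)) / (1 - s))"
    by (auto simp: d_def w_def)
   also have "... <= D * ((p (fst z) - r (fst z)) * (q (snd z) - r (snd z)) / (1 - s))"
    using assms(5)[of "fst z" "snd z"] z 0 by (intro mult_right_mono) (auto simp: d_def \<Omega>_def)
   finally show "d z * w z <= D * ((p (fst z) - r (fst z)) * (q (snd z) - r (snd z)) / (1 - s))" .
  qed
  also have "... = D * ((1 - s) * (1 - s) / (1 - s))"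
  proof -
   have "(\<Sum>z\<in>\<Omega> \<times> \<Omega>. (p (fst z) - r (fst z)) * (q (snd z) - r (snd z))) = (1 - s) * (1 - s)"
    by (simp add: sum.cartesian_product' sum_product[symmetric] pr)
   then show ?thesis by (simp add: sum_distrib_left[symmetric] sum_divide_distrib[symmetric])
  qed
  also have "... = D * (1 - s)" by simp
  also have "... <= \<delta> * D" using s\<delta> assms(4) by (simp add: mult.commute mult_left_mono)
  finally show ?thesis by (simp add: d_def ennreal_leI)
 qed
 have "\<forall>(X, Y)\<in>set_pmf \<pi>. finite X & finite Y"
  using pi(1) wgraphD(1)[OF assms(1)] by (auto simp: \<Omega>_def intro: matchings_finite)
 moreover have "0 <= \<delta> * D" using s\<delta> s1 assms(4) by simp
 ultimately show ?thesis using fst_eq snd_eq cost unfolding couple_def couplings_def by blast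
qed

section \<open>Augmenting paths and matching size\<close>

definition mate :: "'v set set => 'v => 'v" where
 "mate M v = other v (THE e. e \<in> M & v \<in> e)"

definition edge_family :: "'v set set => bool" where
 "edge_family M \<longleftrightarrow> finite M & pairwise disjnt M & (\<forall>e\<in>M. card e = 2)"

lemma mate_edge:
 assumes "edge_family M" "e \<in> M" "v \<in> e"
 shows "mate M v = other v e" "e = {v, mate M v}" "mate M v ~= v" "mate M v \<in> \<Union>M" "mate M (mate M v) = v"
proof -
 have the: "(THE e. e \<in> M & u \<in> e) = e" if "u \<in> e" for u
  using assms(1,2) that by (intro the_equality) (auto simp: edge_family_def pairwise_def disjnt_def)
 show 1: "mate M v = other v e" by (simp add: mate_def the[OF assms(3)])
 have c: "card e = 2" using assms by (simp add: edge_family_def)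
 show 2: "e = {v, mate M v}" "mate M v ~= v" using other_edge[OF c assms(3)] unfolding 1 by auto
 then have m: "mate M v \<in> e" by auto
 then show "mate M v \<in> \<Union>M" using assms(2) by auto
 have "mate M (mate M v) = other (mate M v) e" by (simp add: mate_def[of M "mate M v"] the[OF m])
 then show "mate M (mate M v) = v" using other_edge[OF c m] 2 by auto
qed

lemma mate_props:
 assumes "edge_family M" "v \<in> \<Union>M"
 shows "{v, mate M v} \<in> M" "mate M v ~= v" "mate M v \<in> \<Union>M" "mate M (mate M v) = v"
proof -
 obtain e where e: "e \<in> M" "v \<in> e" using assms(2) by blast
 note m = mate_edge[OF assms(1) e]
 show "{v, mate M v} \<in> M" "mate M v ~= v" "mate M v \<in> \<Union>M" "mate M (mate M v) = v" using m e(1) by auto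
qed

lemma edge_family_disjnt: "edge_family M ==> e \<in> M ==> f \<in> M ==> e ~= f ==> disjnt e f"
 by (simp add: edge_family_def pairwise_def)

lemma card_Union_edge_family:
 assumes "edge_family M" shows "card (\<Union>M) = 2 * card M" "finite (\<Union>M)"
proof -
 have "finite e" if "e \<in> M" for e using assms that by (intro card_ge_0_finite) (auto simp: edge_family_def)
 then show "finite (\<Union>M)" using assms by (auto simp: edge_family_def)
 have "card (\<Union>M) = (\<Sum>e\<in>M. card e)"
  using assms \<open>!!e. e \<in> M ==> finite e\<close> by (intro card_Union_disjoint) (auto simp: edge_family_def)
 also have "... = 2 * card M" using assms by (simp add: edge_family_def)
 finally show "card (\<Union>M) = 2 * card M" .
qed

text \<open>The alternating walk from an exposed vertex \<open>s\<close>: \<open>S\<close>-edges lead from \<open>pos i\<close> to \<open>mid (Suc i)\<close>,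
 \<open>M\<close>-edges from \<open>mid i\<close> to \<open>pos i\<close>.\<close>

definition alt_step :: "'v set set => 'v set set => 'v => 'v" where
 "alt_step S M x = mate M (mate S x)"

text \<open>At uncovered vertices \<open>mate\<close> takes arbitrary values, so the walk is
  meaningful only while it is alive.\<close>

definition alive :: "'v set set => 'v set set => nat => 'v => bool" where
 "alive S M j s \<longleftrightarrow> (\<forall>i<j. (alt_step S M ^^ i) s \<in> \<Union>S & mate S ((alt_step S M ^^ i) s) \<in> \<Union>M)"

text \<open>An alternating path with \<open>j\<close> edges of \<open>M\<close> that ends at an
  exposed vertex. Traversed edges are removed from \<open>M\<close>, which forbids reuse and matches
  conditioning the Gibbs measure on the edge \<open>g\<close>. That \<open>s\<close> is exposed is
  required separately where the predicate is used.\<close>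

primrec short_path :: "'v set set => nat => 'v set set => 'v => bool" where
 "short_path S 0 M s \<longleftrightarrow> mate S s \<notin> \<Union>M"
| "short_path S (Suc j) M s \<longleftrightarrow>
   (\<exists>g\<in>M. mate S s \<in> g & other (mate S s) g \<in> \<Union>S & short_path S j (M - {g}) (other (mate S s) g))"

section \<open>Alternating walks and the deficit of a matching\<close>

context
 fixes S M :: "'v set set"
 assumes S: "edge_family S" and M: "edge_family M"
begin

lemma alt_step_inj:
 assumes "x \<in> \<Union>S" "mate S x \<in> \<Union>M" "y \<in> \<Union>S" "mate S y \<in> \<Union>M" "alt_step S M x = alt_step S M y"
 shows "x = y"
 using assms mate_props(4)[OF S] mate_props(4)[OF M] unfolding alt_step_def by metis

lemma alive_Suc: "alive S M (Suc j) s \<longleftrightarrow> alive S M j s & (alt_step S M ^^ j) s \<in> \<Union>S & mate S ((alt_step S M ^^ j) s) \<in> \<Union>M"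
 by (auto simp: alive_def less_Suc_eq)

lemma alive_mono: "alive S M j s ==> i <= j ==> alive S M i s"
 by (auto simp: alive_def)

lemma alive_range: assumes "alive S M j s" "0 < j" shows "(alt_step S M ^^ j) s \<in> \<Union>M"
proof -
 obtain i where i: "j = Suc i" using assms(2) by (cases j) auto
 then have "mate S ((alt_step S M ^^ i) s) \<in> \<Union>M" using assms(1) by (simp add: alive_Suc)
 from mate_props(3)[OF M this] show ?thesis by (simp add: i alt_step_def)
qed

text \<open>Steps are injective, and a living walk meets a vertex exposed by \<open>M\<close> only
  at its start. Tracing two walks back from a common vertex therefore reaches both starts at the
  same time.\<close>

lemma orbit_inj:
 assumes "s \<notin> \<Union>M" "s' \<notin> \<Union>M" "alive S M i s" "alive S M j s'" "(alt_step S M ^^ i) s = (alt_step S M ^^ j) s'"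
 shows "s = s' & i = j"
 using assms(3-5)
proof (induction i arbitrary: j)
 case 0
 show ?case
 proof (cases "j = 0")
  case False
  then have "(alt_step S M ^^ j) s' \<in> \<Union>M" using alive_range[OF 0(2)] by simp
  then show ?thesis using 0 assms(1) by simp
 qed (use 0 in simp)
next
 case (Suc i)
 show ?case
 proof (cases j)
  case 0
  then show ?thesis using Suc.prems alive_range[OF Suc.prems(1)] assms(2) by simp
 next
  case (Suc k)
  have "(alt_step S M ^^ i) s = (alt_step S M ^^ k) s'"
  proof (rule alt_step_inj)
   show "alt_step S M ((alt_step S M ^^ i) s) = alt_step S M ((alt_step S M ^^ k) s')" using Suc.prems(3) Suc by simp
  qed (use Suc.prems(1,2) Suc in \<open>simp_all add: alive_Suc\<close>)
  then show ?thesis using Suc.IH[of k] Suc.prems Suc by (simp add: alive_Suc)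
 qed
qed

text \<open>No vertex is visited in both roles. If it were, applying the two involutions to the
  coincidence yields another one whose indices are two closer, until an edge of \<open>S\<close> or
  \<open>M\<close> would have to be a loop.\<close>

lemma mid_neq_pos:
 assumes "alive S M j s" "1 <= p" "p <= j" "1 <= l" "l <= j"
 shows "mate S ((alt_step S M ^^ (p - 1)) s) ~= (alt_step S M ^^ l) s"
proof -
 define y where "y i = (alt_step S M ^^ i) s" for i
 define a where "a i = mate S (y (i - 1))" for i
 have yS: "y i \<in> \<Union>S" and aM: "a (Suc i) \<in> \<Union>M" if "i < j" for i
  using assms(1) that by (auto simp: alive_def y_def a_def)
 have ya: "y (Suc i) = mate M (a (Suc i))" for i by (simp add: y_def a_def alt_step_def)
 have \<alpha>y: "mate S (y i) = a (Suc i)" for i by (simp add: a_def)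
 have \<alpha>a: "mate S (a (Suc i)) = y i" if "i < j" for i using mate_props(4)[OF S yS[OF that]] by (simp add: a_def)
 have \<beta>y: "mate M (y (Suc i)) = a (Suc i)" if "i < j" for i using mate_props(4)[OF M aM[OF that]] by (simp add: ya)
 have "a p ~= y l" if "1 <= p" "p <= j" "1 <= l" "l <= j" for p l
  using that
 proof (induction "(p - l) + (l - p)" arbitrary: p l rule: less_induct)
  case less
  obtain p' where p': "p = Suc p'" using less.prems by (cases p) auto
  obtain l' where l': "l = Suc l'" using less.prems by (cases l) auto
  show ?case
  proof
   assume eq: "a p = y l"
   consider "p = l" | "p = Suc l" | "Suc l < p" | "p < l" by linarith
   then show False
   proof cases
    case 1
    have "mate M (a p) ~= a p" using mate_props(2)[OF M aM[of p']] less.prems p' by simp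
    then show False using eq 1 ya[of p'] p' by simp
   next
    case 2
    then have "mate S (y l) = y l" using eq \<alpha>y[of l] by simp
    then show False using mate_props(2)[OF S yS[of l]] less.prems 2 by simp
   next
    case 3
    have "y p' = a (Suc l)" using eq \<alpha>y[of l] \<alpha>a[of p'] less.prems p' by simp
    moreover obtain p'' where p'': "p' = Suc p''" using 3 p' l' by (cases p') auto
    ultimately have "a p' = mate M (a (Suc l))" using \<beta>y[of p''] less.prems p' by simp
    then have "a p' = y (Suc l)" by (simp add: ya)
    moreover have "a p' ~= y (Suc l)" using less.hyps[of p' "Suc l"] 3 less.prems p' p'' by simp
    ultimately show False by simp
   next
    case 4
    have "a l = y p" using eq \<beta>y[of l'] ya[of p'] less.prems p' l' by simp
    then have "y l' = a (Suc p)" using \<alpha>a[of l'] \<alpha>y[of p] less.prems l' by simp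
    moreover have "a (Suc p) ~= y l'"
    proof (cases "l' = 0")
     case True then show ?thesis using 4 l' less.prems by simp
    next
     case False
     show ?thesis
     proof (cases "Suc p <= l'")
      case True
      then show ?thesis using less.hyps[of "Suc p" l'] 4 less.prems l' False by simp
     next
      case False2: False
      then have "l' = p" using 4 l' by simp
      then show ?thesis using \<alpha>y[of p] mate_props(2)[OF S yS[of p]] less.prems l' by simp
     qed
    qed
    ultimately show False by simp
   qed
  qed
 qed
 from this[OF assms(2-5)] show ?thesis by (simp add: a_def y_def)
qed

text \<open>Removing traversed edges from \<open>M\<close> must not block later ones, that is, the
  edges \<open>{a l, y l}\<close> have to be distinct. They could only coincide in equal or in
  opposite roles, which \<open>orbit_inj\<close> and \<open>mid_neq_pos\<close> exclude.\<close>

lemma short_path_of_alive: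
 assumes "s \<notin> \<Union>M" "alive S M j s" "(alt_step S M ^^ j) s \<in> \<Union>S" "mate S ((alt_step S M ^^ j) s) \<notin> \<Union>M"
 shows "short_path S j M s"
proof -
 define y where "y i = (alt_step S M ^^ i) s" for i
 define a where "a i = mate S (y (i - 1))" for i
 define G where "G i = (%l. {a l, y l}) ` {1..i}" for i
 have aM: "a (Suc i) \<in> \<Union>M" and yS: "y i \<in> \<Union>S" if "i < j" for i
  using assms(2) that by (auto simp: alive_def y_def a_def)
 have "short_path S (j - i) (M - G i) (y i)" if "i <= j" for i
  using that
 proof (induction i rule: inc_induct)
  case base
  then show ?case using assms(4) by (auto simp: y_def)
 next
  case (step i)
  define g where "g = {a (Suc i), y (Suc i)}"
  have m: "mate S (y i) = a (Suc i)" by (simp add: a_def)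
  have ys: "y (Suc i) = mate M (a (Suc i))" by (simp add: y_def a_def alt_step_def)
  have gM: "g \<in> M" unfolding g_def ys by (rule mate_props(1)[OF M aM[OF step(2)]])
  have "g \<notin> G i"
  proof
   assume "g \<in> G i"
   then obtain l where l: "1 <= l" "l <= i" "g = {a l, y l}" by (auto simp: G_def)
   then have "a (Suc i) = a l \<or> a (Suc i) = y l" by (auto simp: g_def)
   then show False
   proof
    assume "a (Suc i) = a l"
    then have "mate S (y i) = mate S (y (l - 1))" by (simp add: a_def)
    then have "mate S (mate S (y i)) = mate S (mate S (y (l - 1)))" by simp
    moreover have "l - 1 < j" using l step(2) by simp
    ultimately have "y i = y (l - 1)" using mate_props(4)[OF S yS[OF step(2)]] mate_props(4)[OF S yS[of "l - 1"]] by simp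
    then have "i = l - 1" using orbit_inj[OF assms(1,1), of i "l - 1"] alive_mono[OF assms(2)] l step(2) by (auto simp: y_def)
    then show False using l by simp
   next
    assume "a (Suc i) = y l"
    then show False using mid_neq_pos[OF assms(2), of "Suc i" l] l step(2) by (auto simp: a_def y_def)
   qed
  qed
  then have gG: "g \<in> M - G i" using gM by simp
  have o: "other (a (Suc i)) g = y (Suc i)"
  proof -
   have "a (Suc i) \<in> g" by (simp add: g_def)
   from mate_edge(1)[OF M gM this] show ?thesis by (simp add: ys)
  qed
  have yU: "y (Suc i) \<in> \<Union>S"
  proof (cases "Suc i = j")
   case True then show ?thesis using assms(3) by (simp add: y_def)
  next
   case False then show ?thesis using yS[of "Suc i"] step(2) by simp
  qed
  have MG: "M - G i - {g} = M - G (Suc i)" by (auto simp: G_def g_def atLeastAtMostSuc_conv)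
  have ji: "j - i = Suc (j - Suc i)" using step(2) by simp
  show ?case unfolding ji short_path.simps m
  proof (intro bexI[OF _ gG] conjI)
   show "a (Suc i) \<in> g" by (simp add: g_def)
   show "other (a (Suc i)) g \<in> \<Union>S" unfolding o by (rule yU)
   show "short_path S (j - Suc i) (M - G i - {g}) (other (a (Suc i)) g)" unfolding o MG by (rule step(3))
  qed
 qed
 from this[of 0] show ?thesis by (simp add: G_def y_def)
qed

text \<open>The walk from a vertex covered by \<open>S\<close> and exposed by \<open>M\<close>
  survives \<open>k\<close> rounds, ends a short augmenting path, or reaches a vertex covered by
  \<open>M\<close> but not by \<open>S\<close>. Long walks are disjoint, so there are at most
  \<open>2 * card M / k\<close>. Walks of the last kind end at distinct vertices and cancel against
  the vertices covered by \<open>M\<close> only.\<close>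

lemma matching_deficit:
 assumes "0 < k"
 shows "2 * real k * (real (card S) - real (card M)) <= 2 * real (card M)
   + real k * (\<Sum>s\<in>\<Union>S. \<Sum>j<k. of_bool (s \<notin> \<Union>M & short_path S j M s))"
proof -
 let ?U = "\<Union>S" and ?V = "\<Union>M"
 have fin: "finite ?U" "finite ?V" using card_Union_edge_family(2) S M by auto
 define I where "I = ?U - ?V"
 define long where "long = {s \<in> I. alive S M k s}"
 define sh where "sh = {s \<in> I. \<exists>j<k. short_path S j M s}"
 define out where "out = {s \<in> I. \<exists>j<k. alive S M j s & (alt_step S M ^^ j) s \<in> ?V - ?U}"
 have finI: "finite I" using fin by (simp add: I_def)
 have "I <= long Un sh Un out"
 proof
  fix s assume s: "s \<in> I"
  show "s \<in> long Un sh Un out"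
  proof (cases "alive S M k s")
   case True then show ?thesis using s by (simp add: long_def)
  next
   case False
   have "\<exists>j<k. alive S M j s & \<not> alive S M (Suc j) s"
   proof (rule ccontr)
    assume no: "\<not> (\<exists>j<k. alive S M j s & \<not> alive S M (Suc j) s)"
    have "i <= k ==> alive S M i s" for i
    proof (induction i)
     case 0 show ?case by (simp add: alive_def)
    next
     case (Suc i) then show ?case using no by (simp add: Suc_le_eq)
    qed
    then show False using False by simp
   qed
   then obtain j where jk: "j < k" and aj: "alive S M j s" and n: "\<not> alive S M (Suc j) s" by blast
   have nd: "\<not> ((alt_step S M ^^ j) s \<in> ?U & mate S ((alt_step S M ^^ j) s) \<in> ?V)"
    using n aj unfolding alive_Suc by blast
   show ?thesis
   proof (cases "(alt_step S M ^^ j) s \<in> ?U")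
    case True
    then have "short_path S j M s" using nd s by (intro short_path_of_alive aj) (auto simp: I_def)
    then have "s \<in> sh" unfolding sh_def using s jk by blast
    then show ?thesis by simp
   next
    case False
    have "j ~= 0"
    proof
     assume "j = 0"
     then have "(alt_step S M ^^ j) s = s" by simp
     then show False using False s by (simp add: I_def)
    qed
    then have "(alt_step S M ^^ j) s \<in> ?V" using alive_range[OF aj] by simp
    then have "s \<in> out" unfolding out_def using s jk aj False by blast
    then show ?thesis by simp
   qed
  qed
 qed
 then have cI: "card I <= card long + card sh + card out"
 proof -
  assume sub: "I <= long Un sh Un out"
  have "finite long" "finite sh" "finite out" using finI by (simp_all add: long_def sh_def out_def)
  then have "card I <= card (long Un sh Un out)" using sub by (intro card_mono) auto
  also have "... <= card (long Un sh) + card out" by (rule card_Un_le)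
  also have "card (long Un sh) <= card long + card sh" by (rule card_Un_le)
  finally show ?thesis by simp
 qed
 have c_long: "k * card long <= card ?V"
 proof -
  have "inj_on (%(s, i). (alt_step S M ^^ Suc i) s) (long \<times> {..<k})"
  proof (rule inj_onI)
   fix z z' assume z: "z \<in> long \<times> {..<k}" "z' \<in> long \<times> {..<k}"
    "(case z of (s, i) => (alt_step S M ^^ Suc i) s) = (case z' of (s, i) => (alt_step S M ^^ Suc i) s)"
   obtain s i where zi: "z = (s, i)" by (cases z)
   obtain s' i' where zi': "z' = (s', i')" by (cases z')
   have *: "s \<in> long" "i < k" "s' \<in> long" "i' < k" "(alt_step S M ^^ Suc i) s = (alt_step S M ^^ Suc i') s'"
    using z unfolding zi zi' by (simp_all only: mem_Sigma_iff lessThan_iff prod.case)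
   then have "s \<notin> ?V" "s' \<notin> ?V" "alive S M (Suc i) s" "alive S M (Suc i') s'"
    using alive_mono[of k s "Suc i"] alive_mono[of k s' "Suc i'"] by (auto simp: long_def I_def Suc_le_eq)
   from orbit_inj[OF this *(5)] show "z = z'" by (simp add: zi zi')
  qed
  moreover have "(%(s, i). (alt_step S M ^^ Suc i) s) ` (long \<times> {..<k}) <= ?V"
  proof (rule image_subsetI)
   fix z assume z: "z \<in> long \<times> {..<k}"
   obtain s i where zi: "z = (s, i)" by (cases z)
   have "alive S M k s" "Suc i <= k" using z by (simp_all add: zi long_def Suc_le_eq)
   then have "alive S M (Suc i) s" by (rule alive_mono)
   then show "(case z of (s, i) => (alt_step S M ^^ Suc i) s) \<in> ?V" unfolding zi prod.case by (rule alive_range) simp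
  qed
  ultimately have "card (long \<times> {..<k}) <= card ?V" by (metis card_inj_on_le fin(2))
  then show ?thesis by (simp add: card_cartesian_product mult.commute)
 qed
 have c_out: "card out <= card (?V - ?U)"
 proof -
  define f where "f s = (SOME j. j < k & alive S M j s & (alt_step S M ^^ j) s \<in> ?V - ?U)" for s
  have f: "f s < k & alive S M (f s) s & (alt_step S M ^^ f s) s \<in> ?V - ?U" if "s \<in> out" for s
  proof -
   have "\<exists>j. j < k & alive S M j s & (alt_step S M ^^ j) s \<in> ?V - ?U"
    using that unfolding out_def mem_Collect_eq by (rule conjunct2)
   then show ?thesis unfolding f_def by (rule someI_ex)
  qed
  have "inj_on (%s. (alt_step S M ^^ f s) s) out"
  proof (rule inj_onI)
   fix s s' assume "s \<in> out" "s' \<in> out" "(alt_step S M ^^ f s) s = (alt_step S M ^^ f s') s'"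
   then show "s = s'" using orbit_inj[of s s' "f s" "f s'"] f by (auto simp: out_def I_def)
  qed
  then show ?thesis by (rule card_inj_on_le) (use f fin in auto)
 qed
 have c_sh: "real (card sh) <= (\<Sum>s\<in>?U. \<Sum>j<k. of_bool (s \<notin> ?V & short_path S j M s))"
 proof -
  have "real (card sh) = (\<Sum>s\<in>sh. 1)" by simp
  also have "... <= (\<Sum>s\<in>sh. \<Sum>j<k. of_bool (s \<notin> ?V & short_path S j M s))"
  proof (rule sum_mono)
   fix s assume "s \<in> sh"
   then obtain j where j: "j < k" "s \<notin> ?V & short_path S j M s" by (auto simp: sh_def I_def)
   then have "of_bool (s \<notin> ?V & short_path S j M s) <= (\<Sum>j<k. of_bool (s \<notin> ?V & short_path S j M s) :: real)"
    by (intro member_le_sum) auto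
   then show "1 <= (\<Sum>j<k. of_bool (s \<notin> ?V & short_path S j M s) :: real)" using j by simp
  qed
  also have "... <= (\<Sum>s\<in>?U. \<Sum>j<k. of_bool (s \<notin> ?V & short_path S j M s))"
   using fin by (intro sum_mono2) (auto simp: sh_def I_def intro!: sum_nonneg)
  finally show ?thesis .
 qed
 have "card I + card (?U \<inter> ?V) = card ?U" unfolding I_def using fin by (metis add.commute card_Int_Diff)
 moreover have "card (?V - ?U) + card (?U \<inter> ?V) = card ?V" using fin by (metis Int_commute add.commute card_Int_Diff)
 ultimately have "real (card I) - real (card (?V - ?U)) = 2 * real (card S) - 2 * real (card M)"
  using card_Union_edge_family(1)[OF S] card_Union_edge_family(1)[OF M] by linarith
 then have "2 * real (card S) - 2 * real (card M) <= real (card long) + real (card sh)"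
  using cI c_out by linarith
 then have "real k * (2 * real (card S) - 2 * real (card M)) <= real k * real (card long) + real k * real (card sh)"
  using mult_left_mono[of _ _ "real k"] by (simp add: distrib_left[symmetric])
 moreover have "real k * real (card long) <= 2 * real (card M)"
  using c_long card_Union_edge_family(1)[OF M] by (simp flip: of_nat_mult)
 moreover have "real k * real (card sh) <= real k * (\<Sum>s\<in>?U. \<Sum>j<k. of_bool (s \<notin> ?V & short_path S j M s))"
  using c_sh by (intro mult_left_mono) auto
 ultimately show ?thesis by (simp add: algebra_simps)
qed

end

text \<open>Path flipping, one exchange at a time. Trading the \<open>M\<close>-edge
  \<open>{a, y}\<close> for the \<open>S\<close>-edge \<open>{s, a}\<close> replaces the factor
  \<open>gw y\<close> by \<open>gw s\<close>, and the argument continues at \<open>y\<close> in the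
  graph without \<open>s\<close> and \<open>a\<close>, while \<open>V\<close> pays for the choice of
  \<open>y\<close>. The final vertex contributes a factor of at least 1. The condition that an
  \<open>S\<close>-edge is either still present or disjoint from all of \<open>F\<close> guarantees
  that the next \<open>S\<close>-edge is available.\<close>

lemma vertex_weight_recursion:
 fixes gw :: "'v => real" and V :: "nat => 'v => real"
 assumes "wgraph lam B E" "edge_family S" "!!e x. e \<in> E ==> x \<in> e ==> lam e = gw x * gw (other x e)"
  "!!x. x \<in> \<Union>E ==> 1 <= gw x"
  "!!x. x \<in> \<Union>E ==> 1 <= V 1 x" "!!j e x. e \<in> E ==> x \<in> e ==> V j (other x e) <= V (Suc j) x"
  "!!j x. (\<Sum>e\<in>inc x E. V j (other x e)) <= V (Suc j) x" "!!j x. 0 <= V j x"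
  "F <= E" "!!e. e \<in> S ==> e \<in> F \<or> (\<forall>f\<in>F. disjnt e f)" "s \<in> \<Union>S" "{s, mate S s} \<in> F"
 shows "gw s * (\<Sum>M\<in>matchings (avoid s F). weight lam M * of_bool (short_path S j M s)) <= V (2 * j + 1) s * Zsum lam F"
 using assms(9-12)
proof (induction j arbitrary: F s)
 case (0 F s)
 note w = wgraph_subset[OF assms(1) 0(1)]
 define a where "a = mate S s"
 have sa: "{s, a} \<in> F" "{s, a} \<in> E" using 0 by (auto simp: a_def)
 have as: "a ~= s" using mate_props(2)[OF assms(2) 0(3)] by (simp add: a_def)
 have oth: "other s {s, a} = a" using other_edge[of "{s, a}" s] as by auto
 have "(\<Sum>M\<in>matchings (avoid s F). weight lam M * of_bool (short_path S 0 M s)) = Zsum lam (avoid a (avoid s F))"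
  unfolding Zsum_def using wgraphD(1)[OF wgraph_avoid[OF w]]
  by (intro sum.mono_neutral_cong_right) (auto simp: matchings_def avoid_def a_def)
 also have "... = Zsum lam (away {s, a} F)" by (simp add: avoid_avoid)
 finally have eq: "(\<Sum>M\<in>matchings (avoid s F). weight lam M * of_bool (short_path S 0 M s)) = Zsum lam (away {s, a} F)" .
 have Z: "lam {s, a} * Zsum lam (away {s, a} F) <= Zsum lam F"
  using edge_prob_le(1)[OF w sa(1)] wgraphD(7)[OF w] by (simp add: edge_prob_def)
 have lam: "lam {s, a} = gw s * gw a" using assms(3)[OF sa(2), of s] oth by simp
 have gs: "1 <= gw s" "1 <= gw a" using assms(4)[of s] assms(4)[of a] sa(2) by auto
 have Za: "0 <= Zsum lam (away {s, a} F)" using wgraphD(7)[OF wgraph_away[OF w, of "{s, a}"]] by simp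
 have "gw s * 1 * Zsum lam (away {s, a} F) <= gw s * gw a * Zsum lam (away {s, a} F)"
  using gs Za by (intro mult_right_mono mult_left_mono) auto
 also have "... <= 1 * Zsum lam F" using Z lam by simp
 also have "... <= V 1 s * Zsum lam F" using assms(5)[of s] sa(2) wgraphD(7)[OF w] by (intro mult_right_mono) auto
 finally show ?case unfolding eq by simp
next
 case (Suc j F s)
 note w = wgraph_subset[OF assms(1) Suc.prems(1)]
 define a where "a = mate S s"
 have sa: "{s, a} \<in> F" "{s, a} \<in> E" "{s, a} \<in> S" using Suc.prems mate_props(1)[OF assms(2) Suc.prems(3)] by (auto simp: a_def)
 have as: "a ~= s" using mate_props(2)[OF assms(2) Suc.prems(3)] by (simp add: a_def)
 have oth: "other s {s, a} = a" "other a {s, a} = s" using other_edge[of "{s, a}" s] other_edge[of "{s, a}" a] as by auto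
 define H where "H = avoid s F"
 define F' where "F' = avoid a H"
 have wH: "wgraph lam B H" unfolding H_def by (rule wgraph_avoid[OF w])
 have F': "F' = away {s, a} F" by (simp add: F'_def H_def avoid_avoid)
 have wF': "wgraph lam B F'" unfolding F'_def by (rule wgraph_avoid[OF wH])
 have F'E: "F' <= E" using Suc.prems(1) away_subset[of "{s, a}" F] F' by auto
 have inv: "e \<in> F' \<or> (\<forall>f\<in>F'. disjnt e f)" if e: "e \<in> S" for e
 proof (cases "e = {s, a}")
  case True
  then show ?thesis unfolding F' away_def by simp
 next
  case False
  then have d: "disjnt {s, a} e" using edge_family_disjnt[OF assms(2) sa(3) e] by simp
  show ?thesis
  proof (cases "e \<in> F")
   case True
   then show ?thesis using d by (simp add: F' away_def)
  next
   case False
   then have "\<forall>f\<in>F. disjnt e f" using Suc.prems(2)[OF e] by simp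
   then show ?thesis by (simp add: F' away_def)
  qed
 qed
 define T where "T = (%g. \<Sum>M\<in>matchings (away g H). weight lam M * of_bool (other a g \<in> \<Union>S & short_path S j M (other a g)))"
 have "(\<Sum>M\<in>matchings H. weight lam M * of_bool (short_path S (Suc j) M s)) = (\<Sum>g\<in>inc a H. lam g * T g)"
 proof -
  have "(\<Sum>M\<in>matchings (avoid a H). weight lam M * of_bool (short_path S (Suc j) M s)) = 0"
   by (rule sum.neutral) (auto simp: matchings_def avoid_def a_def)
  moreover have "(\<Sum>M\<in>matchings (away g H). weight lam (insert g M) * of_bool (short_path S (Suc j) (insert g M) s)) = lam g * T g"
   if g: "g \<in> inc a H" for g
   unfolding T_def sum_distrib_left
  proof (rule sum.cong[OF refl])
   fix M assume M: "M \<in> matchings (away g H)"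
   have g2: "g \<in> H" "a \<in> g" "g ~= {}" using g by (auto simp: inc_def)
   have gM: "g \<notin> M" by (rule notin_away[OF g2(3) M])
   have finM: "finite M" using matchings_finite[OF _ M] wgraphD(1)[OF wgraph_away[OF wH]] by blast
   have uniq: "h = g" if "h \<in> insert g M" "a \<in> h" for h
    using that M g2 by (auto simp: matchings_def away_def disjnt_def)
   have "short_path S (Suc j) (insert g M) s \<longleftrightarrow> other a g \<in> \<Union>S & short_path S j (insert g M - {g}) (other a g)"
    unfolding short_path.simps a_def[symmetric] using uniq g2(2) by blast
   moreover have "insert g M - {g} = M" using gM by auto
   ultimately show "weight lam (insert g M) * of_bool (short_path S (Suc j) (insert g M) s)
    = lam g * (weight lam M * of_bool (other a g \<in> \<Union>S & short_path S j M (other a g)))"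
    using weight_insert[OF finM gM, of lam] by simp
  qed
  ultimately show ?thesis unfolding sum_matchings_vertex[OF wgraphD(1)[OF wH], of "%M. weight lam M * of_bool (short_path S (Suc j) M s)" a]
   by simp
 qed
 also have "... <= (\<Sum>g\<in>inc a H. gw a * V (2 * j + 1) (other a g) * Zsum lam F')"
 proof (rule sum_mono)
  fix g assume g: "g \<in> inc a H"
  define y where "y = other a g"
  have g2: "g \<in> F" "g \<in> E" "a \<in> g" "s \<notin> g" using g Suc.prems(1) by (auto simp: inc_def H_def avoid_def)
  have c2: "card g = 2" using wgraphD(2)[OF assms(1) g2(2)] .
  have gy: "g = {a, y}" "y ~= a" unfolding y_def using other_edge[OF c2 g2(3)] by auto
  have aw: "away g H = avoid y F'" unfolding F'_def y_def by (rule away_eq[OF c2 g2(3)])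
  have lam: "lam g = gw a * gw y" unfolding y_def by (rule assms(3)[OF g2(2,3)])
  have ga: "1 <= gw a" using assms(4)[of a] sa(2) by auto
  have Zp: "0 <= Zsum lam F'" using wgraphD(7)[OF wF'] by simp
  have V0: "0 <= V (2 * j + 1) y" by (rule assms(8))
  show "lam g * T g <= gw a * V (2 * j + 1) (other a g) * Zsum lam F'"
  proof (cases "y \<in> \<Union>S")
   case False
   then have "T g = 0" by (simp add: T_def y_def)
   then show ?thesis using ga Zp V0 by (simp add: y_def)
  next
   case True
   have "{y, mate S y} \<in> S" by (rule mate_props(1)[OF assms(2) True])
   moreover have "\<not> disjnt {y, mate S y} g" using gy by (auto simp: disjnt_def)
   ultimately have "{y, mate S y} \<in> F" using Suc.prems(2) g2(1) by blast
   moreover have "{y, mate S y} ~= {s, a}" using gy g2(4) by (auto simp: doubleton_eq_iff)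
   then have "disjnt {s, a} {y, mate S y}" using edge_family_disjnt[OF assms(2) sa(3) \<open>{y, mate S y} \<in> S\<close>] by simp
   ultimately have "{y, mate S y} \<in> F'" by (simp only: F' away_def mem_Collect_eq simp_thms)
   from Suc.IH[OF F'E inv True this] have "gw y * T g <= V (2 * j + 1) y * Zsum lam F'"
    using True by (simp add: T_def aw y_def[symmetric])
   then have "gw a * (gw y * T g) <= gw a * (V (2 * j + 1) y * Zsum lam F')" using ga by (intro mult_left_mono) auto
   then show ?thesis by (simp add: lam y_def[symmetric] mult.assoc)
  qed
 qed
 also have "... = gw a * Zsum lam F' * (\<Sum>g\<in>inc a H. V (2 * j + 1) (other a g))" by (simp add: sum_distrib_left mult_ac)
 finally have main: "(\<Sum>M\<in>matchings H. weight lam M * of_bool (short_path S (Suc j) M s))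
   <= gw a * Zsum lam F' * (\<Sum>g\<in>inc a H. V (2 * j + 1) (other a g))" .
 have gs: "1 <= gw s" "1 <= gw a" using assms(4)[of s] assms(4)[of a] sa(2) by auto
 \<comment> \<open>One round of the trip uses two rounds of \<open>V\<close>: the sum over the
   neighbours of \<open>a\<close>, then the passage from \<open>a\<close> to
   \<open>s\<close>.\<close>
 have Vs: "(\<Sum>g\<in>inc a H. V (2 * j + 1) (other a g)) <= V (2 * Suc j + 1) s"
 proof -
  have "(\<Sum>g\<in>inc a H. V (2 * j + 1) (other a g)) <= (\<Sum>g\<in>inc a E. V (2 * j + 1) (other a g))"
   using assms(8) Suc.prems(1) wgraphD(1)[OF assms(1)] by (intro sum_mono2) (auto simp: inc_def H_def avoid_def)
  also have "... <= V (Suc (2 * j + 1)) a" by (rule assms(7))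
  also have "... <= V (Suc (Suc (2 * j + 1))) s" using assms(6)[OF sa(2), of s "Suc (2 * j + 1)"] oth by simp
  finally show ?thesis by simp
 qed
 have Vn: "0 <= (\<Sum>g\<in>inc a H. V (2 * j + 1) (other a g))" using assms(8) by (intro sum_nonneg)
 have Zl: "lam {s, a} * Zsum lam F' <= Zsum lam F"
  using edge_prob_le(1)[OF w sa(1)] wgraphD(7)[OF w] by (simp add: edge_prob_def F')
 have lam: "lam {s, a} = gw s * gw a" using assms(3)[OF sa(2), of s] oth by simp
 have "gw s * (\<Sum>M\<in>matchings H. weight lam M * of_bool (short_path S (Suc j) M s))
   <= gw s * (gw a * Zsum lam F' * (\<Sum>g\<in>inc a H. V (2 * j + 1) (other a g)))"
  using main gs by (intro mult_left_mono) auto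
 also have "... = lam {s, a} * Zsum lam F' * (\<Sum>g\<in>inc a H. V (2 * j + 1) (other a g))" by (simp add: lam)
 also have "... <= Zsum lam F * V (2 * Suc j + 1) s"
  using Zl Vs Vn wgraphD(7)[OF w] by (intro mult_mono) auto
 finally show ?case by (simp add: H_def mult.commute)
qed

section \<open>Vertex weights, approximation and sensitivity\<close>

text \<open>Summing over both ends of an edge, \<open>u\<close> itself included, makes the values
  nondecreasing in the number of rounds. The value after \<open>j\<close> rounds depends only on
  edges near \<open>u\<close>, which the sensitivity bound exploits.\<close>

primrec vwt :: "nat set set => nat => nat => nat" where
 "vwt E 0 u = 0"
| "vwt E (Suc j) u = (\<Sum>e\<in>inc u E. 1 + (\<Sum>v\<in>e. vwt E j v))"

definition edge_wt :: "nat => nat set set => nat set => nat" where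
 "edge_wt k E e = (\<Prod>v\<in>e. k\<^sup>2 * vwt E (2 * k) v)"

text \<open>The truncation at \<open>1\<close> only affects sets that are not edges.\<close>

definition lamw :: "nat => nat set set => nat set => real" where
 "lamw k E e = max 1 (real (edge_wt k E e))"

text \<open>Without these edges a deletion that lowers the maximum degree from 2 to 1 would turn
  many random decisions about isolated edges into deterministic ones all over the graph.\<close>

definition iso_edges :: "nat set set => nat set set" where
 "iso_edges E = {e \<in> E. \<forall>f\<in>E. f ~= e \<longrightarrow> disjnt e f}"

text \<open>For maximum degree 1 the sensitivity may be at most a power of 1. Returning
  \<open>E\<close> meets this exactly, since deleting an edge changes the answer by that edge
  only.\<close>

definition alg :: "nat => (nat => nat set set => nat) => nat => nat set set => nat set set pmf" where
 "alg k T n E = (if max_degree n E <= 1 then return_pmf E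
   else map_pmf (%M. M Un iso_edges E) (glauber (edge_wt k E) E (T n E)))"

text \<open>An upper bound for one plus the weighted degree. There are at most \<open>D\<close>
  edges of weight at most \<open>k ^ 4 * (2 * D + 1) ^ (4 * k)\<close> at a vertex, where
  \<open>k ^ 4 <= (D + 1) ^ (4 * k)\<close> and \<open>2 * D + 1 <= (D + 1) ^ 2\<close>; this makes
  \<open>12 * k + 1 <= 14 * k\<close>.\<close>

definition Qn :: "nat => nat => nat" where "Qn k D = (D + 1) ^ (14 * k)"

section \<open>Bounds on degrees and weights\<close>

lemma simple_graphD:
 assumes "simple_graph n E"
 shows "finite E" "!!e. e \<in> E ==> card e = 2" "!!e. e \<in> E ==> e <= {..<n}" "\<Union>E <= {..<n}"
proof -
 have "E <= Pow {..<n}" using assms by (auto simp: simple_graph_def)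
 then show "finite E" by (rule finite_subset) simp
qed (use assms in \<open>auto simp: simple_graph_def\<close>)

lemma simple_graph_subset: "simple_graph n E ==> F <= E ==> simple_graph n F"
 by (auto simp: simple_graph_def)

lemma card_inc_le_max_degree:
 assumes "simple_graph n E" shows "card (inc u E) <= max_degree n E"
proof (cases "u < n")
 case True
 then have "vertex_degree E u <= max_degree n E" unfolding max_degree_def by (intro Max_ge) auto
 then show ?thesis by (simp add: vertex_degree_def inc_def)
next
 case False
 then have "inc u E = {}" using simple_graphD(3)[OF assms] by (auto simp: inc_def)
 then show ?thesis by simp
qed

lemma max_degree_mono: assumes "simple_graph n E" "F <= E" shows "max_degree n F <= max_degree n E"
proof -
 have "vertex_degree F u <= vertex_degree E u" for u
  unfolding vertex_degree_def using assms(2) simple_graphD(1)[OF assms(1)] by (intro card_mono) auto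
 moreover have "vertex_degree E u <= max_degree n E" if "u < n" for u
  unfolding max_degree_def using that by (intro Max_ge) auto
 ultimately show ?thesis unfolding max_degree_def[of n F] by (intro Max.boundedI) (auto intro: order_trans)
qed

lemma vwt_edge: assumes "card e = 2" "x \<in> e" shows "(\<Sum>v\<in>e. f v) = f x + (f (other x e) :: nat)"
proof -
 have "e = {x, other x e}" "x ~= other x e" using other_edge[OF assms] by auto
 then show ?thesis by (metis (no_types) sum.insert finite.emptyI finite_insert insertE empty_iff sum.empty add.right_neutral)
qed

lemma vwt_props:
 assumes "simple_graph n E"
 shows "e \<in> E ==> x \<in> e ==> vwt E j (other x e) <= vwt E (Suc j) x"
  "(\<Sum>e\<in>inc x E. vwt E j (other x e)) <= vwt E (Suc j) x"
  "x \<in> \<Union>E ==> 1 <= vwt E (Suc j) x"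
  "vwt E j x <= vwt E (Suc j) x" "vwt E 1 x = card (inc x E)"
  "vwt E j x + 1 <= (2 * max_degree n E + 1) ^ j"
proof -
 note g = simple_graphD[OF assms]
 have fi: "finite (inc x E)" for x using g(1) by (simp add: inc_def)
 have trm: "1 + (\<Sum>v\<in>e. vwt E j v) <= vwt E (Suc j) x" if "e \<in> E" "x \<in> e" for e x j
 proof -
  have "e \<in> inc x E" using that by (simp add: inc_def)
  then show ?thesis unfolding vwt.simps using fi[of x] by (intro member_le_sum) auto
 qed
 show "vwt E j (other x e) <= vwt E (Suc j) x" if "e \<in> E" "x \<in> e"
  using trm[OF that, of j] vwt_edge[OF g(2)[OF that(1)] that(2), of "vwt E j"] by linarith
 show "1 <= vwt E (Suc j) x" if "x \<in> \<Union>E"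
 proof -
  from that obtain e where "e \<in> E" "x \<in> e" by blast
  from trm[OF this, of j] show ?thesis by linarith
 qed
 have "(\<Sum>e\<in>inc x E. vwt E j (other x e)) <= (\<Sum>e\<in>inc x E. 1 + (\<Sum>v\<in>e. vwt E j v))"
 proof (rule sum_mono)
  fix e assume "e \<in> inc x E"
  then have "card e = 2" "x \<in> e" using g(2) by (auto simp: inc_def)
  from vwt_edge[OF this, of "vwt E j"] show "vwt E j (other x e) <= 1 + (\<Sum>v\<in>e. vwt E j v)" by linarith
 qed
 then show "(\<Sum>e\<in>inc x E. vwt E j (other x e)) <= vwt E (Suc j) x" by simp
 show "vwt E j x <= vwt E (Suc j) x"
 proof (cases "inc x E = {}")
  case True
  then have "vwt E j x = 0" by (cases j) auto
  then show ?thesis by simp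
 next
  case False
  then obtain e where e: "e \<in> E" "x \<in> e" by (auto simp: inc_def)
  from trm[OF this, of j] vwt_edge[OF g(2)[OF e(1)] e(2), of "vwt E j"] show ?thesis by linarith
 qed
 show "vwt E 1 x = card (inc x E)" by simp
 define D where "D = max_degree n E"
 show "vwt E j x + 1 <= (2 * max_degree n E + 1) ^ j"
 proof (induction j arbitrary: x)
  case (Suc j)
  define m where "m = (2 * D + 1) ^ j"
  have m: "vwt E j v + 1 <= m" for v using Suc by (simp add: m_def D_def)
  have "vwt E (Suc j) x <= (\<Sum>e\<in>inc x E. 2 * m)"
   unfolding vwt.simps
  proof (rule sum_mono)
   fix e assume "e \<in> inc x E"
   then have "card e = 2" "x \<in> e" using g(2) by (auto simp: inc_def)
   from vwt_edge[OF this, of "vwt E j"] m[of x] m[of "other x e"] show "1 + (\<Sum>v\<in>e. vwt E j v) <= 2 * m" by linarith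
  qed
  also have "... = card (inc x E) * (2 * m)" by simp
  also have "... <= D * (2 * m)" using card_inc_le_max_degree[OF assms] by (intro mult_right_mono) (auto simp: D_def)
  finally have "vwt E (Suc j) x + 1 <= D * (2 * m) + m" using m[of x] by linarith
  also have "... = (2 * D + 1) ^ Suc j" by (simp add: m_def algebra_simps)
  finally show ?case by (simp add: D_def)
 qed simp
qed

lemma vwt_mono: assumes "simple_graph n E" "i <= j" shows "vwt E i x <= vwt E j x"
 using assms(2)
proof (induction j rule: dec_induct)
 case (step j)
 then show ?case using vwt_props(4)[OF assms(1), of j x] by linarith
qed simp

lemma edge_wt_edge: assumes "simple_graph n E" "e \<in> E" "x \<in> e"
 shows "edge_wt k E e = (k\<^sup>2 * vwt E (2 * k) x) * (k\<^sup>2 * vwt E (2 * k) (other x e))"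
proof -
 have "e = {x, other x e}" "x ~= other x e" using other_edge[OF simple_graphD(2)[OF assms(1,2)] assms(3)] by auto
 then show ?thesis unfolding edge_wt_def by (metis (no_types, lifting) prod.insert finite.emptyI finite_insert insertE empty_iff prod.empty mult_1_right)
qed

lemma gw_ge: assumes "simple_graph n E" "1 <= k" "x \<in> \<Union>E" shows "1 <= k\<^sup>2 * vwt E (2 * k) x"
proof -
 obtain j where j: "2 * k = Suc j" using assms(2) by (cases "2 * k") auto
 have "1 <= vwt E (2 * k) x" unfolding j by (rule vwt_props(3)[OF assms(1,3)])
 moreover have "1 <= k\<^sup>2" using assms(2) by simp
 ultimately show ?thesis by simp
qed

lemma lamw_edge: assumes "simple_graph n E" "1 <= k" "e \<in> E"
 shows "lamw k E e = real (edge_wt k E e)" "1 <= edge_wt k E e"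
proof -
 obtain x where x: "x \<in> e" using simple_graphD(2)[OF assms(1,3)] by fastforce
 have "other x e \<in> e" using other_edge(1)[OF simple_graphD(2)[OF assms(1,3)] x] by auto
 then have "x \<in> \<Union>E" "other x e \<in> \<Union>E" using x assms(3) by auto
 then have "1 * 1 <= (k\<^sup>2 * vwt E (2 * k) x) * (k\<^sup>2 * vwt E (2 * k) (other x e))"
  using gw_ge[OF assms(1,2)] by (intro mult_mono) auto
 then show "1 <= edge_wt k E e" unfolding edge_wt_edge[OF assms(1,3) x] by simp
 then show "lamw k E e = real (edge_wt k E e)" by (simp add: lamw_def)
qed

lemma edge_wt_le: assumes "simple_graph n E" "e \<in> E"
 shows "edge_wt k E e <= k ^ 4 * (2 * max_degree n E + 1) ^ (4 * k)"
proof -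
 obtain x where x: "x \<in> e" using simple_graphD(2)[OF assms] by fastforce
 define m where "m = (2 * max_degree n E + 1) ^ (2 * k)"
 have v: "vwt E (2 * k) y <= m" for y using vwt_props(6)[OF assms(1), of "2 * k" y] by (simp add: m_def)
 have "edge_wt k E e <= (k\<^sup>2 * m) * (k\<^sup>2 * m)"
  unfolding edge_wt_edge[OF assms x] using v by (intro mult_mono) auto
 also have "... = k ^ 4 * (m * m)" by (simp add: power_numeral_reduce)
 also have "m * m = (2 * max_degree n E + 1) ^ (4 * k)" by (simp add: m_def power_add[symmetric])
 finally show ?thesis .
qed

lemma Qn_bound:
 assumes "1 <= k" "1 <= D"
 shows "D * (k ^ 4 * (2 * D + 1) ^ (4 * k)) + 1 <= Qn k D" "(2 * D + 3) ^ (2 * k) <= Qn k D" "D + 1 <= Qn k D" "2 ^ 14 <= Qn k D"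
proof -
 define d where "d = D + 1"
 have d: "2 <= d" using assms by (simp add: d_def)
 have "k ^ 4 <= (2 ^ k) ^ 4" using less_exp[of k] by (intro power_mono) auto
 also have "... = 2 ^ (4 * k)" by (simp add: power_mult[symmetric] mult.commute)
 also have "... <= d ^ (4 * k)" using d by (intro power_mono) auto
 finally have k4: "k ^ 4 <= d ^ (4 * k)" .
 have "2 * D + 1 <= d ^ 2" by (simp add: d_def power2_eq_square)
 then have "(2 * D + 1) ^ (4 * k) <= (d ^ 2) ^ (4 * k)" by (intro power_mono) auto
 also have "... = d ^ (8 * k)" by (simp add: power_mult[symmetric])
 finally have "k ^ 4 * (2 * D + 1) ^ (4 * k) <= d ^ (4 * k) * d ^ (8 * k)" using k4 by (intro mult_mono) auto
 also have "... = d ^ (12 * k)" by (simp add: power_add[symmetric])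
 finally have "D * (k ^ 4 * (2 * D + 1) ^ (4 * k)) + 1 <= D * d ^ (12 * k) + d ^ (12 * k)"
  using d by (intro add_mono mult_left_mono) auto
 also have "... = d ^ (12 * k + 1)" by (simp add: d_def algebra_simps)
 also have "... <= d ^ (14 * k)" using d assms by (intro power_increasing) auto
 finally show "D * (k ^ 4 * (2 * D + 1) ^ (4 * k)) + 1 <= Qn k D" by (simp add: Qn_def d_def)
 have "2 * D + 3 <= 4 * d" by (simp add: d_def)
 also have "... <= d ^ 2 * d" using power_mono[OF d, of 2] by (intro mult_right_mono) auto
 also have "... = d ^ 3" by (simp add: power_numeral_reduce)
 finally have "(2 * D + 3) ^ (2 * k) <= (d ^ 3) ^ (2 * k)" by (intro power_mono) auto
 also have "... = d ^ (6 * k)" by (simp add: power_mult[symmetric])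
 also have "... <= d ^ (14 * k)" using d by (intro power_increasing) auto
 finally show "(2 * D + 3) ^ (2 * k) <= Qn k D" by (simp add: Qn_def d_def)
 have "d ^ 1 <= d ^ (14 * k)" using d assms by (intro power_increasing) auto
 then show "D + 1 <= Qn k D" by (simp add: Qn_def d_def)
 have "(2::nat) ^ 14 <= d ^ 14" using d by (intro power_mono) auto
 also have "... <= d ^ (14 * k)" using d assms by (intro power_increasing) auto
 finally show "2 ^ 14 <= Qn k D" by (simp add: Qn_def d_def)
qed

lemma wgraph_lamw:
 assumes "simple_graph n E" "1 <= k" "max_degree n E <= D" "1 <= D"
 shows "wgraph (lamw k E) (real (Qn k D) - 1) E"
proof -
 note g = simple_graphD[OF assms(1)]
 have "(\<Sum>e\<in>inc x E. lamw k E e) <= real (Qn k D) - 1" for x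
 proof -
  have "(\<Sum>e\<in>inc x E. lamw k E e) = (\<Sum>e\<in>inc x E. real (edge_wt k E e))"
   by (intro sum.cong refl) (auto simp: inc_def lamw_edge[OF assms(1,2)])
  also have "... = real (\<Sum>e\<in>inc x E. edge_wt k E e)" by simp
  also have "(\<Sum>e\<in>inc x E. edge_wt k E e) <= (\<Sum>e\<in>inc x E. k ^ 4 * (2 * D + 1) ^ (4 * k))"
  proof (rule sum_mono)
   fix e assume "e \<in> inc x E"
   then have "edge_wt k E e <= k ^ 4 * (2 * max_degree n E + 1) ^ (4 * k)" using edge_wt_le[OF assms(1)] by (simp add: inc_def)
   also have "... <= k ^ 4 * (2 * D + 1) ^ (4 * k)" using assms(3) by (intro mult_left_mono power_mono) auto
   finally show "edge_wt k E e <= k ^ 4 * (2 * D + 1) ^ (4 * k)" .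
  qed
  also have "... = card (inc x E) * (k ^ 4 * (2 * D + 1) ^ (4 * k))" by simp
  also have "... <= D * (k ^ 4 * (2 * D + 1) ^ (4 * k))"
   using card_inc_le_max_degree[OF assms(1), of x] assms(3) by (intro mult_right_mono) auto
  finally show ?thesis using Qn_bound(1)[OF assms(2,4)] by linarith
 qed
 moreover have "0 <= real (Qn k D) - 1" using Qn_bound(3)[OF assms(2,4)] by simp
 moreover have "0 < lamw k E e" for e by (simp add: lamw_def less_max_iff_disj)
 ultimately show ?thesis using g by (simp add: wgraph_def)
qed

section \<open>Approximation ratio\<close>

lemma matchings_is_matching: "matchings E = {M. is_matching E M}"
 by (auto simp: matchings_def is_matching_def)

lemma matching_number_props:
 assumes "finite E"
 shows "M \<in> matchings E ==> card M <= matching_number E" "\<exists>M\<in>matchings E. card M = matching_number E"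
proof -
 have fin: "finite (card ` matchings E)" using assms by simp
 show "card M <= matching_number E" if "M \<in> matchings E"
  unfolding matching_number_def matchings_is_matching[symmetric] using fin that by (intro Max_ge) auto
 have "matchings E ~= {}" using empty_matching[of E] by blast
 then have "Max (card ` matchings E) \<in> card ` matchings E" using fin by (intro Max_in) auto
 then show "\<exists>M\<in>matchings E. card M = matching_number E"
  unfolding matching_number_def matchings_is_matching[symmetric] by auto
qed

lemma matching_edge_family: "simple_graph n E ==> M \<in> matchings E ==> edge_family M"
 using simple_graphD(1,2)[of n E] matchings_finite[of E M] by (auto simp: edge_family_def matchings_def)

lemma card_matching_le: assumes "simple_graph n E" "M \<in> matchings E" shows "2 * card M <= n"
proof -
 note f = matching_edge_family[OF assms]
 have "\<Union>M <= {..<n}" using assms simple_graphD(4)[OF assms(1)] by (auto simp: matchings_def)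
 then have "card (\<Union>M) <= card {..<n}" by (intro card_mono) auto
 then show ?thesis using card_Union_edge_family(1)[OF f] by simp
qed

text \<open>For each length the path probability is at most
  \<open>V (2 * j + 1) s / gw s <= 1 / k\<^sup>2\<close>. Over twice \<open>\<nu>\<close> vertices
  and \<open>k\<close> lengths, \<open>matching_deficit\<close> then receives
  \<open>2 * \<nu>\<close> from short paths and as much from long walks, a relative loss of
  \<open>2 / k\<close>.\<close>

lemma gibbs_matching_size:
 assumes "simple_graph n E" "1 <= k" "wgraph (lamw k E) B E"
 shows "(1 - 2 / real k) * real (matching_number E) <= gex (lamw k E) E (%M. real (card M))"
proof -
 note g = simple_graphD[OF assms(1)] and w = assms(3)
 define lam where "lam = lamw k E"
 define \<nu> where "\<nu> = real (matching_number E)"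
 obtain S where S: "S \<in> matchings E" "card S = matching_number E" using matching_number_props(2)[OF g(1)] by blast
 have fS: "edge_family S" by (rule matching_edge_family[OF assms(1) S(1)])
 have k0: "0 < real k" using assms(2) by simp
 define gw where "gw x = real (k\<^sup>2 * vwt E (2 * k) x)" for x
 define V where "V j x = real (vwt E j x)" for j x
 have prob: "gex lam E (%M. of_bool (s \<notin> \<Union>M & short_path S j M s)) <= 1 / (real k)\<^sup>2" if s: "s \<in> \<Union>S" and j: "j < k" for s j
 proof -
  have sE: "s \<in> \<Union>E" using s S(1) by (auto simp: matchings_def)
  have "gw s * (\<Sum>M\<in>matchings (avoid s E). weight lam M * of_bool (short_path S j M s)) <= V (2 * j + 1) s * Zsum lam E"
  proof (rule vertex_weight_recursion[where B = B and E = E, OF w[folded lam_def] fS])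
   show "lam e = gw x * gw (other x e)" if "e \<in> E" "x \<in> e" for e x
    using that by (simp add: lam_def lamw_edge(1)[OF assms(1,2)] edge_wt_edge[OF assms(1)] gw_def)
   show "1 <= gw x" if "x \<in> \<Union>E" for x using gw_ge[OF assms(1,2) that] by (simp add: gw_def flip: of_nat_mult of_nat_power)
   show "1 <= V 1 x" if "x \<in> \<Union>E" for x using vwt_props(3)[OF assms(1) that, of 0] by (simp add: V_def)
   show "V j (other x e) <= V (Suc j) x" if "e \<in> E" "x \<in> e" for j e x
    using vwt_props(1)[OF assms(1) that, of j] unfolding V_def by (simp only: of_nat_le_iff)
   show "(\<Sum>e\<in>inc x E. V j (other x e)) <= V (Suc j) x" for j x
    using vwt_props(2)[OF assms(1), where x = x and j = j] unfolding V_def by (simp only: of_nat_sum[symmetric] of_nat_le_iff)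
   show "0 <= V j x" for j x by (simp add: V_def)
   show "e \<in> E \<or> (\<forall>f\<in>E. disjnt e f)" if "e \<in> S" for e using that S(1) by (auto simp: matchings_def)
   show "{s, mate S s} \<in> E" using mate_props(1)[OF fS s] S(1) by (auto simp: matchings_def)
  qed (use s in auto)
  moreover have "(\<Sum>M\<in>matchings E. weight lam M * of_bool (s \<notin> \<Union>M & short_path S j M s)) = (\<Sum>M\<in>matchings (avoid s E). weight lam M * of_bool (short_path S j M s))"
   using g(1) by (intro sum.mono_neutral_cong_right) (auto simp: matchings_def avoid_def)
  ultimately have 1: "gw s * (\<Sum>M\<in>matchings E. weight lam M * of_bool (s \<notin> \<Union>M & short_path S j M s)) <= V (2 * j + 1) s * Zsum lam E"
   by simp
  \<comment> \<open>Lengths \<open>j < k\<close> need the weights up to round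
    \<open>2 * k - 1\<close>; this is why \<open>edge_wt\<close> uses \<open>2 * k\<close>
    rounds.\<close>
  have Vle: "V (2 * j + 1) s <= V (2 * k) s" unfolding V_def using vwt_mono[OF assms(1), of "2 * j + 1" "2 * k" s] j by (simp del: vwt.simps of_nat_sum add: of_nat_le_iff)
  have Z: "0 < Zsum lam E" using wgraphD(7)[OF w] by (simp add: lam_def)
  have "V (2 * j + 1) s * Zsum lam E <= V (2 * k) s * Zsum lam E" using Vle Z by (intro mult_right_mono) auto
  then have "gw s * (\<Sum>M\<in>matchings E. weight lam M * of_bool (s \<notin> \<Union>M & short_path S j M s)) <= V (2 * k) s * Zsum lam E"
   using 1 by linarith
  moreover have "gw s = (real k)\<^sup>2 * V (2 * k) s" by (simp add: gw_def V_def)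
  moreover have "0 < V (2 * k) s"
   using gw_ge[OF assms(1,2) sE] by (simp add: V_def Suc_le_eq)
  ultimately have "(real k)\<^sup>2 * (\<Sum>M\<in>matchings E. weight lam M * of_bool (s \<notin> \<Union>M & short_path S j M s)) <= Zsum lam E"
   by (simp add: mult.assoc mult.left_commute[of _ "V (2 * k) s"])
  then show ?thesis unfolding gex_def using Z k0 by (simp add: field_simps)
 qed
 define c where "c = gex lam E (%M. real (card M))"
 have w': "wgraph lam B E" using w by (simp add: lam_def)
 have c\<nu>: "c <= \<nu>"
 proof -
  have "c <= gex lam E (%_. \<nu>)" unfolding c_def \<nu>_def using matching_number_props(1)[OF g(1)] by (intro gex_mono[OF w']) auto
  then show ?thesis by (simp add: gex_const[OF w'])
 qed
 have "gex lam E (%M. 2 * real k * (real (card S) - real (card M))) <= gex lam E (%M. 2 * real (card M)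
   + real k * (\<Sum>s\<in>\<Union>S. \<Sum>j<k. of_bool (s \<notin> \<Union>M & short_path S j M s)))"
  using assms(2) by (intro gex_mono[OF w'] matching_deficit[OF fS matching_edge_family[OF assms(1)]]) auto
 also have "... = 2 * c + real k * (\<Sum>s\<in>\<Union>S. \<Sum>j<k. gex lam E (%M. of_bool (s \<notin> \<Union>M & short_path S j M s)))"
  by (simp only: gex_add gex_cmult gex_sum c_def)
 also have "... <= 2 * \<nu> + real k * (\<Sum>s\<in>\<Union>S. \<Sum>j<k. 1 / (real k)\<^sup>2)"
  using c\<nu> by (intro add_mono mult_left_mono sum_mono prob) auto
 also have "(\<Sum>s\<in>\<Union>S. \<Sum>j<k. 1 / (real k)\<^sup>2) = 2 * \<nu> * (real k * (1 / (real k)\<^sup>2))"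
  using card_Union_edge_family(1)[OF fS] S(2) by (simp add: \<nu>_def)
 also have "real k * (2 * \<nu> * (real k * (1 / (real k)\<^sup>2))) = 2 * \<nu>" using k0 by (simp add: power2_eq_square)
 also have "gex lam E (%M. 2 * real k * (real (card S) - real (card M))) = 2 * real k * (\<nu> - c)"
  by (simp only: gex_cmult gex_diff gex_const[OF w'] c_def S(2) \<nu>_def)
 finally have "real k * (\<nu> - c) <= 2 * \<nu>" by simp
 then have "\<nu> - c <= 2 * \<nu> / real k" using k0 by (simp add: field_simps)
 then show ?thesis by (simp add: \<nu>_def[symmetric] c_def lam_def algebra_simps)
qed

text \<open>The error \<open>1 / (n * k)\<close> is multiplied by at most \<open>n\<close>, the
  largest possible difference of two matchings. The resulting \<open>1 / k\<close> is within a
  relative loss \<open>1 / k\<close> because a graph with an edge has matching number at least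
  1.\<close>

lemma glauber_size:
 assumes "simple_graph n E" "1 <= k" "E ~= {}"
  and mix: "gex (lamw k E) E (%M. \<bar>glauber_density (lamw k E) E t M - 1\<bar>) <= 1 / (real n * real k)"
 shows "set_pmf (glauber (edge_wt k E) E t) <= matchings E"
  "(1 - 3 / real k) * real (matching_number E) <= measure_pmf.expectation (glauber (edge_wt k E) E t) (%M. real (card M))"
  "couple (glauber (edge_wt k E) E t) (gibbs (lamw k E) E) 1"
proof -
 note g = simple_graphD[OF assms(1)]
 define D where "D = max 1 (max_degree n E)"
 define lam where "lam = lamw k E"
 define f where "f = glauber_density lam E t"
 define \<mu> where "\<mu> = glauber (edge_wt k E) E t"
 define \<delta> where "\<delta> = 1 / (real n * real k)"
 have w: "wgraph lam (real (Qn k D) - 1) E" unfolding lam_def using assms(2) by (intro wgraph_lamw[OF assms(1)]) (auto simp: D_def)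
 have d: "density_of lam E \<mu> f" unfolding f_def \<mu>_def
  by (rule glauber_density_props(3)[OF w assms(3)]) (simp add: lam_def lamw_edge[OF assms(1,2)])
 then show sub: "set_pmf (glauber (edge_wt k E) E t) <= matchings E" by (simp add: density_of_def \<mu>_def)
 obtain e where e: "e \<in> E" using assms(3) by blast
 then obtain x where "x \<in> e" using g(2) by fastforce
 then have n0: "0 < n" using g(3)[OF e] by auto
 have n\<delta>: "\<delta> * real n = 1 / real k" using n0 by (simp add: \<delta>_def)
 have "couple \<mu> (gibbs lam E) (\<delta> * real n)"
 proof (rule couple_density[OF w d])
  show "gex lam E (%M. \<bar>f M - 1\<bar>) <= \<delta>" using mix by (simp add: lam_def f_def \<delta>_def)
  fix M N assume M: "M \<in> matchings E" and N: "N \<in> matchings E"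
  have fin: "finite M" "finite N" using matchings_finite[OF g(1)] M N by auto
  have "card (sym_diff M N) <= card (M Un N)" using fin by (intro card_mono) auto
  also have "... <= card M + card N" by (rule card_Un_le)
  also have "... <= n" using card_matching_le[OF assms(1) M] card_matching_le[OF assms(1) N] by linarith
  finally show "real (card (sym_diff M N)) <= real n" by simp
 qed simp
 then show "couple (glauber (edge_wt k E) E t) (gibbs (lamw k E) E) 1"
  unfolding n\<delta> \<mu>_def lam_def using assms(2) by (elim couple_mono) simp
 have "measure_pmf.expectation \<mu> (%M. real (card M)) = (\<Sum>M\<in>matchings E. real (card M) * pmf \<mu> M)"
  using sub g(1) by (intro integral_measure_pmf_real) (auto simp: \<mu>_def)
 also have "... = gex lam E (%M. f M * real (card M))"
  using d by (auto simp: gex_def density_of_def sum_divide_distrib intro!: sum.cong)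
 also have "... \<ge> gex lam E (%M. real (card M) - \<bar>f M - 1\<bar> * real n)"
 proof (rule gex_mono[OF w])
  fix M assume M: "M \<in> matchings E"
  have "(1 - f M) * real (card M) <= \<bar>f M - 1\<bar> * real n"
   using card_matching_le[OF assms(1) M] by (intro mult_mono) auto
  then show "real (card M) - \<bar>f M - 1\<bar> * real n <= f M * real (card M)" by (simp add: algebra_simps)
 qed
 also have "gex lam E (%M. real (card M) - \<bar>f M - 1\<bar> * real n) = gex lam E (%M. real (card M)) - real n * gex lam E (%M. \<bar>f M - 1\<bar>)"
  by (simp only: gex_diff gex_cmult mult.commute[of _ "real n"])
 finally have 1: "gex lam E (%M. real (card M)) - real n * gex lam E (%M. \<bar>f M - 1\<bar>) <= measure_pmf.expectation \<mu> (%M. real (card M))" .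
 have "real n * gex lam E (%M. \<bar>f M - 1\<bar>) <= real n * \<delta>"
  using mix by (intro mult_left_mono) (auto simp: lam_def f_def \<delta>_def)
 also have "... = 1 / real k" using n\<delta> by (simp add: mult.commute)
 also have "... <= real (matching_number E) / real k"
 proof -
  have "{e} \<in> matchings E" using e by (auto simp: matchings_def)
  from matching_number_props(1)[OF g(1) this] show ?thesis using assms(2) by (simp add: divide_right_mono)
 qed
 finally have 2: "real n * gex lam E (%M. \<bar>f M - 1\<bar>) <= real (matching_number E) / real k" .
 have "(1 - 3 / real k) * real (matching_number E) = (1 - 2 / real k) * real (matching_number E) - real (matching_number E) / real k"
  by (simp add: field_simps)
 then show "(1 - 3 / real k) * real (matching_number E) <= measure_pmf.expectation (glauber (edge_wt k E) E t) (%M. real (card M))"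
  using 1 2 gibbs_matching_size[OF assms(1,2) w[unfolded lam_def]] unfolding lam_def \<mu>_def by linarith
qed

lemma iso_edges_matching: assumes "M \<in> matchings E" shows "M Un iso_edges E \<in> matchings E"
 using assms unfolding matchings_def iso_edges_def pairwise_def by (auto simp: disjnt_sym)

lemma iso_edges_all: assumes "simple_graph n E" "max_degree n E <= 1" shows "iso_edges E = E"
proof -
 have "disjnt e f" if "e \<in> E" "f \<in> E" "f ~= e" for e f
 proof (rule ccontr)
  assume "\<not> disjnt e f"
  then obtain x where "x \<in> e" "x \<in> f" by (auto simp: disjnt_def)
  then have "{e, f} <= inc x E" using that by (auto simp: inc_def)
  then have "card {e, f} <= card (inc x E)" using simple_graphD(1)[OF assms(1)] by (intro card_mono) (auto simp: inc_def)
  then show False using that card_inc_le_max_degree[OF assms(1), of x] assms(2) by simp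
 qed
 then show ?thesis by (auto simp: iso_edges_def)
qed

lemma E_matching_if_degree_le_1: assumes "simple_graph n E" "max_degree n E <= 1" shows "E \<in> matchings E"
 using iso_edges_matching[OF empty_matching, of E] iso_edges_all[OF assms] by simp

definition mixed :: "nat => (nat => nat set set => nat) => bool" where
 "mixed k T \<longleftrightarrow> (\<forall>n E. simple_graph n E \<longrightarrow> 2 <= max_degree n E \<longrightarrow>
   gex (lamw k E) E (%M. \<bar>glauber_density (lamw k E) E (T n E) M - 1\<bar>) <= 1 / (real n * real k))"

lemma max_degree_empty: "max_degree n {} = 0"
proof -
 have "insert 0 (vertex_degree {} ` {..<n}) = {0}" by (auto simp: vertex_degree_def)
 then show ?thesis unfolding max_degree_def by (simp only: Max_singleton)
qed

lemma alg_approximates: assumes "1 <= k" "mixed k T" shows "approximates_matching (1 - 3 / real k) (alg k T)"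
 unfolding approximates_matching_def
proof (intro allI impI)
 fix n E assume E: "simple_graph n E"
 note g = simple_graphD[OF E]
 show "(\<forall>M\<in>set_pmf (alg k T n E). is_matching E M) &
   (1 - 3 / real k) * real (matching_number E) <= measure_pmf.expectation (alg k T n E) (%M. real (card M))"
 proof (cases "max_degree n E <= 1")
  case True
  have m: "E \<in> matchings E" by (rule E_matching_if_degree_le_1[OF E True])
  obtain S where S: "S \<in> matchings E" "card S = matching_number E" using matching_number_props(2)[OF g(1)] by blast
  have "card S <= card E" using S(1) g(1) by (intro card_mono) (auto simp: matchings_def)
  then have "(1 - 3 / real k) * real (matching_number E) <= 1 * real (card E)"
   using S(2) by (intro mult_mono) auto
  then show ?thesis using True m by (simp add: alg_def matchings_is_matching)
 next
  case False
  then have E0: "E ~= {}" using max_degree_empty by auto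
  define \<mu> where "\<mu> = glauber (edge_wt k E) E (T n E)"
  have a: "alg k T n E = map_pmf (%M. M Un iso_edges E) \<mu>" using False by (simp add: alg_def \<mu>_def)
  have mix: "gex (lamw k E) E (%M. \<bar>glauber_density (lamw k E) E (T n E) M - 1\<bar>) <= 1 / (real n * real k)"
   using assms(2) E False by (auto simp: mixed_def)
  note s = glauber_size[OF E assms(1) E0 mix, folded \<mu>_def]
  have fin: "finite (set_pmf \<mu>)" by (rule finite_subset[OF s(1)]) (use g(1) in simp)
  have "measure_pmf.expectation \<mu> (%M. real (card M)) <= measure_pmf.expectation \<mu> (%M. real (card (M Un iso_edges E)))"
  proof (rule integral_mono_AE)
   have "finite (M Un iso_edges E)" if "M \<in> set_pmf \<mu>" for M
    using that s(1) g(1) matchings_finite[OF g(1), of M] by (auto simp: iso_edges_def)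
   then show "AE M in measure_pmf \<mu>. real (card M) <= real (card (M Un iso_edges E))"
    by (auto simp: AE_measure_pmf_iff intro!: card_mono)
  qed (auto intro!: integrable_measure_pmf_finite fin)
  then show ?thesis using s(1,2) iso_edges_matching[of _ E] by (auto simp: a matchings_is_matching)
 qed
qed

text \<open>Both branches of \<open>alg\<close> take a common form: if all edges are isolated, the
  union with \<open>iso_edges E\<close> is \<open>E\<close> whatever the Gibbs sample is. So the
  sensitivity argument need not ask which branch the smaller graph takes.\<close>

lemma alg_gibbs:
 assumes "simple_graph n E" "1 <= k" "mixed k T"
 shows "couple (alg k T n E) (map_pmf (%M. M Un iso_edges E) (gibbs (lamw k E) E)) 1"
proof -
 note g = simple_graphD[OF assms(1)]
 have w: "wgraph (lamw k E) (real (Qn k (max 1 (max_degree n E))) - 1) E"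
  using assms(2) by (intro wgraph_lamw[OF assms(1)]) auto
 have fi: "finite (iso_edges E)" using g(1) by (simp add: iso_edges_def)
 show ?thesis
 proof (cases "max_degree n E <= 1")
  case True
  have "map_pmf (%M. M Un iso_edges E) (gibbs (lamw k E) E) = map_pmf (%_. E) (gibbs (lamw k E) E)"
   using gibbs_props(1)[OF w] unfolding iso_edges_all[OF assms(1) True]
   by (intro map_pmf_cong refl) (auto simp: matchings_def)
  then have "alg k T n E = map_pmf (%M. M Un iso_edges E) (gibbs (lamw k E) E)" using True by (simp add: alg_def)
  moreover have "couple (alg k T n E) (alg k T n E) 1"
   using g(1) True by (intro couple_mono[OF couple_refl]) (auto simp: alg_def)
  ultimately show ?thesis by simp
 next
  case False
  then have E0: "E ~= {}" using max_degree_empty by auto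
  have mix: "gex (lamw k E) E (%M. \<bar>glauber_density (lamw k E) E (T n E) M - 1\<bar>) <= 1 / (real n * real k)"
   using assms(1,3) False by (auto simp: mixed_def)
  have "couple (map_pmf (%M. M Un iso_edges E) (glauber (edge_wt k E) E (T n E))) (map_pmf (%M. M Un iso_edges E) (gibbs (lamw k E) E)) (0 + 1)"
   by (rule couple_map[OF glauber_size(3)[OF assms(1,2) E0 mix]]) (use fi in \<open>auto intro!: card_mono\<close>)
  then show ?thesis using False by (simp add: alg_def)
 qed
qed

text \<open>A ball around \<open>d\<close>, grown by one neighbourhood per round, outside which the
  weights of that round do not notice the deletion.\<close>

primrec changed :: "nat set set => nat set => nat => nat set" where
 "changed E d 0 = {}"
| "changed E d (Suc j) = d Un \<Union>{e \<in> E. e \<inter> changed E d j ~= {}}"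

lemma vwt_unchanged: "u \<notin> changed E d j ==> vwt E j u = vwt (E - {d}) j u"
proof (induction j arbitrary: u)
 case (Suc j)
 then have u: "u \<notin> d" and e: "e \<inter> changed E d j = {}" if "e \<in> inc u E" for e using that by (auto simp: inc_def)
 have "inc u (E - {d}) = inc u E" using Suc.prems by (auto simp: inc_def)
 moreover have "(\<Sum>v\<in>e. vwt E j v) = (\<Sum>v\<in>e. vwt (E - {d}) j v)" if "e \<in> inc u E" for e
  using e[OF that] by (intro sum.cong refl Suc.IH) auto
 ultimately show ?case by simp
qed simp

lemma card_touching: assumes "simple_graph n E" "finite S"
 shows "finite {e \<in> E. e \<inter> S ~= {}}" "card {e \<in> E. e \<inter> S ~= {}} <= card S * max_degree n E"
proof -
 show "finite {e \<in> E. e \<inter> S ~= {}}" using simple_graphD(1)[OF assms(1)] by simp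
 have "{e \<in> E. e \<inter> S ~= {}} = (\<Union>v\<in>S. inc v E)" by (auto simp: inc_def)
 then have "card {e \<in> E. e \<inter> S ~= {}} <= (\<Sum>v\<in>S. card (inc v E))" using card_UN_le[OF assms(2)] by simp
 also have "... <= (\<Sum>v\<in>S. max_degree n E)" by (intro sum_mono card_inc_le_max_degree[OF assms(1)])
 finally show "card {e \<in> E. e \<inter> S ~= {}} <= card S * max_degree n E" by simp
qed

lemma card_changed: assumes "simple_graph n E" "card d = 2"
 shows "finite (changed E d j) & card (changed E d j) + 1 <= (2 * max_degree n E + 3) ^ j"
proof (induction j)
 case (Suc j)
 define D where "D = max_degree n E"
 define c where "c = card (changed E d j)"
 have IH: "finite (changed E d j)" "c + 1 <= (2 * D + 3) ^ j" using Suc by (auto simp: c_def D_def)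
 define Y where "Y = {e \<in> E. e \<inter> changed E d j ~= {}}"
 have Y: "finite Y" "card Y <= c * D" using card_touching[OF assms(1) IH(1)] by (auto simp: Y_def c_def D_def)
 have ye: "card e = 2" if "e \<in> Y" for e using that simple_graphD(2)[OF assms(1)] by (simp add: Y_def)
 have fd: "finite d" using assms(2) card.infinite by fastforce
 have fe: "finite e" if "e \<in> Y" for e using ye[OF that] card.infinite by fastforce
 have "card (d Un \<Union>Y) <= card d + card (\<Union>Y)" by (rule card_Un_le)
 also have "card (\<Union>Y) <= (\<Sum>e\<in>Y. card e)" by (rule card_Union_le_sum_card)
 also have "... = 2 * card Y" using ye by simp
 finally have "card (d Un \<Union>Y) <= 2 + 2 * (c * D)" using assms(2) Y(2) by linarith
 then have "card (d Un \<Union>Y) + 1 <= (2 * D + 3) * (c + 1)" by (simp add: algebra_simps)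
 also have "... <= (2 * D + 3) * (2 * D + 3) ^ j" using IH(2) by (intro mult_left_mono) auto
 finally show ?case using fd fe Y(1) by (auto simp: Y_def[symmetric] D_def)
qed simp

text \<open>All edges that meet the changed region are removed from both graphs. What is left is the
  same graph with the same weights, so the cost is twice the number of removed edges times the cost
  of one removal.\<close>

lemma couple_gibbs_delete:
 assumes "simple_graph n E" "1 <= k" "max_degree n E <= D" "1 <= D" "d \<in> E"
 shows "couple (gibbs (lamw k E) E) (gibbs (lamw k (E - {d})) (E - {d})) (2 * (1 + real D * real (Qn k D)) * (1 + 2 * (real (Qn k D) - 1)))"
proof -
 define F where "F = E - {d}"
 define B where "B = real (Qn k D) - 1"
 have F: "simple_graph n F" "max_degree n F <= D"
  using simple_graph_subset[OF assms(1), of F] max_degree_mono[OF assms(1), of F] assms(3) by (auto simp: F_def)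
 have wE: "wgraph (lamw k E) B E" and wF: "wgraph (lamw k F) B F"
  using wgraph_lamw[OF assms(1-4)] wgraph_lamw[OF F(1) assms(2) F(2) assms(4)] by (auto simp: B_def)
 define S where "S = changed E d (2 * k)"
 define X where "X = insert d {e \<in> E. e \<inter> S ~= {}}"
 have S: "finite S" "card S + 1 <= (2 * max_degree n E + 3) ^ (2 * k)"
  using card_changed[OF assms(1) simple_graphD(2)[OF assms(1,5)]] by (auto simp: S_def)
 have "card S <= (2 * D + 3) ^ (2 * k)"
  using S(2) power_mono[of "2 * max_degree n E + 3" "2 * D + 3" "2 * k"] assms(3) by linarith
 then have SQ: "card S <= Qn k D" using Qn_bound(2)[OF assms(2,4)] by linarith
 have fX: "finite X" using card_touching(1)[OF assms(1) S(1)] by (simp add: X_def)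
 have "card X <= Suc (card {e \<in> E. e \<inter> S ~= {}})"
  using card_touching(1)[OF assms(1) S(1)] by (simp add: X_def card_insert_if)
 also have "... <= Suc (Qn k D * D)"
  using card_touching(2)[OF assms(1) S(1)] mult_le_mono[OF SQ assms(3)] by linarith
 finally have "real (card X) <= real (Suc (Qn k D * D))" by (simp only: of_nat_le_iff)
 then have cX: "real (card X) <= 1 + real D * real (Qn k D)" by (simp add: mult.commute)
 have "E - X = F - X" by (auto simp: F_def X_def)
 moreover have "gibbs (lamw k E) (E - X) = gibbs (lamw k F) (E - X)"
 proof (rule gibbs_cong)
  show "wgraph (lamw k E) B (E - X)" by (rule wgraph_subset[OF wE]) auto
  show "wgraph (lamw k F) B (E - X)" by (rule wgraph_subset[OF wF]) (auto simp: F_def X_def)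
  fix e assume "e \<in> E - X"
  then have "e \<inter> changed E d (2 * k) = {}" by (auto simp: X_def S_def)
  then have "edge_wt k E e = edge_wt k F e"
   unfolding edge_wt_def F_def by (intro prod.cong refl arg_cong2[where f = times] vwt_unchanged) auto
  then show "lamw k E e = lamw k F e" by (simp add: lamw_def)
 qed
 ultimately have "couple (gibbs (lamw k E) E) (gibbs (lamw k F) (F - X)) (real (card X) * (1 + 2 * B))"
  using couple_remove_edges[OF fX wE] by simp
 from couple_trans[OF this couple_sym[OF couple_remove_edges[OF fX wF]]]
 have "couple (gibbs (lamw k E) E) (gibbs (lamw k F) F) (2 * real (card X) * (1 + 2 * B))" by (simp add: algebra_simps)
 moreover have "2 * real (card X) * (1 + 2 * B) <= 2 * (1 + real D * real (Qn k D)) * (1 + 2 * B)"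
  using cX wgraphD(4)[OF wE] by (intro mult_right_mono mult_left_mono) auto
 ultimately show ?thesis unfolding F_def B_def by (rule couple_mono)
qed

lemma card_sym_diff_iso_edges:
 assumes "simple_graph n E" "d \<in> E"
 shows "card (sym_diff (iso_edges E) (iso_edges (E - {d}))) <= 1 + 2 * max_degree n E"
proof -
 have d: "card d = 2" by (rule simple_graphD(2)[OF assms])
 then have fd: "finite d" using card.infinite by fastforce
 have "sym_diff (iso_edges E) (iso_edges (E - {d})) <= insert d {e \<in> E. e \<inter> d ~= {}}"
  by (auto simp: iso_edges_def disjnt_def)
 then have "card (sym_diff (iso_edges E) (iso_edges (E - {d}))) <= card (insert d {e \<in> E. e \<inter> d ~= {}})"
  using card_touching(1)[OF assms(1) fd] by (intro card_mono) auto
 also have "... <= 1 + card {e \<in> E. e \<inter> d ~= {}}" using card_touching(1)[OF assms(1) fd] by (simp add: card_insert_if)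
 finally show ?thesis using card_touching(2)[OF assms(1) fd, unfolded d] by linarith
qed

text \<open>Each output is within 1 of its Gibbs sample, the Gibbs samples are within
  \<open>4 * q ^ 3\<close> of each other, and isolated edges change only near \<open>d\<close>.
  Since \<open>q\<close> is at least \<open>2 ^ 14\<close>, the sum stays below
  \<open>q ^ 4\<close>.\<close>

lemma alg_sensitivity:
 assumes "simple_graph n E" "1 <= k" "mixed k T" "d \<in> E"
 shows "wasserstein (alg k T n E) (alg k T n (E - {d})) <= (if max_degree n E <= 1 then 1 else real (Qn k (max_degree n E)) ^ 4)"
proof (cases "max_degree n E <= 1")
 case True
 have "max_degree n (E - {d}) <= 1" using max_degree_mono[OF assms(1), of "E - {d}"] True by auto
 then have a: "alg k T n E = return_pmf E" "alg k T n (E - {d}) = return_pmf (E - {d})" using True by (auto simp: alg_def)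
 have f: "finite E" by (rule simple_graphD(1)[OF assms(1)])
 have "sym_diff E (E - {d}) = {d}" using assms(4) by auto
 then have "couple (map_pmf (%_. E) (return_pmf E)) (map_pmf (%_. E - {d}) (return_pmf E)) (1 + 0)"
  using f by (intro couple_map[OF couple_refl]) auto
 then show ?thesis using True by (simp add: a couple_wasserstein)
next
 case False
 define D where "D = max_degree n E"
 define q where "q = real (Qn k D)"
 have D: "1 <= D" "max_degree n E <= D" using False by (auto simp: D_def)
 define F where "F = E - {d}"
 have F: "simple_graph n F" using simple_graph_subset[OF assms(1), of F] by (auto simp: F_def)
 have fin: "finite E" "finite F" using simple_graphD(1)[OF assms(1)] by (auto simp: F_def)
 have fi: "finite (iso_edges E)" "finite (iso_edges F)" using fin by (auto simp: iso_edges_def)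
 have "couple (map_pmf (%M. M Un iso_edges E) (gibbs (lamw k E) E)) (map_pmf (%M. M Un iso_edges F) (gibbs (lamw k F) F))
   ((1 + 2 * real D) + 2 * (1 + real D * q) * (1 + 2 * (q - 1)))"
 proof (rule couple_map)
  show "couple (gibbs (lamw k E) E) (gibbs (lamw k F) F) (2 * (1 + real D * q) * (1 + 2 * (q - 1)))"
   unfolding F_def q_def by (rule couple_gibbs_delete[OF assms(1,2) D(2,1) assms(4)])
  fix X Y :: "nat set set" assume XY: "finite X" "finite Y"
  have "card (sym_diff (X Un iso_edges E) (Y Un iso_edges F)) <= card (sym_diff (iso_edges E) (iso_edges F) Un sym_diff X Y)"
   using XY fi by (intro card_mono) auto
  also have "... <= card (sym_diff (iso_edges E) (iso_edges F)) + card (sym_diff X Y)" by (rule card_Un_le)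
  also have "... <= (1 + 2 * D) + card (sym_diff X Y)"
   using card_sym_diff_iso_edges[OF assms(1,4)] by (simp add: F_def D_def)
  finally have "real (card (sym_diff (X Un iso_edges E) (Y Un iso_edges F))) <= real ((1 + 2 * D) + card (sym_diff X Y))"
   by (simp only: of_nat_le_iff)
  then show "real (card (sym_diff (X Un iso_edges E) (Y Un iso_edges F))) <= (1 + 2 * real D) + real (card (sym_diff X Y))" by simp
 qed (use fi in auto)
 from couple_trans[OF alg_gibbs[OF assms(1-3)] couple_trans[OF this couple_sym[OF alg_gibbs[OF F assms(2,3)]]]]
 have "couple (alg k T n E) (alg k T n F) (1 + (((1 + 2 * real D) + 2 * (1 + real D * q) * (1 + 2 * (q - 1))) + 1))" .
 moreover have "1 + (((1 + 2 * real D) + 2 * (1 + real D * q) * (1 + 2 * (q - 1))) + 1) <= q ^ 4"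
 proof -
  have q: "real D + 1 <= q" using Qn_bound(3)[OF assms(2) D(1)] by (simp add: q_def)
  have q2: "10 <= q" using Qn_bound(4)[OF assms(2) D(1)] by (simp add: q_def)
  have "real D * q <= (q - 1) * q" using q q2 by (intro mult_right_mono) auto
  then have "1 + real D * q <= q * q" using q2 by (simp add: algebra_simps)
  then have "2 * (1 + real D * q) * (1 + 2 * (q - 1)) <= 2 * (q * q) * (2 * q)" using q2 by (intro mult_mono) auto
  also have "... = 4 * q ^ 3" by (simp add: power3_eq_cube)
  finally have "1 + (((1 + 2 * real D) + 2 * (1 + real D * q) * (1 + 2 * (q - 1))) + 1) <= 4 * q ^ 3 + 2 * q + 1" using q by linarith
  also have "... <= 4 * q ^ 3 + 3 * q ^ 3"
   using power_increasing[of 1 3 q] one_le_power[of q 3] q2 by simp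
  also have "... <= q * q ^ 3" using q2 by (simp add: mult_right_mono)
  finally show ?thesis by (simp add: power_numeral_reduce)
 qed
 ultimately show ?thesis using False couple_wasserstein[OF couple_mono] by (simp add: F_def D_def q_def)
qed

section \<open>Straight-line code on the random-access machine\<close>

abbreviation (input) st :: "(nat => nat) => (nat => nat) => state" where
 "st R \<mu> \<equiv> \<lparr>reg = R, mem = \<mu>\<rparr>"

definition words_le :: "nat => state => bool" where
 "words_le W s \<longleftrightarrow> (\<forall>i. reg s i <= W & mem s i <= W)"

text \<open>The time \<open>t\<close> is the same for all random outcomes, so times simply add under
  concatenation. Quantifying over \<open>rest\<close> makes the statement usable in any context, and
  the word bound covers all intermediate configurations.\<close>

definition does :: "nat => stmt list => state => nat => state pmf => bool" where
 "does W cs s t D \<longleftrightarrow> (\<forall>rest. run t (cs @ rest, s) = map_pmf (Pair rest) D &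
   (\<forall>t'\<le>t. \<forall>c\<in>set_pmf (run t' (cs @ rest, s)). words_le W (snd c)))"

lemma run_add: "run (a + b) c = bind_pmf (run a c) (run b)"
 by (induction a arbitrary: c) (auto simp: bind_return_pmf bind_assoc_pmf intro!: bind_pmf_cong)

lemma does_nil: "words_le W s ==> does W [] s 0 (return_pmf s)"
 by (simp add: does_def)

text \<open>The distribution is kept over abstract values \<open>x\<close>, such as matchings, with
  \<open>G x\<close> the machine state that represents \<open>x\<close>; the next piece of code may
  then be analysed in terms of \<open>x\<close>.\<close>

lemma does_append_map:
 assumes "does W cs s t (map_pmf G D)" "!!x. x \<in> set_pmf D ==> does W cs' (G x) t' (D' x)"
 shows "does W (cs @ cs') s (t + t') (bind_pmf D D')"
 unfolding does_def
proof (intro allI conjI impI)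
 fix rest
 have 1: "run t (cs @ cs' @ rest, s) = map_pmf (Pair (cs' @ rest)) (map_pmf G D)" using assms(1) by (auto simp: does_def)
 have "run (t + t') (cs @ cs' @ rest, s) = bind_pmf D (%x. run t' (cs' @ rest, G x))"
  by (simp add: run_add 1 bind_map_pmf)
 also have "... = bind_pmf D (%x. map_pmf (Pair rest) (D' x))"
  using assms(2) by (intro bind_pmf_cong refl) (auto simp: does_def)
 finally show "run (t + t') ((cs @ cs') @ rest, s) = map_pmf (Pair rest) (bind_pmf D D')" by (simp add: map_bind_pmf)
 fix u assume u: "u <= t + t'"
 show "\<forall>c\<in>set_pmf (run u ((cs @ cs') @ rest, s)). words_le W (snd c)"
 proof (cases "u <= t")
  case True
  then show ?thesis using assms(1) by (simp add: does_def)
 next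
  case False
  then obtain v where v: "u = t + v" "v <= t'" using u by (metis add_le_cancel_left le_iff_add nle_le)
  have "run u ((cs @ cs') @ rest, s) = bind_pmf D (%x. run v (cs' @ rest, G x))"
   by (simp add: v run_add 1 bind_map_pmf)
  then show ?thesis using assms(2) v(2) by (auto simp: does_def)
 qed
qed

lemma does_append:
 assumes "does W cs s t D" "!!s'. s' \<in> set_pmf D ==> does W cs' s' t' (D' s')"
 shows "does W (cs @ cs') s (t + t') (bind_pmf D D')"
 using does_append_map[of W cs s t id D cs' t' D'] assms by (simp add: map_pmf_id)

lemma does_seq:
 assumes "does W cs s t (return_pmf s1)" "does W cs' s1 t' D"
 shows "does W (cs @ cs') s (t + t') D"
 using does_append[OF assms(1), of cs' t' "%_. D"] assms(2) by (simp add: bind_return_pmf)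

lemma does_first_step:
 assumes "!!rest. step (c # rest, s) = return_pmf (b @ rest, s)" "words_le W s" "does W b s t D"
 shows "does W [c] s (Suc t) D"
 unfolding does_def
proof (intro allI conjI impI)
 fix rest u assume "u <= Suc t"
 then show "\<forall>c\<in>set_pmf (run u ([c] @ rest, s)). words_le W (snd c)"
  using assms by (cases u) (auto simp: does_def bind_return_pmf)
qed (use assms in \<open>simp add: does_def bind_return_pmf\<close>)

lemma does_IfNZ:
 assumes "words_le W s" "does W (if reg s r ~= 0 then ts else es) s t D"
 shows "does W [IfNZ r ts es] s (Suc t) D"
 by (rule does_first_step[OF _ assms]) simp

lemma does_WhileNZ:
 assumes "words_le W s" "reg s r ~= 0" "does W b s t D" "!!s'. s' \<in> set_pmf D ==> does W [WhileNZ r b] s' t' (D' s')"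
 shows "does W [WhileNZ r b] s (Suc (t + t')) (bind_pmf D D')"
 by (rule does_first_step[OF _ assms(1) does_append[OF assms(3,4)]]) (use assms(2) in auto)

lemma does_WhileNZ_map:
 assumes "words_le W s" "reg s r ~= 0" "does W b s t (map_pmf G D)" "!!x. x \<in> set_pmf D ==> does W [WhileNZ r b] (G x) t' (D' x)"
 shows "does W [WhileNZ r b] s (Suc (t + t')) (bind_pmf D D')"
 by (rule does_first_step[OF _ assms(1) does_append_map[OF assms(3,4)]]) (use assms(2) in auto)

lemma does_WhileNZ_done:
 assumes "words_le W s" "reg s r = 0" shows "does W [WhileNZ r b] s 1 (return_pmf s)"
proof -
 have "does W [WhileNZ r b] s (Suc 0) (return_pmf s)"
  by (rule does_first_step[OF _ assms(1) does_nil[OF assms(1)]]) (use assms(2) in auto)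
 then show ?thesis by simp
qed

lemma does_countdown:
 assumes "!!c. c <= N ==> words_le W (S c) & reg (S c) r = c" "!!c. c < N ==> does W b (S (Suc c)) t (return_pmf (S c))"
 shows "does W [WhileNZ r b] (S N) (N * (t + 1) + 1) (return_pmf (S 0))"
 using assms
proof (induction N)
 case 0
 then show ?case using does_WhileNZ_done[of W "S 0" r b] by simp
next
 case (Suc N)
 have "does W [WhileNZ r b] (S (Suc N)) (Suc (t + (N * (t + 1) + 1))) (bind_pmf (return_pmf (S N)) (%_. return_pmf (S 0)))"
 proof (rule does_WhileNZ)
  show "words_le W (S (Suc N))" "reg (S (Suc N)) r ~= 0" using Suc.prems(1)[of "Suc N"] by auto
  show "does W b (S (Suc N)) t (return_pmf (S N))" using Suc.prems(2)[of N] by simp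
  show "does W [WhileNZ r b] s' (N * (t + 1) + 1) (return_pmf (S 0))" if "s' \<in> set_pmf (return_pmf (S N))" for s'
   using that Suc by simp
 qed
 then show ?case by (simp add: bind_return_pmf add_ac)
qed

text \<open>Evaluation of straight-line code. The last equation is a dummy for control statements,
  which \<open>straight\<close> excludes.\<close>

fun sem :: "stmt list => state => state pmf" where
 "sem [] s = return_pmf s"
| "sem (Const r c # cs) s = sem cs (set_reg r c s)"
| "sem (Binop f r x y # cs) s = sem cs (set_reg r (apply_binop f (reg s x) (reg s y)) s)"
| "sem (Load r a # cs) s = sem cs (set_reg r (mem s (reg s a)) s)"
| "sem (Store a r # cs) s = sem cs (s\<lparr>mem := (mem s)(reg s a := reg s r)\<rparr>)"
| "sem (Rand r k # cs) s = bind_pmf (uniform_below (reg s k)) (%x. sem cs (set_reg r x s))"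
| "sem (c # cs) s = return_pmf s"

fun straight :: "nat => stmt => bool" where
 "straight V (Const r c) \<longleftrightarrow> c <= V"
| "straight V (IfNZ _ _ _) \<longleftrightarrow> False"
| "straight V (WhileNZ _ _) \<longleftrightarrow> False"
| "straight V _ \<longleftrightarrow> True"

lemma words_le_set_reg: "words_le V s ==> x <= V ==> words_le V (set_reg r x s)"
 by (simp add: words_le_def set_reg_def)

lemma words_le_store: "words_le V s ==> x <= V ==> words_le V (s\<lparr>mem := (mem s)(a := x)\<rparr>)"
 by (simp add: words_le_def)

lemma words_le_mono: "words_le V s ==> V <= W ==> words_le W s"
 unfolding words_le_def by (meson order_trans)

lemma apply_binop_le: assumes "x <= V" "y <= V" "2 <= V" shows "apply_binop f x y <= V * V"
proof -
 have "2 * V <= V * V" using assms(3) by (intro mult_le_mono) auto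
 then have V: "V + V <= V * V" unfolding mult_2 .
 have "x div y <= x" "x mod y <= x" by auto
 moreover have "x * y <= V * V" using assms by (intro mult_le_mono)
 moreover have "x - y <= x" by simp
 ultimately show ?thesis using assms(1,2) V by (cases f; simp only: apply_binop.simps; linarith)
qed

lemma uniform_below_le: "x \<in> set_pmf (uniform_below k) ==> x <= k"
 by (cases "k = 0") (auto simp: uniform_below_def set_pmf_of_set lessThan_empty_iff)

text \<open>One operation at most squares the largest word, so short blocks of code need no bookkeeping.\<close>

lemma does_straight:
 assumes "\<forall>c\<in>set cs. straight V c" "words_le V s" "2 <= V" "V ^ (2 ^ length cs) <= W"
 shows "does W cs s (length cs) (sem cs s)"
 using assms
proof (induction cs arbitrary: s V)
 case Nil
 then show ?case by (auto intro!: does_nil elim: words_le_mono)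
next
 case (Cons c cs)
 have V2: "V <= V * V" "2 <= V * V" using Cons.prems(3) mult_le_mono[OF Cons.prems(3), of 1 V] by auto
 have "(V * V) ^ (2 ^ length cs) = V ^ (2 ^ length (c # cs))" by (simp add: power_mult power2_eq_square)
 then have W: "(V * V) ^ (2 ^ length cs) <= W" using Cons.prems(4) by simp
 have VW: "V <= W" by (rule order_trans[OF self_le_power Cons.prems(4)]) (use Cons.prems(3) in auto)
 have st: "\<forall>c\<in>set cs. straight (V * V) c"
 proof
  fix d assume "d \<in> set cs"
  then have "straight V d" using Cons.prems(1) by simp
  then show "straight (V * V) d" using order_trans[OF _ V2(1)] by (cases d) auto
 qed
 have IH: "does W cs s' (length cs) (sem cs s')" if "words_le (V * V) s'" for s'
  by (rule Cons.IH[OF st that V2(2) W])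
 define D where "D = map_pmf snd (step ([c], s))"
 have step: "step (c # rest, s) = map_pmf (Pair rest) D" for rest
  using Cons.prems(1) by (cases c) (auto simp: D_def map_pmf_comp)
 have DV: "words_le (V * V) s'" if "s' \<in> set_pmf D" for s'
 proof -
  have wV: "words_le (V * V) s" by (rule words_le_mono[OF Cons.prems(2) V2(1)])
  have le: "reg s i <= V * V" "mem s i <= V * V" "reg s i <= V" for i using wV Cons.prems(2) by (auto simp: words_le_def)
  show ?thesis using that Cons.prems(1) V2 order_trans[OF uniform_below_le le(1)] le apply_binop_le[OF le(3) le(3) Cons.prems(3)]
   by (cases c) (auto simp: D_def intro!: words_le_set_reg words_le_store wV intro: order_trans)
 qed
 have run0: "run 0 = return_pmf" by (rule ext) simp
 have "does W [c] s 1 D"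
  unfolding does_def
 proof (intro allI conjI impI)
  fix rest u assume "u <= (1::nat)"
  then consider "u = 0" | "u = 1" by linarith
  then show "\<forall>d\<in>set_pmf (run u ([c] @ rest, s)). words_le W (snd d)"
  proof cases
   case 2
   have "V * V <= W" by (rule order_trans[OF self_le_power W]) (use V2(2) Cons.prems(3) in auto)
   then show ?thesis using DV words_le_mono by (auto simp: 2 step run0 bind_return_pmf')
  qed (use words_le_mono[OF Cons.prems(2) VW] in simp)
 qed (simp add: step run0 bind_return_pmf')
 then have "does W ([c] @ cs) s (1 + length cs) (bind_pmf D (sem cs))"
  by (rule does_append) (rule IH[OF DV])
 moreover have "bind_pmf D (sem cs) = sem (c # cs) s"
  using Cons.prems(1) by (cases c) (auto simp: D_def bind_return_pmf map_pmf_comp bind_map_pmf)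
 ultimately show ?case by simp
qed

lemma does_halt:
 assumes "does W P s t D" "(1::nat) <= W"
 shows "word_bounded P s (real W)" "real t <= \<tau> ==> map_pmf output_edges D = \<mu> ==> outputs_within P s \<mu> \<tau>"
proof -
 have run: "run t (P, s) = map_pmf (Pair []) D" and wb: "!!u c. u <= t ==> c \<in> set_pmf (run u (P, s)) ==> words_le W (snd c)"
  using assms(1) unfolding does_def by (metis append_Nil2)+
 have stay: "run u ([], s) = return_pmf ([], s)" for u s by (induction u) (auto simp: bind_return_pmf)
 have "words_le W (snd c)" if c: "c \<in> set_pmf (run u (P, s))" for u c
 proof (cases "u <= t")
  case False
  then obtain v where "u = t + v" by (metis le_iff_add nle_le)
  then have "run u (P, s) = run t (P, s)" by (simp add: run_add run bind_map_pmf stay) (simp add: map_pmf_def)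
  then show ?thesis using c wb[of t c] by simp
 qed (use c wb in auto)
 then show "word_bounded P s (real W)" by (fastforce simp: word_bounded_def words_le_def)
 show "outputs_within P s \<mu> \<tau>" if "real t <= \<tau>" "map_pmf output_edges D = \<mu>"
  unfolding outputs_within_def using that by (intro exI[of _ t]) (auto simp: run map_pmf_comp)
qed


text \<open>Blocks have at most 60 instructions and each at most squares the largest word. The power
  stays fixed however long the program runs, because every loop state satisfies the bound
  \<open>V\<close> again.\<close>

definition word_cap :: "nat => nat" where "word_cap V = V ^ (2 ^ 60)"

lemma does_block:
 assumes "words_le V s" "2 <= V" "\<forall>c\<in>set cs. straight V c" "length cs <= 60" "sem cs s = D" "length cs = t"
 shows "does (word_cap V) cs s t D"
proof -
 have "V ^ (2 ^ length cs) <= word_cap V"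
  unfolding word_cap_def using assms(2,4) by (intro power_increasing) auto
 from does_straight[OF assms(3,1,2) this] show ?thesis using assms(5,6) by simp
qed

lemma word_cap_ge: "2 <= V ==> V <= word_cap V"
 unfolding word_cap_def by (intro self_le_power) auto

text \<open>Registers: \<open>2\<close> and \<open>3\<close> hold the constants \<open>1\<close> and \<open>2\<close>, and \<open>9\<close> is never written and reads \<open>0\<close>; \<open>4\<close> and \<open>5\<close> are
 the base addresses of the current and the next vertex array, \<open>6\<close> and \<open>7\<close> are counters, \<open>8\<close> is the maximum degree.
 \<open>10\<close> to \<open>19\<close> are scratch and are cleared by every loop body, so that loop states are determined exactly.
 \<open>20\<close>, \<open>22\<close>, \<open>23\<close> are the base addresses of the degrees, the matched-vertex flags and the chosen-edge flags; \<open>24\<close> to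
 \<open>28\<close> hold \<open>k\<^sup>2\<close>, \<open>Q\<close>, \<open>Q\<^sup>1\<^sup>2 n\<^sup>2\<close>, a power of two times \<open>bitlen n\<close>, and the number of doublings left. In truncated
 arithmetic \<open>x + (y - x)\<close> is the maximum and \<open>1 - (1 - x)\<close> the test \<open>x ~= 0\<close>.\<close>

definition pass_body :: "stmt list" where
 "pass_body = [Binop Sub 6 6 2, Binop Add 10 6 6, Load 11 10, Binop Add 10 10 2, Load 12 10,
   Binop Add 13 4 11, Load 13 13, Binop Add 14 4 12, Load 14 14, Binop Add 13 13 14, Binop Add 13 13 2,
   Binop Add 11 5 11, Load 14 11, Binop Add 14 14 13, Store 11 14,
   Binop Add 12 5 12, Load 14 12, Binop Add 14 14 13, Store 12 14,
   Const 10 0, Const 11 0, Const 12 0, Const 13 0, Const 14 0]"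

definition max_body :: "stmt list" where
 "max_body = [Binop Sub 6 6 2, Binop Add 10 6 6, Load 11 10, Binop Add 11 5 11, Load 11 11,
   Binop Sub 11 11 8, Binop Add 8 8 11, Binop Add 10 10 2, Load 11 10, Binop Add 11 5 11, Load 11 11,
   Binop Sub 11 11 8, Binop Add 8 8 11, Const 10 0, Const 11 0]"

section \<open>Loops over the edge list\<close>

locale edge_list_input =
 fixes n k :: nat and es :: "(nat \<times> nat) list" and E :: "nat set set" and V :: nat
 assumes sg: "simple_graph n E" and el: "is_edge_list es E" and ne: "es ~= []" and k1: "1 <= k"
  and V2: "2 <= V"
begin

abbreviation (input) "runs \<equiv> does (word_cap V)"

definition "m = length es"
definition "eu i = fst (es ! i)"
definition "ew i = snd (es ! i)"
definition "ed i = {eu i, ew i}"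

lemma ed_bij: "bij_betw ed {..<m} E"
proof -
 have "ed i = map (%(u, v). {u, v}) es ! i" if "i < m" for i
  using that by (simp add: ed_def eu_def ew_def m_def case_prod_unfold)
 moreover have "bij_betw (%i. map (%(u, v). {u, v}) es ! i) {..<length (map (%(u, v). {u, v}) es)} E"
  using el by (intro bij_betw_nth) (auto simp: is_edge_list_def)
 ultimately show ?thesis using bij_betw_cong[of "{..<m}" ed] by (simp only: m_def length_map lessThan_iff)
qed

lemma ed_in: "i < m ==> ed i \<in> E" using ed_bij by (auto simp: bij_betw_def)

lemma ends: assumes "i < m" shows "eu i ~= ew i" "eu i < n" "ew i < n"
proof -
 have "card (ed i) = 2" "ed i <= {..<n}" using simple_graphD[OF sg] ed_in[OF assms] by auto
 then show "eu i ~= ew i" "eu i < n" "ew i < n" by (auto simp: ed_def)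
qed

lemma m_card: "m = card E" using bij_betw_same_card[OF ed_bij] by simp

lemma m_pos: "0 < m" using ne by (simp add: m_def)

definition "has_edges \<mu> \<longleftrightarrow> (\<forall>i<m. \<mu> (2 * i) = eu i & \<mu> (Suc (2 * i)) = ew i)"

text \<open>The loop counter runs downwards: when it stands at \<open>c\<close>, the edges with
  index at least \<open>c\<close> have been processed.\<close>

definition "psum f c x = (\<Sum>i | c <= i & i < m & x \<in> ed i. Suc (f (eu i) + f (ew i)))"

lemma psum_step: assumes "c < m"
 shows "psum f c x = psum f (Suc c) x + (if x \<in> ed c then Suc (f (eu c) + f (ew c)) else 0)"
proof -
 have "{i. c <= i & i < m & x \<in> ed i} = (if x \<in> ed c then {c} else {}) Un {i. Suc c <= i & i < m & x \<in> ed i}"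
  using assms by (auto simp: Suc_le_eq order.order_iff_strict)
 moreover have "finite {i. Suc c <= i & i < m & x \<in> ed i}" by simp
 ultimately show ?thesis unfolding psum_def by (auto simp: sum.insert_if)
qed

lemma psum_m: "psum f m x = 0" unfolding psum_def by (intro sum.neutral) auto

lemma psum_le: "psum f c x <= psum f 0 x"
 unfolding psum_def by (intro sum_mono2) auto

lemma psum_vwt: "psum (vwt E j) 0 x = vwt E (Suc j) x"
proof -
 have "vwt E (Suc j) x = (\<Sum>e\<in>E. if x \<in> e then 1 + (\<Sum>v\<in>e. vwt E j v) else 0)"
  using simple_graphD(1)[OF sg] by (simp add: inc_def sum.inter_filter[symmetric])
 also have "... = (\<Sum>i<m. if x \<in> ed i then 1 + (\<Sum>v\<in>ed i. vwt E j v) else 0)"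
  using sum.reindex_bij_betw[OF ed_bij, of "%e. if x \<in> e then 1 + (\<Sum>v\<in>e. vwt E j v) else 0"] by simp
 also have "... = (\<Sum>i<m. if x \<in> ed i then Suc (vwt E j (eu i) + vwt E j (ew i)) else 0)"
  using ends(1) by (intro sum.cong) (auto simp: ed_def)
 also have "... = (\<Sum>i | i \<in> {..<m} & x \<in> ed i. Suc (vwt E j (eu i) + vwt E j (ew i)))"
  by (rule sum.inter_filter[symmetric]) simp
 also have "... = psum (vwt E j) 0 x" by (simp add: psum_def)
 finally show ?thesis by simp
qed

lemma does_pass:
 assumes R: "R 2 = 1" "R 4 = src" "R 5 = dst" "R 10 = 0" "R 11 = 0" "R 12 = 0" "R 13 = 0" "R 14 = 0"
  and \<mu>: "has_edges \<mu>" "!!u. u < n ==> \<mu> (src + u) = f u" "!!u. u < n ==> \<mu> (dst + u) = 0"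
  and le: "2 * m <= src" "src + n <= dst"
  and w: "words_le V (st R \<mu>)" "m <= V" "!!u. psum f 0 u <= V"
 shows "runs [WhileNZ 6 pass_body] (st (R(6 := m)) \<mu>) (m * (24 + 1) + 1)
  (return_pmf (st (R(6 := 0)) ((%a. if dst <= a & a < dst + n then psum f 0 (a - dst) else \<mu> a))))"
proof -
 define pm where "pm c = (%a. if dst <= a & a < dst + n then psum f c (a - dst) else \<mu> a)" for c
 define S where "S c = (st (R(6 := c)) (pm c))" for c
 have pm_m: "pm m = \<mu>"
 proof
  fix a show "pm m a = \<mu> a" using \<mu>(3)[of "a - dst"] by (auto simp: pm_def psum_m)
 qed
 have wS: "words_le V (S c)" if "c <= m" for c
  using w(1,2) order_trans[OF psum_le w(3)] that by (auto simp: words_le_def S_def pm_def)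
 have "runs [WhileNZ 6 pass_body] (S m) (m * (24 + 1) + 1) (return_pmf (S 0))"
 proof (rule does_countdown)
  show "words_le (word_cap V) (S c) & reg (S c) 6 = c" if "c <= m" for c
   using words_le_mono[OF wS[OF that] word_cap_ge[OF V2]] by (simp add: S_def)
  fix c assume c: "c < m"
  note ed = ends[OF c]
  have e: "pm d (2 * c) = eu c" "pm d (Suc (2 * c)) = ew c" for d
   using \<mu>(1) c le by (auto simp: pm_def has_edges_def)
  have f: "pm d (src + eu c) = f (eu c)" "pm d (src + ew c) = f (ew c)" for d
   using \<mu>(2) ed le by (auto simp: pm_def)
  have g: "pm d (dst + eu c) = psum f d (eu c)" "pm d (dst + ew c) = psum f d (ew c)" for d
   using ed by (auto simp: pm_def)
  have upd: "(pm (Suc c))(dst + eu c := psum f (Suc c) (eu c) + Suc (f (eu c) + f (ew c)),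
    dst + ew c := psum f (Suc c) (ew c) + Suc (f (eu c) + f (ew c))) = pm c"
   using ed by (auto simp: fun_eq_iff pm_def psum_step[OF c] ed_def)
  have Rz: "R(6 := c, 10 := 0, 11 := 0, 12 := 0, 13 := 0, 14 := 0) = R(6 := c)" using R by (auto simp: fun_eq_iff)
  show "runs pass_body (S (Suc c)) 24 (return_pmf (S c))"
  proof (rule does_block[OF wS V2])
   show "sem pass_body (S (Suc c)) = return_pmf (S c)"
    using upd Rz ed(1) by (simp add: pass_body_def S_def set_reg_def R e f g mult_2[symmetric])
  qed (use c in \<open>auto simp: pass_body_def\<close>)
 qed
 then show ?thesis unfolding S_def pm_m by (simp add: pm_def)
qed

definition "mxd h c = Max (insert 0 ((%i. max (h (eu i)) (h (ew i) :: nat)) ` {c..<m}))"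

lemma mxd_step: assumes "c < m" shows "mxd h c = max (max (mxd h (Suc c)) (h (eu c))) (h (ew c))"
proof -
 have "{c..<m} = insert c {Suc c..<m}" using assms by auto
 then show ?thesis unfolding mxd_def by (simp add: insert_commute[of 0] max.assoc max.commute max.left_commute)
qed

lemma mxd_m: "mxd h m = 0" by (simp add: mxd_def)

lemma mxd_le: assumes "!!i. i < m ==> h (eu i) <= b & h (ew i) <= b" shows "mxd h c <= b"
 unfolding mxd_def using assms by (auto intro!: Max.boundedI)

lemma mxd_max_degree: "mxd (vwt E 1) 0 = max_degree n E"
proof (rule antisym)
 have deg: "vwt E 1 x = vertex_degree E x" for x using vwt_props(5)[OF sg, of x] by (simp add: vertex_degree_def inc_def)
 have dle: "vertex_degree E x <= max_degree n E" if "x < n" for x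
  unfolding max_degree_def using that by (intro Max_ge) auto
 show "mxd (vwt E 1) 0 <= max_degree n E" using dle ends by (intro mxd_le) (simp del: vwt.simps add: deg[unfolded One_nat_def])
 have "vertex_degree E x <= mxd (vwt E 1) 0" for x
 proof (cases "vertex_degree E x = 0")
  case False
  then have "{e \<in> E. x \<in> e} ~= {}" unfolding vertex_degree_def by (metis card.empty)
  then obtain e where "e \<in> E" "x \<in> e" by blast
  then obtain i where i: "i < m" "x \<in> ed i" using ed_bij by (auto simp: bij_betw_def)
  have "max (vertex_degree E (eu i)) (vertex_degree E (ew i)) <= mxd (vertex_degree E) 0"
   unfolding mxd_def using i(1) by (intro Max_ge) auto
  then have "vertex_degree E x <= mxd (vertex_degree E) 0" using i(2) by (auto simp: ed_def)
  moreover have "vwt E 1 = vertex_degree E" using deg by blast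
  ultimately show ?thesis by simp
 qed simp
 then show "max_degree n E <= mxd (vwt E 1) 0" unfolding max_degree_def by (intro Max.boundedI) auto
qed

lemma does_max:
 assumes R: "R 2 = 1" "R 5 = dst" "R 8 = 0" "R 10 = 0" "R 11 = 0"
  and \<mu>: "has_edges \<mu>" "!!u. u < n ==> \<mu> (dst + u) = h u"
  and w: "words_le V (st R \<mu>)" "m <= V"
 shows "runs [WhileNZ 6 max_body] (st (R(6 := m)) \<mu>) (m * (15 + 1) + 1)
  (return_pmf (st (R(6 := 0, 8 := mxd h 0)) \<mu>))"
proof -
 define S where "S c = (st (R(6 := c, 8 := mxd h c)) \<mu>)" for c
 have S_m: "S m = (st (R(6 := m)) \<mu>)" using R by (auto simp: S_def mxd_m fun_eq_iff)
 have "h (eu i) <= V & h (ew i) <= V" if "i < m" for i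
  using w(1) ends[OF that] \<mu>(2) by (auto simp: words_le_def) (metis)+
 then have wS: "words_le V (S c)" if "c <= m" for c
  using w mxd_le[of h V c] that by (auto simp: words_le_def S_def)
 have "runs [WhileNZ 6 max_body] (S m) (m * (15 + 1) + 1) (return_pmf (S 0))"
 proof (rule does_countdown)
  show "words_le (word_cap V) (S c) & reg (S c) 6 = c" if "c <= m" for c
   using words_le_mono[OF wS[OF that] word_cap_ge[OF V2]] by (simp add: S_def)
  fix c assume c: "c < m"
  note ed = ends[OF c]
  have e: "\<mu> (2 * c) = eu c" "\<mu> (Suc (2 * c)) = ew c" "\<mu> (dst + eu c) = h (eu c)" "\<mu> (dst + ew c) = h (ew c)"
   using \<mu> c ed by (auto simp: has_edges_def)
  have mx: "a + (b - a) = max a b" for a b :: nat by simp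
  have Rz: "R(6 := c, 8 := x, 10 := 0, 11 := 0) = R(6 := c, 8 := x)" for x using R by (auto simp: fun_eq_iff)
  have Rz': "R(8 := x, 6 := c, 10 := 0, 11 := 0) = R(6 := c, 8 := x)" for x using R by (auto simp: fun_eq_iff)
  show "runs max_body (S (Suc c)) 15 (return_pmf (S c))"
  proof (rule does_block[OF wS V2])
   show "sem max_body (S (Suc c)) = return_pmf (S c)"
    using Rz Rz' by (simp add: max_body_def S_def set_reg_def R e mx mult_2[symmetric] mxd_step[OF c] del: add_diff_inverse_nat)
  qed (use c in \<open>auto simp: max_body_def\<close>)
 qed
 then show ?thesis unfolding S_m by (simp add: S_def)
qed

end

section \<open>The program\<close>

text \<open>The number of binary digits replaces the logarithm of \<open>n\<close>, which the
  machine cannot compute directly.\<close>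

fun bitlen :: "nat => nat" where
 "bitlen x = (if x = 0 then 0 else Suc (bitlen (x div 2)))"

declare bitlen.simps [simp del]

lemma bitlen_le: "bitlen x <= x"
proof (induction x rule: less_induct)
 case (less x)
 show ?case
 proof (cases "x = 0")
  case False
  then have "bitlen (x div 2) <= x div 2" by (intro less) simp
  moreover have "bitlen x = Suc (bitlen (x div 2))" using False bitlen.simps[of x] by simp
  ultimately show ?thesis using False by linarith
 qed (simp add: bitlen.simps)
qed

text \<open>An integer version of the smaller of the two mixing times: \<open>2 ^ (q ^ 10)\<close>
  dominates \<open>exp (432 * q ^ 5)\<close> and the lower terms, \<open>q ^ 12\<close> the
  constants that come with the spectral gap.\<close>

definition runtime :: "nat => nat => nat set set => nat" where
 "runtime k n E = (let q = Qn k (max_degree n E) in card E * min (2 ^ (q ^ 10) * bitlen n) (q ^ 12 * n * n))"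

definition round_body :: "stmt list" where
 "round_body = [Binop Add 4 5 9, Binop Add 5 5 0, Binop Add 6 1 9] @ [WhileNZ 6 pass_body] @ [Binop Sub 7 7 2]"

definition glauber_head :: "stmt list" where
 "glauber_head = [Binop Add 11 10 10, Load 12 11, Binop Add 11 11 2, Load 13 11,
   Binop Add 11 23 10, Load 14 11, Binop Add 15 5 12, Load 15 15, Binop Mul 15 24 15,
   Binop Add 16 5 13, Load 16 16, Binop Mul 16 24 16, Binop Mul 15 15 16, Binop Add 15 15 2]"

text \<open>Register 19 takes the number of matched ends minus twice the flag of the edge itself,
  that is, the number of ends blocked by other edges. Testing this by arithmetic instead of a branch
  gives every step the same duration.\<close>

definition glauber_tail :: "stmt list" where
 "glauber_tail = [Binop Add 12 22 12, Binop Add 13 22 13, Load 17 12, Load 18 13,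
   Binop Sub 16 2 16, Binop Sub 16 2 16, Binop Add 19 17 18, Binop Sub 19 19 14, Binop Sub 19 19 14,
   Binop Sub 19 2 19, Binop Mul 16 16 19, Store 11 16, Binop Sub 17 17 14, Binop Add 17 17 16, Store 12 17,
   Binop Sub 18 18 14, Binop Add 18 18 16, Store 13 18, Binop Sub 6 6 2,
   Const 10 0, Const 11 0, Const 12 0, Const 13 0, Const 14 0, Const 15 0, Const 16 0, Const 17 0, Const 18 0, Const 19 0]"

definition glauber_body :: "stmt list" where
 "glauber_body = Rand 10 1 # glauber_head @ Rand 16 15 # glauber_tail"

text \<open>Compaction in place: the write position never passes the read position. Every edge is
  written, but the position advances only if the edge is chosen or its degree sum is at most
  2.\<close>

definition output_body :: "stmt list" where
 "output_body = [Binop Sub 10 1 6, Binop Sub 6 6 2, Binop Add 11 23 10, Load 11 11, Binop Add 10 10 10, Load 12 10,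
   Binop Add 10 10 2, Load 13 10, Binop Add 14 20 12, Load 14 14, Binop Add 15 20 13, Load 15 15,
   Binop Add 14 14 15, Binop Sub 14 14 3, Binop Sub 14 2 14, Binop Add 11 11 14, Binop Sub 11 2 11, Binop Sub 11 2 11,
   Binop Add 14 7 7, Store 14 12, Binop Add 14 14 2, Store 14 13, Binop Add 7 7 11,
   Const 10 0, Const 11 0, Const 12 0, Const 13 0, Const 14 0, Const 15 0]"

abbreviation (input) arrays_code :: "nat => stmt list" where
 "arrays_code k \<equiv> [Binop Add 22 5 0, Binop Add 23 22 0, Binop Add 8 8 2, Const 25 1, Const 6 (14 * k)]"

abbreviation (input) powers_code :: "stmt list" where
 "powers_code \<equiv> [Binop Mul 11 25 25, Binop Mul 11 11 11, Binop Mul 12 11 11, Binop Mul 26 12 11, Binop Mul 28 25 25,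
    Binop Mul 28 28 12, Binop Mul 26 26 0, Binop Mul 26 26 0, Const 11 0, Const 12 0, Binop Sub 10 26 27, Binop Mul 10 10 28]"

text \<open>The number \<open>2 ^ (q ^ 10)\<close> may exceed every admissible word, so doubling
  stops at the cap in register 26. The loop condition is the product of the distance to the cap and
  the number of doublings left.\<close>

abbreviation (input) double_body :: "stmt list" where
 "double_body \<equiv> [Binop Add 27 27 27, Binop Sub 28 28 2, Binop Sub 10 26 27, Binop Mul 10 10 28]"

abbreviation (input) steps_code :: "nat => stmt list" where
 "steps_code k \<equiv> [Binop Sub 10 26 27, Binop Sub 10 26 10, Binop Mul 6 10 1, Const 10 0, Const 24 (k\<^sup>2)]"

abbreviation (input) half_body :: "stmt list" where
 "half_body \<equiv> [Binop Div 10 10 3, Binop Add 27 27 2]"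

abbreviation (input) power_body :: "stmt list" where
 "power_body \<equiv> [Binop Mul 25 25 8, Binop Sub 6 6 2]"

definition program_rest :: "nat => stmt list" where
 "program_rest k =
   [Const 10 0, Binop Add 20 5 9, Const 7 (2 * k - 1)]
   @ [WhileNZ 7 round_body]
   @ arrays_code k
   @ [WhileNZ 6 power_body]
   @ [Binop Add 10 0 9]
   @ [WhileNZ 10 half_body]
   @ powers_code
   @ [WhileNZ 10 double_body]
   @ steps_code k
   @ [WhileNZ 6 glauber_body]
   @ [Binop Add 6 1 9]
   @ [WhileNZ 6 output_body]
   @ [Binop Add 1 7 9]"

definition program :: "nat => stmt list" where
 "program k = [IfNZ 1
   ([Const 2 1, Const 3 2, Binop Add 4 1 1, Binop Add 5 4 0, Binop Add 6 1 9]
   @ [WhileNZ 6 pass_body] @ [Binop Add 6 1 9] @ [WhileNZ 6 max_body]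
   @ [Binop Sub 10 8 2] @ [IfNZ 10 (program_rest k) []]) []]"

section \<open>Correctness of the loops for the step count and the vertex weights\<close>

context edge_list_input
begin

lemma does_bitlen:
 assumes "R 2 = 1" "R 3 = 2" "words_le V (st R \<mu>)" "x <= V" "l + bitlen x <= V"
 shows "runs [WhileNZ 10 half_body] (st (R(10 := x, 27 := l)) \<mu>)
  (bitlen x * 3 + 1) (return_pmf (st (R(10 := 0, 27 := l + bitlen x)) \<mu>))"
 using assms(4,5)
proof (induction x arbitrary: l rule: less_induct)
 case (less x)
 define s where "s = (st (R(10 := x, 27 := l)) \<mu>)"
 have w: "words_le V s" using assms(3) less.prems by (auto simp: words_le_def s_def)
 have w': "words_le (word_cap V) s" by (rule words_le_mono[OF w word_cap_ge[OF V2]])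
 show ?case
 proof (cases "x = 0")
  case True
  then have b: "bitlen x = 0" and s: "(st (R(10 := 0, 27 := l + bitlen x)) \<mu>) = s" by (simp_all add: s_def bitlen.simps)
  have "reg s 10 = 0" using True by (simp add: s_def)
  from does_WhileNZ_done[OF w' this] show ?thesis unfolding s unfolding s_def[symmetric] b by simp
 next
  case False
  have b: "bitlen x = Suc (bitlen (x div 2))" using False bitlen.simps[of x] by simp
  define s' where "s' = (st (R(10 := x div 2, 27 := Suc l)) \<mu>)"
  have "runs half_body s 2 (return_pmf s')"
   by (rule does_block[OF w V2]) (auto simp: s_def s'_def set_reg_def assms fun_upd_twist)
  moreover have "runs [WhileNZ 10 half_body] s' (bitlen (x div 2) * 3 + 1)
    (return_pmf (st (R(10 := 0, 27 := l + bitlen x)) \<mu>))"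
  proof -
   have e: "l + bitlen x = Suc l + bitlen (x div 2)" using b by simp
   have "x div 2 < x" "x div 2 <= V" "Suc l + bitlen (x div 2) <= V" using False less.prems b by auto
   from less.IH[OF this] show ?thesis unfolding e s'_def .
  qed
  ultimately have "runs [WhileNZ 10 half_body] s (Suc (2 + (bitlen (x div 2) * 3 + 1)))
    (return_pmf (st (R(10 := 0, 27 := l + bitlen x)) \<mu>))"
   using does_WhileNZ[OF w', of 10 half_body 2 "return_pmf s'" "bitlen (x div 2) * 3 + 1"
    "%_. return_pmf (st (R(10 := 0, 27 := l + bitlen x)) \<mu>)"] False
   by (simp add: bind_return_pmf) (simp add: s_def)
  moreover have "Suc (2 + (bitlen (x div 2) * 3 + 1)) = bitlen x * 3 + 1" using b by simp
  ultimately show ?thesis unfolding s_def by (simp only:)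
 qed
qed

text \<open>Only the minimum with \<open>S\<close> is needed of the final value. The last doubling
  starts below \<open>S\<close>, so nothing exceeds \<open>b\<close>. The two bounds on
  \<open>N\<close> later charge this loop to the sampling time.\<close>

lemma does_doubling:
 fixes S :: nat
 assumes R: "R 2 = 1" "R 26 = S" "words_le V (st R \<mu>)" and c: "1 <= c" "c <= b" "2 * S <= b" "b <= V" "S * i <= V" "i <= V"
 shows "\<exists>N c' i'. runs [WhileNZ 10 double_body]
   (st (R(10 := (S - c) * i, 27 := c, 28 := i)) \<mu>) (N * 5 + 1)
   (return_pmf (st (R(10 := 0, 27 := c', 28 := i')) \<mu>))
  & min c' S = min (2 ^ i * c) S & N <= i & N <= S - c & c' <= b & i' <= i"
 using c
proof (induction i arbitrary: c)
 case 0
 define s where "s = (st (R(10 := 0, 27 := c, 28 := 0)) \<mu>)"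
 have w: "words_le V s" using R 0 by (auto simp: words_le_def s_def)
 have s: "(st (R(10 := (S - c) * 0, 27 := c, 28 := 0)) \<mu>) = s" by (simp add: s_def)
 have r0: "reg s 10 = 0" by (simp add: s_def)
 have s2: "(st (R(10 := 0, 27 := c, 28 := 0)) \<mu>) = s" by (simp only: s_def)
 show ?case unfolding s
  by (rule exI[of _ "0::nat"], rule exI[of _ c], rule exI[of _ "0::nat"], unfold s2)
   (use does_WhileNZ_done[OF words_le_mono[OF w word_cap_ge[OF V2]] r0] 0 in simp)
next
 case (Suc i)
 define b' where "b' = double_body"
 define s where "s = (st (R(10 := (S - c) * Suc i, 27 := c, 28 := Suc i)) \<mu>)"
 have "(S - c) * Suc i <= S * Suc i" by (intro mult_le_mono) auto
 then have w: "words_le V s" using R Suc.prems by (auto simp: words_le_def s_def)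
 have w': "words_le (word_cap V) s" by (rule words_le_mono[OF w word_cap_ge[OF V2]])
 show ?case
 proof (cases "S <= c")
  case True
  have "c <= 2 ^ Suc i * c" by simp
  then have mn: "min c S = min (2 ^ Suc i * c) S" using True by (simp only: min_absorb2 order_trans[OF True])
  have s2: "(st (R(10 := 0, 27 := c, 28 := Suc i)) \<mu>) = s" using True by (simp add: s_def)
  have "reg s 10 = 0" using True by (simp add: s_def)
  note d = does_WhileNZ_done[OF w' this, of b']
  show ?thesis unfolding s_def[symmetric] b'_def[symmetric]
   by (rule exI[of _ "0::nat"], rule exI[of _ c], rule exI[of _ "Suc i"], unfold s2) (use d mn True Suc.prems in simp)
 next
  case False
  define s' where "s' = (st (R(10 := (S - 2 * c) * i, 27 := 2 * c, 28 := i)) \<mu>)"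
  have "runs b' s 4 (return_pmf s')"
   by (rule does_block[OF w V2]) (auto simp: s_def s'_def b'_def set_reg_def R fun_eq_iff mult_2)
  moreover have pr: "1 <= 2 * c" "2 * c <= b" "2 * S <= b" "b <= V" "S * i <= V" "i <= V" using Suc.prems False by auto
  obtain N c' i' where IH: "runs [WhileNZ 10 b'] s' (N * 5 + 1)
    (return_pmf (st (R(10 := 0, 27 := c', 28 := i')) \<mu>))"
   "min c' S = min (2 ^ i * (2 * c)) S" "N <= i" "N <= S - 2 * c" "c' <= b" "i' <= i"
   using Suc.IH[OF pr] unfolding b'_def s'_def by blast
  ultimately have "runs [WhileNZ 10 b'] s (Suc (4 + (N * 5 + 1))) (return_pmf (st (R(10 := 0, 27 := c', 28 := i')) \<mu>))"
   using does_WhileNZ[OF w', of 10 b' 4 "return_pmf s'" "N * 5 + 1"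
    "%_. return_pmf (st (R(10 := 0, 27 := c', 28 := i')) \<mu>)"] False
   by (simp add: bind_return_pmf) (simp add: s_def)
  moreover have "Suc (4 + (N * 5 + 1)) = Suc N * 5 + 1" by simp
  ultimately have d: "runs [WhileNZ 10 b'] s (Suc N * 5 + 1) (return_pmf (st (R(10 := 0, 27 := c', 28 := i')) \<mu>))"
   by (simp only:)
  have "min c' S = min (2 ^ Suc i * c) S" using IH(2) by (simp add: mult_ac)
  moreover have "Suc N <= S - c" using IH(4) False Suc.prems(1) by linarith
  ultimately show ?thesis unfolding s_def[symmetric] b'_def[symmetric]
   by (intro exI conjI) (rule d, use IH in simp_all)
 qed
qed

lemma does_power:
 assumes R: "R 2 = 1" "R 8 = d" "words_le V (st R \<mu>)" and "d ^ N <= V" "N <= V" "1 <= d"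
 shows "runs [WhileNZ 6 power_body] (st (R(25 := 1, 6 := N)) \<mu>)
  (N * (2 + 1) + 1) (return_pmf (st (R(25 := d ^ N, 6 := 0)) \<mu>))"
proof -
 define S where "S c = (st (R(25 := d ^ (N - c), 6 := c)) \<mu>)" for c
 have wS: "words_le V (S c)" if "c <= N" for c
  using R(3) assms(5) that order_trans[OF power_increasing[of "N - c" N d] assms(4)] assms(6) by (auto simp: words_le_def S_def)
 have "runs [WhileNZ 6 power_body] (S N) (N * (2 + 1) + 1) (return_pmf (S 0))"
 proof (rule does_countdown)
  show "words_le (word_cap V) (S c) & reg (S c) 6 = c" if "c <= N" for c
   using words_le_mono[OF wS[OF that] word_cap_ge[OF V2]] by (simp add: S_def)
  fix c assume c: "c < N"
  then have "N - c = Suc (N - Suc c)" by simp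
  then have d: "d ^ (N - c) = d ^ (N - Suc c) * d" by simp
  show "runs power_body (S (Suc c)) 2 (return_pmf (S c))"
  proof (rule does_block[OF wS V2])
   show "sem power_body (S (Suc c)) = return_pmf (S c)"
    unfolding S_def d by (auto simp: set_reg_def R fun_eq_iff)
  qed (use c in auto)
 qed
 then show ?thesis by (simp add: S_def)
qed

text \<open>The memory after \<open>J\<close> rounds: the edge list, then the weight arrays of
  rounds 0 to \<open>J\<close> in blocks of length \<open>n\<close>. None is overwritten, because
  the degrees, which are round 1, are read again at output.\<close>

definition "am J a = (if a < 2 * m then mem (input_state n es) a
  else if a < 2 * m + Suc J * n then vwt E ((a - 2 * m) div n) ((a - 2 * m) mod n) else 0)"

lemma am_edges: "has_edges (am J)"
 by (auto simp: has_edges_def am_def input_state_def eu_def ew_def m_def)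

lemma am_input: "mem (input_state n es) = am 0"
proof
 fix a show "mem (input_state n es) a = am 0 a"
  by (cases "a < 2 * m") (auto simp: am_def div_less input_state_def m_def)
qed

lemma am_at: assumes "u < n" "j <= J" shows "am J (2 * m + j * n + u) = vwt E j u"
proof -
 have "j * n + u < Suc j * n" using assms(1) by simp
 also have "... <= Suc J * n" using assms(2) by (intro mult_le_mono) auto
 finally show ?thesis using assms(1) by (simp add: am_def)
qed

lemma am_beyond: "2 * m + Suc J * n <= a ==> am J a = 0"
 by (simp add: am_def)

lemma am_step:
 "(%a. if 2 * m + Suc J * n <= a & a < 2 * m + Suc J * n + n then psum (vwt E J) 0 (a - (2 * m + Suc J * n)) else am J a) = am (Suc J)"
proof
 fix a
 show "(if 2 * m + Suc J * n <= a & a < 2 * m + Suc J * n + n then psum (vwt E J) 0 (a - (2 * m + Suc J * n)) else am J a) = am (Suc J) a"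
 proof (cases "2 * m + Suc J * n <= a & a < 2 * m + Suc J * n + n")
  case True
  then obtain u where a: "a = 2 * m + Suc J * n + u" and u: "u < n" by (metis le_iff_add nat_add_left_cancel_less)
  have "am (Suc J) a = vwt E (Suc J) u" unfolding a by (rule am_at[OF u]) simp
  then show ?thesis using True unfolding psum_vwt a by (simp del: vwt.simps)
 next
  case False
  then show ?thesis by (auto simp: am_def)
 qed
qed

lemma am_le: assumes "n <= V" "(2 * max_degree n E + 1) ^ J <= V" shows "am J a <= V"
proof -
 have "mem (input_state n es) a <= V" if "a < 2 * m"
 proof -
  have "a div 2 < m" using that by linarith
  from ends[OF this] show ?thesis using that assms(1) by (auto simp: input_state_def eu_def ew_def)
 qed
 moreover have "vwt E ((a - 2 * m) div n) ((a - 2 * m) mod n) <= V" if "a < 2 * m + Suc J * n"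
 proof -
  have n0: "0 < n" using ends(2)[OF m_pos] by simp
  have "a - 2 * m < Suc J * n" using that n0 by (cases "a < 2 * m") auto
  then have j: "(a - 2 * m) div n <= J" using n0 by (metis less_Suc_eq_le div_less_iff_less_mult)
  have "vwt E ((a - 2 * m) div n) ((a - 2 * m) mod n) <= vwt E J ((a - 2 * m) mod n)" by (rule vwt_mono[OF sg j])
  then show ?thesis using vwt_props(6)[OF sg, of J "(a - 2 * m) mod n"] assms(2) by linarith
 qed
 ultimately show ?thesis by (auto simp: am_def)
qed

lemma does_rounds:
 assumes R: "R 0 = n" "R 1 = m" "R 2 = 1" "R 9 = 0" "R 4 = 2 * m" "R 5 = 2 * m + n" "R 6 = 0" "R 10 = 0" "R 11 = 0" "R 12 = 0" "R 13 = 0" "R 14 = 0"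
  and w: "words_le V (st R (am 1))" "2 * m + (2 * k + 1) * n <= V" "(2 * max_degree n E + 1) ^ (2 * k) <= V" "2 * k <= V"
 shows "runs [WhileNZ 7 round_body] (st (R(7 := 2 * k - 1)) (am 1)) ((2 * k - 1) * ((3 + ((m * (24 + 1) + 1) + 1)) + 1) + 1)
  (return_pmf (st (R(4 := 2 * m + (2 * k - 1) * n, 5 := 2 * m + 2 * k * n, 7 := 0)) (am (2 * k))))"
proof -
 define S where "S c = (st (R(4 := 2 * m + (2 * k - 1 - c) * n, 5 := 2 * m + (2 * k - c) * n, 7 := c)) (am (2 * k - c)))" for c
 have R1: "R (Suc 0) = m" using R(2) by simp
 have nV: "n <= V" "m <= V" using w(2) by auto
 have pw: "(2 * max_degree n E + 1) ^ J <= V" if "J <= 2 * k" for J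
  using order_trans[OF power_increasing[OF that, of "2 * max_degree n E + 1"] w(3)] by simp
 have am: "am J a <= V" if "J <= 2 * k" for J a by (rule am_le[OF nV(1) pw[OF that]])
 have mn: "2 * m + j * n <= V" if "j <= 2 * k + 1" for j
  using w(2) mult_le_mono1[OF that, of n] by linarith
 have wS: "words_le V (S c)" if "c <= 2 * k - 1" for c
  using w(1) am mn w(4) that by (auto simp: words_le_def S_def)
 have "runs [WhileNZ 7 round_body] (S (2 * k - 1)) ((2 * k - 1) * ((3 + ((m * (24 + 1) + 1) + 1)) + 1) + 1) (return_pmf (S 0))"
 proof (rule does_countdown)
  show "words_le (word_cap V) (S c) & reg (S c) 7 = c" if "c <= 2 * k - 1" for c
   using words_le_mono[OF wS[OF that] word_cap_ge[OF V2]] by (simp add: S_def)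
  fix c assume c: "c < 2 * k - 1"
  define J where "J = 2 * k - Suc c"
  have J: "2 * k - c = Suc J" "2 * k - 1 - c = J" "2 * k - Suc c = J" "J <= 2 * k" "Suc J <= 2 * k" using c by (auto simp: J_def)
  define R' where "R' = R(4 := 2 * m + J * n, 5 := 2 * m + Suc J * n, 7 := Suc c)"
  have wR': "words_le V (st R' (am J))" "words_le V (st R' (am (Suc J)))"
   using w(1) am[OF J(4)] am[OF J(5)] mn[of J] mn[of "Suc J"] J c w(4) by (auto simp: words_le_def R'_def)
  have 1: "runs [Binop Add 4 5 9, Binop Add 5 5 0, Binop Add 6 1 9] (S (Suc c)) 3 (return_pmf (st (R'(6 := m)) (am J)))"
  proof (rule does_block[OF wS V2])
   show "sem [Binop Add 4 5 9, Binop Add 5 5 0, Binop Add 6 1 9] (S (Suc c)) = return_pmf (st (R'(6 := m)) (am J))"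
    unfolding S_def J R'_def by (auto simp: set_reg_def R R1 fun_eq_iff)
  qed (use c in auto)
  have 2: "runs [WhileNZ 6 pass_body] (st (R'(6 := m)) (am J)) (m * (24 + 1) + 1) (return_pmf (st (R'(6 := 0)) (am (Suc J))))"
   unfolding am_step[symmetric]
  proof (rule does_pass[where src = "2 * m + J * n"])
   show "am J (2 * m + J * n + u) = vwt E J u" if "u < n" for u by (rule am_at[OF that]) simp
   show "psum (vwt E J) 0 u <= V" for u
    unfolding psum_vwt using vwt_props(6)[OF sg, of "Suc J" u] pw[OF J(5)] by linarith
  qed (use R wR' nV am_edges am_beyond in \<open>auto simp: R'_def\<close>)
  have 3: "runs [Binop Sub 7 7 2] (st (R'(6 := 0)) (am (Suc J))) 1 (return_pmf (S c))"
  proof (rule does_block[OF _ V2])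
   show "words_le V (st (R'(6 := 0)) (am (Suc J)))" using wR'(2) by (auto simp: words_le_def)
   show "sem [Binop Sub 7 7 2] (st (R'(6 := 0)) (am (Suc J))) = return_pmf (S c)"
    unfolding S_def J R'_def using J by (auto simp: set_reg_def R fun_eq_iff)
  qed auto
  show "runs round_body (S (Suc c)) (3 + ((m * (24 + 1) + 1) + 1)) (return_pmf (S c))"
   unfolding round_body_def by (rule does_seq[OF 1 does_seq[OF 2 3]])
 qed
 moreover have "S (2 * k - 1) = (st (R(7 := 2 * k - 1)) (am 1))"
  using k1 R by (auto simp: S_def fun_eq_iff)
 ultimately show ?thesis by (simp add: S_def)
qed

end

lemma words_le_upd: "words_le V (st R \<mu>) ==> x <= V ==> words_le V (st (R(r := x)) \<mu>)"
 by (simp add: words_le_def)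

lemma words_le_mem: "words_le V (st R \<mu>) ==> (!!a. \<mu>' a <= V) ==> words_le V (st R (\<mu>'))"
 by (simp add: words_le_def)

section \<open>Correctness of the sampler and of the output loop\<close>

context edge_list_input
begin

definition "gm mb sb \<mu> M = (%a. if sb <= a & a < sb + m then of_bool (ed (a - sb) \<in> M)
  else if mb <= a & a < mb + n then of_bool (a - mb \<in> \<Union>M) else (\<mu> a :: nat))"

text \<open>If the edge is present, it accounts for both of its matched ends, and the two
  subtractions of \<open>s\<close> cancel it. If it is absent, any matched end is blocked by another
  edge. In both cases the second factor of \<open>nw\<close> is the availability test of
  \<open>upd\<close>.\<close>

lemma upd_flags:
 assumes M: "M \<in> matchings E" and i: "i < m"
  and s: "s = (of_bool (ed i \<in> M) :: nat)" and fu: "fu = (of_bool (eu i \<in> \<Union>M) :: nat)" and fv: "fv = (of_bool (ew i \<in> \<Union>M) :: nat)"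
  and nw: "nw = (1 - (1 - r)) * (1 - (fu + fv - s - s))"
 shows "nw = of_bool (ed i \<in> upd (ed i) r M)" "fu - s + nw = of_bool (eu i \<in> \<Union>(upd (ed i) r M))"
  "fv - s + nw = of_bool (ew i \<in> \<Union>(upd (ed i) r M))"
  "j < m ==> j ~= i ==> ed j \<in> upd (ed i) r M \<longleftrightarrow> ed j \<in> M"
  "x \<notin> ed i ==> x \<in> \<Union>(upd (ed i) r M) \<longleftrightarrow> x \<in> \<Union>M"
proof -
 define av where "av \<longleftrightarrow> (\<forall>f\<in>M - {ed i}. disjnt (ed i) f)"
 have U: "upd (ed i) r M = (if r ~= 0 & av then insert (ed i) M else M - {ed i})" by (simp add: upd_def av_def)
 have pw: "pairwise disjnt M" using M by (simp add: matchings_def)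
 have in_ed: "eu i \<in> ed i" "ew i \<in> ed i" by (auto simp: ed_def)
 have "nw = of_bool (ed i \<in> upd (ed i) r M) & fu - s + nw = of_bool (eu i \<in> \<Union>(upd (ed i) r M)) & fv - s + nw = of_bool (ew i \<in> \<Union>(upd (ed i) r M))"
 proof (cases "ed i \<in> M")
  case True
  have av: av unfolding av_def using pw True by (auto simp: pairwise_def)
  have "eu i \<notin> \<Union>(M - {ed i})" "ew i \<notin> \<Union>(M - {ed i})" using av in_ed unfolding av_def disjnt_def by blast+
  moreover have "eu i \<in> \<Union>M" "ew i \<in> \<Union>M" using True in_ed by blast+
  moreover have "upd (ed i) r M = (if r = 0 then M - {ed i} else M)" using av True by (simp add: U insert_absorb)
  ultimately show ?thesis using True by (cases "r = 0") (simp_all add: s fu fv nw del: Union_iff UN_iff)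
 next
  case False
  then have Md: "M - {ed i} = M" by auto
  have av: "av \<longleftrightarrow> eu i \<notin> \<Union>M & ew i \<notin> \<Union>M" unfolding av_def Md by (auto simp: disjnt_def ed_def)
  show ?thesis
  proof (cases "r ~= 0 & av")
   case True
   then have "eu i \<notin> \<Union>M" "ew i \<notin> \<Union>M" "upd (ed i) r M = insert (ed i) M" using av by (auto simp: U)
   moreover have "eu i \<in> \<Union>(insert (ed i) M)" "ew i \<in> \<Union>(insert (ed i) M)" using in_ed by auto
   ultimately show ?thesis using True False by (simp add: s fu fv nw del: Union_iff UN_iff Union_insert)
  next
   case no: False
   then have "upd (ed i) r M = M" "r = 0 \<or> eu i \<in> \<Union>M \<or> ew i \<in> \<Union>M" using av Md by (auto simp: U)
   then show ?thesis using False by (elim disjE) (simp_all add: s fu fv nw del: Union_iff UN_iff)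
  qed
 qed
 then show "nw = of_bool (ed i \<in> upd (ed i) r M)" "fu - s + nw = of_bool (eu i \<in> \<Union>(upd (ed i) r M))"
  "fv - s + nw = of_bool (ew i \<in> \<Union>(upd (ed i) r M))" by auto
 show "ed j \<in> upd (ed i) r M \<longleftrightarrow> ed j \<in> M" if "j < m" "j ~= i"
 proof -
  have "ed j ~= ed i" using that i ed_bij by (auto simp: bij_betw_def inj_on_def)
  then show ?thesis by (auto simp: U)
 qed
 show "x \<in> \<Union>(upd (ed i) r M) \<longleftrightarrow> x \<in> \<Union>M" if "x \<notin> ed i" using that by (auto simp: U)
qed

lemma gm_upd:
 assumes M: "M \<in> matchings E" and i: "i < m" and le: "mb + n <= sb"
  and s: "s = gm mb sb \<mu> M (sb + i)" and fu: "fu = gm mb sb \<mu> M (mb + eu i)" and fv: "fv = gm mb sb \<mu> M (mb + ew i)"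
  and nw: "nw = (1 - (1 - r)) * (1 - (fu + fv - s - s))"
 shows "(gm mb sb \<mu> M)(sb + i := nw, mb + eu i := fu - s + nw, mb + ew i := fv - s + nw) = gm mb sb \<mu> (upd (ed i) r M)"
proof
 fix a
 note ed = ends[OF i]
 have s': "s = of_bool (ed i \<in> M)" "fu = of_bool (eu i \<in> \<Union>M)" "fv = of_bool (ew i \<in> \<Union>M)"
  using i ed le by (auto simp: s fu fv gm_def)
 note f = upd_flags[OF M i s' nw]
 consider "a = sb + i" | "a = mb + eu i" | "a = mb + ew i" | "sb <= a" "a < sb + m" "a ~= sb + i" | "mb <= a" "a < mb + n" "a ~= mb + eu i" "a ~= mb + ew i"
  | "\<not> (sb <= a & a < sb + m)" "\<not> (mb <= a & a < mb + n)" by argo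
 then show "((gm mb sb \<mu> M)(sb + i := nw, mb + eu i := fu - s + nw, mb + ew i := fv - s + nw)) a = gm mb sb \<mu> (upd (ed i) r M) a"
 proof cases
  case 1
  then show ?thesis using f(1) i ed le by (simp add: gm_def)
 next
  case 2
  then show ?thesis using f(2) i ed le by (simp add: gm_def)
 next
  case 3
  then show ?thesis using f(3) i ed le by (simp add: gm_def)
 next
  case 4
  then have "a - sb < m" "a - sb ~= i" "a ~= mb + eu i" "a ~= mb + ew i" using ed le by auto
  then show ?thesis using f(4)[of "a - sb"] 4 by (simp add: gm_def)
 next
  case 5
  then have "a - mb \<notin> ed i" "a ~= sb + i" "\<not> sb <= a" using le by (auto simp: ed_def)
  then show ?thesis using f(5)[of "a - mb"] 5 by (simp add: gm_def)
 next
  case 6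
  then have "a ~= sb + i" "a ~= mb + eu i" "a ~= mb + ew i" using ed i by auto
  moreover have "gm mb sb \<mu> N a = \<mu> a" for N using 6 by (simp only: gm_def if_False)
  ultimately show ?thesis by simp
 qed
qed

text \<open>The chain unrolled at its first step, which is how the loop executes it, while
  \<open>glauber\<close> is unrolled at its last.\<close>

primrec giter :: "nat => nat set set => nat set set pmf" where
 "giter 0 M = return_pmf M"
| "giter (Suc t) M = bind_pmf (glauber_step (edge_wt k E) E M) (giter t)"

lemma giter_glauber: "bind_pmf (glauber (edge_wt k E) E a) (giter t) = glauber (edge_wt k E) E (a + t)"
proof (induction t arbitrary: a)
 case 0
 have "giter 0 = return_pmf" by (rule ext) simp
 then show ?case by (simp add: bind_return_pmf')
next
 case (Suc t)
 have "bind_pmf (glauber (edge_wt k E) E a) (giter (Suc t)) = bind_pmf (glauber (edge_wt k E) E (Suc a)) (giter t)"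
  by (simp add: bind_assoc_pmf) (rule bind_pmf_cong, simp_all)
 then show ?case unfolding Suc[of "Suc a"] by (simp del: giter.simps)
qed

lemma glauber_step_matching: assumes "M \<in> matchings E" "M' \<in> set_pmf (glauber_step (edge_wt k E) E M)" shows "M' \<in> matchings E"
proof -
 have "finite E" "E ~= {}" using simple_graphD(1)[OF sg] ed_in[OF m_pos] by auto
 then show ?thesis using assms upd_matching by (auto simp: glauber_step_def set_pmf_of_set)
qed

lemma uniform_edge: "map_pmf ed (uniform_below m) = pmf_of_set E"
proof -
 have "map_pmf ed (pmf_of_set {..<m}) = pmf_of_set (ed ` {..<m})"
  using ed_bij m_pos by (intro map_pmf_of_set_inj) (auto simp: bij_betw_def)
 then show ?thesis using ed_bij m_pos by (simp add: uniform_below_def bij_betw_def)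
qed

lemma does_glauber:
 assumes R: "R 1 = m" "R 2 = 1" "R 5 = vb" "R 22 = mb" "R 23 = sb" "R 24 = k\<^sup>2"
   "R 10 = 0" "R 11 = 0" "R 12 = 0" "R 13 = 0" "R 14 = 0" "R 15 = 0" "R 16 = 0" "R 17 = 0" "R 18 = 0" "R 19 = 0"
  and \<mu>: "has_edges \<mu>" "!!u. u < n ==> \<mu> (vb + u) = vwt E (2 * k) u"
  and le: "2 * m <= vb" "vb + n <= mb" "mb + n <= sb"
  and w: "words_le V (st R \<mu>)" "N <= V"
  and M: "M \<in> matchings E"
 shows "runs [WhileNZ 6 glauber_body] (st (R(6 := N)) (gm mb sb \<mu> M)) (N * (45 + 1) + 1)
  (map_pmf (%M. (st (R(6 := 0)) (gm mb sb \<mu> M))) (giter N M))"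
proof -
 define G where "G M c = (st (R(6 := c)) (gm mb sb \<mu> M))" for M c
 have R1: "R (Suc 0) = m" using R(1) by simp
 have wG: "words_le V (G M c)" if "c <= V" for M c
 proof -
  have "gm mb sb \<mu> M a <= V" for a using w(1) V2 by (auto simp: gm_def words_le_def)
  then show ?thesis using w(1) that by (simp add: words_le_def G_def)
 qed
 have step: "sem glauber_body (G M (Suc c)) = map_pmf (%M. G M c) (glauber_step (edge_wt k E) E M)" if M: "M \<in> matchings E" for M c
 proof -
  define g where "g = gm mb sb \<mu> M"
  have "sem glauber_body (G M (Suc c)) = bind_pmf (uniform_below m) (%i. sem (glauber_head @ Rand 16 15 # glauber_tail) (st (R(6 := Suc c, 10 := i)) g))"
   by (simp add: glauber_body_def G_def R1 set_reg_def g_def)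
  also have "... = bind_pmf (uniform_below m) (%i. map_pmf (%r. G (upd (ed i) r M) c) (pmf_of_set {..<Suc (edge_wt k E (ed i))}))"
  proof (rule bind_pmf_cong[OF refl])
   fix i assume "i \<in> set_pmf (uniform_below m)"
   then have i: "i < m" using m_pos by (auto simp: uniform_below_def set_pmf_of_set lessThan_empty_iff)
   note ed = ends[OF i]
   define s where "s = g (sb + i)"
   define fu where "fu = g (mb + eu i)"
   define fv where "fv = g (mb + ew i)"
   define u where "u = eu i"
   define v where "v = ew i"
   have old: "g a = \<mu> a" if "a < mb" for a using that le by (simp add: g_def gm_def)
   have e: "g (2 * i) = u" "g (Suc (2 * i)) = v" using \<mu>(1) i le by (auto simp: old has_edges_def u_def v_def)
   have x: "g (vb + u) = vwt E (2 * k) u" "g (vb + v) = vwt E (2 * k) v" using \<mu>(2) ed le by (auto simp: old u_def v_def)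
   have y: "g (sb + i) = s" "g (mb + u) = fu" "g (mb + v) = fv" by (auto simp: s_def fu_def fv_def u_def v_def)
   define W where "W = edge_wt k E (ed i)"
   have eui: "eu i \<in> ed i" by (simp add: ed_def)
   have oth: "ew i = other (eu i) (ed i)"
   proof -
    from other_edge[OF simple_graphD(2)[OF sg ed_in[OF i]] eui] show ?thesis using ed(1) by (auto simp: ed_def)
   qed
   have W: "k\<^sup>2 * vwt E (2 * k) u * (k\<^sup>2 * vwt E (2 * k) v) = W"
    unfolding W_def u_def v_def using edge_wt_edge[OF sg ed_in[OF i] eui, of k, folded oth] by (rule sym)
   have dis: "u ~= v" "sb + i ~= mb + u" "sb + i ~= mb + v" using ed le i by (auto simp: u_def v_def)
   have Rz: "R(6 := c, 10 := 0, 11 := 0, 12 := 0, 13 := 0, 14 := 0, 15 := 0, 16 := 0, 17 := 0, 18 := 0, 19 := 0) = R(6 := c)"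
    using R by (auto simp: fun_eq_iff)
   define nw where "nw r = (1 - (1 - r)) * (1 - (fu + fv - s - s))" for r :: nat
   have up: "g(sb + i := nw r, mb + u := fu - s + nw r, mb + v := fv - s + nw r) = gm mb sb \<mu> (upd (ed i) r M)" for r
    unfolding g_def u_def v_def by (rule gm_upd[OF M i le(3)]) (auto simp: s_def fu_def fv_def g_def nw_def)
   define s1 where "s1 = (st (R(6 := Suc c, 10 := i, 12 := u, 13 := v, 11 := sb + i, 14 := s, 16 := k\<^sup>2 * vwt E (2 * k) v, 15 := Suc W)) g)"
   have 1: "sem (glauber_head @ Rand 16 15 # glauber_tail) (st (R(6 := Suc c, 10 := i)) g) = sem (Rand 16 15 # glauber_tail) s1"
    by (simp add: glauber_head_def set_reg_def R e x y s1_def mult_2[symmetric] W del: sem.simps(6))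
   have 2: "sem glauber_tail (set_reg 16 r s1) = return_pmf (G (upd (ed i) r M) c)" for r
   proof -
    have "sem glauber_tail (set_reg 16 r s1) = return_pmf (st (R(6 := c, 10 := 0, 11 := 0, 12 := 0, 13 := 0, 14 := 0, 15 := 0, 16 := 0, 17 := 0, 18 := 0, 19 := 0)) (g(sb + i := nw r, mb + u := fu - s + nw r, mb + v := fv - s + nw r)))"
     using dis by (simp add: glauber_tail_def set_reg_def R y s1_def nw_def)
    then show ?thesis unfolding up Rz G_def .
   qed
   have "sem (Rand 16 15 # glauber_tail) s1 = bind_pmf (uniform_below (Suc W)) (%r. sem glauber_tail (set_reg 16 r s1))"
    by (simp add: s1_def)
   then show "sem (glauber_head @ Rand 16 15 # glauber_tail) (st (R(6 := Suc c, 10 := i)) g)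
     = map_pmf (%r. G (upd (ed i) r M) c) (pmf_of_set {..<Suc (edge_wt k E (ed i))})"
    by (simp add: 1 2 uniform_below_def W_def map_pmf_def)
  qed
  also have "... = bind_pmf (pmf_of_set E) (%e. map_pmf (%r. G (upd e r M) c) (pmf_of_set {..<Suc (edge_wt k E e)}))"
   by (simp add: uniform_edge[symmetric] bind_map_pmf)
  also have "... = map_pmf (%M. G M c) (glauber_step (edge_wt k E) E M)"
   by (simp add: glauber_step_def map_bind_pmf map_pmf_comp)
  finally show ?thesis .
 qed
 have "runs [WhileNZ 6 glauber_body] (G M N) (N * (45 + 1) + 1) (map_pmf (%M. G M 0) (giter N M))"
  if "N <= V" "M \<in> matchings E" for N M
  using that
 proof (induction N arbitrary: M)
  case 0
  have "reg (G M 0) 6 = 0" by (simp add: G_def)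
  from does_WhileNZ_done[OF words_le_mono[OF wG word_cap_ge[OF V2]] this] show ?case by simp
 next
  case (Suc N)
  have w: "words_le V (G M (Suc N))" using wG Suc.prems by blast
  have b: "runs glauber_body (G M (Suc N)) 45 (map_pmf (%M. G M N) (glauber_step (edge_wt k E) E M))"
   by (rule does_block[OF w V2 _ _ step[OF Suc.prems(2)]]) (auto simp: glauber_body_def glauber_head_def glauber_tail_def)
  have "runs [WhileNZ 6 glauber_body] (G M (Suc N)) (Suc (45 + (N * (45 + 1) + 1)))
    (bind_pmf (glauber_step (edge_wt k E) E M) (%M. map_pmf (%M. G M 0) (giter N M)))"
  proof (rule does_WhileNZ_map[OF words_le_mono[OF w word_cap_ge[OF V2]] _ b])
   show "reg (G M (Suc N)) 6 ~= 0" by (simp add: G_def)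
   fix M' assume "M' \<in> set_pmf (glauber_step (edge_wt k E) E M)"
   then have "M' \<in> matchings E" by (rule glauber_step_matching[OF Suc.prems(2)])
   from Suc.IH[OF _ this] show "runs [WhileNZ 6 glauber_body] (G M' N) (N * (45 + 1) + 1) (map_pmf (%M. G M 0) (giter N M'))"
    using Suc.prems(1) by simp
  qed
  moreover have "bind_pmf (glauber_step (edge_wt k E) E M) (%M. map_pmf (%M. G M 0) (giter N M)) = map_pmf (%M. G M 0) (giter (Suc N) M)"
   by (simp add: map_bind_pmf)
  moreover have "Suc (45 + (N * (45 + 1) + 1)) = Suc N * (45 + 1) + 1" by simp
  ultimately show ?case by (simp only:)
 qed
 from this[OF w(2) M] show ?thesis by (simp only: G_def)
qed

primrec cnt :: "(nat => bool) => nat => nat" where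
 "cnt P 0 = 0"
| "cnt P (Suc i) = cnt P i + of_bool (P i)"

primrec cm :: "(nat => nat) => (nat => bool) => nat => nat => nat" where
 "cm \<mu> P 0 = \<mu>"
| "cm \<mu> P (Suc i) = (cm \<mu> P i)(2 * cnt P i := eu i, Suc (2 * cnt P i) := ew i)"

lemma cnt_le: "cnt P i <= i" by (induction i) auto

lemma cm_props:
 shows "!!a. 2 * i <= a ==> cm \<mu> P i a = \<mu> a"
  "(%j. {cm \<mu> P i (2 * j), cm \<mu> P i (2 * j + 1)}) ` {..<cnt P i} = ed ` {j. j < i & P j}"
  "!!a. (!!a. \<mu> a <= V) ==> n <= V ==> i <= m ==> cm \<mu> P i a <= V"
proof -
 show "cm \<mu> P i a = \<mu> a" if "2 * i <= a" for a
  using that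
 proof (induction i)
  case (Suc i)
  then have "a ~= 2 * cnt P i" "a ~= Suc (2 * cnt P i)" "2 * i <= a" using cnt_le[of P i] by auto
  then show ?case using Suc.IH by simp
 qed simp
 show "(%j. {cm \<mu> P i (2 * j), cm \<mu> P i (2 * j + 1)}) ` {..<cnt P i} = ed ` {j. j < i & P j}"
 proof (induction i)
  case (Suc i)
  have "(%j. {cm \<mu> P (Suc i) (2 * j), cm \<mu> P (Suc i) (2 * j + 1)}) ` {..<cnt P i} = (%j. {cm \<mu> P i (2 * j), cm \<mu> P i (2 * j + 1)}) ` {..<cnt P i}"
  proof (intro image_cong refl)
   fix j assume "j \<in> {..<cnt P i}"
   then have "2 * j ~= 2 * cnt P i" "2 * j ~= Suc (2 * cnt P i)" "2 * j + 1 ~= 2 * cnt P i" "2 * j + 1 ~= Suc (2 * cnt P i)"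
    by simp_all
   then show "{cm \<mu> P (Suc i) (2 * j), cm \<mu> P (Suc i) (2 * j + 1)} = {cm \<mu> P i (2 * j), cm \<mu> P i (2 * j + 1)}"
    unfolding cm.simps fun_upd_apply by (simp only: if_False)
  qed
  moreover have "{cm \<mu> P (Suc i) (2 * cnt P i), cm \<mu> P (Suc i) (2 * cnt P i + 1)} = ed i" by (simp add: ed_def)
  moreover have "{j. j < Suc i & P j} = (if P i then insert i {j. j < i & P j} else {j. j < i & P j})" by (auto simp: less_Suc_eq)
  moreover have "{..<cnt P (Suc i)} = (if P i then insert (cnt P i) {..<cnt P i} else {..<cnt P i})" by auto
  ultimately show ?case using Suc by (simp del: cm.simps cnt.simps)
 qed simp
 show "cm \<mu> P i a <= V" if "!!a. \<mu> a <= V" "n <= V" "i <= m" for a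
  using that(3)
 proof (induction i arbitrary: a)
  case (Suc i)
  then show ?case using ends[of i] that(2) by (auto intro: order_trans[OF less_imp_le])
 qed (simp add: that)
qed

lemma does_output:
 assumes R: "R 1 = m" "R 2 = 1" "R 3 = 2" "R 7 = 0" "R 20 = db" "R 23 = sb"
   "R 10 = 0" "R 11 = 0" "R 12 = 0" "R 13 = 0" "R 14 = 0" "R 15 = 0"
  and \<mu>: "has_edges \<mu>" "!!u. u < n ==> \<mu> (db + u) = h u" "!!i. i < m ==> \<mu> (sb + i) = of_bool (Q i)"
  and le: "2 * m <= db" "2 * m <= sb"
  and w: "words_le V (st R \<mu>)" "m <= V" "n <= V"
  and P: "!!i. P i \<longleftrightarrow> Q i \<or> h (eu i) + h (ew i) <= 2"
 shows "runs [WhileNZ 6 output_body] (st (R(6 := m)) \<mu>) (m * (29 + 1) + 1)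
  (return_pmf (st (R(6 := 0, 7 := cnt P m)) (cm \<mu> P m)))"
proof -
 define S where "S c = (st (R(6 := c, 7 := cnt P (m - c))) (cm \<mu> P (m - c)))" for c
 have R1: "R (Suc 0) = m" using R(1) by simp
 have S_m: "S m = (st (R(6 := m)) \<mu>)" using R by (auto simp: S_def fun_eq_iff)
 have wS: "words_le V (S c)" if "c <= m" for c
 proof -
  have "cnt P (m - c) <= V" using cnt_le[of P "m - c"] w(2) by linarith
  moreover have "cm \<mu> P (m - c) a <= V" for a using w(1,3) by (intro cm_props(3)) (auto simp: words_le_def)
  ultimately show ?thesis using w that by (auto simp: words_le_def S_def)
 qed
 have "runs [WhileNZ 6 output_body] (S m) (m * (29 + 1) + 1) (return_pmf (S 0))"
 proof (rule does_countdown)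
  show "words_le (word_cap V) (S c) & reg (S c) 6 = c" if "c <= m" for c
   using words_le_mono[OF wS[OF that] word_cap_ge[OF V2]] by (simp add: S_def)
  fix c assume c: "c < m"
  define i where "i = m - Suc c"
  have i: "i < m" "m - c = Suc i" "m - Suc c = i" using c by (auto simp: i_def)
  note ed = ends[OF i(1)]
  define g where "g = cm \<mu> P i"
  define J where "J = cnt P i"
  define q where "q = (of_bool (Q i) :: nat)"
  have old: "g a = \<mu> a" if "2 * i <= a" for a using cm_props(1)[OF that] by (simp add: g_def)
  have e: "g (2 * i) = eu i" "g (Suc (2 * i)) = ew i" "g (db + eu i) = h (eu i)" "g (db + ew i) = h (ew i)" "g (sb + i) = q"
   using \<mu> i le ed by (auto simp: old has_edges_def q_def)
  have f: "Suc 0 - (Suc 0 - (q + (Suc 0 - (h (eu i) + h (ew i) - 2)))) = of_bool (P i)"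
   by (auto simp: P q_def)
  have Rz: "R(6 := c, 7 := x, 10 := 0, 11 := 0, 12 := 0, 13 := 0, 14 := 0, 15 := 0) = R(6 := c, 7 := x)" for x
   using R by (auto simp: fun_eq_iff)
  show "runs output_body (S (Suc c)) 29 (return_pmf (S c))"
  proof (rule does_block[OF wS V2])
   have "sem output_body (S (Suc c)) = return_pmf (st (R(6 := c, 7 := J + of_bool (P i), 10 := 0, 11 := 0, 12 := 0, 13 := 0, 14 := 0, 15 := 0)) (g(2 * J := eu i, Suc (2 * J) := ew i)))"
    unfolding S_def i by (simp add: output_body_def set_reg_def R R1 i e f g_def[symmetric] J_def[symmetric] mult_2[symmetric])
   then show "sem output_body (S (Suc c)) = return_pmf (S c)" unfolding Rz by (simp add: S_def i g_def J_def)
  qed (use c in \<open>auto simp: output_body_def\<close>)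
 qed
 then show ?thesis unfolding S_m by (simp add: S_def)
qed

text \<open>Both ends have degree at least 1, so a degree sum of at most 2 forces both degrees to be
  1.\<close>

lemma iso_degree: assumes "i < m" shows "ed i \<in> iso_edges E \<longleftrightarrow> vwt E 1 (eu i) + vwt E 1 (ew i) <= 2"
proof -
 have fin: "finite (inc x E)" for x using simple_graphD(1)[OF sg] by (simp add: inc_def)
 have mem: "ed i \<in> inc (eu i) E" "ed i \<in> inc (ew i) E" using ed_in[OF assms] by (auto simp: inc_def ed_def)
 have ge: "1 <= card (inc (eu i) E)" "1 <= card (inc (ew i) E)" using mem fin by (auto simp: Suc_le_eq card_gt_0_iff)
 have "ed i \<in> iso_edges E \<longleftrightarrow> inc (eu i) E = {ed i} & inc (ew i) E = {ed i}"
  using ed_in[OF assms] by (auto simp: iso_edges_def inc_def disjnt_def ed_def)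
 also have "... \<longleftrightarrow> card (inc (eu i) E) = 1 & card (inc (ew i) E) = 1"
  using mem by (auto simp: card_1_singleton_iff)
 also have "... \<longleftrightarrow> card (inc (eu i) E) + card (inc (ew i) E) <= 2" using ge by linarith
 finally show ?thesis unfolding vwt_props(5)[OF sg] .
qed


section \<open>Correctness of the whole program\<close>

lemma input_regs: "input_state n es = (st ((%_. 0)(0 := n, 1 := m)) (am 0))"
 unfolding am_input[symmetric] by (simp add: input_state_def m_def)

lemma does_degrees:
 assumes le: "5 * m + (2 * k + 4) * n + 14 * k + k\<^sup>2 + (2 * max_degree n E + 1) ^ (2 * k) + max_degree n E + 2 <= V"
  and fin: "runs (if 1 < max_degree n E then program_rest k else [])
   (st ((%_. 0)(0 := n, 1 := m, 2 := 1, 3 := 2, 4 := 2 * m, 5 := 2 * m + n, 6 := 0, 8 := max_degree n E, 10 := max_degree n E - 1)) (am 1)) t D"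
 shows "runs (program k) (input_state n es) (41 * m + t + 11) D"
proof -
 define R where "R = ((%_. 0)(0 := n, 1 := m, 2 := 1, 3 := 2, 4 := 2 * m, 5 := 2 * m + n) :: nat => nat)"
 define d where "d = max_degree n E"
 have b: "n <= V" "m <= V" "2 * m <= V" "2 * m + n <= V" "d <= V" "(2 * d + 1) ^ (2 * k) <= V" using le by (auto simp: d_def algebra_simps)
 have pw: "(2 * d + 1) ^ j <= V" if "j <= 2 * k" for j
  using order_trans[OF power_increasing[OF that, of "2 * d + 1"] b(6)] by simp
 have am: "am j a <= V" if "j <= 2 * k" for j a using am_le[OF b(1) pw[OF that, unfolded d_def]] .
 have k2: "0 <= 2 * k" "1 <= 2 * k" using k1 by auto
 have z: "words_le V (st ((%_. 0)) (am j))" if "j <= 2 * k" for j using am[OF that] by (simp add: words_le_def)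
 have wR: "words_le V (st R (am 0))" "words_le V (st R (am 1))"
  unfolding R_def using b V2 k1 by (auto intro!: words_le_upd z k2)
 have w0: "words_le V (input_state n es)" unfolding input_regs using b by (intro words_le_upd z k2) auto
 have 1: "runs [Const 2 1, Const 3 2, Binop Add 4 1 1, Binop Add 5 4 0, Binop Add 6 1 9] (input_state n es) 5
   (return_pmf (st (R(6 := m)) (am 0)))"
  by (rule does_block[OF w0 V2]) (use V2 in \<open>auto simp: input_regs set_reg_def R_def fun_eq_iff\<close>)
 have a1: "(%a. if 2 * m + n <= a & a < 2 * m + n + n then psum (vwt E 0) 0 (a - (2 * m + n)) else am 0 a) = am 1"
  using am_step[of 0] unfolding One_nat_def[symmetric] mult_1 .
 have 2: "runs [WhileNZ 6 pass_body] (st (R(6 := m)) (am 0)) (m * (24 + 1) + 1) (return_pmf (st (R(6 := 0)) (am 1)))"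
  unfolding a1[symmetric]
 proof (rule does_pass[where src = "2 * m"])
  show "am 0 (2 * m + u) = vwt E 0 u" if "u < n" for u using am_at[OF that, of 0 0] by simp
  show "psum (vwt E 0) 0 u <= V" for u
   unfolding psum_vwt using vwt_props(6)[OF sg, of "Suc 0" u] pw[of "Suc 0"] k2 by (simp add: d_def)
  show "am 0 (2 * m + n + u) = 0" if "u < n" for u by (rule am_beyond) simp
 qed (use wR b am_edges in \<open>auto simp: R_def\<close>)
 have w6: "words_le V (st (R(6 := 0)) (am 1))" using wR(2) by (intro words_le_upd) auto
 have 3: "runs [Binop Add 6 1 9] (st (R(6 := 0)) (am 1)) 1 (return_pmf (st (R(6 := m)) (am 1)))"
  by (rule does_block[OF w6 V2]) (auto simp: set_reg_def R_def fun_eq_iff)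
 have mx: "mxd (vwt E 1) 0 = d" using mxd_max_degree by (simp add: d_def)
 have 4: "runs [WhileNZ 6 max_body] (st (R(6 := m)) (am 1)) (m * (15 + 1) + 1) (return_pmf (st (R(6 := 0, 8 := d)) (am 1)))"
  unfolding mx[symmetric]
 proof (rule does_max[where dst = "2 * m + n"])
  show "am 1 (2 * m + n + u) = vwt E 1 u" if "u < n" for u using am_at[OF that, of 1 1] by simp
 qed (use wR b am_edges in \<open>auto simp: R_def\<close>)
 define s where "s = (st (R(6 := 0, 8 := d, 10 := d - 1)) (am 1))"
 have w8: "words_le V (st (R(6 := 0, 8 := d)) (am 1))" using wR(2) b by (intro words_le_upd) auto
 have 5: "runs [Binop Sub 10 8 2] (st (R(6 := 0, 8 := d)) (am 1)) 1 (return_pmf s)"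
  by (rule does_block[OF w8 V2]) (auto simp: set_reg_def R_def s_def)
 have ws: "words_le V s" unfolding s_def using wR(2) b by (intro words_le_upd) auto
 have 6: "runs [IfNZ 10 (program_rest k) []] s (Suc t) D"
 proof (rule does_IfNZ[OF words_le_mono[OF ws word_cap_ge[OF V2]]])
  have "(reg s 10 ~= 0) = (1 < d)" by (auto simp: s_def)
  then show "runs (if reg s 10 ~= 0 then program_rest k else []) s t D"
   using fin unfolding s_def R_def d_def by (simp only:)
 qed
 have m1: "reg (input_state n es) 1 ~= 0" using m_pos by (simp add: input_regs)
 have "runs (program k) (input_state n es) (Suc (5 + ((m * (24 + 1) + 1) + (1 + ((m * (15 + 1) + 1) + (1 + Suc t)))))) D"
  unfolding program_def
  by (rule does_IfNZ[OF words_le_mono[OF w0 word_cap_ge[OF V2]]], unfold if_P[OF m1])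
   (rule does_seq[OF 1 does_seq[OF 2 does_seq[OF 3 does_seq[OF 4 does_seq[OF 5 6]]]]])
 moreover have "Suc (5 + ((m * (24 + 1) + 1) + (1 + ((m * (15 + 1) + 1) + (1 + Suc t))))) = 41 * m + t + 11" by simp
 ultimately show ?thesis by (simp only:)
qed

text \<open>Neither the edge list nor the edge count has been touched at this point, so the input is
  read back as the output \<open>E\<close>.\<close>

lemma program_small_degree:
 assumes le: "5 * m + (2 * k + 4) * n + 14 * k + k\<^sup>2 + (2 * max_degree n E + 1) ^ (2 * k) + max_degree n E + 2 <= V"
  and d: "max_degree n E <= 1"
 shows "\<exists>D. runs (program k) (input_state n es) (41 * m + 11) D & map_pmf output_edges D = return_pmf E"
proof -
 define s where "s = (st ((%_. 0)(0 := n, 1 := m, 2 := 1, 3 := 2, 4 := 2 * m, 5 := 2 * m + n, 6 := 0, 8 := max_degree n E, 10 := max_degree n E - 1)) (am 1))"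
 have "am 1 a <= V" for a
  by (rule am_le) (use le power_increasing[of 1 "2 * k" "2 * max_degree n E + 1"] k1 in \<open>auto simp: algebra_simps\<close>)
 then have "words_le V s" unfolding s_def using le by (intro words_le_upd) (auto simp: words_le_def algebra_simps)
 then have "runs [] s 0 (return_pmf s)" by (intro does_nil words_le_mono[OF _ word_cap_ge[OF V2]])
 then have "runs (program k) (input_state n es) (41 * m + 0 + 11) (return_pmf s)"
  using d by (intro does_degrees[OF le]) (simp only: s_def not_le[symmetric] simp_thms if_False)
 moreover have "output_edges s = ed ` {..<m}"
  unfolding output_edges_def using am_edges[of 1] by (intro image_cong) (auto simp: s_def has_edges_def ed_def)
 then have "output_edges s = E" using ed_bij by (simp add: bij_betw_def)
 ultimately show ?thesis by (intro exI[of _ "return_pmf s"]) simp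
qed

lemma program_large_degree:
 assumes le: "5 * m + (2 * k + 4) * n + 14 * k + k\<^sup>2 + (2 * max_degree n E + 1) ^ (2 * k) + max_degree n E + 2 <= V"
  and le2: "Qn k (max_degree n E) ^ 22 * n * n * (m + 2) + n <= V"
  and deg: "1 < max_degree n E"
 shows "\<exists>t D. runs (program k) (input_state n es) t D & map_pmf output_edges D = alg k (runtime k) n E
  & t <= 300 * (k * m + bitlen n + runtime k n E)"
proof -
 let ?A = "am (2 * k)"
 define d where "d = max_degree n E"
 define Q where "Q = Qn k d"
 define S where "S = Q ^ 12 * n * n"
 define L where "L = bitlen n"
 define T where "T = runtime k n E"
 define vb where "vb = 2 * m + 2 * k * n"
 define mb where "mb = vb + n"
 define sb where "sb = mb + n"
 have n1: "1 <= n" using ends(2)[OF m_pos] by simp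
 have d1: "1 <= d" using deg by (simp add: d_def)
 have Q1: "1 <= Q" using Qn_bound(3)[OF k1 d1] by (simp add: Q_def)
 have L1: "1 <= L" using n1 bitlen.simps[of n] by (simp add: L_def)
 have Ln: "L <= n" using bitlen_le[of n] by (simp add: L_def)
 have T: "T = m * min (2 ^ (Q ^ 10) * L) S" by (simp add: T_def runtime_def Let_def m_card Q_def d_def S_def L_def)
 have qp: "Q ^ i * n * n <= Q ^ 22 * n * n" if "i <= 22" for i using Q1 that by (intro mult_le_mono power_increasing) auto
 \<comment> \<open>The largest quantity in the computation of the step count is the loop condition
   of the doublings, at most \<open>S * Q ^ 10\<close>, whence the exponent
   \<open>22 = 12 + 10\<close>.\<close>
 define X where "X = Q ^ 22 * n * n"
 have X: "X * (m + 2) + n <= V" using le2 by (simp add: X_def Q_def d_def)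
 then have X2: "2 * X + n <= V" "m * X <= V" "X <= V" by (auto simp: algebra_simps)
 have nX: "Q ^ i <= X" if "i <= 22" for i
 proof -
  have "Q ^ i * 1 * 1 <= Q ^ i * n * n" using n1 by (intro mult_le_mono) auto
  then show ?thesis using qp[OF that] unfolding X_def mult_1_right by (rule order_trans)
 qed
 have SX: "S <= X" using qp[of 12] by (simp add: S_def X_def)
 have SQ: "S * Q ^ 10 <= X" by (simp add: S_def X_def power_add[symmetric] mult_ac)
 have b: "n <= V" "m <= V" "2 * m <= V" "2 * m + n <= V" "d + 1 <= V" "(2 * d + 1) ^ (2 * k) <= V" "2 * m + (2 * k + 1) * n <= V" "2 * k <= V" "14 * k <= V" "k\<^sup>2 <= V"
  "vb <= V" "mb <= V" "sb <= V" "2 * m + (2 * k - 1) * n <= V"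
  using le by (auto simp: d_def vb_def mb_def sb_def algebra_simps diff_mult_distrib)
 have am: "am j a <= V" if "j <= 2 * k" for j a
  using am_le[OF b(1), of j] order_trans[OF power_increasing[OF that, of "2 * d + 1"] b(6)] by (simp add: d_def)
 have k2: "1 <= 2 * k" using k1 by auto
 have z: "words_le V (st ((%_. 0)) (am j))" if "j <= 2 * k" for j using am[OF that] by (simp add: words_le_def)
 define R1 where "R1 = ((%_. 0)(0 := n, 1 := m, 2 := 1, 3 := 2, 4 := 2 * m, 5 := 2 * m + n) :: nat => nat)"
 define R2 where "R2 = R1(8 := d, 20 := 2 * m + n)"
 let ?R2 = "R2(4 := 2 * m + (2 * k - 1) * n, 5 := 2 * m + 2 * k * n, 7 := 0)"
 define R3 where "R3 = R2(4 := 2 * m + (2 * k - 1) * n, 5 := vb, 22 := mb, 23 := sb, 8 := Suc d)"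
 define R5 where "R5 = R3(25 := Q, 26 := S)"
 have w1: "words_le V (st R1 (am j))" if "j <= 2 * k" for j unfolding R1_def using b V2 by (auto intro!: words_le_upd z that)
 have w2: "words_le V (st R2 (am j))" if "j <= 2 * k" for j unfolding R2_def using b by (intro words_le_upd w1 that) auto
 have w3: "words_le V (st R3 (?A))" unfolding R3_def using b by (intro words_le_upd w2) auto
 have QV: "Q ^ i <= V" if "i <= 22" for i using nX[OF that] X2 by linarith
 have w5: "words_le V (st R5 (?A))" unfolding R5_def using SX X2 QV[of 1] by (intro words_le_upd w3) auto
 define s0 where "s0 = (st ((%_. 0)(0 := n, 1 := m, 2 := 1, 3 := 2, 4 := 2 * m, 5 := 2 * m + n, 6 := 0, 8 := d, 10 := d - 1)) (am 1))"
 have ws0: "words_le V s0" unfolding s0_def using b V2 k1 by (auto intro!: words_le_upd z k2)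
 have 1: "runs [Const 10 0, Binop Add 20 5 9, Const 7 (2 * k - 1)] s0 3 (return_pmf (st (R2(7 := 2 * k - 1)) (am 1)))"
  by (rule does_block[OF ws0 V2]) (use b in \<open>auto simp: s0_def R1_def R2_def set_reg_def fun_eq_iff\<close>)
 have 2: "runs [WhileNZ 7 round_body] (st (R2(7 := 2 * k - 1)) (am 1)) ((2 * k - 1) * ((3 + ((m * (24 + 1) + 1) + 1)) + 1) + 1)
  (return_pmf (st (?R2) (?A)))"
  by (rule does_rounds) (use w2[OF k2] b in \<open>auto simp: R2_def R1_def d_def\<close>)
 have 3: "runs (arrays_code k)
   (st (?R2) (?A)) 5
   (return_pmf (st (R3(25 := 1, 6 := 14 * k)) (?A)))"
 proof (rule does_block[OF _ V2])
  show "words_le V (st (?R2) (?A))"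
   using b by (intro words_le_upd w2) (auto simp: vb_def)
  show "sem (arrays_code k)
   (st (?R2) (?A)) = return_pmf (st (R3(25 := 1, 6 := 14 * k)) (?A))"
   by (auto simp: set_reg_def R3_def R2_def R1_def vb_def mb_def sb_def fun_eq_iff)
 qed (use b V2 in auto)
 have Qd: "Suc d ^ (14 * k) = Q" by (simp add: Q_def Qn_def)
 have 4: "runs [WhileNZ 6 power_body] (st (R3(25 := 1, 6 := 14 * k)) (?A))
  (14 * k * (2 + 1) + 1) (return_pmf (st (R3(25 := Q, 6 := 0)) (?A)))"
  unfolding Qd[symmetric] by (rule does_power) (use w3 b QV[of 1] in \<open>auto simp: R3_def R2_def R1_def Qd\<close>)
 have wR3Q: "words_le V (st (R3(25 := Q)) (?A))" using QV[of 1] by (intro words_le_upd w3) auto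
 have 5: "runs [Binop Add 10 0 9] (st (R3(25 := Q, 6 := 0)) (?A)) 1
  (return_pmf (st ((R3(25 := Q))(10 := n, 27 := 0)) (?A)))"
  by (rule does_block[OF words_le_upd[OF wR3Q] V2]) (auto simp: set_reg_def R3_def R2_def R1_def fun_eq_iff)
 have 6: "runs [WhileNZ 10 half_body] (st ((R3(25 := Q))(10 := n, 27 := 0)) (?A))
   (L * 3 + 1) (return_pmf (st ((R3(25 := Q))(10 := 0, 27 := 0 + L)) (?A)))"
  unfolding L_def by (rule does_bitlen) (use wR3Q b Ln in \<open>auto simp: R3_def R2_def R1_def L_def\<close>)
 define s6 where "s6 = (st ((R3(25 := Q))(10 := 0, 27 := 0 + L)) (?A))"
 have ws6: "words_le V s6" unfolding s6_def using w3 QV[of 1] b Ln by (intro words_le_upd) auto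
 define s7 where "s7 = (st (R5(10 := (S - L) * Q ^ 10, 27 := L, 28 := Q ^ 10)) (?A))"
 have 7: "runs powers_code s6 12 (return_pmf s7)"
 proof (rule does_block[OF ws6 V2])
  have q: "Q * Q * (Q * Q) * (Q * Q * (Q * Q)) * (Q * Q * (Q * Q)) * n * n = S"
   "Q * Q * (Q * Q * (Q * Q) * (Q * Q * (Q * Q))) = Q ^ 10"
   by (simp_all add: S_def eval_nat_numeral)
  show "sem powers_code s6 = return_pmf s7"
   by (simp add: s6_def s7_def set_reg_def R5_def R3_def R2_def R1_def q) (auto simp: fun_eq_iff)
 qed auto
 obtain N c i where 8: "runs [WhileNZ 10 double_body] s7 (N * 5 + 1)
   (return_pmf (st (R5(10 := 0, 27 := c, 28 := i)) (?A)))"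
   and c: "min c S = min (2 ^ (Q ^ 10) * L) S" "N <= Q ^ 10" "N <= S - L" "c <= 2 * X + n" "i <= Q ^ 10"
 proof -
  have r: "R5 2 = 1" "R5 26 = S" by (auto simp: R5_def R3_def R2_def R1_def)
  have x: "L <= 2 * X + n" "2 * S <= 2 * X + n" "S * Q ^ 10 <= V" "Q ^ 10 <= V"
   using Ln SX SQ X2 QV[of 10] by auto
  show ?thesis using does_doubling[OF r w5 L1 x(1,2) X2(1) x(3,4)] that unfolding s7_def by blast
 qed
 define R6 where "R6 = R5(27 := c, 28 := i, 24 := k\<^sup>2)"
 have ci: "c <= V" "i <= V" using c X2 QV[of 10] by auto
 have w6: "words_le V (st R6 (?A))" unfolding R6_def using ci b by (intro words_le_upd w5) auto
 have Tc: "(S - (S - c)) * m = T" using c(1) unfolding T by (simp add: min_def mult.commute split: if_splits)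
 have 9: "runs (steps_code k)
   (st (R5(10 := 0, 27 := c, 28 := i)) (?A)) 5 (return_pmf (st (R6(6 := T)) (?A)))"
 proof (rule does_block[OF _ V2])
  show "words_le V (st (R5(10 := 0, 27 := c, 28 := i)) (?A))" using ci by (intro words_le_upd w5) auto
  show "sem (steps_code k)
   (st (R5(10 := 0, 27 := c, 28 := i)) (?A)) = return_pmf (st (R6(6 := T)) (?A))"
   by (simp add: set_reg_def R6_def R5_def R3_def R2_def R1_def Tc) (auto simp: fun_eq_iff)
 qed (use b in auto)
 have vb: "vb = 2 * m + (2 * k) * n" by (simp add: vb_def)
 have zero: "?A a = 0" if "mb <= a" for a
  by (rule am_beyond) (use that in \<open>simp add: mb_def vb_def\<close>)
 have g0: "?A = gm mb sb ?A {}" using zero by (auto simp: fun_eq_iff gm_def sb_def)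
 have TV: "T <= V"
 proof -
  have "T <= m * S" unfolding T by (intro mult_le_mono) auto
  also have "... <= m * X" using SX by (intro mult_le_mono) auto
  finally show ?thesis using X2 by linarith
 qed
 define G where "G M = (st (R6(6 := 0)) (gm mb sb ?A M))" for M
 have gg: "giter T {} = glauber (edge_wt k E) E T" using giter_glauber[of 0 T] by (simp add: bind_return_pmf)
 have 10: "runs [WhileNZ 6 glauber_body] (st (R6(6 := T)) (?A)) (T * (45 + 1) + 1) (map_pmf G (glauber (edge_wt k E) E T))"
 proof -
  have "runs [WhileNZ 6 glauber_body] (st (R6(6 := T)) (gm mb sb ?A {})) (T * (45 + 1) + 1)
   (map_pmf (%M. (st (R6(6 := 0)) (gm mb sb ?A M))) (giter T {}))"
  proof (rule does_glauber[where vb = vb])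
   show "?A (vb + u) = vwt E (2 * k) u" if "u < n" for u unfolding vb by (rule am_at[OF that]) simp
  qed (use w6 TV am_edges in \<open>auto simp: R6_def R5_def R3_def R2_def R1_def vb_def mb_def sb_def\<close>)
  then show ?thesis unfolding G_def gg g0[symmetric] .
 qed
 define P where "P M j \<longleftrightarrow> ed j \<in> M \<or> vwt E 1 (eu j) + vwt E 1 (ew j) <= 2" for M j
 define F where "F M = (st (R6(6 := 0, 7 := cnt (P M) m, 1 := cnt (P M) m)) (cm (gm mb sb ?A M) (P M) m))" for M
 have 11: "runs ([Binop Add 6 1 9] @ [WhileNZ 6 output_body] @ [Binop Add 1 7 9]) (G M) (1 + ((m * (29 + 1) + 1) + 1)) (return_pmf (F M))" for M
 proof -
  define \<mu> where "\<mu> = gm mb sb ?A M"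
  have \<mu>V: "\<mu> a <= V" for a using am[of "2 * k"] V2 by (auto simp: \<mu>_def gm_def)
  have w: "words_le V (st R6 \<mu>)" by (rule words_le_mem[OF w6 \<mu>V])
  have old: "\<mu> a = ?A a" if "a < mb" for a using that by (simp add: \<mu>_def gm_def sb_def)
  have "runs [Binop Add 6 1 9] (G M) 1 (return_pmf (st (R6(6 := m)) \<mu>))"
   unfolding G_def \<mu>_def[symmetric]
   by (rule does_block[OF words_le_upd[OF w] V2]) (auto simp: set_reg_def R6_def R5_def R3_def R2_def R1_def fun_eq_iff)
  moreover have "runs [WhileNZ 6 output_body] (st (R6(6 := m)) \<mu>) (m * (29 + 1) + 1)
    (return_pmf (st (R6(6 := 0, 7 := cnt (P M) m)) (cm \<mu> (P M) m)))"
  proof (rule does_output[where db = "2 * m + n" and h = "vwt E 1" and Q = "%j. ed j \<in> M"])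
   have vbm: "2 * m + n + n <= mb" using k1 by (simp add: mb_def vb_def Suc_le_eq)
   show "has_edges \<mu>" using am_edges[of "2 * k"] vbm by (auto simp: has_edges_def old)
   show "\<mu> (2 * m + n + u) = vwt E 1 u" if "u < n" for u
    using am_at[OF that, of 1 "2 * k"] k1 vbm that by (simp add: old)
   show "\<mu> (sb + i) = of_bool (ed i \<in> M)" if "i < m" for i using that by (simp add: \<mu>_def gm_def)
  qed (use w b in \<open>auto simp: P_def R6_def R5_def R3_def R2_def R1_def sb_def mb_def vb_def\<close>)
  moreover have "runs [Binop Add 1 7 9] (st (R6(6 := 0, 7 := cnt (P M) m)) (cm \<mu> (P M) m)) 1 (return_pmf (F M))"
  proof (rule does_block[OF _ V2])
   have "cm \<mu> (P M) m a <= V" for a using \<mu>V b by (intro cm_props(3)) auto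
   from words_le_mem[OF w this] show "words_le V (st (R6(6 := 0, 7 := cnt (P M) m)) (cm \<mu> (P M) m))"
    using order_trans[OF cnt_le[of "P M" m] b(2)] by (intro words_le_upd) auto
  qed (auto simp: F_def \<mu>_def set_reg_def R6_def R5_def R3_def R2_def R1_def)
  ultimately show ?thesis by (intro does_seq)
 qed
 define D where "D = map_pmf F (glauber (edge_wt k E) E T)"
 have 12: "runs (program_rest k) s0
   (3 + (((2 * k - 1) * ((3 + ((m * (24 + 1) + 1) + 1)) + 1) + 1) + (5 + ((14 * k * (2 + 1) + 1) + (1 + ((L * 3 + 1) + (12 + ((N * 5 + 1) + (5
   + ((T * (45 + 1) + 1) + (1 + ((m * (29 + 1) + 1) + 1)))))))))))) D"
  unfolding program_rest_def D_def map_pmf_def[of F]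
  by (intro does_seq[OF 1] does_seq[OF 2] does_seq[OF 3] does_seq[OF 4] does_seq[OF 5] does_seq[OF 6] does_seq[OF 7[unfolded s6_def]] does_seq[OF 8] does_seq[OF 9]
   does_append_map[OF 10] 11)
 define \<tau> where "\<tau> = 3 + (((2 * k - 1) * ((3 + ((m * (24 + 1) + 1) + 1)) + 1) + 1) + (5 + ((14 * k * (2 + 1) + 1) + (1 + ((L * 3 + 1) + (12 + ((N * 5 + 1) + (5
   + ((T * (45 + 1) + 1) + (1 + ((m * (29 + 1) + 1) + 1)))))))))))"
 have "runs (program k) (input_state n es) (41 * m + \<tau> + 11) D"
  using 12 deg by (intro does_degrees[OF le]) (simp only: \<tau>_def s0_def d_def if_True)
 moreover have "map_pmf output_edges D = alg k (runtime k) n E"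
 proof -
  have out: "output_edges (F M) = M Un iso_edges E" if "M \<in> matchings E" for M
  proof -
   have "output_edges (F M) = ed ` {j. j < m & P M j}"
    using cm_props(2)[where \<mu> = "gm mb sb ?A M" and P = "P M" and i = m] by (simp add: output_edges_def F_def)
   also have "... = ed ` {j. j < m & (ed j \<in> M \<or> ed j \<in> iso_edges E)}"
    unfolding P_def using iso_degree by (intro arg_cong[where f = "image ed"] Collect_cong) blast
   also have "... = {e \<in> ed ` {..<m}. e \<in> M \<or> e \<in> iso_edges E}" by auto
   also have "ed ` {..<m} = E" using ed_bij by (simp add: bij_betw_def)
   also have "{e \<in> E. e \<in> M \<or> e \<in> iso_edges E} = M Un iso_edges E" using that by (auto simp: matchings_def iso_edges_def)
   finally show ?thesis .
  qed
  have gm: "set_pmf (glauber (edge_wt k E) E t) <= matchings E" for t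
   using glauber_step_matching by (induction t) auto
  have "map_pmf output_edges D = map_pmf (%M. M Un iso_edges E) (glauber (edge_wt k E) E T)"
   unfolding D_def map_pmf_comp using gm by (intro map_pmf_cong refl out) auto
  then show ?thesis using deg by (simp add: alg_def T_def)
 qed
 moreover have "41 * m + \<tau> + 11 <= 300 * (k * m + bitlen n + runtime k n E)"
 proof -
  \<comment> \<open>The doublings number at most \<open>Q ^ 10\<close>, hence at most
    \<open>2 ^ (Q ^ 10) * L\<close>, and at most \<open>S\<close>; so computing the step count costs
    no more than executing the steps.\<close>
  have "Q ^ 10 <= 2 ^ (Q ^ 10)" using less_exp[of "Q ^ 10"] by simp
  then have "N <= 2 ^ (Q ^ 10) * L" using c(2) L1 mult_le_mono[of "Q ^ 10" "2 ^ (Q ^ 10)" 1 L] by linarith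
  then have "1 * N <= m * min (2 ^ (Q ^ 10) * L) S" using c(3) m_pos by (intro mult_le_mono) auto
  then have NT: "N <= T" unfolding T by simp
  have mk: "m <= k * m" "k <= k * m" "1 <= k * m" using k1 m_pos by (auto simp: Suc_le_eq)
  have "(2 * k - 1) * ((3 + ((m * (24 + 1) + 1) + 1)) + 1) <= (2 * k) * (25 * m + 6)" by (intro mult_le_mono) auto
  also have "... = 50 * (k * m) + 12 * k" by (simp add: algebra_simps)
  finally have "\<tau> <= 3 + ((50 * (k * m) + 12 * k + 1) + (5 + ((14 * k * (2 + 1) + 1) + (1 + ((L * 3 + 1) + (12 + ((N * 5 + 1) + (5
   + ((T * (45 + 1) + 1) + (1 + ((m * (29 + 1) + 1) + 1)))))))))))" unfolding \<tau>_def by linarith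
  then have "\<tau> <= 50 * (k * m) + 54 * k + 3 * L + 5 * N + 46 * T + 30 * m + 40" by simp
  then have "41 * m + \<tau> + 11 <= 50 * (k * m) + 54 * k + 3 * L + 51 * T + 71 * m + 51" using NT by linarith
  also have "... <= 50 * (k * m) + 54 * (k * m) + 3 * L + 51 * T + 71 * (k * m) + 51 * (k * m)" using mk by (intro add_mono) auto
  also have "... <= 300 * (k * m + L + T)" by simp
  finally show ?thesis by (simp only: L_def T_def)
 qed
 ultimately show ?thesis by blast
qed

end

section \<open>Running time and constants\<close>

lemma bitlen_bounds: shows "x < 2 ^ bitlen x" "1 <= x ==> 2 ^ bitlen x <= 2 * x"
proof -
 have "x < 2 ^ bitlen x & (1 <= x \<longrightarrow> 2 ^ bitlen x <= 2 * x)"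
 proof (induction x rule: less_induct)
  case (less x)
  show ?case
  proof (cases "x = 0")
   case False
   then have b: "bitlen x = Suc (bitlen (x div 2))" using bitlen.simps[of x] by simp
   have IH: "x div 2 < 2 ^ bitlen (x div 2)" "1 <= x div 2 \<longrightarrow> 2 ^ bitlen (x div 2) <= 2 * (x div 2)"
    using less[of "x div 2"] False by auto
   have "2 ^ bitlen (x div 2) <= x"
   proof (cases "1 <= x div 2")
    case True
    then show ?thesis using IH(2) by linarith
   next
    case no: False
    then have "bitlen (x div 2) = 0" using bitlen.simps[of "x div 2"] by simp
    then show ?thesis using False by simp
   qed
   then show ?thesis using IH(1) b by simp
  qed (simp add: bitlen.simps)
 qed
 then show "x < 2 ^ bitlen x" "1 <= x ==> 2 ^ bitlen x <= 2 * x" by auto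
qed

lemma bitlen_ln: assumes "1 <= x" shows "ln (real x) <= real (bitlen x)" "2 <= x ==> real (bitlen x) <= 3 * ln (real x)"
proof -
 have "real x < real (2 ^ bitlen x)" using bitlen_bounds(1)[of x] by (simp only: of_nat_less_iff)
 then have "ln (real x) <= ln (2 ^ bitlen x)" using assms by simp
 also have "... = real (bitlen x) * ln 2" by (simp add: ln_realpow)
 also have "... <= real (bitlen x) * 1" using ln_2_less_1 by (intro mult_left_mono) auto
 finally show "ln (real x) <= real (bitlen x)" by simp
 assume x: "2 <= x"
 have "real (2 ^ bitlen x) <= real (2 * x)" using bitlen_bounds(2)[OF assms] by (simp only: of_nat_le_iff)
 then have "ln (2 ^ bitlen x) <= ln (2 * real x)" using assms by simp
 then have "real (bitlen x) * ln 2 <= ln 2 + ln (real x)" using assms by (simp add: ln_realpow ln_mult)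
 moreover have "ln 2 <= ln (real x)" using x by simp
 ultimately have "real (bitlen x) * ln 2 <= 2 * ln (real x)" by linarith
 moreover have "real (bitlen x) * (2 / 3) <= real (bitlen x) * ln 2" using ln2_ge_two_thirds by (intro mult_left_mono) auto
 ultimately show "real (bitlen x) <= 3 * ln (real x)" by linarith
qed

lemma k_le_Qn: assumes "1 <= d" shows "k <= Qn k d"
proof -
 have "k <= 2 ^ k" using less_exp[of k] by simp
 also have "... <= (d + 1) ^ k" using assms by (intro power_mono) auto
 also have "... <= Qn k d" unfolding Qn_def by (intro power_increasing) auto
 finally show ?thesis .
qed

lemma ln_le_self: "0 < x ==> ln x <= (x :: real)"
 using ln_le_minus_one[of x] by simp

text \<open>Three regimes. If the polynomial term is the minimum, the gap over all vertices is used.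
  Otherwise entropy is used when there are at least \<open>q ^ 27\<close> edges, and with fewer
  edges again the gap, now over the non-isolated vertices.\<close>

lemma runtime_mixed: assumes k1: "1 <= k" shows "mixed k (runtime k)"
 unfolding mixed_def
proof (intro allI impI)
 fix n E assume sg: "simple_graph n E" and deg: "2 <= max_degree n E"
 note g = simple_graphD[OF sg]
 define d where "d = max_degree n E"
 define Q where "Q = Qn k d"
 define q where "q = real Q"
 define L where "L = real (bitlen n)"
 define m where "m = real (card E)"
 define \<delta> where "\<delta> = 1 / (real n * real k)"
 have E0: "E ~= {}" using deg max_degree_empty by auto
 have d1: "1 <= d" "max_degree n E <= d" using deg by (auto simp: d_def)
 have w: "wgraph (lamw k E) (q - 1) E" using wgraph_lamw[OF sg k1 d1(2,1)] by (simp add: q_def Q_def)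
 have q: "2 ^ 14 <= q" using Qn_bound(4)[OF k1 d1(1)] unfolding q_def Q_def by (metis of_nat_le_iff of_nat_numeral of_nat_power)
 have q1: "1 <= q" "2 <= q" "1000 <= q" using q by auto
 have qk: "real k <= q" using k_le_Qn[OF d1(1), of k] by (simp add: q_def Q_def)
 obtain e where e: "e \<in> E" using E0 by blast
 then obtain x where "x \<in> e" using g(2) by fastforce
 then have n1: "1 <= n" using g(3)[OF e] by auto
 have L1: "1 <= L" using n1 bitlen.simps[of n] by (simp add: L_def)
 have Ln: "ln (real n) <= L" using bitlen_ln(1)[OF n1] by (simp add: L_def)
 have m1: "1 <= m" using E0 g(1) by (simp add: m_def Suc_le_eq card_gt_0_iff)
 have \<delta>: "0 < \<delta>" using n1 k1 by (simp add: \<delta>_def)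
 have lnq: "0 <= ln q" "ln q <= q" using q1 ln_le_self[of q] by auto
 have lnk: "ln (real k) <= q" using ln_le_self[of "real k"] k1 qk by simp
 have ln\<delta>: "ln (1 / \<delta>) = ln (real n) + ln (real k)" using n1 k1 by (simp add: \<delta>_def ln_mult)
 have nL: "0 <= ln (real n)" "0 <= ln (real k)" using n1 k1 by auto
 define T where "T = runtime k n E"
 have T: "real T = m * min (2 ^ (Q ^ 10) * L) (q ^ 12 * real n * real n)"
  by (simp add: T_def runtime_def Let_def m_def L_def q_def Q_def d_def of_nat_min)
 note ent = glauber_mixing_entropy[OF w, where \<delta> = \<delta> and t = T] and var = glauber_mixing_variance[OF w E0, where \<delta> = \<delta> and t = T]
 have "gex (lamw k E) E (%M. \<bar>glauber_density (lamw k E) E T M - 1\<bar>) <= \<delta>"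
 proof (cases "2 ^ (Q ^ 10) * L <= q ^ 12 * real n * real n")
  case False
  show ?thesis
  proof (rule var[where U = "{..<n}"])
   have "real n * 1 <= real n * q" using q1 by (intro mult_left_mono) auto
   then have "ln (real n) <= real n * q" using ln_le_self[of "real n"] n1 unfolding mult_1_right by linarith
   moreover have "ln (real k) <= real n * q" 
   proof -
    have "1 * q <= real n * q" using n1 q1 by (intro mult_right_mono) auto
    then show ?thesis using lnk unfolding mult_1 by (rule order_trans[rotated])
   qed
   moreover have "real n * ln q <= real n * q" using lnq by (intro mult_left_mono) auto
   ultimately have "real n * ln q + 2 * ln (1 / \<delta>) <= real n * q + 2 * (real n * q + real n * q)"
    unfolding ln\<delta> using lnq(2) by (intro add_mono mult_left_mono) auto
   also have "... = 5 * (real n * q)" by simp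
   finally have "real n * ln q + 2 * ln (1 / \<delta>) <= 5 * (real n * q)" .
   then have "m * (real n * (8 * q ^ 4)) * (real n * ln q + 2 * ln (1 / \<delta>)) <= m * (real n * (8 * q ^ 4)) * (5 * (real n * q))"
    using m1 q1 by (intro mult_left_mono) auto
   also have "... = m * ((40 * q ^ 5) * real n * real n)" by (simp add: power_numeral_reduce)
   also have "... <= m * (q ^ 12 * real n * real n)"
   proof -
    have "40 * q ^ 5 <= q * q ^ 5" using q1 by (intro mult_right_mono) auto
    also have "... = q ^ 6" by (simp add: power_numeral_reduce)
    also have "... <= q ^ 12" using q1 by (intro power_increasing) auto
    finally show ?thesis using m1 by (intro mult_left_mono mult_right_mono) auto
   qed
   also have "... = real T" using False by (simp add: T)
   finally show "real (card E) * (real (card {..<n}) * (8 * (1 + (q - 1)) ^ 4)) * (real (card {..<n}) * ln (1 + (q - 1)) + 2 * ln (1 / \<delta>)) <= real T"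
    by (simp add: m_def)
  qed (use q1 g \<delta> in auto)
 next
  case True
  then have TT: "real T = m * (2 ^ (Q ^ 10) * L)" by (simp add: T)
  show ?thesis
  proof (cases "q ^ 27 <= m")
   case big: True
   show ?thesis
   proof (rule ent[where U = "{..<n}"])
    show "1 <= lamw k E e" for e by (simp add: lamw_def)
    have "ln (real n * q) + 2 * ln (2 / \<delta>) = 3 * ln (real n) + ln q + 2 * ln 2 + 2 * ln (real k)"
     using n1 q1 k1 by (simp add: \<delta>_def ln_mult)
    also have "... <= 3 * L + q + 2 * 1 + 2 * q" using Ln lnq lnk ln_2_less_1 by linarith
    also have "... <= 3 * (L * q) + 5 * (L * q)"
    proof -
     define y where "y = L * q"
     have "L * 1 <= y" "1 * q <= y" unfolding y_def using L1 q1 by (auto intro!: mult_left_mono mult_right_mono simp del: mult_1_right mult_1)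
     then show ?thesis using L1 unfolding y_def[symmetric] by linarith
    qed
    also have "... <= L * (q * q)" using mult_right_mono[of 8 q "L * q"] L1 q1 by (simp add: mult_ac)
    finally have "m * exp (432 * q ^ 5) * (ln (real n * q) + 2 * ln (2 / \<delta>)) <= m * exp (432 * q ^ 5) * (L * (q * q))"
     using m1 by (intro mult_left_mono) auto
    also have "... <= m * exp (432 * q ^ 5) * (L * exp (2 * q))"
    proof -
     have "q <= exp q" using exp_ge_add_one_self[of q] by linarith
     then have "q * q <= exp q * exp q" using q1 by (intro mult_mono) auto
     then have "q * q <= exp (2 * q)" by (simp add: exp_add[symmetric])
     then show ?thesis using m1 L1 by (intro mult_left_mono) auto
    qed
    also have "... = m * (exp (432 * q ^ 5 + 2 * q) * L)" by (simp add: exp_add)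
    also have "... <= m * (exp (q ^ 10 * ln 2) * L)"
    proof -
     have "q ^ 1 <= q ^ 5" using q1 by (intro power_increasing) auto
     then have "432 * q ^ 5 + 2 * q <= 434 * q ^ 5" by simp
     also have "... <= (q ^ 5 * (2 / 3)) * q ^ 5"
     proof (rule mult_right_mono)
      have "q ^ 1 <= q ^ 5" using q1 by (intro power_increasing) auto
      then show "434 <= q ^ 5 * (2 / 3)" using q1 by simp
     qed (use q1 in auto)
     also have "... = q ^ 10 * (2 / 3)" by (simp add: power_numeral_reduce)
     also have "... <= q ^ 10 * ln 2" using ln2_ge_two_thirds q1 by (intro mult_left_mono) auto
     finally show ?thesis using m1 L1 by (intro mult_left_mono mult_right_mono) auto
    qed
    also have "exp (q ^ 10 * ln 2) = 2 ^ (Q ^ 10)"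
     using exp_of_nat_mult[of "Q ^ 10" "ln (2 :: real)"] by (simp add: q_def)
    also have "m * (2 ^ (Q ^ 10) * L) = real T" by (simp add: TT)
    finally show "real (card E) * exp (432 * (1 + (q - 1)) ^ 5) * (ln (real (card {..<n}) * (1 + (q - 1))) + 2 * ln (2 / \<delta>)) <= real T"
     by (simp add: m_def)
   qed (use q1 g \<delta> big in \<open>auto simp: m_def\<close>)
  next
   case small: False
   \<comment> \<open>Tensorization does not apply here, but at most \<open>2 * q ^ 27\<close>
     vertices are non-isolated. The gap bound is then a power of \<open>q\<close> times
     \<open>L\<close>, which \<open>2 ^ (Q ^ 10)\<close> dominates.\<close>
   define N where "N = real (card (\<Union>E))"
   have fU: "finite (\<Union>E)" using g(4) finite_subset by blast
   have "card (\<Union>E) <= (\<Sum>e\<in>E. card e)" by (rule card_Union_le_sum_card)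
   also have "... = 2 * card E" using g(2) by simp
   finally have "real (card (\<Union>E)) <= real (2 * card E)" by (simp only: of_nat_le_iff)
   then have N: "N <= 2 * q ^ 27" using small by (simp add: N_def m_def)
   have N0: "0 <= N" by (simp add: N_def)
   show ?thesis
   proof (rule var[where U = "\<Union>E"])
    have "N * ln q <= (2 * q ^ 27) * q" using N N0 lnq q1 by (intro mult_mono) auto
    also have "... = 2 * q ^ 28" by (simp add: power_numeral_reduce)
    finally have "N * ln q + 2 * ln (1 / \<delta>) <= 2 * q ^ 28 + 2 * (L + q)" unfolding ln\<delta> using Ln lnk by (intro add_mono mult_left_mono) auto
    also have "... = 2 * q ^ 28 + 2 * L + 2 * q" by simp
    finally have "N * ln q + 2 * ln (1 / \<delta>) <= 2 * q ^ 28 + 2 * L + 2 * q" .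
    also have "... <= 2 * (L * q ^ 28) + 2 * (L * q ^ 28) + 2 * (L * q ^ 28)"
    proof (intro add_mono mult_left_mono)
     have p: "1 <= q ^ 28" "q ^ 1 <= q ^ 28" using one_le_power[OF q1(1)] power_increasing[OF _ q1(1), of 1 28] by (simp_all del: power_one_right)
     show "q ^ 28 <= L * q ^ 28" using mult_right_mono[OF L1, of "q ^ 28"] q1 by simp
     then show "q <= L * q ^ 28" using p(2) by simp
     show "L <= L * q ^ 28" using mult_left_mono[OF p(1), of L] L1 by simp
    qed auto
    finally have a: "N * ln q + 2 * ln (1 / \<delta>) <= 6 * (L * q ^ 28)" by simp
    have "N * (8 * q ^ 4) <= (2 * q ^ 27) * (8 * q ^ 4)" using N q1 by (intro mult_right_mono) auto
    also have "... = 16 * q ^ 31" by (simp add: power_add[symmetric])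
    finally have b: "N * (8 * q ^ 4) <= 16 * q ^ 31" .
    have "m * (N * (8 * q ^ 4)) * (N * ln q + 2 * ln (1 / \<delta>)) <= m * (16 * q ^ 31) * (6 * (L * q ^ 28))"
     by (rule mult_mono[OF mult_left_mono[OF b] a]) (use m1 q1 N0 lnq nL in \<open>auto simp: ln\<delta>\<close>)
    also have "... = m * (96 * q ^ 59 * L)" by (simp add: power_add[symmetric])
    also have "... <= m * (2 ^ (Q ^ 10) * L)"
    proof -
     have "96 * q ^ 59 <= q * q ^ 59" using q1 by (intro mult_right_mono) auto
     also have "... = q ^ 60" by (metis power_Suc numeral_eq_Suc pred_numeral_simps(2,3) semiring_norm(26,27,28))
     also have "... <= (2 ^ Q) ^ 60" unfolding q_def using of_nat_less_two_power[of Q, where ?'a = real] by (intro power_mono) auto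
     also have "... = 2 ^ (60 * Q)" by (simp add: power_mult[symmetric] mult.commute)
     also have "... <= 2 ^ (Q ^ 10)"
     proof (rule power_increasing)
      have Q: "1000 <= Q" using q1(3) by (simp add: q_def)
      have "60 * Q <= Q * Q" using Q by (intro mult_le_mono) auto
      also have "... = Q ^ 2" by (simp add: power2_eq_square)
      also have "... <= Q ^ 10" using Q by (intro power_increasing) auto
      finally show "60 * Q <= Q ^ 10" .
     qed simp
     finally show ?thesis using m1 L1 by (intro mult_left_mono mult_right_mono) auto
    qed
    also have "... = real T" by (simp add: TT)
    finally show "real (card E) * (real (card (\<Union>E)) * (8 * (1 + (q - 1)) ^ 4)) * (real (card (\<Union>E)) * ln (1 + (q - 1)) + 2 * ln (1 / \<delta>)) <= real T"
     by (simp add: m_def N_def)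
   qed (use q1 fU \<delta> in auto)
  qed
 qed
 then show "gex (lamw k E) E (%M. \<bar>glauber_density (lamw k E) E (runtime k n E) M - 1\<bar>) <= 1 / (real n * real k)"
  by (simp add: T_def \<delta>_def)
qed

text \<open>For \<open>d >= 2\<close> one has \<open>d + 1 <= d\<^sup>2\<close>, which doubles
  \<open>14 * k\<close>, and \<open>k <= 4 / \<epsilon>\<close> gives \<open>28 * 4 = 112\<close>.
  The powers 4, 10 and 12 of \<open>Qn\<close> yield the exponents 448, 1120 and 1344.\<close>

lemma Qn_powr:
 assumes "2 <= d" "real k <= 4 / \<epsilon>" "0 < \<epsilon>"
 shows "real (Qn k d) ^ i <= real d powr (112 * real i / \<epsilon>)"
proof -
 have "d + 1 <= d * d" using mult_le_mono1[OF assms(1), of d] assms(1) by linarith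
 then have "(d + 1) ^ (14 * k * i) <= (d * d) ^ (14 * k * i)" by (intro power_mono) auto
 also have "... = d ^ (28 * k * i)" by (simp add: power2_eq_square[symmetric] power_mult[symmetric] mult.assoc)
 finally have "real ((d + 1) ^ (14 * k * i)) <= real (d ^ (28 * k * i))" by (simp only: of_nat_le_iff)
 then have "real (Qn k d) ^ i <= real d ^ (28 * k * i)" by (simp add: Qn_def power_mult[symmetric] add.commute)
 also have "... = real d powr real (28 * k * i)" by (rule powr_realpow[symmetric]) (use assms(1) in simp)
 also have "... <= real d powr (112 * real i / \<epsilon>)"
 proof (rule powr_mono)
  have "28 * real k * real i <= 28 * (4 / \<epsilon>) * real i" using assms(2) by (intro mult_right_mono mult_left_mono) auto
  then show "real (28 * k * i) <= 112 * real i / \<epsilon>" by simp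
 qed (use assms(1) in auto)
 finally show ?thesis .
qed

lemma alg_sensitivity_powr:
 assumes "simple_graph n E" "1 <= k" "real k <= 4 / \<epsilon>" "0 < \<epsilon>"
 shows "sensitivity (alg k (runtime k)) n E <= real (max_degree n E) powr (448 / \<epsilon>)"
proof -
 note g = simple_graphD[OF assms(1)]
 have "wasserstein (alg k (runtime k) n E) (alg k (runtime k) n (E - {d})) <= real (max_degree n E) powr (448 / \<epsilon>)" if "d \<in> E" for d
 proof -
  from g(2)[OF that] obtain x where x: "x \<in> d" by fastforce
  have "0 < card (inc x E)" using that x g(1) by (auto simp: inc_def card_gt_0_iff)
  then have d1: "1 <= max_degree n E" using card_inc_le_max_degree[OF assms(1), of x] by linarith
  have "(if max_degree n E <= 1 then 1 else real (Qn k (max_degree n E)) ^ 4) <= real (max_degree n E) powr (448 / \<epsilon>)"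
   using Qn_powr[of "max_degree n E" k \<epsilon> 4] assms(3,4) d1 by (cases "max_degree n E = 1") auto
  then show ?thesis using alg_sensitivity[OF assms(1,2) runtime_mixed[OF assms(2)] that] by linarith
 qed
 then show ?thesis unfolding sensitivity_def using g(1) by (intro Max.boundedI) auto
qed

lemma card_edges_le: assumes "simple_graph n E" shows "card E <= n\<^sup>2" "max_degree n E <= n\<^sup>2"
proof -
 have "E <= (%(u, v). {u, v}) ` ({..<n} \<times> {..<n})"
 proof
  fix e assume e: "e \<in> E"
  from simple_graphD(2)[OF assms e] obtain u v where "e = {u, v}" by (auto simp: card_2_iff)
  then show "e \<in> (%(u, v). {u, v}) ` ({..<n} \<times> {..<n})" using simple_graphD(3)[OF assms e] by auto
 qed
 then have "card E <= card ((%(u, v). {u, v}) ` ({..<n} \<times> {..<n}))" by (intro card_mono) auto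
 also have "... <= card ({..<n} \<times> {..<n})" by (rule card_image_le) simp
 finally show c: "card E <= n\<^sup>2" by (simp add: power2_eq_square)
 have "vertex_degree E x <= card E" for x unfolding vertex_degree_def using simple_graphD(1)[OF assms] by (intro card_mono) auto
 then show "max_degree n E <= n\<^sup>2" unfolding max_degree_def using c by (intro Max.boundedI) (auto intro: order_trans)
qed

text \<open>With \<open>D + 1 <= (n + 2)\<^sup>2\<close>, where \<open>D\<close> is the maximum
  degree, \<open>Qn\<close> is at most \<open>(n + 2) ^ (28 * k)\<close> and its 22nd power
  contributes \<open>616 * k\<close>; the remaining \<open>24 * k\<close> covers the polynomial
  factors.\<close>

lemma word_size_bounds:
 assumes "simple_graph n E" "1 <= k" "1 <= n"
 defines "V \<equiv> (n + 2) ^ (640 * k)"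
 shows "5 * card E + (2 * k + 4) * n + 14 * k + k\<^sup>2 + (2 * max_degree n E + 1) ^ (2 * k) + max_degree n E + 2 <= V"
  "Qn k (max_degree n E) ^ 22 * n * n * (card E + 2) + n <= V" "2 <= V"
proof -
 define N where "N = n + 2"
 define d where "d = max_degree n E"
 define m where "m = card E"
 have N: "3 <= N" using assms(3) by (simp add: N_def)
 have N2: "n\<^sup>2 + 4 * n + 4 = N\<^sup>2" by (simp add: N_def power2_eq_square algebra_simps)
 have md: "m + 2 <= N\<^sup>2" "d + 1 <= N\<^sup>2" "d + 2 <= N\<^sup>2" "n <= N\<^sup>2" using card_edges_le[OF assms(1)] N2 by (auto simp: m_def d_def)
 have mono: "N ^ i <= N ^ j" if "i <= j" for i j using N that by (intro power_increasing) auto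
 have "k <= 2 ^ k" using less_exp[of k] by simp
 also have "... <= N ^ k" using N by (intro power_mono) auto
 finally have kN: "k <= N ^ k" .
 define Y where "Y = N ^ (6 * k)"
 have c: "5 <= N\<^sup>2" "6 <= N\<^sup>2" "14 <= N ^ 3" using power_mono[OF N, of 2] power_mono[OF N, of 3] by auto
 have "5 * m <= N\<^sup>2 * N\<^sup>2" using c md by (intro mult_le_mono) auto
 also have "... <= Y" unfolding Y_def power_add[symmetric] using assms(2) by (intro mono) auto
 finally have t1: "5 * m <= Y" .
 have "(2 * k + 4) * n <= (6 * k) * N" using assms(2) by (intro mult_le_mono) (auto simp: N_def)
 also have "... <= (N\<^sup>2 * N ^ k) * N ^ 1" using c kN by (intro mult_le_mono) auto
 also have "... <= Y" unfolding Y_def power_add[symmetric] using assms(2) by (intro mono) auto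
 finally have t2: "(2 * k + 4) * n <= Y" .
 have "14 * k <= N ^ 3 * N ^ k" using c kN by (intro mult_le_mono) auto
 also have "... <= Y" unfolding Y_def power_add[symmetric] using assms(2) by (intro mono) auto
 finally have t3: "14 * k <= Y" .
 have "k\<^sup>2 <= N ^ k * N ^ k" using kN unfolding power2_eq_square by (intro mult_le_mono) auto
 also have "... <= Y" unfolding Y_def power_add[symmetric] by (intro mono) auto
 finally have t4: "k\<^sup>2 <= Y" .
 have "2 * d + 1 <= 2 * N\<^sup>2" using md by linarith
 also have "... <= N * N\<^sup>2" using N by (intro mult_le_mono) auto
 also have "... = N ^ 3" by (simp add: power_numeral_reduce)
 finally have "(2 * d + 1) ^ (2 * k) <= (N ^ 3) ^ (2 * k)" by (intro power_mono) auto
 then have t5: "(2 * d + 1) ^ (2 * k) <= Y" by (simp add: Y_def power_mult[symmetric])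
 have "d + 2 <= Y" unfolding Y_def by (rule order_trans[OF md(3)]) (use assms(2) in \<open>auto intro!: mono\<close>)
 then have "5 * m + (2 * k + 4) * n + 14 * k + k\<^sup>2 + (2 * d + 1) ^ (2 * k) + d + 2 <= 6 * Y" using t1 t2 t3 t4 t5 by linarith
 also have "... <= N\<^sup>2 * Y" using c by (intro mult_le_mono) auto
 also have "... <= V" unfolding V_def Y_def N_def[symmetric] power_add[symmetric] using assms(2) by (intro mono) auto
 finally show "5 * card E + (2 * k + 4) * n + 14 * k + k\<^sup>2 + (2 * max_degree n E + 1) ^ (2 * k) + max_degree n E + 2 <= V"
  by (simp add: m_def d_def)
 have "Qn k d <= (N\<^sup>2) ^ (14 * k)" unfolding Qn_def using md by (intro power_mono) auto
 then have "Qn k d <= N ^ (28 * k)" by (simp add: power_mult[symmetric])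
 then have "Qn k d ^ 22 <= (N ^ (28 * k)) ^ 22" by (intro power_mono) auto
 also have "... = N ^ (616 * k)" by (simp add: power_mult[symmetric] mult.commute)
 finally have "Qn k d ^ 22 * n * n * (m + 2) <= N ^ (616 * k) * N ^ 1 * N ^ 1 * N\<^sup>2"
  using md by (intro mult_le_mono) (auto simp: N_def)
 also have "... = N ^ (616 * k + 4)" by (simp add: power_add power_numeral_reduce)
 finally have "Qn k d ^ 22 * n * n * (m + 2) + n <= N ^ (616 * k + 4) + N ^ (616 * k + 4)"
  using mono[of 1 "616 * k + 4"] by (simp add: N_def)
 also have "... <= N * N ^ (616 * k + 4)" unfolding mult_2[symmetric] using N by (intro mult_le_mono) auto
 also have "... = N ^ (616 * k + 5)" by (simp add: power_add power_numeral_reduce)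
 also have "... <= V" unfolding V_def N_def[symmetric] using assms(2) by (intro mono) auto
 finally show "Qn k (max_degree n E) ^ 22 * n * n * (card E + 2) + n <= V" by (simp add: m_def d_def)
 have "N ^ 1 <= V" unfolding V_def N_def[symmetric] using assms(2) by (intro mono) auto
 then show "2 <= V" using N by simp
qed

abbreviation (input) time_bound :: "real => nat => nat set set => real" where
 "time_bound \<epsilon> n E \<equiv> min (exp (real (max_degree n E) powr (1120 / \<epsilon>)) * real (card E) * ln (real n) + 1 * real n)
   (1 / \<epsilon> * real (max_degree n E) powr (1344 / \<epsilon>) * (real n)\<^sup>2 * real (card E) * ln (real n))"

text \<open>An edge forces \<open>n >= 2\<close>, so \<open>ln n >= 1 / 2\<close> and terms linear
  in the number of edges fit under both bounds. The factor \<open>k\<close> disappears in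
  \<open>exp (q ^ 10)\<close> in the first bound and in \<open>1 / \<epsilon>\<close> in the
  second.\<close>

lemma program_time:
 assumes sg: "simple_graph n E" and E0: "E ~= {}" and k: "1 <= k" "real k <= 4 / \<epsilon>" and \<epsilon>: "0 < \<epsilon>" "\<epsilon> < 1"
 defines "\<tau> \<equiv> time_bound \<epsilon> n E"
 shows "max_degree n E <= 1 ==> real (41 * card E + 11) <= 4000 * (1 + \<tau>)"
  "1 < max_degree n E ==> t <= 300 * (k * card E + bitlen n + runtime k n E) ==> real t <= 4000 * (1 + \<tau>)"
proof -
 note g = simple_graphD[OF sg]
 define d where "d = max_degree n E"
 define l where "l = ln (real n)"
 define m where "m = real (card E)"
 obtain e where e: "e \<in> E" using E0 by blast
 have n2: "2 <= n" using card_mono[OF _ g(3)[OF e]] g(2)[OF e] by simp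
 obtain x where x: "x \<in> e" using g(2)[OF e] by fastforce
 have "0 < card (inc x E)" using e x g(1) by (auto simp: inc_def card_gt_0_iff)
 then have d1: "1 <= d" using card_inc_le_max_degree[OF sg, of x] by (simp add: d_def)
 have m1: "1 <= m" using E0 g(1) by (simp add: m_def Suc_le_eq card_gt_0_iff)
 have "ln 2 <= l" using n2 by (simp add: l_def)
 then have l: "1 / 2 <= l" using ln2_ge_two_thirds by linarith
 have ml: "m <= 2 * (m * l)" using mult_left_mono[OF l, of m] m1 by simp
 have e1: "1 <= 1 / \<epsilon>" using \<epsilon> by simp
 have nn: "1 <= (real n)\<^sup>2" using n2 by simp
 define A where "A = exp (real d powr (1120 / \<epsilon>)) * m * l"
 define B where "B = 1 / \<epsilon> * real d powr (1344 / \<epsilon>) * (real n)\<^sup>2 * m * l"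
 have \<tau>: "\<tau> = min (A + real n) B" by (simp add: \<tau>_def A_def B_def d_def m_def l_def)
 have fin: "y <= 4000 * (1 + \<tau>)" if "y <= 4000 * A" "y <= 4000 * B" for y
  using that unfolding \<tau> by (simp add: min_def)
 have p1: "1 <= real d powr c" if "0 <= c" for c using d1 that ge_one_powr_ge_zero[of "real d" c] by simp
 have mA: "m * l <= A"
 proof -
  have "1 * (m * l) <= exp (real d powr (1120 / \<epsilon>)) * (m * l)" using m1 l by (intro mult_right_mono) auto
  then show ?thesis by (simp add: A_def mult_ac)
 qed
 have mB: "c * (m * l) <= B" if "c <= 1 / \<epsilon> * real d powr (1344 / \<epsilon>) * (real n)\<^sup>2" for c
  using mult_right_mono[OF that, of "m * l"] m1 l by (simp add: B_def mult_ac)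
 have pe: "1 / \<epsilon> * 1 * 1 <= 1 / \<epsilon> * real d powr (1344 / \<epsilon>) * (real n)\<^sup>2"
  using p1[of "1344 / \<epsilon>"] nn \<epsilon> by (intro mult_mono) auto
 then have mB1: "(1 / \<epsilon>) * (m * l) <= B" by (intro mB) simp
 have mB0: "m * l <= B" using mult_right_mono[OF e1, of "m * l"] mB1 m1 l by simp
 show "real (41 * card E + 11) <= 4000 * (1 + \<tau>)" if "max_degree n E <= 1"
 proof (rule fin)
  have "real (41 * card E + 11) <= 52 * m" using m1 by (simp add: m_def)
  also have "... <= 104 * (m * l)" using ml by linarith
  finally have *: "real (41 * card E + 11) <= 104 * (m * l)" .
  have "0 <= m * l" using m1 l by simp
  then show "real (41 * card E + 11) <= 4000 * A" "real (41 * card E + 11) <= 4000 * B" using * mA mB0 by linarith+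
 qed
 assume deg: "1 < max_degree n E" and t: "t <= 300 * (k * card E + bitlen n + runtime k n E)"
 have d2: "2 <= d" using deg by (simp add: d_def)
 define Q where "Q = Qn k d"
 define q where "q = real Q"
 have qk: "real k <= q" using k_le_Qn[OF d1, of k] by (simp add: q_def Q_def)
 have q1: "1 <= q" using Qn_bound(3)[OF k(1) d1] by (simp add: q_def Q_def)
 define L where "L = real (bitlen n)"
 define T where "T = real (runtime k n E)"
 have T: "T = m * min (2 ^ (Q ^ 10) * L) (q ^ 12 * real n * real n)"
  by (simp add: T_def runtime_def Let_def m_def L_def q_def Q_def d_def of_nat_min)
 have L: "L <= 3 * l" using bitlen_ln(2)[of n] n2 by (simp add: L_def l_def)
 have "l * 1 <= l * m" using m1 l by (intro mult_left_mono) auto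
 then have Lm: "L <= 3 * (m * l)" using L by (simp add: mult.commute)
 have "real t <= real (300 * (k * card E + bitlen n + runtime k n E))" using t by (simp only: of_nat_le_iff)
 then have t0: "real t <= 300 * (real k * m + L + T)" by (simp add: m_def L_def T_def)
 \<comment> \<open>The worst case is \<open>8 + 3 + 2 = 13\<close>, and
   \<open>300 * 13 <= 4000\<close>.\<close>
 have tt: "real t <= 4000 * z" if "real k * m <= 8 * z" "L <= 3 * z" "T <= 2 * z \<or> real k * m <= 2 * z & T <= 3 * z" "0 <= z" for z
 proof -
  define y where "y = real k * m"
  have "y + L + T <= 13 * z" using that unfolding y_def[symmetric] by linarith
  then have "300 * (y + L + T) <= 300 * (13 * z)" by (intro mult_left_mono) auto
  also have "... <= 4000 * z" using that(4) by simp
  finally show ?thesis using t0 unfolding y_def by (rule order_trans[rotated])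
 qed
 show "real t <= 4000 * (1 + \<tau>)"
 proof (rule fin)
  define X where "X = exp (q ^ 10)"
  have XA: "X * (m * l) <= A"
  proof -
   have "q ^ 10 <= real d powr (1120 / \<epsilon>)" using Qn_powr[OF d2 k(2) \<epsilon>(1), of 10] by (simp add: q_def Q_def)
   then have "X * (m * l) <= exp (real d powr (1120 / \<epsilon>)) * (m * l)" using m1 l unfolding X_def by (intro mult_right_mono) auto
   then show ?thesis by (simp add: A_def mult_ac)
  qed
  have "q ^ 1 <= q ^ 10" using q1 by (intro power_increasing) auto
  then have "real k <= X" unfolding X_def using qk exp_ge_add_one_self[of "q ^ 10"] unfolding power_one_right by linarith
  then have "real k * m <= X * (2 * (m * l))" using ml m1 by (intro mult_mono) (auto simp: X_def)
  then have a: "real k * m <= 2 * A" using XA by simp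
  have b: "L <= 3 * A" using Lm mA by linarith
  have "(2::real) ^ (Q ^ 10) <= exp 1 ^ (Q ^ 10)" using exp_ge_add_one_self[of 1] by (intro power_mono) auto
  also have "... = X" by (simp add: X_def q_def exp_of_nat_mult[symmetric])
  finally have "2 ^ (Q ^ 10) * L <= X * (3 * l)" using L by (intro mult_mono) (auto simp: X_def L_def)
  then have "T <= m * (X * (3 * l))" unfolding T using m1 by (intro mult_left_mono) (auto simp: min_le_iff_disj)
  also have "... = 3 * (X * (m * l))" by simp
  finally have "T <= 3 * A" using XA by linarith
  moreover have "0 <= A" using m1 l by (simp add: A_def)
  ultimately show "real t <= 4000 * A" using a b by (intro tt) auto
 next
  have "real k * m <= (4 / \<epsilon>) * (2 * (m * l))" using k(2) ml m1 \<epsilon> by (intro mult_mono) auto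
  then have a: "real k * m <= 8 * B" using mB1 by simp
  have b: "L <= 3 * B" using Lm mB0 by linarith
  have "q ^ 12 <= real d powr (1344 / \<epsilon>)" using Qn_powr[OF d2 k(2) \<epsilon>(1), of 12] by (simp add: q_def Q_def)
  then have "1 * q ^ 12 * (real n)\<^sup>2 <= 1 / \<epsilon> * real d powr (1344 / \<epsilon>) * (real n)\<^sup>2" using e1 q1 \<epsilon> by (intro mult_mono) auto
  from mB[OF this] have "q ^ 12 * (real n)\<^sup>2 * (m * l) <= B" by simp
  moreover have "T <= m * (q ^ 12 * real n * real n)" unfolding T using m1 by (intro mult_left_mono) auto
  moreover have "m * (q ^ 12 * real n * real n) = q ^ 12 * (real n)\<^sup>2 * m" by (simp add: power2_eq_square)
  moreover have "q ^ 12 * (real n)\<^sup>2 * m <= q ^ 12 * (real n)\<^sup>2 * (2 * (m * l))" using ml q1 by (intro mult_left_mono) auto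
  ultimately have c: "T <= 2 * B" by simp
  have "0 <= B" using mB0 m1 l mult_nonneg_nonneg[of m l] by linarith
  then show "real t <= 4000 * B" using a b c by (intro tt) auto
 qed
qed

lemma program_implements:
 assumes k: "1 <= k" "real k <= 4 / \<epsilon>" and \<epsilon>: "0 < \<epsilon>" "\<epsilon> < 1"
 shows "implements (program k) (alg k (runtime k)) (%n. (real n + 2) powr (2560 * 2 ^ 60 / \<epsilon>))
  (%n E. 4000 * (1 + time_bound \<epsilon> n E))"
 unfolding implements_def
proof (intro allI impI)
 fix n E and es :: "(nat \<times> nat) list" assume sg: "simple_graph n E" and el: "is_edge_list es E"
 define \<tau> where "\<tau> = time_bound \<epsilon> n E"
 define V where "V = (n + 2) ^ (640 * k)"
 have V1: "n + 2 <= V" unfolding V_def using k(1) by (intro self_le_power) auto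
 have V2: "2 <= V" using V1 by simp
 have cap: "real (word_cap V) <= (real n + 2) powr (2560 * 2 ^ 60 / \<epsilon>)"
 proof -
  have "real (word_cap V) = (real n + 2) powr real (640 * k * 2 ^ 60)"
   by (simp only: word_cap_def V_def power_mult[symmetric] of_nat_power of_nat_add of_nat_numeral powr_realpow)
  also have "... <= (real n + 2) powr (2560 * 2 ^ 60 / \<epsilon>)"
  proof (rule powr_mono)
   have "640 * real k * 2 ^ 60 <= 640 * (4 / \<epsilon>) * 2 ^ 60" using k(2) by (intro mult_right_mono mult_left_mono) auto
   then show "real (640 * k * 2 ^ 60) <= 2560 * 2 ^ 60 / \<epsilon>" by simp
  qed simp
  finally show ?thesis .
 qed
 have "\<exists>t D. does (word_cap V) (program k) (input_state n es) t D & map_pmf output_edges D = alg k (runtime k) n E & real t <= 4000 * (1 + \<tau>)"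
 proof (cases "es = []")
  \<comment> \<open>Without edges the program stops after its first test. The minimum in the time
    bound is then 0, and the summand 1 in front of it pays for that step.\<close>
  case True
  then have E: "E = {}" using el by (simp add: is_edge_list_def)
  define s where "s = input_state n es"
  have s: "reg s 1 = 0" "output_edges s = {}" using True by (auto simp: s_def input_state_def output_edges_def)
  have "words_le V s" using V1 True by (auto simp: words_le_def s_def input_state_def)
  from words_le_mono[OF this word_cap_ge[OF V2]] have w: "words_le (word_cap V) s" .
  have "does (word_cap V) (program k) s (Suc 0) (return_pmf s)"
   unfolding program_def by (rule does_IfNZ[OF w]) (use s(1) does_nil[OF w] in simp)
  moreover have "alg k (runtime k) n E = return_pmf {}" by (simp add: alg_def E max_degree_empty)
  moreover have "\<tau> = 0" by (simp add: \<tau>_def E)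
  ultimately show ?thesis using s(2) unfolding s_def[symmetric] by (intro exI[of _ "Suc 0"] exI[of _ "return_pmf s"]) simp
 next
  case False
  interpret edge_list_input n k es E V
   by unfold_locales (use sg el False k V2 in auto)
  have E0: "E ~= {}" using ed_in[OF m_pos] by auto
  have n1: "1 <= n" using ends(2)[OF m_pos] by simp
  note b = word_size_bounds[OF sg k(1) n1, folded V_def, folded m_card]
  note tm = program_time[OF sg E0 k \<epsilon>, folded \<tau>_def m_card]
  show ?thesis
  proof (cases "max_degree n E <= 1")
   case True
   obtain D where "does (word_cap V) (program k) (input_state n es) (41 * m + 11) D" "map_pmf output_edges D = return_pmf E"
    using program_small_degree[OF b(1) True] by blast
   moreover have "alg k (runtime k) n E = return_pmf E" using True by (simp add: alg_def)
   ultimately show ?thesis using tm(1)[OF True] by metis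
  next
   case False
   then have deg: "1 < max_degree n E" by simp
   obtain t D where "does (word_cap V) (program k) (input_state n es) t D" "map_pmf output_edges D = alg k (runtime k) n E"
     "t <= 300 * (k * m + bitlen n + runtime k n E)"
    using program_large_degree[OF b(1,2) deg] by blast
   then show ?thesis using tm(2)[OF deg] by blast
  qed
 qed
 then obtain t D where d: "does (word_cap V) (program k) (input_state n es) t D" "map_pmf output_edges D = alg k (runtime k) n E" "real t <= 4000 * (1 + \<tau>)"
  by blast
 have "1 <= word_cap V" using word_cap_ge[OF V2] V2 by linarith
 note h = does_halt[OF d(1) this]
 have "word_bounded (program k) (input_state n es) ((real n + 2) powr (2560 * 2 ^ 60 / \<epsilon>))"
  using h(1) cap unfolding word_bounded_def by (fast intro: order_trans)
 then show "word_bounded (program k) (input_state n es) ((real n + 2) powr (2560 * 2 ^ 60 / \<epsilon>)) &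
   outputs_within (program k) (input_state n es) (alg k (runtime k) n E) (4000 * (1 + time_bound \<epsilon> n E))"
  using h(2)[OF d(3,2)] by (simp only: \<tau>_def)
qed

theorem theorem1p1:
  shows "\<exists>C a\<^sub>1 a\<^sub>2 b w K :: real. C > 0 \<and> a\<^sub>1 > 0 \<and> a\<^sub>2 > 0 \<and> b > 0 \<and> w > 0 \<and> K > 0 \<and>
    (\<forall>\<epsilon>::real. 0 < \<epsilon> \<and> \<epsilon> < 1 \<longrightarrow>
      (\<exists>A P. approximates_matching (1 - \<epsilon>) A \<and>
        (\<forall>n E. simple_graph n E \<longrightarrow>
          sensitivity A n E \<le> real (max_degree n E) powr (C / \<epsilon>)) \<and>
        implements P A
          (\<lambda>n. (real n + 2) powr (w / \<epsilon>))
          (\<lambda>n E. K * (1 + min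
            (exp (real (max_degree n E) powr (a\<^sub>1 / \<epsilon>)) * real (card E) * ln (real n) + b * real n)
            (1 / \<epsilon> * real (max_degree n E) powr (a\<^sub>2 / \<epsilon>) * (real n)\<^sup>2 * real (card E) * ln (real n))))))"
proof -
 have main: "\<exists>A P. approximates_matching (1 - \<epsilon>) A &
    (\<forall>n E. simple_graph n E \<longrightarrow>
     sensitivity A n E <= real (max_degree n E) powr (448 / \<epsilon>)) &
    implements P A
     (%n. (real n + 2) powr (2560 * 2 ^ 60 / \<epsilon>))
     (%n E. 4000 * (1 + time_bound \<epsilon> n E))"
  if \<epsilon>: "0 < \<epsilon>" "\<epsilon> < 1" for \<epsilon> :: real
 proof -
  \<comment> \<open>The least \<open>k\<close> with \<open>3 / k <= \<epsilon>\<close>, to cover the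
    losses \<open>2 / k\<close> and \<open>1 / k\<close>; because \<open>\<epsilon> < 1\<close>,
    rounding up keeps it below \<open>4 / \<epsilon>\<close>.\<close>
  define k where "k = nat \<lceil>3 / \<epsilon>\<rceil>"
  have c: "3 / \<epsilon> <= real k" unfolding k_def by (rule real_nat_ceiling_ge)
  have "3 <= 3 / \<epsilon>" using \<epsilon> by (simp add: field_simps)
  then have k1: "1 <= k" using c by linarith
  have "real k = real_of_int \<lceil>3 / \<epsilon>\<rceil>" unfolding k_def using \<open>3 <= 3 / \<epsilon>\<close> by simp
  then have "real k <= 3 / \<epsilon> + 1" by linarith
  also have "... <= 4 / \<epsilon>" using \<epsilon> by (simp add: field_simps)
  finally have k4: "real k <= 4 / \<epsilon>" .
  have "3 / real k <= \<epsilon>" using c \<epsilon> k1 by (simp add: field_simps)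
  then have "(1 - \<epsilon>) * real (matching_number E) <= (1 - 3 / real k) * real (matching_number E)" for E
   by (intro mult_right_mono) auto
  then have "approximates_matching (1 - \<epsilon>) (alg k (runtime k))"
   using alg_approximates[OF k1 runtime_mixed[OF k1]] unfolding approximates_matching_def by (meson order_trans)
  then show ?thesis using alg_sensitivity_powr[OF _ k1 k4 \<epsilon>(1)] program_implements[OF k1 k4 \<epsilon>] by blast
 qed
 show ?thesis
  \<comment> \<open>The exponents 448, 1120 and 1344 are those of \<open>Qn_powr\<close>;
    \<open>2560 * 2 ^ 60\<close> is \<open>640 * k * 2 ^ 60\<close> with
    \<open>k <= 4 / \<epsilon>\<close>, and 4000 comes from \<open>program_time\<close>.\<close>
  by (rule exI[of _ 448], rule exI[of _ 1120], rule exI[of _ 1344], rule exI[of _ 1], rule exI[of _ "2560 * 2 ^ 60"], rule exI[of _ 4000])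
   (use main in auto)
qed

end
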